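(* Let $p$ be a prime with $p>101$. Let $F$ be an integral quintic form (homogeneous of degree $5$) whose reduction modulo $p$ is a non-degenerate quintic form over $\mathbb{F}_p$ of order at least $6$. Then $R(F)$ is dense in $\mathbb{Q}_p$.
   Context: For an integral form $F$ in $r$ variables, $R(F)=\{F(\overline{x})/F(\overline{y}) : \overline{x},\overline{y}\in\mathbb{Z}^r,\ F(\overline{y})\neq 0\}$, and density is in the $p$-adic topology. The order of a form over a field $K$ is the smallest integer $m$ such that the form is equivalent, via an invertible linear change of variables over $K$, to a form explicitly involving only $m$ variables; a form in $n$ variables is non-degenerate if its order equals $n$. *)

theory Defs
  imports Complex_Main "HOL-Library.Poly_Mapping" "HOL-Computational_Algebra.Primes"
begin

text \<open>Multivariate polynomials with integer coefficients in variables X_0, X_1, ...,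
  represented as finitely supported maps from monomials (exponent vectors) to coefficients.\<close>
type_synonym zpoly = "(nat \<Rightarrow>\<^sub>0 nat) \<Rightarrow>\<^sub>0 int"

definition zVar :: "nat \<Rightarrow> zpoly" where
  "zVar i = Poly_Mapping.single (Poly_Mapping.single i 1) 1"

definition zConst :: "int \<Rightarrow> zpoly" where
  "zConst c = Poly_Mapping.single 0 c"

definition mon_deg :: "(nat \<Rightarrow>\<^sub>0 nat) \<Rightarrow> nat" where
  "mon_deg \<alpha> = (\<Sum>i\<in>Poly_Mapping.keys \<alpha>. Poly_Mapping.lookup \<alpha> i)"

definition is_int_form :: "nat \<Rightarrow> nat \<Rightarrow> zpoly \<Rightarrow> bool" where
  "is_int_form n d F \<longleftrightarrow> (\<forall>\<alpha>\<in>Poly_Mapping.keys F. Poly_Mapping.keys \<alpha> \<subseteq> {..<n} \<and> mon_deg \<alpha> = d)"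

definition zeval :: "zpoly \<Rightarrow> (nat \<Rightarrow> int) \<Rightarrow> int" where
  "zeval F x = (\<Sum>\<alpha>\<in>Poly_Mapping.keys F. Poly_Mapping.lookup F \<alpha> * (\<Prod>i\<in>Poly_Mapping.keys \<alpha>. x i ^ Poly_Mapping.lookup \<alpha> i))"

definition lin_subst :: "nat \<Rightarrow> (nat \<Rightarrow> nat \<Rightarrow> int) \<Rightarrow> zpoly \<Rightarrow> zpoly" where
  "lin_subst n A F = (\<Sum>\<alpha>\<in>Poly_Mapping.keys F. zConst (Poly_Mapping.lookup F \<alpha>) *
      (\<Prod>i\<in>Poly_Mapping.keys \<alpha>. (\<Sum>j<n. zConst (A i j) * zVar j) ^ Poly_Mapping.lookup \<alpha> i))"

definition invertible_mod :: "int \<Rightarrow> nat \<Rightarrow> (nat \<Rightarrow> nat \<Rightarrow> int) \<Rightarrow> bool" where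
  "invertible_mod p n A \<longleftrightarrow> (\<exists>B :: nat \<Rightarrow> nat \<Rightarrow> int. \<forall>i<n. \<forall>k<n.
      (\<Sum>j<n. A i j * B j k) mod p = (if i = k then 1 else 0) mod p)"

definition involves_only_mod :: "int \<Rightarrow> nat \<Rightarrow> zpoly \<Rightarrow> bool" where
  "involves_only_mod p m P \<longleftrightarrow> (\<forall>\<alpha>\<in>Poly_Mapping.keys P. \<not> Poly_Mapping.keys \<alpha> \<subseteq> {..<m} \<longrightarrow> p dvd Poly_Mapping.lookup P \<alpha>)"

definition equiv_m_vars_mod :: "int \<Rightarrow> nat \<Rightarrow> zpoly \<Rightarrow> nat \<Rightarrow> bool" where
  "equiv_m_vars_mod p n F m \<longleftrightarrow>
     (\<exists>A. invertible_mod p n A \<and> involves_only_mod p m (lin_subst n A F))"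

definition order_mod :: "int \<Rightarrow> nat \<Rightarrow> zpoly \<Rightarrow> nat" where
  "order_mod p n F = (LEAST m. equiv_m_vars_mod p n F m)"

definition nondegenerate_mod :: "int \<Rightarrow> nat \<Rightarrow> zpoly \<Rightarrow> bool" where
  "nondegenerate_mod p n F \<longleftrightarrow> order_mod p n F = n"

definition ratio_set :: "zpoly \<Rightarrow> rat set" where
  "ratio_set F = {of_int (zeval F x) / of_int (zeval F y) | x y. zeval F y \<noteq> 0}"

text \<open>A set of rationals is dense in Q_p: since Q is dense in Q_p, this means every
  rational q is approximated p-adically to any precision p^k, i.e. s - q has
  p-adic valuation at least k (s - q = p^k a / b with p not dividing b).\<close>
definition padic_dense :: "int \<Rightarrow> rat set \<Rightarrow> bool" where
  "padic_dense p S \<longleftrightarrow> (\<forall>q::rat. \<forall>k::nat. \<exists>s\<in>S. \<exists>a b::int.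
      b \<noteq> 0 \<and> \<not> p dvd b \<and> s - q = of_int (p ^ k * a) / of_int b)"

end

theory Submission
  imports
    "HOL-Algebra.Algebraic_Closure_Type"
    "HOL-Analysis.Cartesian_Space"
    "HOL-Combinatorics.Permutations"
    "Berlekamp_Zassenhaus.Finite_Field"
    Defs
begin

text \<open>By Hensel's lemma it suffices to find a nonsingular zero of \<open>F\<close> modulo \<open>p\<close>: along a line through it \<open>F\<close> takes
  all \<open>p\<close>-adic values divisible by \<open>p\<close>. Suppose that all zeros over the prime field are singular, and let \<open>\<Phi>\<close> be the
  symmetric 5-linear form with \<open>\<Phi> x x x x x = F x\<close>. In at least six variables Chevalley's theorem gives a zero \<open>a \<noteq> 0\<close>,
  and \<open>F (x a + y) = 10 x\<^sup>3 \<Phi> a a a y y + 10 x\<^sup>2 \<Phi> a a y y y + 5 x \<Phi> a y y y y + \<Phi> y y y y y\<close> is for every \<open>y\<close> a cubic in \<open>x\<close>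
  without simple roots. Restricting \<open>y\<close> to lines turns this into polynomial identities, because a polynomial of small
  degree all of whose values are squares (or nonsquares, or noncubes) over a large prime field is, up to a constant, a
  perfect power. Together with Chevalley's theorem these identities produce in each case a vertex, which is
  impossible for a non-degenerate form.\<close>

section \<open>Prime fields\<close>

class prime_field = finite_field + field_gcd +
  assumes prime_CARD: "prime (card (UNIV :: 'a set))"

class big_prime_field = prime_field +
  assumes CARD_gt: "101 < card (UNIV :: 'a set)"

lemma CHAR_eq_CARD: "CHAR('a :: prime_field) = CARD('a)"
  using CHAR_dvd_CARD[where ?'a='a] prime_CARD[where ?'a='a] CHAR_not_1'[where ?'a='a]
  by (auto simp: prime_nat_iff)

lemma of_int_eq_0_iff_dvd: "(of_int k :: 'a :: prime_field) = 0 \<longleftrightarrow> int CARD('a) dvd k"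
  by (simp add: of_int_eq_0_iff_char_dvd CHAR_eq_CARD)

lemma surj_of_int: "surj (of_int :: int \<Rightarrow> 'a :: prime_field)"
proof -
  have "inj_on (of_int :: int \<Rightarrow> 'a) {0..<int CARD('a)}"
  proof (rule inj_onI)
    fix i j :: int
    assume ij: "i \<in> {0..<int CARD('a)}" "j \<in> {0..<int CARD('a)}" "of_int i = (of_int j :: 'a)"
    then have "int CARD('a) dvd i - j"
      by (simp flip: of_int_eq_0_iff_dvd)
    moreover have "\<bar>i - j\<bar> < int CARD('a)" using ij by auto
    ultimately show "i = j"
      using zdvd_not_zless[of "\<bar>i - j\<bar>" "int CARD('a)"] by fastforce
  qed
  then have "(of_int :: int \<Rightarrow> 'a) ` {0..<int CARD('a)} = UNIV"
    by (intro card_seteq) (auto simp: card_image)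
  then show ?thesis by auto
qed

lemma numeral_neq_0_big_prime_field [simp]:
  "(numeral k :: 'a :: big_prime_field) \<noteq> 0" if "numeral k \<le> (101 :: nat)"
proof
  assume "(numeral k :: 'a) = 0"
  then have "(of_nat (numeral k) :: 'a) = 0" by simp
  then have "CHAR('a) dvd numeral k"
    using of_nat_eq_0_iff_char_dvd by blast
  then have "CHAR('a) \<le> numeral k" by (simp add: dvd_imp_le)
  then show False using that CARD_gt[where ?'a='a] by (simp add: CHAR_eq_CARD)
qed

lemma zero_neq_numeral_big_prime_field [simp]:
  "(0 :: 'a :: big_prime_field) \<noteq> numeral k" if "numeral k \<le> (101 :: nat)"
  using numeral_neq_0_big_prime_field[OF that, where 'a='a] by metis

lemma odd_CARD: "odd CARD('a :: big_prime_field)"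
  using prime_CARD[where ?'a='a] CARD_gt[where ?'a='a] prime_odd_nat by fastforce

lemma CARD_eq_half: "CARD('a :: big_prime_field) = 2 * ((CARD('a) - 1) div 2) + 1"
  using odd_CARD[where ?'a='a] by presburger

lemmas power_CARD [simp] = finite_field_power_card_eq_same

lemma power_CARD_minus_1:
  fixes x :: "'a :: finite_field"
  assumes "x \<noteq> 0"
  shows "x ^ (CARD('a) - 1) = 1"
proof -
  have "x * x ^ (CARD('a) - 1) = x ^ CARD('a)"
    by (simp flip: power_Suc del: power_CARD)
  then show ?thesis using assms by simp
qed

lemma freshmans_dream_CARD:
  assumes "CHAR('b :: comm_ring_1) = CARD('a :: prime_field)"
  shows "(x + y :: 'b) ^ CARD('a) = x ^ CARD('a) + y ^ CARD('a)"
proof (rule freshmans_dream)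
  show "prime CHAR('b)" unfolding assms by (rule prime_CARD)
qed (rule assms[symmetric])

lemma poly_power_CARD:
  fixes P :: "'a :: prime_field poly"
  shows "P ^ CARD('a) = pcompose P (monom 1 CARD('a))"
proof (induction P)
  case (pCons a P)
  have "pCons a P ^ CARD('a) = ([:a:] + monom 1 1 * P) ^ CARD('a)"
    by (simp add: monom_altdef)
  also have "\<dots> = [:a:] ^ CARD('a) + (monom 1 1 * P) ^ CARD('a)"
    by (intro freshmans_dream_CARD) (simp only: semiring_char_poly CHAR_eq_CARD)
  also have "\<dots> = [:a:] + monom 1 CARD('a) * P ^ CARD('a)"
    by (simp add: poly_const_pow power_mult_distrib monom_power)
  finally show ?case
    using pCons by (simp add: pcompose_pCons)
qed (simp add: zero_power)

lemma poly_eq_0_if_vanishing: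
  fixes P :: "'a :: {finite, idom} poly"
  assumes "\<And>t. poly P t = 0" "degree P < CARD('a)"
  shows "P = 0"
  using card_poly_roots_bound[of P] assms by fastforce

lemma
  fixes z :: "'a :: idom"
  assumes "n > 0"
  shows finite_nth_roots_idom: "finite {x. x ^ n = z}"
    and card_nth_roots_idom_le: "card {x. x ^ n = z} \<le> n"
proof -
  have "coeff (monom 1 n - [:z:]) n = 1"
    using assms by (simp add: coeff_pCons split: nat.split)
  then have nz: "monom 1 n - [:z:] \<noteq> 0" by force
  have roots: "{x. x ^ n = z} = {x. poly (monom 1 n - [:z:]) x = 0}"
    by (simp add: poly_monom)
  show "finite {x. x ^ n = z}"
    unfolding roots by (rule poly_roots_finite[OF nz])
  have "degree (monom 1 n - [:z:]) \<le> n"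
    by (intro degree_diff_le degree_monom_le) simp
  then show "card {x. x ^ n = z} \<le> n"
    unfolding roots using card_poly_roots_bound[OF nz] by linarith
qed

text \<open>There are at least \<open>m\<close> nonzero \<open>n\<close>-th powers, and the polynomial \<open>X\<^sup>m - 1\<close> vanishes on them.\<close>

lemma nth_power_if_residue:
  fixes y :: "'a :: finite_field"
  assumes card: "CARD('a) = n * m + 1" and y: "y ^ m = 1"
  shows "\<exists>x. y = x ^ n"
proof -
  have "finite (UNIV :: 'a set)" "{0, 1 :: 'a} \<subseteq> UNIV" by simp_all
  then have "card {0, 1 :: 'a} \<le> CARD('a)" by (rule card_mono)
  then have pos: "n > 0" "m > 0" using card by (auto intro: Nat.gr0I)
  let ?N = "(\<lambda>x :: 'a. x ^ n) ` (UNIV - {0})"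
  have "x ^ n \<in> {y. y ^ m = 1}" if "x \<noteq> 0" for x :: 'a
    using power_CARD_minus_1[OF that] card by (simp add: power_mult)
  then have sub: "?N \<subseteq> {y. y ^ m = 1}" by blast
  have "n * m = card (UNIV - {0 :: 'a})"
    using card by (simp add: card_Diff_subset)
  also have "\<dots> = (\<Sum>z\<in>?N. card {x \<in> UNIV - {0}. x ^ n = z})"
    using sum.image_gen[of "UNIV - {0 :: 'a}" "\<lambda>_. 1 :: nat" "\<lambda>x. x ^ n"] by simp
  also have "\<dots> \<le> (\<Sum>z\<in>?N. n)"
  proof (rule sum_mono)
    fix z :: 'a
    have "card {x \<in> UNIV - {0}. x ^ n = z} \<le> card {x. x ^ n = z}" by (rule card_mono) auto
    then show "card {x \<in> UNIV - {0}. x ^ n = z} \<le> n"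
      using card_nth_roots_idom_le[OF pos(1), of z] by linarith
  qed
  finally have "m \<le> card ?N" using pos by simp
  then have "card {y :: 'a. y ^ m = 1} \<le> card ?N"
    using card_nth_roots_idom_le[OF pos(2), of "1 :: 'a"] by linarith
  then have "?N = {y. y ^ m = 1}"
    using sub by (intro card_seteq) auto
  then show ?thesis using y by blast
qed

lemma exists_nonsquare: "\<exists>n :: 'a :: big_prime_field. \<forall>s. n \<noteq> s\<^sup>2"
proof (rule ccontr)
  assume "\<not> ?thesis"
  then have "surj (\<lambda>s :: 'a. s\<^sup>2)" by (metis surjI)
  then have "inj (\<lambda>s :: 'a. s\<^sup>2)" by (simp add: finite_UNIV_surj_inj)
  from injD[OF this, of 1 "-1"] have "(1 :: 'a) = -1" by simp
  then have "(2 :: 'a) = 0" by (metis add.right_inverse one_add_one)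
  then show False by simp
qed

definition nonsq :: "'a :: big_prime_field"
  where "nonsq = (SOME n. \<forall>s. n \<noteq> s\<^sup>2)"

lemma nonsq: "nonsq \<noteq> (s :: 'a :: big_prime_field)\<^sup>2"
  using someI_ex[OF exists_nonsquare[where ?'a='a]] unfolding nonsq_def by blast

lemma nonsq_neq_0 [simp]: "(nonsq :: 'a :: big_prime_field) \<noteq> 0"
  using nonsq[of 0] by auto

lemma square_eq_nonsq_times_square_iff:
  "x\<^sup>2 = nonsq * y\<^sup>2 \<longleftrightarrow> x = 0 \<and> y = (0 :: 'a :: big_prime_field)"
proof (cases "y = 0")
  case False
  then show ?thesis using nonsq[of "x / y"] by (auto simp: field_simps)
qed simp

lemma nonsquare_power_half:
  fixes a :: "'a :: big_prime_field"
  assumes "\<And>s. a \<noteq> s\<^sup>2"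
  shows "a ^ ((CARD('a) - 1) div 2) = - 1"
proof -
  define m where "m = (CARD('a) - 1) div 2"
  have card: "CARD('a) = 2 * m + 1"
    unfolding m_def by (rule CARD_eq_half)
  have "a \<noteq> 0" using assms[of 0] by auto
  then have "(a ^ m)\<^sup>2 = 1"
    using power_CARD_minus_1[of a] card by (simp add: mult.commute flip: power_mult)
  then have "a ^ m = 1 \<or> a ^ m = - 1" by (simp add: power2_eq_1_iff)
  then show ?thesis
    using nth_power_if_residue[OF card, of a] assms unfolding m_def by blast
qed

lemma nonsq_times_nonsquare:
  fixes a :: "'a :: big_prime_field"
  assumes "\<And>s. a \<noteq> s\<^sup>2"
  obtains s where "s \<noteq> 0" "nonsq * a = s\<^sup>2"
proof -
  have "(nonsq * a) ^ ((CARD('a) - 1) div 2) = 1"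
    by (simp only: power_mult_distrib nonsquare_power_half[OF assms] nonsquare_power_half[OF nonsq]) simp
  then obtain s where s: "nonsq * a = s\<^sup>2"
    using nth_power_if_residue[OF CARD_eq_half] by blast
  have "a \<noteq> 0" using assms[of 0] by auto
  then have "s \<noteq> 0" using s by auto
  then show ?thesis using s that by blast
qed

section \<open>Stepanov's method\<close>

subsection \<open>Bivariate polynomials\<close>

lemma bounded_polys_PiE:
  fixes S :: "nat \<Rightarrow> 'b :: comm_monoid_add set"
  shows "bij_betw (\<lambda>P. restrict (coeff P) {..k}) {P. degree P \<le> k \<and> (\<forall>j\<le>k. coeff P j \<in> S j)} (PiE {..k} S)"
proof (rule bij_betw_byWitness[where f' = "\<lambda>g. \<Sum>i\<le>k. monom (g i) i"])
  have coeff: "coeff (\<Sum>i\<le>k. monom (g i) i) j = (if j \<le> k then g j else 0)" for g :: "nat \<Rightarrow> 'b" and j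
    by (simp add: coeff_sum)
  show "\<forall>P\<in>{P. degree P \<le> k \<and> (\<forall>j\<le>k. coeff P j \<in> S j)}. (\<Sum>i\<le>k. monom (restrict (coeff P) {..k} i) i) = P"
    by (auto intro!: poly_eqI simp: coeff coeff_eq_0)
  show "\<forall>g\<in>PiE {..k} S. restrict (coeff (\<Sum>i\<le>k. monom (g i) i)) {..k} = g"
    by (auto simp: coeff PiE_def extensional_def restrict_def)
  show "(\<lambda>g. \<Sum>i\<le>k. monom (g i) i) ` PiE {..k} S \<subseteq> {P. degree P \<le> k \<and> (\<forall>j\<le>k. coeff P j \<in> S j)}"
    by (auto simp: coeff degree_le)
qed (auto split: if_splits)

lemma
  shows finite_degree_le: "finite {P :: 'a :: {comm_ring_1, finite} poly. degree P \<le> k}"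
    and card_degree_le: "card {P :: 'a poly. degree P \<le> k} = CARD('a) ^ Suc k"
proof -
  note bij = bounded_polys_PiE[of k "\<lambda>_. UNIV :: 'a set", simplified]
  show "finite {P :: 'a poly. degree P \<le> k}"
    using bij_betw_finite[OF bij] by (simp add: finite_PiE)
  show "card {P :: 'a poly. degree P \<le> k} = CARD('a) ^ Suc k"
    using bij_betw_same_card[OF bij] by (simp add: card_PiE)
qed

definition bounded_bipolys :: "nat \<Rightarrow> (nat \<Rightarrow> nat) \<Rightarrow> 'a :: {comm_ring_1, finite} poly poly set"
  where "bounded_bipolys k b = {P. degree P \<le> k \<and> (\<forall>j\<le>k. degree (coeff P j) \<le> b j)}"

lemma
  shows finite_bounded_bipolys: "finite (bounded_bipolys k b :: 'a :: {comm_ring_1, finite} poly poly set)"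
    and card_bounded_bipolys: "card (bounded_bipolys k b :: 'a poly poly set) = CARD('a) ^ (\<Sum>j\<le>k. Suc (b j))"
proof -
  note bij = bounded_polys_PiE[of k "\<lambda>j. {c :: 'a poly. degree c \<le> b j}",
      simplified mem_Collect_eq, folded bounded_bipolys_def]
  show "finite (bounded_bipolys k b :: 'a poly poly set)"
    using bij_betw_finite[OF bij] by (simp add: finite_PiE finite_degree_le)
  show "card (bounded_bipolys k b :: 'a poly poly set) = CARD('a) ^ (\<Sum>j\<le>k. Suc (b j))"
    using bij_betw_same_card[OF bij] by (simp add: card_PiE card_degree_le power_sum del: power_Suc)
qed

lemma bounded_bipolys_diff:
  "P \<in> bounded_bipolys k b \<Longrightarrow> Q \<in> bounded_bipolys k b \<Longrightarrow> P - Q \<in> bounded_bipolys k b"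
  unfolding bounded_bipolys_def by (auto intro: degree_diff_le)

definition total_degree_le :: "nat \<Rightarrow> 'a :: comm_ring_1 poly poly \<Rightarrow> bool"
  where "total_degree_le N P \<longleftrightarrow> (\<forall>j. coeff P j \<noteq> 0 \<longrightarrow> degree (coeff P j) + j \<le> N)"

lemma total_degree_le_0 [simp]: "total_degree_le N 0"
  by (simp add: total_degree_le_def)

lemma total_degree_le_mono: "total_degree_le M P \<Longrightarrow> M \<le> N \<Longrightarrow> total_degree_le N P"
  unfolding total_degree_le_def by fastforce

lemma total_degree_le_pCons_iff:
  "total_degree_le N (pCons a P) \<longleftrightarrow> degree a \<le> N \<and> (P = 0 \<or> 1 \<le> N \<and> total_degree_le (N - 1) P)"
proof
  assume bound: "total_degree_le N (pCons a P)"
  have a: "degree a \<le> N"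
    using bound[unfolded total_degree_le_def, rule_format, of 0] by (cases "a = 0") simp_all
  have P: "degree (coeff P j) + Suc j \<le> N" if "coeff P j \<noteq> 0" for j
    using bound[unfolded total_degree_le_def, rule_format, of "Suc j"] that by simp
  then have "1 \<le> N" if "P \<noteq> 0"
    using P[of "degree P", OF leading_coeff_neq_0[OF that]] by linarith
  then show "degree a \<le> N \<and> (P = 0 \<or> 1 \<le> N \<and> total_degree_le (N - 1) P)"
    using a P by (fastforce simp: total_degree_le_def)
qed (auto simp: total_degree_le_def coeff_pCons split: nat.splits)

lemma total_degree_le_uminus [simp]: "total_degree_le N (- P) \<longleftrightarrow> total_degree_le N P"
  by (simp add: total_degree_le_def)

lemma total_degree_le_add:
  assumes "total_degree_le N P" "total_degree_le N Q"
  shows "total_degree_le N (P + Q)"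
  unfolding total_degree_le_def
proof (intro allI impI)
  fix j assume "coeff (P + Q) j \<noteq> 0"
  then have j: "j \<le> N"
    using assms unfolding total_degree_le_def by (metis add_leE coeff_add add_0)
  have "degree (coeff P j) \<le> N - j" "degree (coeff Q j) \<le> N - j"
    using assms[unfolded total_degree_le_def, rule_format, of j]
    by (cases "coeff P j = 0"; cases "coeff Q j = 0"; simp)+
  then have "degree (coeff (P + Q) j) \<le> N - j" by (simp add: degree_add_le)
  then show "degree (coeff (P + Q) j) + j \<le> N" using j by simp
qed

lemma total_degree_le_diff: "total_degree_le N P \<Longrightarrow> total_degree_le N Q \<Longrightarrow> total_degree_le N (P - Q)"
  using total_degree_le_add[of N P "- Q"] by simp

lemma total_degree_le_smult:
  assumes "total_degree_le N P" "degree a \<le> M"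
  shows "total_degree_le (M + N) (smult a P)"
  unfolding total_degree_le_def
proof (intro allI impI)
  fix j assume "coeff (smult a P) j \<noteq> 0"
  then have "coeff P j \<noteq> 0" by auto
  then have "degree (coeff P j) + j \<le> N"
    using assms(1) unfolding total_degree_le_def by blast
  then show "degree (coeff (smult a P) j) + j \<le> M + N"
    using degree_mult_le[of a "coeff P j"] assms(2) by simp
qed

lemma total_degree_le_mult:
  "total_degree_le M P \<Longrightarrow> total_degree_le N Q \<Longrightarrow> total_degree_le (M + N) (P * Q)"
proof (induction P arbitrary: M)
  case (pCons a P)
  have a: "degree a \<le> M" and P: "P = 0 \<or> 1 \<le> M \<and> total_degree_le (M - 1) P"
    using pCons.prems(1) by (simp_all add: total_degree_le_pCons_iff)
  have "total_degree_le (M + N) (smult a Q)"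
    using pCons.prems(2) a by (rule total_degree_le_smult)
  moreover have "total_degree_le (M + N) (pCons 0 (P * Q))"
    using P pCons.IH[of "M - 1"] pCons.prems(2) by (auto simp: total_degree_le_pCons_iff)
  ultimately show ?case by (simp add: total_degree_le_add)
qed simp

lemma total_degree_le_bounded_bipolys:
  assumes "P \<in> bounded_bipolys k b" "\<And>j. j \<le> k \<Longrightarrow> b j + j \<le> N"
  shows "total_degree_le N P"
  unfolding total_degree_le_def
proof (intro allI impI)
  fix j assume "coeff P j \<noteq> 0"
  then have "j \<le> k" using le_degree[of P j] assms(1) unfolding bounded_bipolys_def by simp
  then show "degree (coeff P j) + j \<le> N"
    using assms unfolding bounded_bipolys_def by (fastforce intro: order_trans[rotated])
qed

definition diagonal :: "'a :: comm_ring_1 poly poly \<Rightarrow> 'a poly"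
  where "diagonal P = poly P [:0, 1:]"

abbreviation diag_div :: "'a :: comm_ring_1 poly poly \<Rightarrow> 'a poly poly"
  where "diag_div P \<equiv> synthetic_div P [:0, 1:]"

definition outer_poly :: "'a :: comm_ring_1 poly \<Rightarrow> 'a poly poly"
  where "outer_poly c = map_poly (\<lambda>a. [:a:]) c"

lemma poly_outer_poly: "poly (outer_poly c) q = pcompose c q"
  by (simp add: outer_poly_def pcompose_altdef)

lemma diagonal_simps [simp]:
  "diagonal (P - Q) = diagonal P - diagonal Q" "diagonal (P * Q) = diagonal P * diagonal Q"
  "diagonal (smult c P) = c * diagonal P" "diagonal (outer_poly c) = c"
  by (simp_all add: diagonal_def poly_outer_poly pcompose_idR)

lemma total_degree_le_outer_poly: "degree c \<le> N \<Longrightarrow> total_degree_le N (outer_poly c)"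
  unfolding total_degree_le_def outer_poly_def by (auto simp: coeff_map_poly dest: le_degree)

lemma degree_diagonal_le: "total_degree_le N P \<Longrightarrow> degree (diagonal P) \<le> N"
proof (induction P arbitrary: N)
  case (pCons a P)
  have "degree ([:0, 1:] * diagonal P) \<le> N"
  proof (cases "P = 0")
    case False
    then have "1 \<le> N" "degree (diagonal P) \<le> N - 1"
      using pCons by (simp_all add: total_degree_le_pCons_iff)
    then show ?thesis using degree_pCons_le[of 0 "diagonal P"] by simp
  qed (simp add: diagonal_def)
  then have "degree (a + [:0, 1:] * diagonal P) \<le> N"
    using pCons.prems by (intro degree_add_le) (simp add: total_degree_le_pCons_iff)
  then show ?case by (simp add: diagonal_def)
qed (simp add: diagonal_def)

lemma total_degree_le_diag_div: "total_degree_le N P \<Longrightarrow> total_degree_le (N - 1) (diag_div P)"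
proof (induction P arbitrary: N)
  case (pCons a P)
  show ?case
  proof (cases "P = 0")
    case False
    have P: "total_degree_le (N - 1) P"
      using pCons.prems False by (simp add: total_degree_le_pCons_iff)
    obtain b Q where Q: "P = pCons b Q" by (cases P)
    have "1 \<le> N - 1" if "diag_div P \<noteq> 0"
    proof -
      have "Q \<noteq> 0" using that unfolding Q by auto
      then show ?thesis using P unfolding Q total_degree_le_pCons_iff by blast
    qed
    then show ?thesis
      using pCons.IH[OF P] degree_diagonal_le[OF P]
      by (auto simp: total_degree_le_pCons_iff diagonal_def)
  qed simp
qed simp

lemma synthetic_div_diff:
  fixes P Q :: "'b :: comm_ring_1 poly"
  shows "synthetic_div (P - Q) c = synthetic_div P c - synthetic_div Q c"
proof (induction P arbitrary: Q)
  case 0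
  show ?case by (induction Q) (simp_all flip: add: minus_pCons)
next
  case (pCons a P)
  show ?case by (cases Q) (simp add: pCons.IH)
qed

definition frob_subst :: "'a :: {comm_ring_1, finite} poly poly \<Rightarrow> 'a poly"
  where "frob_subst P = poly P (monom 1 CARD('a))"

lemma frob_subst_simps [simp]:
  "frob_subst (P - Q) = frob_subst P - frob_subst Q" "frob_subst (P * Q) = frob_subst P * frob_subst Q"
  "frob_subst (smult c P) = c * frob_subst P"
  by (simp_all add: frob_subst_def)

lemma frob_subst_outer_poly [simp]: "frob_subst (outer_poly c) = (c :: 'a :: prime_field poly) ^ CARD('a)"
  by (simp add: frob_subst_def poly_outer_poly poly_power_CARD)

lemma frob_subst_diag_div:
  fixes P :: "'a :: {comm_ring_1, finite} poly poly"
  assumes "diagonal P = 0"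
  shows "(monom 1 CARD('a) - [:0, 1:]) * frob_subst (diag_div P) = frob_subst P"
proof -
  have "P = [:- [:0, 1:], 1:] * diag_div P"
    using synthetic_div_correct'[of "[:0, 1:]" P] assms by (simp add: diagonal_def)
  then have "frob_subst P = frob_subst [:- [:0, 1:], 1:] * frob_subst (diag_div P)"
    unfolding frob_subst_simps(2)[symmetric] by (rule arg_cong)
  moreover have "frob_subst [:- [:0, 1:], 1:] = monom 1 CARD('a) - [:0, 1 :: 'a:]"
    by (simp add: frob_subst_def)
  ultimately show ?thesis by simp
qed

lemma degree_frob_subst_le:
  fixes P :: "'a :: {comm_ring_1, finite} poly poly"
  assumes "degree P \<le> k" "\<And>j. degree (coeff P j) \<le> N"
  shows "degree (frob_subst P) \<le> N + CARD('a) * k"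
  unfolding frob_subst_def poly_altdef
proof (rule degree_sum_le)
  fix i assume i: "i \<in> {..degree P}"
  have "degree (coeff P i * monom 1 CARD('a) ^ i) \<le> degree (coeff P i) + CARD('a) * i"
    using degree_mult_le[of "coeff P i" "monom 1 CARD('a) ^ i"] degree_monom_le[of "1 :: 'a" "CARD('a) * i"]
    by (simp add: monom_power mult.commute)
  also have "\<dots> \<le> N + CARD('a) * k" using assms i by (auto intro!: add_mono)
  finally show "degree (coeff P i * monom 1 CARD('a) ^ i) \<le> N + CARD('a) * k" .
qed simp

lemma
  fixes P :: "'a :: {idom, finite} poly poly"
  assumes "P \<noteq> 0" "\<And>j. degree (coeff P j) < CARD('a)"
  shows frob_subst_neq_0: "frob_subst P \<noteq> 0"
    and degree_frob_subst: "degree (frob_subst P) = degree (lead_coeff P) + CARD('a) * degree P"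
proof -
  have "frob_subst P \<noteq> 0 \<and> degree (frob_subst P) = degree (lead_coeff P) + CARD('a) * degree P"
    using assms
  proof (induction P)
    case (pCons a P)
    show ?case
    proof (cases "P = 0")
      case False
      have "degree (coeff P j) < CARD('a)" for j using pCons.prems(2)[of "Suc j"] by simp
      then have IH: "frob_subst P \<noteq> 0" "degree (frob_subst P) = degree (lead_coeff P) + CARD('a) * degree P"
        using pCons.IH False by auto
      have "degree (monom 1 CARD('a) * frob_subst P) = CARD('a) + degree (frob_subst P)"
        using IH(1) by (simp add: degree_mult_eq degree_monom_eq)
      moreover have "degree a < CARD('a)" using pCons.prems(2)[of 0] by simp
      ultimately have "degree (a + monom 1 CARD('a) * frob_subst P) = CARD('a) + degree (frob_subst P)"
        by (simp add: degree_add_eq_right)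
      moreover have "frob_subst (pCons a P) = a + monom 1 CARD('a) * frob_subst P"
        by (simp add: frob_subst_def)
      ultimately show ?thesis using False IH(2) by force
    qed (use pCons.prems in \<open>simp add: frob_subst_def\<close>)
  qed simp
  then show "frob_subst P \<noteq> 0" "degree (frob_subst P) = degree (lead_coeff P) + CARD('a) * degree P"
    by simp_all
qed

lemma sum_order_le_degree_finite:
  fixes P :: "'a :: {idom, finite} poly"
  assumes "P \<noteq> 0"
  shows "(\<Sum>t\<in>S. order t P) \<le> degree P"
proof -
  have "(\<Sum>t\<in>S. order t P) \<le> (\<Sum>t\<in>UNIV. order t P)" by (rule sum_mono2) auto
  also have "\<dots> = (\<Sum>t | poly P t = 0. order t P)"
    by (rule sum.mono_neutral_right) (auto simp: order_root)
  also have "\<dots> \<le> degree P" by (rule sum_order_le_degree[OF assms])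
  finally show ?thesis .
qed

subsection \<open>Auxiliary polynomials for \<open>y\<^sup>n = e(x)\<close>\<close>

locale superelliptic =
  fixes n m D :: nat and e :: "'a :: prime_field poly"
  assumes CARD_eq: "CARD('a) = n * m + 1" and n_ge_2: "2 \<le> n" and degree_le: "degree e \<le> D"
begin

text \<open>In state \<open>s < n\<close> a family \<open>(T\<^sub>j)\<close> stands for the polynomial \<open>aux_eval s T\<close>. As
  \<open>g\<^sup>n e = e(X\<^sup>q)\<close> for \<open>g = e\<^sup>m\<close>, multiplication by \<open>g - 1\<close> permutes the powers of \<open>g\<close>, and if
  all coefficients of the product vanish for \<open>Y = X\<close>, it is divisible by \<open>X\<^sup>q - X\<close>.\<close>

definition aux_eval :: "nat \<Rightarrow> (nat \<Rightarrow> 'a poly poly) \<Rightarrow> 'a poly" where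
  "aux_eval s T = (\<Sum>j<n. frob_subst (T j) * (if s < j then e else 1) * (e ^ m) ^ j)"

definition aux_coeff :: "nat \<Rightarrow> (nat \<Rightarrow> 'a poly poly) \<Rightarrow> nat \<Rightarrow> 'a poly poly" where
  "aux_coeff s T j = (if j = 0 then outer_poly e * T (n - 1) else T (j - 1))
     - (if j = Suc s mod n then smult e (T j) else T j)"

definition aux_step :: "nat \<Rightarrow> (nat \<Rightarrow> 'a poly poly) \<Rightarrow> nat \<Rightarrow> 'a poly poly" where
  "aux_step s T j = diag_div (aux_coeff s T j)"

primrec aux_iter :: "nat \<Rightarrow> (nat \<Rightarrow> 'a poly poly) \<Rightarrow> nat \<Rightarrow> 'a poly poly" where
  "aux_iter 0 T = T"
| "aux_iter (Suc i) T = aux_step (i mod n) (aux_iter i T)"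

lemma power_CARD_eq: "e ^ CARD('a) = e * (e ^ m) ^ n"
  by (simp add: CARD_eq mult.commute flip: power_mult)

lemma diagonal_aux_coeff_0:
  assumes "s < n" and zero: "\<And>j. j \<in> {1..<n} \<Longrightarrow> diagonal (aux_coeff s T j) = 0"
  shows "diagonal (aux_coeff s T 0) = 0"
proof -
  let ?s = "Suc s mod n"
  have s: "?s \<le> n - 1" using n_ge_2 by (metis Suc_le_eq Suc_pred' less_Suc_eq_le mod_less_divisor pos2 order_less_le_trans)
  have "diagonal (T 0) = (if ?s \<noteq> 0 \<and> ?s \<le> j then e else 1) * diagonal (T j)" if "j < n" for j
    using that
  proof (induction j)
    case (Suc j)
    have "diagonal (aux_coeff s T (Suc j)) = 0" using zero[of "Suc j"] Suc.prems by simp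
    then have "diagonal (T j) = (if Suc j = ?s then e else 1) * diagonal (T (Suc j))"
      by (simp add: aux_coeff_def split: if_splits)
    then show ?case using Suc by (auto simp: le_Suc_eq)
  qed auto
  from this[of "n - 1"] show ?thesis
    using n_ge_2 s by (auto simp: aux_coeff_def)
qed

lemma aux_eval_step:
  assumes s: "s < n" and zero: "\<And>j. j \<in> {1..<n} \<Longrightarrow> diagonal (aux_coeff s T j) = 0"
  shows "(monom 1 CARD('a) - [:0, 1:]) * aux_eval (Suc s mod n) (aux_step s T) =
    aux_eval s T * (e ^ m - 1) * (if Suc s = n then e else 1)"
proof -
  define w where "w s j = (if s < j then e else 1)" for s j :: nat
  define \<epsilon> where "\<epsilon> = (if Suc s = n then e else 1)"
  let ?s = "Suc s mod n" and ?g = "e ^ m" and ?f = "\<lambda>j. frob_subst (T j) * w s j"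
  obtain k where k: "n = Suc k" using n_ge_2 by (cases n) auto
  have coeff_0: "w ?s 0 * frob_subst (aux_coeff s T 0) = \<epsilon> * (?f k * ?g ^ n - ?f 0)"
    unfolding aux_coeff_def using s k
    by (cases "Suc s = n") (simp_all add: w_def \<epsilon>_def power_CARD_eq algebra_simps)
  have coeff_Suc: "w ?s (Suc j) * frob_subst (aux_coeff s T (Suc j)) = \<epsilon> * (?f j - ?f (Suc j))" if "j < k" for j
    unfolding aux_coeff_def using s k that
    by (cases "Suc s = n") (auto simp: w_def \<epsilon>_def algebra_simps)
  have "(monom 1 CARD('a) - [:0, 1:]) * aux_eval ?s (aux_step s T) =
      (\<Sum>j<n. w ?s j * frob_subst (aux_coeff s T j) * ?g ^ j)"
  proof -
    have "(monom 1 CARD('a) - [:0, 1:]) * frob_subst (aux_step s T j) = frob_subst (aux_coeff s T j)" if "j < n" for j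
      unfolding aux_step_def using diagonal_aux_coeff_0[OF s zero] zero that
      by (intro frob_subst_diag_div) (cases "j = 0"; simp)
    then show ?thesis
      unfolding aux_eval_def w_def[symmetric] sum_distrib_left
      by (intro sum.cong) (simp_all only: lessThan_iff mult_ac)
  qed
  also have "\<dots> = \<epsilon> * (?f k * ?g ^ n - ?f 0) + (\<Sum>j<k. \<epsilon> * (?f j - ?f (Suc j)) * ?g ^ Suc j)"
    unfolding k sum.lessThan_Suc_shift using coeff_0 coeff_Suc by (simp add: k)
  also have "\<dots> = \<epsilon> * ((\<Sum>j<n. ?f j * ?g ^ Suc j) - (\<Sum>j<n. ?f j * ?g ^ j))"
    unfolding k sum.lessThan_Suc_shift[of "\<lambda>j. ?f j * ?g ^ j"]
    by (simp add: sum_subtractf sum_distrib_left algebra_simps)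
  also have "\<dots> = aux_eval s T * (?g - 1) * \<epsilon>"
    by (simp add: aux_eval_def w_def sum_distrib_left sum_distrib_right algebra_simps flip: sum_subtractf)
  finally show ?thesis by (simp add: \<epsilon>_def)
qed

lemma aux_eval_iter:
  assumes "\<And>l j. l < i \<Longrightarrow> j \<in> {1..<n} \<Longrightarrow> diagonal (aux_coeff (l mod n) (aux_iter l T) j) = 0"
  shows "(monom 1 CARD('a) - [:0, 1:]) ^ i * aux_eval (i mod n) (aux_iter i T) =
    aux_eval 0 T * (e ^ m - 1) ^ i * e ^ (i div n)"
  using assms
proof (induction i)
  case (Suc i)
  let ?w = "monom 1 CARD('a) - [:0, 1 :: 'a:]" and ?s = "i mod n"
  have "?w ^ Suc i * aux_eval (Suc i mod n) (aux_iter (Suc i) T) =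
      ?w ^ i * (?w * aux_eval (Suc ?s mod n) (aux_step ?s (aux_iter i T)))"
    by (simp add: mod_Suc_eq mult_ac)
  also have "\<dots> = (?w ^ i * aux_eval ?s (aux_iter i T)) * (e ^ m - 1) * (if Suc ?s = n then e else 1)"
    using Suc.prems n_ge_2 by (subst aux_eval_step) (auto simp: mult_ac)
  also have "?w ^ i * aux_eval ?s (aux_iter i T) = aux_eval 0 T * (e ^ m - 1) ^ i * e ^ (i div n)"
    using Suc by simp
  finally show ?case
    using n_ge_2 by (auto simp: div_Suc mod_Suc mult_ac split: if_splits)
qed simp

lemma aux_coeff_diff: "aux_coeff s (\<lambda>j. T j - U j) j = aux_coeff s T j - aux_coeff s U j"
  by (simp add: aux_coeff_def algebra_simps smult_diff_right)

lemma aux_iter_diff: "aux_iter i (\<lambda>j. T j - U j) = (\<lambda>j. aux_iter i T j - aux_iter i U j)"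
  by (induction i) (simp_all add: aux_step_def[abs_def] aux_coeff_diff synthetic_div_diff)

definition weight_le :: "nat \<Rightarrow> nat \<Rightarrow> (nat \<Rightarrow> 'a poly poly) \<Rightarrow> bool" where
  "weight_le W s T \<longleftrightarrow> (\<forall>j<n. total_degree_le (W - (if s < j then D else 0)) (T j))"

lemma total_degree_aux_coeff_le:
  assumes T: "weight_le W s T" and s: "s < n" and W: "D \<le> W" and j: "j < n"
  shows "total_degree_le (W + (if Suc s = n then D else 0) - (if Suc s mod n < j then D else 0))
    (aux_coeff s T j)"
proof -
  let ?N = "W + (if Suc s = n then D else 0) - (if Suc s mod n < j then D else 0)"
  have bound: "total_degree_le (W - (if s < i then D else 0)) (T i)" if "i < n" for i
    using T that unfolding weight_le_def by blast
  have "total_degree_le ?N (if j = 0 then outer_poly e * T (n - 1) else T (j - 1))"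
  proof (cases j)
    case 0
    have "total_degree_le (D + (W - (if s < n - 1 then D else 0))) (outer_poly e * T (n - 1))"
      using bound[of "n - 1"] n_ge_2 degree_le by (intro total_degree_le_mult total_degree_le_outer_poly) auto
    then have "total_degree_le ?N (outer_poly e * T (n - 1))"
      by (rule total_degree_le_mono) (use 0 s W in auto)
    then show ?thesis using 0 by simp
  next
    case (Suc l)
    have "total_degree_le ?N (T l)"
      by (rule total_degree_le_mono[OF bound]) (use Suc j s in \<open>auto simp: mod_Suc\<close>)
    then show ?thesis using Suc by simp
  qed
  moreover have "total_degree_le ?N (if j = Suc s mod n then smult e (T j) else T j)"
  proof (cases "j = Suc s mod n")
    case True
    have "total_degree_le (D + (W - (if s < j then D else 0))) (smult e (T j))"
      by (rule total_degree_le_smult[OF bound[OF j] degree_le])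
    then have "total_degree_le ?N (smult e (T j))"
      by (rule total_degree_le_mono) (use True s W in \<open>auto simp: mod_Suc split: if_splits\<close>)
    then show ?thesis using True by simp
  next
    case False
    have "total_degree_le ?N (T j)"
      by (rule total_degree_le_mono[OF bound[OF j]]) (use False j s in \<open>auto simp: mod_Suc split: if_splits\<close>)
    then show ?thesis using False by simp
  qed
  ultimately show ?thesis unfolding aux_coeff_def by (rule total_degree_le_diff)
qed

lemma weight_le_aux_step:
  assumes "weight_le W s T" "s < n" "D \<le> W"
  shows "weight_le (W + (if Suc s = n then D else 0) - 1) (Suc s mod n) (aux_step s T)"
  unfolding weight_le_def aux_step_def
proof (intro allI impI)
  fix j assume "j < n"
  from total_degree_le_diag_div[OF total_degree_aux_coeff_le[OF assms this]]
  show "total_degree_le (W + (if Suc s = n then D else 0) - 1 - (if Suc s mod n < j then D else 0))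
      (diag_div (aux_coeff s T j))"
    by (simp only: diff_commute)
qed

lemma
  assumes W: "D + n \<le> W" and D: "n \<le> D"
  shows weight_ge: "D \<le> W + D * (i div n) - i"
    and weight_Suc: "W + D * (i div n) - i + (if Suc (i mod n) = n then D else 0) = W + D * (Suc i div n) - i"
proof -
  have "i = n * (i div n) + i mod n" by simp
  also have "\<dots> \<le> D * (i div n) + n"
    using D n_ge_2 by (intro add_mono mult_right_mono) (auto intro: less_imp_le)
  finally show ge: "D \<le> W + D * (i div n) - i" using W by linarith
  have "D * (Suc i div n) = D * (i div n) + (if Suc (i mod n) = n then D else 0)"
    by (simp add: div_Suc mod_Suc)
  moreover have "i \<le> W + D * (i div n)" using ge D n_ge_2 by linarith
  ultimately show "W + D * (i div n) - i + (if Suc (i mod n) = n then D else 0) = W + D * (Suc i div n) - i"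
    by linarith
qed

lemma weight_le_aux_iter:
  assumes "weight_le W 0 T" "D + n \<le> W" "n \<le> D"
  shows "weight_le (W + D * (i div n) - i) (i mod n) (aux_iter i T)"
proof (induction i)
  case (Suc i)
  have "i mod n < n" using n_ge_2 by simp
  from weight_le_aux_step[OF Suc.IH this weight_ge[OF assms(2,3)]]
  show ?case
    unfolding weight_Suc[OF assms(2,3)] by (simp add: mod_Suc_eq)
qed (use assms in simp)

lemma degree_diagonal_aux_iter_le:
  assumes "weight_le W 0 T" "D + n \<le> W" "n \<le> D" "j < n"
  shows "degree (diagonal (aux_coeff (i mod n) (aux_iter i T) j))
    \<le> W + D * (Suc i div n) - i - (if Suc i mod n < j then D else 0)"
proof -
  have "i mod n < n" using n_ge_2 by simp
  from total_degree_aux_coeff_le[OF weight_le_aux_iter[OF assms(1-3)] this weight_ge[OF assms(2,3)] assms(4)]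
  show ?thesis
    unfolding weight_Suc[OF assms(2,3)] by (simp add: mod_Suc_eq degree_diagonal_le)
qed

lemma card_PiE_degree_le:
  "finite I \<Longrightarrow> card (PiE I (\<lambda>x. {c :: 'a poly. degree c \<le> d x})) = CARD('a) ^ (\<Sum>x\<in>I. Suc (d x))"
  by (simp add: card_PiE card_degree_le power_sum del: power_Suc)

text \<open>The linear conditions of the first \<open>K\<close> steps are outnumbered by the coefficients at our disposal.\<close>

lemma exists_equal_diagonals:
  fixes k :: "nat \<Rightarrow> nat" and b :: "nat \<Rightarrow> nat \<Rightarrow> nat"
  assumes W: "D + n \<le> W" and D: "n \<le> D"
    and box: "\<And>j l. j < n \<Longrightarrow> l \<le> k j \<Longrightarrow> b j l + l \<le> W - (if 0 < j then D else 0)"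
    and many: "(\<Sum>i<K. \<Sum>j\<in>{1..<n}. Suc (W + D * (Suc i div n) - i - (if Suc i mod n < j then D else 0)))
      < (\<Sum>j<n. \<Sum>l\<le>k j. Suc (b j l))"
  obtains U V where "U \<noteq> V" "U \<in> PiE {..<n} (\<lambda>j. bounded_bipolys (k j) (b j))"
    "V \<in> PiE {..<n} (\<lambda>j. bounded_bipolys (k j) (b j))"
    "\<forall>i<K. \<forall>j\<in>{1..<n}. diagonal (aux_coeff (i mod n) (aux_iter i U) j) = diagonal (aux_coeff (i mod n) (aux_iter i V) j)"
proof -
  define I where "I = {..<K} \<times> {1..<n}"
  define d where "d = (\<lambda>(i, j). W + D * (Suc i div n) - i - (if Suc i mod n < j then D else 0))"
  define G where "G = (PiE {..<n} (\<lambda>j. bounded_bipolys (k j) (b j)) :: (nat \<Rightarrow> 'a poly poly) set)"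
  define h where "h T = (\<lambda>(i, j)\<in>I. diagonal (aux_coeff (i mod n) (aux_iter i T) j))" for T
  have "h ` G \<subseteq> PiE I (\<lambda>x. {c. degree c \<le> d x})"
  proof (intro image_subsetI)
    fix T assume "T \<in> G"
    then have "T j \<in> bounded_bipolys (k j) (b j)" if "j < n" for j
      using that unfolding G_def by blast
    then have "weight_le W 0 T"
      unfolding weight_le_def using total_degree_le_bounded_bipolys[OF _ box] by blast
    note degree_diagonal_aux_iter_le[OF this W D]
    then show "h T \<in> PiE I (\<lambda>x. {c. degree c \<le> d x})"
      unfolding h_def d_def I_def by (intro restrict_PiE_iff[THEN iffD2]) auto
  qed
  then have "card (h ` G) \<le> card (PiE I (\<lambda>x. {c :: 'a poly. degree c \<le> d x}))"
    by (rule card_mono[rotated]) (simp add: I_def finite_PiE finite_degree_le)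
  also have "\<dots> = CARD('a) ^ (\<Sum>x\<in>I. Suc (d x))"
    by (rule card_PiE_degree_le) (simp add: I_def)
  also have "\<dots> < CARD('a) ^ (\<Sum>j<n. \<Sum>l\<le>k j. Suc (b j l))"
  proof (rule power_strict_increasing)
    show "(\<Sum>x\<in>I. Suc (d x)) < (\<Sum>j<n. \<Sum>l\<le>k j. Suc (b j l))"
      using many unfolding I_def d_def sum.cartesian_product by (simp add: case_prod_beta)
    show "1 < CARD('a)" using prime_CARD by (rule prime_gt_1_nat)
  qed
  also have "\<dots> = card G"
    by (simp add: G_def card_PiE card_bounded_bipolys power_sum del: power_Suc)
  finally have "\<not> inj_on h G" by (rule pigeonhole)
  then obtain U V where UV: "U \<in> G" "V \<in> G" "h U = h V" "U \<noteq> V"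
    unfolding inj_on_def by blast
  have "diagonal (aux_coeff (i mod n) (aux_iter i U) j) = diagonal (aux_coeff (i mod n) (aux_iter i V) j)"
    if "i < K" "j \<in> {1..<n}" for i j
    using fun_cong[OF UV(3), of "(i, j)"] that by (simp add: h_def I_def)
  then show ?thesis using that UV unfolding G_def by blast
qed

lemma exists_auxiliary_family:
  fixes k :: "nat \<Rightarrow> nat" and b :: "nat \<Rightarrow> nat \<Rightarrow> nat"
  assumes "D + n \<le> W" "n \<le> D"
    and "\<And>j l. j < n \<Longrightarrow> l \<le> k j \<Longrightarrow> b j l + l \<le> W - (if 0 < j then D else 0)"
    and "(\<Sum>i<K. \<Sum>j\<in>{1..<n}. Suc (W + D * (Suc i div n) - i - (if Suc i mod n < j then D else 0)))
      < (\<Sum>j<n. \<Sum>l\<le>k j. Suc (b j l))"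
  obtains T where "\<exists>j<n. T j \<noteq> 0" "\<And>j. j < n \<Longrightarrow> T j \<in> bounded_bipolys (k j) (b j)"
    "(monom 1 CARD('a) - [:0, 1:]) ^ K dvd aux_eval 0 T * (e ^ m - 1) ^ K * e ^ (K div n)"
proof -
  obtain U V where UV: "U \<noteq> V" "U \<in> PiE {..<n} (\<lambda>j. bounded_bipolys (k j) (b j))"
      "V \<in> PiE {..<n} (\<lambda>j. bounded_bipolys (k j) (b j))"
    and eq: "\<forall>i<K. \<forall>j\<in>{1..<n}. diagonal (aux_coeff (i mod n) (aux_iter i U) j) = diagonal (aux_coeff (i mod n) (aux_iter i V) j)"
    by (rule exists_equal_diagonals[OF assms])
  define T where "T j = U j - V j" for j
  have zero: "diagonal (aux_coeff (i mod n) (aux_iter i T) j) = 0" if "i < K" "j \<in> {1..<n}" for i j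
    using eq that by (simp add: T_def[abs_def] aux_iter_diff aux_coeff_diff)
  show ?thesis
  proof (rule that[of T])
    have "\<exists>j<n. U j \<noteq> V j" using UV by (meson PiE_ext lessThan_iff)
    then show "\<exists>j<n. T j \<noteq> 0" by (simp add: T_def)
    show "T j \<in> bounded_bipolys (k j) (b j)" if "j < n" for j
      using UV(2,3) that unfolding T_def by (auto intro!: bounded_bipolys_diff)
    show "(monom 1 CARD('a) - [:0, 1:]) ^ K dvd aux_eval 0 T * (e ^ m - 1) ^ K * e ^ (K div n)"
      by (rule dvdI[OF aux_eval_iter[OF zero, symmetric]])
  qed
qed

end

lemma order_power:
  fixes p :: "'a :: idom poly"
  shows "p \<noteq> 0 \<Longrightarrow> order x (p ^ n) = n * order x p"
  by (induction n) (simp_all add: order_mult)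

lemma order_bound_if_frobenius_dvd:
  fixes R H e :: "'a :: finite_field poly"
  assumes dvd: "(monom 1 CARD('a) - [:0, 1:]) ^ K dvd R * H ^ K * e ^ l"
    and nz: "R \<noteq> 0" "e \<noteq> 0" and S: "\<And>t. t \<in> S \<Longrightarrow> poly H t \<noteq> 0"
  shows "K * card S \<le> degree R + l * (\<Sum>t\<in>S. order t e)"
proof -
  have "K \<le> order t R + l * order t e" if t: "t \<in> S" for t
  proof -
    have nonzero: "poly H t \<noteq> 0" "H \<noteq> 0" using S[OF t] by auto
    have "[:- t, 1:] dvd monom 1 CARD('a) - [:0, 1:]"
      by (simp add: poly_monom flip: poly_eq_0_iff_dvd)
    then have "[:- t, 1:] ^ K dvd R * H ^ K * e ^ l"
      using dvd dvd_power_same dvd_trans by blast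
    moreover have "R * H ^ K * e ^ l \<noteq> 0" using nz nonzero by simp
    ultimately have "K \<le> order t (R * H ^ K * e ^ l)"
      using order_divides by blast
    also have "\<dots> = order t R + l * order t e"
      using nz nonzero by (simp add: order_mult order_power order_0I)
    finally show ?thesis .
  qed
  then have "(\<Sum>t\<in>S. K) \<le> (\<Sum>t\<in>S. order t R + l * order t e)" by (rule sum_mono)
  also have "\<dots> = (\<Sum>t\<in>S. order t R) + l * (\<Sum>t\<in>S. order t e)"
    by (simp add: sum.distrib sum_distrib_left)
  also have "(\<Sum>t\<in>S. order t R) \<le> degree R"
    by (rule sum_order_le_degree_finite[OF nz(1)])
  finally show ?thesis by (simp add: mult.commute)
qed

subsection \<open>Polynomials with few square values\<close>

lemma degree_coeff_mult_le:
  fixes P Q :: "'a :: comm_ring_1 poly poly"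
  assumes "\<And>j. degree (coeff P j) \<le> K" "\<And>j. degree (coeff Q j) \<le> L"
  shows "degree (coeff (P * Q) j) \<le> K + L"
  unfolding coeff_mult
  by (intro degree_sum_le) (auto intro: order_trans[OF degree_mult_le] add_mono assms)

lemma degree_coeff_bounded_bipolys:
  assumes "P \<in> bounded_bipolys k b" "\<And>j. j \<le> k \<Longrightarrow> b j \<le> N"
  shows "degree (coeff P j) \<le> N"
proof (cases "j \<le> k")
  case True
  then have "degree (coeff P j) \<le> b j" using assms(1) unfolding bounded_bipolys_def by blast
  then show ?thesis using assms(2)[OF True] by (rule order_trans)
next
  case False
  then show ?thesis using assms(1) by (simp add: bounded_bipolys_def coeff_eq_0)
qed

lemma (in superelliptic) square_identity_if_aux_eval_eq_0:
  assumes n: "n = 2" and D: "D = 2 * r" "r \<le> m"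
    and deg: "\<And>j. degree (coeff (T 0) j) \<le> m" "\<And>j. degree (coeff (T 1) j) \<le> m - r"
    and zero: "aux_eval 0 T = 0"
  shows "T 0 * T 0 = T 1 * T 1 * ([:e:] * outer_poly e)"
proof (rule ccontr)
  let ?P = "T 0 * T 0 - T 1 * T 1 * ([:e:] * outer_poly e)"
  assume "\<not> ?thesis"
  then have "?P \<noteq> 0" by simp
  have "degree (coeff [:e:] j) \<le> 2 * r" "degree (coeff (outer_poly e) j) \<le> 0" for j
    using degree_le D(1) by (auto simp: outer_poly_def coeff_map_poly coeff_pCons split: nat.splits)
  then have "degree (coeff (T 1 * T 1 * ([:e:] * outer_poly e)) j) \<le> (m - r) + (m - r) + (2 * r + 0)" for j
    by (intro degree_coeff_mult_le deg) auto
  also have "(m - r) + (m - r) + (2 * r + 0) = m + m" using D(2) by simp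
  finally have "degree (coeff (T 1 * T 1 * ([:e:] * outer_poly e)) j) \<le> m + m" for j .
  moreover have "degree (coeff (T 0 * T 0) j) \<le> m + m" for j
    by (intro degree_coeff_mult_le deg)
  ultimately have "degree (coeff ?P j) \<le> m + m" for j
    unfolding coeff_diff by (intro degree_diff_le)
  then have "degree (coeff ?P j) < CARD('a)" for j
    unfolding CARD_eq n by (rule le_less_trans) simp
  with \<open>?P \<noteq> 0\<close> have "frob_subst ?P \<noteq> 0" by (rule frob_subst_neq_0)
  have "frob_subst (T 0) + frob_subst (T 1) * e * e ^ m = 0"
    using zero[unfolded aux_eval_def] unfolding n by (simp add: numeral_2_eq_2)
  then have "frob_subst (T 0) = - (frob_subst (T 1) * e * e ^ m)" by (simp only: eq_neg_iff_add_eq_0)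
  then have "frob_subst ?P = frob_subst (T 1) * frob_subst (T 1) * e * (e * (e ^ m)\<^sup>2 - e ^ CARD('a))"
    by (simp add: frob_subst_def[of "[:e:]"] power2_eq_square algebra_simps)
  also have "\<dots> = 0" by (simp add: power_CARD_eq n)
  finally show False using \<open>frob_subst ?P \<noteq> 0\<close> by simp
qed

lemma smult_eq_square_if_square_identity:
  fixes A B :: "'a :: prime_field poly poly"
  assumes eq: "A * A = B * B * ([:e:] * outer_poly e)" and s: "poly B [:s:] \<noteq> 0"
  obtains h where "smult (poly e s) e = h\<^sup>2"
proof -
  have "pcompose r [:s:] = [:poly r s:]" for r :: "'a poly"
    by (induction r) (simp_all add: pcompose_pCons)
  then have ab: "(poly A [:s:])\<^sup>2 = (poly B [:s:])\<^sup>2 * smult (poly e s) e"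
    using arg_cong[OF eq, of "\<lambda>P. poly P [:s:]"]
    by (simp add: poly_outer_poly power2_eq_square mult_ac)
  then have "(poly B [:s:])\<^sup>2 dvd (poly A [:s:])\<^sup>2" by (metis dvd_triv_left)
  then have "poly B [:s:] dvd poly A [:s:]" by simp
  then obtain h where "poly A [:s:] = poly B [:s:] * h" by blast
  then have "(poly B [:s:])\<^sup>2 * h\<^sup>2 = (poly B [:s:])\<^sup>2 * smult (poly e s) e"
    using ab by (simp add: power_mult_distrib)
  then have "h\<^sup>2 = smult (poly e s) e"
    using s by (metis mult_left_cancel power_not_zero)
  then show ?thesis by (rule that[OF sym])
qed

lemma card_const_roots_le:
  fixes B :: "'a :: {finite, idom} poly poly"
  assumes "B \<noteq> 0"
  shows "card {s. poly B [:s:] = 0} \<le> degree B"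
proof -
  have "card {s. poly B [:s:] = 0} = card ((\<lambda>s. [:s:]) ` {s. poly B [:s:] = 0})"
    by (simp add: card_image inj_on_def)
  also have "\<dots> \<le> card {x. poly B x = 0}"
    by (intro card_mono poly_roots_finite[OF assms]) auto
  also have "\<dots> \<le> degree B" by (rule card_poly_roots_bound[OF assms])
  finally show ?thesis .
qed

definition nonzero_square_points :: "'a :: comm_ring_1 poly \<Rightarrow> 'a set"
  where "nonzero_square_points \<delta> = {t. \<exists>s. s \<noteq> 0 \<and> poly \<delta> t = s\<^sup>2}"

lemma poly_nonsquare_if_outside_nonzero_square_points:
  assumes "t \<notin> nonzero_square_points \<delta>" "poly \<delta> t \<noteq> 0"
  shows "poly \<delta> t \<noteq> s\<^sup>2"
  using assms unfolding nonzero_square_points_def by (cases "s = 0") auto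

lemma power_half_minus_1_neq_0:
  fixes \<delta> :: "'a :: big_prime_field poly"
  assumes "t \<notin> nonzero_square_points \<delta>"
  shows "poly (\<delta> ^ ((CARD('a) - 1) div 2) - 1) t \<noteq> 0"
proof (cases "poly \<delta> t = 0")
  case True
  then show ?thesis using CARD_gt[where ?'a='a] by (simp add: zero_power)
next
  case False
  have "poly \<delta> t ^ ((CARD('a) - 1) div 2) = - 1"
    using poly_nonsquare_if_outside_nonzero_square_points[OF assms False] by (rule nonsquare_power_half)
  then have eq: "poly (\<delta> ^ ((CARD('a) - 1) div 2) - 1) t = - 1 - 1"
    by (simp only: poly_diff poly_power poly_1)
  show ?thesis unfolding eq by simp
qed

lemma eq_nonsq_times_square_if_smult_eq_square:
  fixes \<delta> h :: "'a :: big_prime_field poly"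
  assumes "\<And>s. a \<noteq> s\<^sup>2" and h: "smult a \<delta> = h\<^sup>2"
  shows "\<exists>h. \<delta> = smult nonsq (h\<^sup>2)"
proof -
  obtain c where c: "c \<noteq> 0" "nonsq * a = c\<^sup>2" using nonsq_times_nonsquare[OF assms(1)] .
  have "\<delta> = smult (inverse (c\<^sup>2)) (smult (nonsq * a) \<delta>)" using c by simp
  also have "smult (nonsq * a) \<delta> = smult nonsq (h\<^sup>2)" by (simp flip: h)
  also have "smult (inverse (c\<^sup>2)) (smult nonsq (h\<^sup>2)) = smult nonsq ((smult (inverse c) h)\<^sup>2)"
    by (simp add: power2_eq_square mult_ac)
  finally show ?thesis by blast
qed

text \<open>The parameters \<open>K\<close> (number of steps), \<open>E\<close> (exceptions), \<open>d\<close> (excess of the weight) trade the degree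
  of \<open>\<delta>\<close> against the number of exceptions.\<close>

locale few_nonzero_squares =
  fixes \<delta> :: "'a :: big_prime_field poly" and m r K E d :: nat
  assumes card: "CARD('a) = 2 * m + 1" and nz: "\<delta> \<noteq> 0" and \<delta>: "degree \<delta> \<le> 2 * r"
    and few: "card (nonzero_square_points \<delta>) \<le> E"
    and r: "0 < r" "r < K" "E + K + 2 * r \<le> 49" and E: "K * E + K div 2 * (2 * r) \<le> 51"
    and many: "(\<Sum>i<K. Suc (m + d + 2 * r * (Suc i div 2) - i - (if Suc i mod 2 = 0 then 2 * r else 0)))
      < (\<Sum>l<K. Suc (min m (m + d - l))) + (\<Sum>l<K - r. Suc (min (m - r) (m + d - 2 * r - l)))"
begin

sublocale superelliptic 2 m "2 * r" \<delta>
  using card \<delta> by unfold_locales simp_all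

lemma m_ge: "51 \<le> m"
  using card CARD_gt[where ?'a='a] by linarith

lemma exists_square_auxiliary:
  obtains T where "\<exists>j<2. T j \<noteq> 0" "degree (T 0) \<le> K - 1" "\<forall>j. degree (coeff (T 0) j) \<le> m"
    "degree (T 1) \<le> K - 1 - r" "\<forall>j. degree (coeff (T 1) j) \<le> m - r"
    "(monom 1 CARD('a) - [:0, 1:]) ^ K dvd aux_eval 0 T * (\<delta> ^ m - 1) ^ K * \<delta> ^ (K div 2)"
proof -
  define k b where "k j = (if j = 0 then K - 1 else K - 1 - r)"
    and "b j l = (if j = 0 then min m (m + d - l) else min (m - r) (m + d - 2 * r - l))" for j l :: nat
  obtain T where T: "\<exists>j<2. T j \<noteq> 0" "\<And>j. j < 2 \<Longrightarrow> T j \<in> bounded_bipolys (k j) (b j)"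
    "(monom 1 CARD('a) - [:0, 1:]) ^ K dvd aux_eval 0 T * (\<delta> ^ m - 1) ^ K * \<delta> ^ (K div 2)"
  proof (rule exists_auxiliary_family[of "m + d" k b K])
    show "b j l + l \<le> m + d - (if 0 < j then 2 * r else 0)" if "j < 2" "l \<le> k j" for j l
      using that r m_ge by (auto simp: b_def k_def)
    have "{..K - 1} = {..<K}" "{..K - 1 - r} = {..<K - r}" using r(2) by auto
    moreover have "(\<Sum>j\<in>{1..<2}. f j) = f 1" "(\<Sum>j<2. f j) = f 0 + f 1" for f :: "nat \<Rightarrow> nat"
      by (simp_all add: numeral_2_eq_2)
    ultimately show "(\<Sum>i<K. \<Sum>j\<in>{1..<2}. Suc (m + d + 2 * r * (Suc i div 2) - i - (if Suc i mod 2 < j then 2 * r else 0)))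
        < (\<Sum>j<2. \<Sum>l\<le>k j. Suc (b j l))"
      using many by (simp add: k_def b_def)
  qed (use r m_ge in auto)
  have "degree (T 0) \<le> K - 1" "degree (coeff (T 0) j) \<le> m" for j
    using T(2)[of 0] degree_coeff_bounded_bipolys[of "T 0" "k 0" "b 0" m j]
    by (auto simp: bounded_bipolys_def k_def b_def)
  moreover have "degree (T 1) \<le> K - 1 - r" "degree (coeff (T 1) j) \<le> m - r" for j
    using T(2)[of 1] degree_coeff_bounded_bipolys[of "T 1" "k 1" "b 1" "m - r" j]
    by (auto simp: bounded_bipolys_def k_def b_def)
  ultimately show ?thesis using that T(1,3) by blast
qed

lemma degree_aux_eval_le:
  assumes "degree (T 0) \<le> K - 1" "\<forall>j. degree (coeff (T 0) j) \<le> m"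
    "degree (T 1) \<le> K - 1 - r" "\<forall>j. degree (coeff (T 1) j) \<le> m - r"
  shows "degree (aux_eval 0 T) \<le> m + CARD('a) * (K - 1)"
proof -
  obtain c where c: "K = Suc (c + r)" using r(2) less_iff_Suc_add by (metis add.commute)
  have "degree (frob_subst (T 1) * \<delta> * \<delta> ^ m) \<le> (m - r) + CARD('a) * (K - 1 - r) + 2 * r + 2 * r * m"
    by (intro order_trans[OF degree_mult_le] add_mono degree_frob_subst_le assms(3) assms(4)[rule_format] \<delta>
        order_trans[OF degree_power_le mult_right_mono]) auto
  also have "\<dots> = m + CARD('a) * (K - 1)"
    using r m_ge by (simp add: c card algebra_simps)
  finally show ?thesis
    using degree_frob_subst_le[OF assms(1) assms(2)[rule_format]] unfolding aux_eval_def
    by (simp add: numeral_2_eq_2 degree_add_le)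
qed

text \<open>A nonzero auxiliary polynomial would have more zeros than its degree allows.\<close>

lemma aux_eval_eq_0:
  assumes degree: "degree (aux_eval 0 T) \<le> m + CARD('a) * (K - 1)"
    and dvd: "(monom 1 CARD('a) - [:0, 1:]) ^ K dvd aux_eval 0 T * (\<delta> ^ m - 1) ^ K * \<delta> ^ (K div 2)"
  shows "aux_eval 0 T = 0"
proof (rule ccontr)
  assume "aux_eval 0 T \<noteq> 0"
  then have "K * card (- nonzero_square_points \<delta>) \<le>
      degree (aux_eval 0 T) + K div 2 * (\<Sum>t\<in>- nonzero_square_points \<delta>. order t \<delta>)"
    using power_half_minus_1_neq_0[of _ \<delta>] card
    by (intro order_bound_if_frobenius_dvd[OF dvd _ nz]) auto
  also have "\<dots> \<le> m + CARD('a) * (K - 1) + K div 2 * (2 * r)"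
    using order_trans[OF sum_order_le_degree_finite[OF nz] \<delta>]
    by (intro add_mono mult_left_mono degree) auto
  finally have zeros: "K * card (- nonzero_square_points \<delta>) \<le> m + CARD('a) * (K - 1) + K div 2 * (2 * r)" .
  have "CARD('a) \<le> card (- nonzero_square_points \<delta>) + E"
    using few card_Un_le[of "nonzero_square_points \<delta>" "- nonzero_square_points \<delta>"] by simp
  then have "K * CARD('a) \<le> K * card (- nonzero_square_points \<delta>) + K * E"
    by (metis distrib_left mult_le_mono2)
  moreover have "K * CARD('a) = CARD('a) * (K - 1) + CARD('a)"
    using r(2) by (cases K) simp_all
  ultimately show False using zeros E card m_ge by linarith
qed

lemma eq_nonsq_times_square: "\<exists>h. \<delta> = smult nonsq (h\<^sup>2)"
proof -
  obtain T where T: "\<exists>j<2. T j \<noteq> 0" "degree (T 0) \<le> K - 1" "\<forall>j. degree (coeff (T 0) j) \<le> m"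
      "degree (T 1) \<le> K - 1 - r" "\<forall>j. degree (coeff (T 1) j) \<le> m - r"
    and dvd: "(monom 1 CARD('a) - [:0, 1:]) ^ K dvd aux_eval 0 T * (\<delta> ^ m - 1) ^ K * \<delta> ^ (K div 2)"
    by (rule exists_square_auxiliary)
  have "r \<le> m" using r(3) m_ge by simp
  have "aux_eval 0 T = 0" using aux_eval_eq_0 degree_aux_eval_le[OF T(2-5)] dvd by blast
  then have identity: "T 0 * T 0 = T 1 * T 1 * ([:\<delta>:] * outer_poly \<delta>)"
    by (rule square_identity_if_aux_eval_eq_0[OF refl refl \<open>r \<le> m\<close> T(3)[rule_format] T(5)[rule_format]])
  have "T 1 \<noteq> 0"
  proof
    assume "T 1 = 0"
    then have "T 0 = 0" using identity by simp
    then show False using \<open>T 1 = 0\<close> T(1) by (auto simp: less_2_cases_iff)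
  qed
  let ?bad = "nonzero_square_points \<delta> \<union> {s. poly \<delta> s = 0} \<union> {s. poly (T 1) [:s:] = 0}"
  have "card ?bad \<le> card (nonzero_square_points \<delta>) + card {s. poly \<delta> s = 0} + card {s. poly (T 1) [:s:] = 0}"
    by (intro order_trans[OF card_Un_le] add_mono card_Un_le order_refl)
  also have "\<dots> \<le> E + 2 * r + (K - 1 - r)"
    using few \<delta> card_poly_roots_bound[OF nz] card_const_roots_le[OF \<open>T 1 \<noteq> 0\<close>] T(4)
    by (intro add_mono) linarith+
  also have "\<dots> < CARD('a)" using r card m_ge by linarith
  finally have "?bad \<noteq> UNIV" by auto
  then obtain s where s: "s \<notin> nonzero_square_points \<delta>" "poly \<delta> s \<noteq> 0" "poly (T 1) [:s:] \<noteq> 0" by blast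
  obtain h where "smult (poly \<delta> s) \<delta> = h\<^sup>2" using smult_eq_square_if_square_identity[OF identity s(3)] .
  with poly_nonsquare_if_outside_nonzero_square_points[OF s(1,2)] show ?thesis
    by (rule eq_nonsq_times_square_if_smult_eq_square)
qed

end

theorem eq_nonsq_times_square_if_at_most_4_nonzero_squares:
  fixes \<delta> :: "'a :: big_prime_field poly"
  assumes "degree \<delta> \<le> 8" "card (nonzero_square_points \<delta>) \<le> 4"
  shows "\<exists>h. \<delta> = smult nonsq (h\<^sup>2)"
proof (cases "\<delta> = 0")
  case False
  obtain m where m: "CARD('a) = 2 * m + 1" using CARD_eq_half[where ?'a='a] by blast
  then have "51 \<le> m" using CARD_gt[where ?'a='a] by linarith
  then have "few_nonzero_squares \<delta> m 4 6 4 5"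
    using assms False m by unfold_locales (simp_all add: lessThan_nat_numeral)
  then show ?thesis by (rule few_nonzero_squares.eq_nonsq_times_square)
qed (intro exI[of _ 0], simp)

theorem eq_nonsq_times_square_if_no_nonzero_squares:
  fixes \<delta> :: "'a :: big_prime_field poly"
  assumes "degree \<delta> \<le> 10" "nonzero_square_points \<delta> = {}"
  shows "\<exists>h. \<delta> = smult nonsq (h\<^sup>2)"
proof (cases "\<delta> = 0")
  case False
  obtain m where m: "CARD('a) = 2 * m + 1" using CARD_eq_half[where ?'a='a] by blast
  then have "51 \<le> m" using CARD_gt[where ?'a='a] by linarith
  then have "few_nonzero_squares \<delta> m 5 9 0 3"
    using assms False m by unfold_locales (simp_all add: lessThan_nat_numeral)
  then show ?thesis by (rule few_nonzero_squares.eq_nonsq_times_square)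
qed (intro exI[of _ 0], simp)

corollary eq_square_if_all_values_squares:
  fixes \<delta> :: "'a :: big_prime_field poly"
  assumes "degree \<delta> \<le> 10" and square: "\<And>t. \<exists>s. poly \<delta> t = s\<^sup>2"
  shows "\<exists>h. \<delta> = h\<^sup>2"
proof -
  have "s = 0" if "poly (smult nonsq \<delta>) t = s\<^sup>2" for s t
  proof -
    obtain r where "poly \<delta> t = r\<^sup>2" using square by blast
    then have "s\<^sup>2 = nonsq * r\<^sup>2" using that by simp
    then show ?thesis by (simp add: square_eq_nonsq_times_square_iff)
  qed
  then have "nonzero_square_points (smult nonsq \<delta>) = {}"
    by (auto simp: nonzero_square_points_def)
  then obtain h where "smult nonsq \<delta> = smult nonsq (h\<^sup>2)"
    using eq_nonsq_times_square_if_no_nonzero_squares[of "smult nonsq \<delta>"] assms(1) by auto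
  then have "smult (inverse nonsq) (smult nonsq \<delta>) = smult (inverse nonsq) (smult nonsq (h\<^sup>2))" by simp
  then show ?thesis by auto
qed

subsection \<open>Cube values of quintic polynomials\<close>

lemma sum_neq_0_if_degrees_distinct:
  fixes f :: "'i \<Rightarrow> 'b :: comm_monoid_add poly"
  assumes "finite I" "i \<in> I" "f i \<noteq> 0" and inj: "inj_on (\<lambda>i. degree (f i)) {i \<in> I. f i \<noteq> 0}"
  shows "sum f I \<noteq> 0"
proof -
  let ?I = "{i \<in> I. f i \<noteq> 0}"
  define N where "N = Max ((\<lambda>i. degree (f i)) ` ?I)"
  have "N \<in> (\<lambda>i. degree (f i)) ` ?I"
    unfolding N_def using assms(1-3) by (intro Max_in) auto
  then obtain l where l: "l \<in> ?I" "degree (f l) = N" by auto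
  have "coeff (f j) N = 0" if "j \<in> I - {l}" for j
  proof (cases "f j = 0")
    case False
    then have "j \<in> ?I" using that by simp
    then have "degree (f j) \<le> N" "degree (f j) \<noteq> degree (f l)"
      using assms(1) that l(1) inj_onD[OF inj, of j l] unfolding N_def by auto
    then show ?thesis using l(2) by (simp add: coeff_eq_0)
  qed simp
  then have "coeff (sum f I) N = coeff (f l) N"
    using assms(1) l(1) by (simp add: coeff_sum sum.remove[of I l])
  then show ?thesis using l by (metis (mono_tags, lifting) coeff_0 leading_coeff_0_iff mem_Collect_eq)
qed

lemma exists_cube_root_if_CARD_mod_3_eq_2:
  fixes y :: "'a :: finite_field"
  assumes "CARD('a) mod 3 = 2"
  shows "\<exists>x. x ^ 3 = y"
proof -
  define m where "m = CARD('a) div 3"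
  have card: "CARD('a) = 3 * m + 2" using assms by (simp add: m_def) presburger
  have "y = y ^ CARD('a)" by simp
  also have "\<dots> = y ^ CARD('a) * y ^ (3 * m + 1)"
    by (cases "y = 0") (use power_CARD_minus_1[of y] card in \<open>simp_all add: zero_power\<close>)
  also have "\<dots> = y ^ ((2 * m + 1) * 3)"
    unfolding card power_add[symmetric] by (rule arg_cong) simp
  finally have "(y ^ (2 * m + 1)) ^ 3 = y" unfolding power_mult ..
  then show ?thesis by blast
qed

lemma prime_field_CARD_mod_3:
  assumes "CARD('a :: big_prime_field) mod 3 \<noteq> 2"
  obtains m where "CARD('a) = 3 * m + 1"
proof -
  have "\<not> 3 dvd CARD('a)"
    using primes_dvd_imp_eq[of 3 "CARD('a)"] prime_CARD[where ?'a='a] CARD_gt[where ?'a='a] by auto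
  then have "CARD('a) = 3 * (CARD('a) div 3) + 1" using assms by presburger
  then show ?thesis by (rule that)
qed

locale quintic_over_cubic_residues = superelliptic 3 m 5 e
  for m :: nat and e :: "'a :: big_prime_field poly" +
  assumes degree_e: "degree e = 5"
begin

lemma m_ge: "27 \<le> m"
  using CARD_eq CARD_gt[where ?'a='a] by linarith

definition summand :: "'a poly poly \<Rightarrow> nat \<Rightarrow> 'a poly"
  where "summand T j = frob_subst T * (if 0 < j then e else 1) * (e ^ m) ^ j"

text \<open>Modulo \<open>q = 3m + 1\<close>, three times the degree of the \<open>j\<close>-th summand is \<open>3i + r\<^sub>j < q\<close> with
  \<open>r = (0, 10, 5)\<close>; hence no two summands cancel.\<close>

lemma
  assumes j: "j < 3" and T: "\<forall>l. degree (coeff T l) \<le> m - [0, 4, 3] ! j" "degree T \<le> [6, 5, 3] ! j"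
    and nz: "summand T j \<noteq> 0"
  shows three_times_degree_mod_CARD: "3 * degree (summand T j) mod CARD('a) mod 3 = j"
    and degree_summand_less: "degree (summand T j) < 7 * CARD('a)"
proof -
  let ?q = "CARD('a)" and ?d = "degree (lead_coeff T)"
  have j': "j = 0 \<or> j = 1 \<or> j = 2" using j by auto
  have d: "?d \<le> m - [0, 4, 3] ! j" using T(1) by blast
  have "degree (coeff T l) < ?q" for l using T(1) CARD_eq by (intro le_less_trans[OF T(1)[rule_format]]) linarith
  moreover have "T \<noteq> 0" using nz by (auto simp: summand_def frob_subst_def)
  ultimately have "degree (frob_subst T) = ?d + ?q * degree T" by (intro degree_frob_subst)
  moreover have "e \<noteq> 0" using degree_e by auto
  ultimately have deg: "degree (summand T j) = ?d + ?q * degree T + (if 0 < j then 5 else 0) + j * m * 5"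
    using nz degree_e unfolding summand_def by (auto simp: degree_mult_eq degree_power_eq)
  have "3 * (?d + ?q * degree T + (if 0 < j then 5 else 0) + j * m * 5) =
      (3 * ?d + [0, 10, 5] ! j) + ?q * (3 * degree T + 5 * j)"
    using j' by (elim disjE) (simp_all add: CARD_eq algebra_simps)
  moreover have "3 * ?d + [0, 10, 5] ! j < ?q"
    using d CARD_eq m_ge j' by (elim disjE) simp_all
  ultimately have "3 * degree (summand T j) mod ?q = 3 * ?d + [0, 10, 5] ! j"
    unfolding deg by (simp only: mod_mult_self2 mod_less)
  then show "3 * degree (summand T j) mod CARD('a) mod 3 = j"
    using j' by (elim disjE) simp_all
  have "?q * degree T \<le> ?q * [6, 5, 3] ! j" using T(2) by (rule mult_le_mono2)
  then show "degree (summand T j) < 7 * CARD('a)"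
    unfolding deg using d CARD_eq m_ge j' by (elim disjE) simp_all
qed

lemma exists_cube_auxiliary:
  obtains T where "\<exists>j<3. T j \<noteq> 0" "\<forall>j<3. (\<forall>l. degree (coeff (T j) l) \<le> m - [0, 4, 3] ! j) \<and> degree (T j) \<le> [6, 5, 3] ! j"
    "(monom 1 CARD('a) - [:0, 1:]) ^ 7 dvd aux_eval 0 T * (e ^ m - 1) ^ 7 * e ^ (7 div 3)"
proof -
  define k :: "nat \<Rightarrow> nat" where "k j = [6, 5, 3] ! j" for j
  define b :: "nat \<Rightarrow> nat \<Rightarrow> nat"
    where "b j l = min (m - [0, 4, 3] ! j) (m + 2 - (if 0 < j then 5 else 0) - l)" for j l
  obtain T where T: "\<exists>j<3. T j \<noteq> 0" "\<And>j. j < 3 \<Longrightarrow> T j \<in> bounded_bipolys (k j) (b j)"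
    "(monom 1 CARD('a) - [:0, 1:]) ^ 7 dvd aux_eval 0 T * (e ^ m - 1) ^ 7 * e ^ (7 div 3)"
  proof (rule exists_auxiliary_family[of "m + 2" k b 7])
    show "b j l + l \<le> m + 2 - (if 0 < j then 5 else 0)" if "j < 3" "l \<le> k j" for j l
    proof -
      have "j = 0 \<or> j = 1 \<or> j = 2" using that(1) by auto
      then show ?thesis using that(2) m_ge by (elim disjE) (simp_all add: b_def k_def)
    qed
    have "{1..<3} = {1, 2 :: nat}" by auto
    then show "(\<Sum>i<7. \<Sum>j\<in>{1..<3}. Suc (m + 2 + 5 * (Suc i div 3) - i - (if Suc i mod 3 < j then 5 else 0)))
        < (\<Sum>j<3. \<Sum>l\<le>k j. Suc (b j l))"
      using m_ge by (simp add: k_def b_def lessThan_nat_numeral atMost_nat_numeral)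
  qed (use m_ge in auto)
  have "degree (coeff (T j) l) \<le> m - [0, 4, 3] ! j" "degree (T j) \<le> [6, 5, 3] ! j" if "j < 3" for j l
    using T(2)[OF that] degree_coeff_bounded_bipolys[OF T(2)[OF that]]
    by (simp_all add: bounded_bipolys_def b_def k_def)
  then show ?thesis using that T(1,3) by blast
qed

lemma
  assumes T: "\<exists>j<3. T j \<noteq> 0"
    "\<forall>j<3. (\<forall>l. degree (coeff (T j) l) \<le> m - [0, 4, 3] ! j) \<and> degree (T j) \<le> [6, 5, 3] ! j"
  shows aux_eval_neq_0: "aux_eval 0 T \<noteq> 0" and degree_aux_eval_less: "degree (aux_eval 0 T) < 7 * CARD('a)"
proof -
  let ?f = "\<lambda>j. summand (T j) j"
  have aux_eval: "aux_eval 0 T = (\<Sum>j<3. ?f j)" by (simp add: aux_eval_def summand_def)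
  have bounds: "\<forall>l. degree (coeff (T j) l) \<le> m - [0, 4, 3] ! j" "degree (T j) \<le> [6, 5, 3] ! j" if "j < 3" for j
    using T(2) that by simp_all
  have mod: "3 * degree (?f j) mod CARD('a) mod 3 = j" and less: "degree (?f j) < 7 * CARD('a)"
    if j: "j < 3" "?f j \<noteq> 0" for j
    by (rule three_times_degree_mod_CARD[OF j(1) bounds[OF j(1)] j(2)],
        rule degree_summand_less[OF j(1) bounds[OF j(1)] j(2)])
  have inj: "inj_on (\<lambda>j. degree (?f j)) {j \<in> {..<3}. ?f j \<noteq> 0}"
  proof (rule inj_onI)
    fix i j assume i: "i \<in> {j \<in> {..<3}. ?f j \<noteq> 0}" and j: "j \<in> {j \<in> {..<3}. ?f j \<noteq> 0}"
      and eq: "degree (?f i) = degree (?f j)"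
    have "i = 3 * degree (?f i) mod CARD('a) mod 3" using i by (intro mod[symmetric]) simp_all
    also have "\<dots> = j" unfolding eq using j by (intro mod) simp_all
    finally show "i = j" .
  qed
  obtain j where j: "j < 3" "T j \<noteq> 0" using T(1) by blast
  have "degree (coeff (T j) l) < CARD('a)" for l
    using CARD_eq by (intro le_less_trans[OF bounds(1)[OF j(1), rule_format]]) linarith
  moreover have "e \<noteq> 0" using degree_e by auto
  ultimately have "?f j \<noteq> 0" using frob_subst_neq_0[OF j(2)] by (simp add: summand_def)
  with j(1) inj show "aux_eval 0 T \<noteq> 0"
    unfolding aux_eval by (intro sum_neq_0_if_degrees_distinct) auto
  have "degree (?f j) < 7 * CARD('a)" if "j < 3" for j
    by (cases "?f j = 0") (simp, rule less[OF that])
  then show "degree (aux_eval 0 T) < 7 * CARD('a)"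
    unfolding aux_eval by (intro degree_sum_less) auto
qed

lemma exists_cube_value: "\<exists>x v. x ^ 3 = poly e v"
proof (rule ccontr)
  assume no: "\<not> ?thesis"
  obtain T where T: "\<exists>j<3. T j \<noteq> 0"
      "\<forall>j<3. (\<forall>l. degree (coeff (T j) l) \<le> m - [0, 4, 3] ! j) \<and> degree (T j) \<le> [6, 5, 3] ! j"
    and dvd: "(monom 1 CARD('a) - [:0, 1:]) ^ 7 dvd aux_eval 0 T * (e ^ m - 1) ^ 7 * e ^ (7 div 3)"
    by (rule exists_cube_auxiliary)
  have "poly (e ^ m - 1) t \<noteq> 0" for t
  proof
    assume "poly (e ^ m - 1) t = 0"
    then have "poly e t ^ m = 1" by (simp add: poly_power)
    then show False using nth_power_if_residue[OF CARD_eq] no by metis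
  qed
  moreover have "e \<noteq> 0" using degree_e by auto
  ultimately have "7 * card (UNIV :: 'a set) \<le> degree (aux_eval 0 T) + 7 div 3 * (\<Sum>t\<in>UNIV. order t e)"
    using aux_eval_neq_0[OF T] by (intro order_bound_if_frobenius_dvd[OF dvd])
  moreover have "order t e = 0" for t
    using no by (intro order_0I) (metis zero_power zero_less_numeral)
  ultimately show False using degree_aux_eval_less[OF T] by simp
qed

end

theorem quintic_takes_cube_value:
  fixes e :: "'a :: big_prime_field poly"
  assumes e: "degree e = 5"
  shows "\<exists>x v. x ^ 3 = poly e v"
proof (cases "CARD('a) mod 3 = 2")
  case True
  then show ?thesis using exists_cube_root_if_CARD_mod_3_eq_2 by blast
next
  case False
  then obtain m where "CARD('a) = 3 * m + 1" by (rule prime_field_CARD_mod_3)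
  then have "quintic_over_cubic_residues m e" using e by unfold_locales simp_all
  then show ?thesis by (rule quintic_over_cubic_residues.exists_cube_value)
qed

section \<open>Cubics over a large prime field\<close>

subsection \<open>Conjugate roots in the algebraic closure\<close>

interpretation to_ac: inj_idom_hom "to_ac :: 'a :: field \<Rightarrow> 'a alg_closure"
  by unfold_locales simp_all

interpretation to_ac_poly: map_poly_inj_idom_hom "to_ac :: 'a :: field \<Rightarrow> 'a alg_closure" ..

abbreviation lift_ac :: "'a :: field poly \<Rightarrow> 'a alg_closure poly"
  where "lift_ac P \<equiv> map_poly to_ac P"

lemma alg_closure_root_exists:
  assumes "0 < degree (c :: 'a :: field poly)"
  obtains \<rho> where "poly (lift_ac c) \<rho> = 0"
  using alg_closed_imp_poly_has_root[of "lift_ac c"] assms by auto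

lemma degree_1_root:
  fixes f :: "'a :: field poly"
  assumes "degree f = 1"
  obtains t where "f = smult (lead_coeff f) [:- t, 1:]" "poly f t = 0"
proof -
  obtain a b where f: "f = [:a, b:]" "b \<noteq> 0" using degree1_coeffs[OF assms] .
  show ?thesis by (rule that[of "- a / b"]) (use f in simp_all)
qed

lemma irreducible_cubic_if_no_root:
  fixes c :: "'a :: field poly"
  assumes "degree c = 3" "\<And>x. poly c x \<noteq> 0"
  shows "irreducible c"
proof (rule irreducibleI)
  show "c \<noteq> 0" using assms(1) by auto
  show "\<not> is_unit c" using assms(1) by (simp add: is_unit_iff_degree \<open>c \<noteq> 0\<close>)
  fix a b assume c: "c = a * b"
  then have nz: "a \<noteq> 0" "b \<noteq> 0" using \<open>c \<noteq> 0\<close> by auto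
  then have deg: "degree a + degree b = 3" using assms(1) c by (simp add: degree_mult_eq)
  have "degree a \<noteq> 1" "degree b \<noteq> 1"
    using assms(2) degree_1_root unfolding c by (metis mult_zero_left mult_zero_right poly_mult)+
  then have "degree a = 0 \<or> degree b = 0" using deg by linarith
  then show "is_unit a \<or> is_unit b" using nz by (simp add: is_unit_iff_degree)
qed

lemma irreducible_dvd_if_common_root:
  fixes c P :: "'a :: field_gcd poly"
  assumes c: "irreducible c" and \<rho>: "poly (lift_ac c) \<rho> = 0" "poly (lift_ac P) \<rho> = 0"
  shows "c dvd P"
proof -
  obtain u v where "u * c + v * P = gcd c P" by (meson bezout_coefficients_fst_snd)
  then have "poly (lift_ac (gcd c P)) \<rho> = poly (lift_ac (u * c + v * P)) \<rho>" by simp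
  also have "\<dots> = 0" using \<rho> by (simp add: hom_distribs)
  finally have root: "poly (lift_ac (gcd c P)) \<rho> = 0" .
  have "\<not> is_unit (gcd c P)"
  proof
    assume "is_unit (gcd c P)"
    then obtain a where "gcd c P = [:a:]" "a dvd 1" by (rule is_unit_polyE)
    then show False using root by (auto simp: hom_distribs)
  qed
  then have "c dvd gcd c P" using irreducibleD'[OF c] by blast
  then show ?thesis by simp
qed

definition frob :: "'a :: prime_field alg_closure \<Rightarrow> 'a alg_closure"
  where "frob x = x ^ CARD('a)"

interpretation frob: inj_idom_hom "frob :: 'a :: prime_field alg_closure \<Rightarrow> 'a alg_closure"
proof
  fix x y :: "'a alg_closure"
  show "frob (x + y) = frob x + frob y"
    unfolding frob_def by (rule freshmans_dream_CARD) (simp only: CHAR_alg_closure CHAR_eq_CARD)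
  show "frob x = 0 \<Longrightarrow> x = 0" by (simp add: frob_def)
qed (simp_all add: frob_def power_mult_distrib)

lemma frob_to_ac [simp]: "frob (to_ac x) = to_ac x"
  by (simp add: frob_def flip: to_ac_power)

lemma poly_lift_ac_frob: "poly (lift_ac P) (frob x) = frob (poly (lift_ac P) x)"
  by (induction P) (simp_all add: hom_distribs)

lemma frob_fixed:
  fixes x :: "'a :: prime_field alg_closure"
  assumes "frob x = x"
  obtains a where "x = to_ac a"
proof -
  have "CARD('a) > 1" using prime_CARD by (rule prime_gt_1_nat)
  define P :: "'a alg_closure poly" where "P = monom 1 CARD('a) + [:0, - 1:]"
  have degP: "degree P = CARD('a)"
    unfolding P_def using \<open>CARD('a) > 1\<close> by (subst degree_add_eq_left) (simp_all add: degree_monom_eq)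
  then have "P \<noteq> 0" using \<open>CARD('a) > 1\<close> by auto
  have roots: "poly P y = frob y - y" for y
    by (simp add: P_def poly_monom frob_def)
  have "card (insert x (range to_ac)) \<le> card {y. poly P y = 0}"
    using assms by (intro card_mono poly_roots_finite[OF \<open>P \<noteq> 0\<close>]) (auto simp: roots)
  also have "\<dots> \<le> CARD('a)" using card_poly_roots_bound[OF \<open>P \<noteq> 0\<close>] degP by simp
  finally have "x \<in> range to_ac"
    by (cases "x \<in> range to_ac") (simp_all add: card_image[OF inj_to_ac])
  then show ?thesis using that by blast
qed

locale irreducible_cubic =
  fixes c :: "'a :: prime_field poly" and \<rho> :: "'a alg_closure"
  assumes degree_c: "degree c = 3" and no_root: "\<And>x. poly c x \<noteq> 0" and root: "poly (lift_ac c) \<rho> = 0"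
begin

lemma dvd_if_root: "poly (lift_ac P) \<rho> = 0 \<Longrightarrow> c dvd P"
  using irreducible_dvd_if_common_root[OF irreducible_cubic_if_no_root[OF degree_c no_root] root] .

lemma eq_0_if_root:
  assumes "poly (lift_ac P) \<rho> = 0" "degree P \<le> 2"
  shows "P = 0"
  using dvd_imp_degree_le[OF dvd_if_root[OF assms(1)]] assms(2) degree_c by fastforce

lemma frob_neq: "frob \<rho> \<noteq> \<rho>"
  using root no_root by (auto elim: frob_fixed)

lemma frob_frob_neq: "frob (frob \<rho>) \<noteq> \<rho>"
proof
  assume period_2: "frob (frob \<rho>) = \<rho>"
  then have "frob (\<rho> + frob \<rho>) = \<rho> + frob \<rho>" "frob (\<rho> * frob \<rho>) = \<rho> * frob \<rho>"
    by (simp_all add: hom_distribs add.commute mult.commute)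
  then obtain s m where "\<rho> + frob \<rho> = to_ac s" "\<rho> * frob \<rho> = to_ac m" by (metis frob_fixed)
  then have "poly (lift_ac [:m, - s, 1:]) \<rho> = 0"
    by (simp add: hom_distribs flip: \<open>\<rho> + frob \<rho> = to_ac s\<close> \<open>\<rho> * frob \<rho> = to_ac m\<close>)
  then have "[:m, - s, 1:] = 0" by (rule eq_0_if_root) simp
  then show False by simp
qed

lemma frob_frob_frob: "frob (frob (frob \<rho>)) = \<rho>"
proof (rule ccontr)
  let ?R = "{\<rho>, frob \<rho>, frob (frob \<rho>), frob (frob (frob \<rho>))}"
  assume "frob (frob (frob \<rho>)) \<noteq> \<rho>"
  then have "card ?R = 4"
    using frob_neq frob_frob_neq by (auto simp: frob.eq_iff)
  have nz: "lift_ac c \<noteq> 0" using degree_c by auto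
  have "?R \<subseteq> {x. poly (lift_ac c) x = 0}" using root by (simp add: poly_lift_ac_frob)
  then have "card ?R \<le> card {x. poly (lift_ac c) x = 0}"
    by (rule card_mono[OF poly_roots_finite[OF nz]])
  also have "\<dots> \<le> 3" using card_poly_roots_bound[OF nz] degree_c by simp
  finally show False using \<open>card ?R = 4\<close> by simp
qed

text \<open>A square root of a nonsquare generates an extension of degree 2, which does not embed into the
  extension of degree 3 generated by \<open>\<rho>\<close>.\<close>

lemma eq_0_if_square_eq_nonsquare_times_square:
  assumes n: "\<nexists>a. n = a\<^sup>2"
    and eq: "(poly (lift_ac d) \<rho>)\<^sup>2 = to_ac n * (poly (lift_ac h) \<rho>)\<^sup>2"
  shows "poly (lift_ac d) \<rho> = 0 \<and> poly (lift_ac h) \<rho> = 0"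
proof (cases "poly (lift_ac h) \<rho> = 0")
  case True
  then show ?thesis using eq by simp
next
  case False
  define \<sigma> where "\<sigma> = poly (lift_ac d) \<rho> / poly (lift_ac h) \<rho>"
  have sq: "\<sigma>\<^sup>2 = to_ac n" using eq False by (simp add: \<sigma>_def power_divide)
  have frob3: "frob (frob (frob \<sigma>)) = \<sigma>"
    unfolding \<sigma>_def by (simp add: frob_def power_divide)
      (simp add: frob_frob_frob flip: frob_def poly_lift_ac_frob)
  have "(frob \<sigma>)\<^sup>2 = \<sigma>\<^sup>2" using sq by (simp flip: frob.hom_power)
  then have "frob \<sigma> = \<sigma> \<or> frob \<sigma> = - \<sigma>" by (simp add: power2_eq_iff)
  then have "frob \<sigma> = \<sigma>" using frob3 by (auto simp: frob.hom_uminus)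
  then obtain a where "\<sigma> = to_ac a" by (rule frob_fixed)
  then have "n = a\<^sup>2" using sq by (metis to_ac_eq_iff to_ac_power)
  with n show ?thesis by blast
qed

end

lemma depressed_cubic_vieta:
  fixes x y z :: "'a :: idom"
  assumes roots: "x ^ 3 + q * x + e = 0" "y ^ 3 + q * y + e = 0" "z ^ 3 + q * z + e = 0"
    and distinct: "x \<noteq> y" "x \<noteq> z" "y \<noteq> z"
  shows "x + y + z = 0" "q = - (x\<^sup>2 + x * y + y\<^sup>2)" "e = x * y * (x + y)"
proof -
  have quotient: "u\<^sup>2 + u * w + w\<^sup>2 + q = 0"
    if "u ^ 3 + q * u + e = 0" "w ^ 3 + q * w + e = 0" "u \<noteq> w" for u w
  proof -
    have "(u - w) * (u\<^sup>2 + u * w + w\<^sup>2 + q) = (u ^ 3 + q * u + e) - (w ^ 3 + q * w + e)"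
      by (simp add: algebra_simps power2_eq_square power3_eq_cube)
    then show ?thesis using that by simp
  qed
  have xy: "x\<^sup>2 + x * y + y\<^sup>2 + q = 0" and xz: "x\<^sup>2 + x * z + z\<^sup>2 + q = 0"
    using quotient roots distinct by blast+
  have "(y - z) * (x + y + z) = (x\<^sup>2 + x * y + y\<^sup>2 + q) - (x\<^sup>2 + x * z + z\<^sup>2 + q)"
    by (simp add: algebra_simps power2_eq_square)
  then show "x + y + z = 0" using xy xz distinct(3) by simp
  show q: "q = - (x\<^sup>2 + x * y + y\<^sup>2)" using xy by (metis add.inverse_inverse eq_neg_iff_add_eq_0 minus_add_cancel)
  have "e = (x ^ 3 + q * x + e) + x * y * (x + y)"
    unfolding q by (simp add: algebra_simps power2_eq_square power3_eq_cube)
  then show "e = x * y * (x + y)" using roots(1) by simp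
qed

lemma depressed_cubic_discriminant:
  fixes x y z :: "'a :: idom"
  assumes "x ^ 3 + q * x + e = 0" "y ^ 3 + q * y + e = 0" "z ^ 3 + q * z + e = 0"
    and "x \<noteq> y" "x \<noteq> z" "y \<noteq> z"
  shows "- 4 * q ^ 3 - 27 * e\<^sup>2 = ((x - y) * (y - z) * (z - x))\<^sup>2"
proof -
  have "z = (x + y + z) - x - y" by simp
  then have z: "z = - x - y" unfolding depressed_cubic_vieta(1)[OF assms] by simp
  show ?thesis unfolding z depressed_cubic_vieta(2,3)[OF assms]
    by (simp add: algebra_simps power2_eq_square power3_eq_cube)
qed

lemma (in irreducible_cubic) depressed_discriminant_square:
  assumes c: "c = [:e, q, 0, 1:]"
  shows "\<exists>s. - 4 * q ^ 3 - 27 * e\<^sup>2 = s\<^sup>2"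
proof -
  define \<Delta> where "\<Delta> = (\<rho> - frob \<rho>) * (frob \<rho> - frob (frob \<rho>)) * (frob (frob \<rho>) - \<rho>)"
  have eval: "poly (lift_ac c) x = x ^ 3 + to_ac q * x + to_ac e" for x
    by (simp add: c algebra_simps power3_eq_cube)
  have "frob \<Delta> = \<Delta>" by (simp add: \<Delta>_def hom_distribs frob_frob_frob)
  then obtain s where s: "\<Delta> = to_ac s" by (rule frob_fixed)
  have "poly (lift_ac c) (frob \<rho>) = 0" "poly (lift_ac c) (frob (frob \<rho>)) = 0"
    using root by (simp_all add: poly_lift_ac_frob)
  then have "- 4 * to_ac q ^ 3 - 27 * (to_ac e)\<^sup>2 = \<Delta>\<^sup>2"
    unfolding \<Delta>_def using root frob_neq frob_frob_neq unfolding eval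
    by (intro depressed_cubic_discriminant) (auto simp: frob.eq_iff)
  then have "to_ac (- 4 * q ^ 3 - 27 * e\<^sup>2) = to_ac (s\<^sup>2)" by (simp add: s)
  then show ?thesis using to_ac_eq_iff by blast
qed

lemma discriminant_square_if_roots_multiple:
  fixes q e :: "'a :: prime_field"
  assumes "\<And>x. x ^ 3 + q * x + e = 0 \<Longrightarrow> 3 * x\<^sup>2 + q = 0"
  shows "\<exists>s. - 4 * q ^ 3 - 27 * e\<^sup>2 = s\<^sup>2"
proof (cases "\<exists>x. x ^ 3 + q * x + e = 0")
  case True
  then obtain x where x: "x ^ 3 + q * x + e = 0" by blast
  then have "q = - (3 * x\<^sup>2)" using assms by (metis add.commute add_eq_0_iff2 minus_unique)
  moreover from this have "e = 2 * x ^ 3" using x by (simp add: algebra_simps power2_eq_square power3_eq_cube)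
  ultimately have "- 4 * q ^ 3 - 27 * e\<^sup>2 = 0\<^sup>2" by (simp add: power_mult_distrib flip: power_mult)
  then show ?thesis by blast
next
  case False
  obtain \<rho> where "poly (lift_ac [:e, q, 0, 1:]) \<rho> = 0"
    using alg_closure_root_exists[of "[:e, q, 0, 1:]"] by auto
  then interpret irreducible_cubic "[:e, q, 0, 1:]" \<rho>
    using False by unfold_locales (auto simp: algebra_simps power3_eq_cube)
  show ?thesis using depressed_discriminant_square by simp
qed

subsection \<open>Quadratic curves without nonsingular rational points\<close>

definition nonsq_norm :: "'a :: big_prime_field poly \<Rightarrow> 'a poly \<Rightarrow> 'a poly"
  where "nonsq_norm P Q = P\<^sup>2 - smult nonsq (Q\<^sup>2)"

lemma nonsq_norm_mult: "nonsq_norm (L * P) (L * Q) = L * (L * nonsq_norm P Q)"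
  by (simp add: nonsq_norm_def algebra_simps power2_eq_square)

lemma nonsq_norm_smult: "nonsq_norm (smult a P) (smult a Q) = smult (a\<^sup>2) (nonsq_norm P Q)"
  by (simp add: nonsq_norm_def smult_diff_right power2_eq_square algebra_simps)

lemma linear_dvd_if_nonsq_norm_eq_0:
  assumes "poly (nonsq_norm P Q) r = 0"
  obtains P' Q' where "P = [:- r, 1:] * P'" "Q = [:- r, 1:] * Q'"
proof -
  have "poly P r = 0 \<and> poly Q r = 0"
    using assms square_eq_nonsq_times_square_iff by (auto simp: nonsq_norm_def)
  then show ?thesis using that unfolding poly_eq_0_iff_dvd dvd_def by blast
qed

lemma poly_pderiv_linear_mult: "poly (pderiv ([:- r, 1:] * q)) r = poly q r"
  for q :: "'a :: idom poly"
  unfolding pderiv_mult poly_add poly_mult by (simp add: pderiv_pCons)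

lemma cubic_with_multiple_roots:
  fixes c :: "'a :: field poly"
  assumes deg: "degree c = 3" and multiple: "\<And>r. poly c r = 0 \<Longrightarrow> poly (pderiv c) r = 0"
    and r: "poly c r = 0"
  obtains b where "b \<noteq> 0" "c = smult b ([:- r, 1:] * ([:- r, 1:] * [:- r, 1:]))"
proof -
  define L where "L = [:- r, 1:]"
  obtain c1 where c1: "c = L * c1" using r unfolding L_def poly_eq_0_iff_dvd dvd_def by blast
  then have "poly c1 r = 0" using multiple[OF r] poly_pderiv_linear_mult[of r c1] by (simp add: L_def)
  then obtain c2 where c2: "c1 = L * c2" unfolding L_def poly_eq_0_iff_dvd dvd_def by blast
  have "c2 \<noteq> 0" using deg unfolding c1 c2 by auto
  moreover have "L \<noteq> 0" "degree L = 1" by (simp_all add: L_def)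
  ultimately have "degree c = 2 + degree c2" unfolding c1 c2 by (simp add: degree_mult_eq)
  then obtain s where s: "c2 = smult (lead_coeff c2) [:- s, 1:]" "poly c2 s = 0"
    using deg degree_1_root[of c2] by (metis add_left_cancel numeral_2_eq_2 numeral_3_eq_3 Suc_eq_plus1)
  then have s0: "poly c s = 0" by (simp add: c1 c2)
  have "c = [:- s, 1:] * smult (lead_coeff c2) (L * L)"
    unfolding c1 c2 by (subst s(1)) (simp only: mult_smult_right mult_smult_left mult_ac)
  then have "poly (smult (lead_coeff c2) (L * L)) s = 0"
    using multiple[OF s0] poly_pderiv_linear_mult[of s "smult (lead_coeff c2) (L * L)"] by simp
  then have "lead_coeff c2 * (poly L s * poly L s) = 0" by (simp only: poly_smult poly_mult)
  then have "s = r" using \<open>c2 \<noteq> 0\<close> by (simp add: L_def)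
  then have c2_eq: "c2 = smult (lead_coeff c2) L" unfolding L_def using s(1) by simp
  then have "c = smult (lead_coeff c2) (L * (L * L))"
    by (metis c1 c2 mult_smult_right)
  then show ?thesis using that[of "lead_coeff c2"] \<open>c2 \<noteq> 0\<close> by (simp only: L_def) simp
qed

locale singular_quadratic_curve =
  fixes c d e :: "'a :: big_prime_field poly"
  assumes degree_c: "degree c = 3" and degree_d: "degree d \<le> 4" and degree_e: "degree e \<le> 5"
    and singular: "\<And>x t. poly c t * x\<^sup>2 + poly d t * x + poly e t = 0 \<Longrightarrow>
      2 * poly c t * x + poly d t = 0 \<and>
      poly (pderiv c) t * x\<^sup>2 + poly (pderiv d) t * x + poly (pderiv e) t = 0"
begin

lemma c_neq_0: "c \<noteq> 0"
  using degree_c by auto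

lemma d_root_if_c_root:
  assumes "poly c t = 0"
  shows "poly d t = 0"
proof (rule ccontr)
  assume nz: "poly d t \<noteq> 0"
  have "poly c t * (- poly e t / poly d t)\<^sup>2 + poly d t * (- poly e t / poly d t) + poly e t = 0"
    using assms nz by simp
  from singular[OF this] show False using assms nz by simp
qed

lemma common_root_of_c_e:
  assumes "poly c r = 0" "poly e r = 0"
  shows "poly (pderiv c) r = 0" "poly (pderiv e) r = 0"
proof -
  have derivative: "poly (pderiv c) r * x\<^sup>2 + poly (pderiv d) r * x + poly (pderiv e) r = 0" for x
    using singular[where x=x and t=r] assms d_root_if_c_root[OF assms(1)] by simp
  show "poly (pderiv e) r = 0" using derivative[of 0] by simp
  moreover have "2 * poly (pderiv c) r =
      (poly (pderiv c) r * 1\<^sup>2 + poly (pderiv d) r * 1 + poly (pderiv e) r)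
      + (poly (pderiv c) r * (- 1)\<^sup>2 + poly (pderiv d) r * - 1 + poly (pderiv e) r)
      - 2 * poly (pderiv e) r"
    by simp
  ultimately show "poly (pderiv c) r = 0" unfolding derivative by simp
qed

lemma nonzero_square_points_discriminant: "nonzero_square_points (d\<^sup>2 - smult 4 (c * e)) = {}"
proof -
  have False if s: "s \<noteq> 0" "poly (d\<^sup>2 - smult 4 (c * e)) t = s\<^sup>2" for s t
  proof (cases "poly c t = 0")
    case True
    then show False using s d_root_if_c_root[OF True] by simp
  next
    case False
    define x where "x = (s - poly d t) / (2 * poly c t)"
    have x: "2 * poly c t * x = s - poly d t" using False by (simp add: x_def)
    have "4 * poly c t * (poly c t * x\<^sup>2 + poly d t * x + poly e t) =
        (2 * poly c t * x + poly d t)\<^sup>2 - poly (d\<^sup>2 - smult 4 (c * e)) t"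
      by (simp add: algebra_simps power2_eq_square)
    also have "\<dots> = 0" using x s(2) by simp
    finally have "poly c t * x\<^sup>2 + poly d t * x + poly e t = 0" using False by simp
    from singular[OF this] show False using x s(1) by simp
  qed
  then show ?thesis unfolding nonzero_square_points_def by blast
qed

lemma discriminant_eq_nonsq_times_square:
  obtains h where "degree h \<le> 4" "nonsq_norm d h = smult 4 (c * e)"
proof -
  let ?\<delta> = "d\<^sup>2 - smult 4 (c * e)"
  have "degree (d\<^sup>2) \<le> 8" using degree_power_le[of d 2] degree_d by linarith
  moreover have "degree (c * e) \<le> 8" using degree_mult_le[of c e] degree_c degree_e by linarith
  ultimately have deg: "degree ?\<delta> \<le> 8" by (intro degree_diff_le) auto
  then obtain h where h: "?\<delta> = smult nonsq (h\<^sup>2)"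
    using eq_nonsq_times_square_if_no_nonzero_squares[OF _ nonzero_square_points_discriminant] by auto
  have "degree h \<le> 4"
  proof (cases "h = 0")
    case False
    then have "degree ?\<delta> = 2 * degree h" unfolding h by (simp add: degree_power_eq)
    then show ?thesis using deg by simp
  qed simp
  then show ?thesis using that h by (simp add: nonsq_norm_def algebra_simps)
qed

context
  fixes h
  assumes degree_h: "degree h \<le> 4" and norm_eq: "nonsq_norm d h = smult 4 (c * e)"
begin

lemma linear_factors_at_c_root:
  assumes "poly c r = 0"
  obtains d1 h1 where "d = [:- r, 1:] * d1" "h = [:- r, 1:] * h1"
  by (rule linear_dvd_if_nonsq_norm_eq_0[of d h r]) (use assms norm_eq that in auto)

lemma c_roots_multiple:
  assumes r: "poly c r = 0"
  shows "poly (pderiv c) r = 0"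
proof -
  obtain d1 h1 where dh: "d = [:- r, 1:] * d1" "h = [:- r, 1:] * h1"
    by (rule linear_factors_at_c_root[OF r])
  obtain c1 where c1: "c = [:- r, 1:] * c1" using r unfolding poly_eq_0_iff_dvd dvd_def by blast
  have "[:- r, 1:] * ([:- r, 1:] * nonsq_norm d1 h1) = [:- r, 1:] * smult 4 (c1 * e)"
    using norm_eq unfolding dh nonsq_norm_mult c1 by (simp only: mult_smult_right mult.assoc)
  then have "[:- r, 1:] * nonsq_norm d1 h1 = smult 4 (c1 * e)"
    by (subst (asm) mult_left_cancel) simp_all
  from arg_cong[OF this, of "\<lambda>P. poly P r"] have "poly c1 r = 0 \<or> poly e r = 0" by simp
  moreover have "poly (pderiv c) r = poly c1 r" unfolding c1 by (rule poly_pderiv_linear_mult)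
  ultimately show ?thesis using common_root_of_c_e[OF r] by auto
qed

lemma c_dvd_if_no_root:
  assumes "\<And>r. poly c r \<noteq> 0"
  shows "c dvd d" "c dvd h"
proof -
  obtain \<rho> where \<rho>: "poly (lift_ac c) \<rho> = 0"
    using alg_closure_root_exists[of c] degree_c by auto
  interpret irreducible_cubic c \<rho> using degree_c assms \<rho> by unfold_locales
  have "poly (lift_ac (nonsq_norm d h)) \<rho> = 0" unfolding norm_eq using \<rho> by (simp add: hom_distribs)
  then have "(poly (lift_ac d) \<rho>)\<^sup>2 = to_ac nonsq * (poly (lift_ac h) \<rho>)\<^sup>2"
    by (simp add: nonsq_norm_def hom_distribs)
  then show "c dvd d" "c dvd h"
    using dvd_if_root eq_0_if_square_eq_nonsquare_times_square nonsq by blast+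
qed

lemma c_dvd_if_root:
  assumes r: "poly c r = 0"
  shows "c dvd d" "c dvd h"
proof -
  define L where "L = [:- r, 1:]"
  have L: "L \<noteq> 0" "poly L r = 0" by (simp_all add: L_def)
  obtain b where b: "b \<noteq> 0" "c = smult b (L * (L * L))"
    unfolding L_def using cubic_with_multiple_roots[OF degree_c c_roots_multiple r] .
  obtain d1 h1 where s1: "d = L * d1" "h = L * h1" unfolding L_def by (rule linear_factors_at_c_root[OF r])
  have "L * (L * nonsq_norm d1 h1) = L * (L * (L * smult (4 * b) e))"
    using norm_eq unfolding s1 nonsq_norm_mult b(2) by (simp add: mult.assoc)
  then have e1: "nonsq_norm d1 h1 = L * smult (4 * b) e" by (simp only: mult_left_cancel[OF L(1)])
  then have "poly (nonsq_norm d1 h1) r = 0" using L(2) by simp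
  then obtain d2 h2 where s2: "d1 = L * d2" "h1 = L * h2"
    unfolding L_def by (rule linear_dvd_if_nonsq_norm_eq_0)
  have e2: "L * nonsq_norm d2 h2 = smult (4 * b) e"
    using e1 unfolding s2 nonsq_norm_mult by (simp only: mult_left_cancel[OF L(1)])
  from arg_cong[OF this, of "\<lambda>P. poly P r"] have "poly e r = 0" using L(2) b(1) by simp
  then have "poly (pderiv (L * nonsq_norm d2 h2)) r = 0"
    unfolding e2 using common_root_of_c_e[OF r] by (simp add: pderiv_smult)
  then have "poly (nonsq_norm d2 h2) r = 0" unfolding L_def poly_pderiv_linear_mult .
  then obtain d3 h3 where s3: "d2 = L * d3" "h2 = L * h3"
    unfolding L_def by (rule linear_dvd_if_nonsq_norm_eq_0)
  show "c dvd d" "c dvd h" unfolding b(2) using b(1) by (simp_all add: smult_dvd_iff s1 s2 s3 mult_dvd_mono)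
qed

lemma factorisation:
  obtains b1 b2 where "degree b1 \<le> 1" "degree b2 \<le> 1" "d = smult 2 (c * b1)" "e = c * nonsq_norm b1 b2"
proof -
  have "c dvd d \<and> c dvd h" using c_dvd_if_no_root c_dvd_if_root by blast
  then obtain b k where bk: "d = c * b" "h = c * k" by blast
  have "c * (c * nonsq_norm b k) = c * smult 4 e"
    using norm_eq unfolding bk nonsq_norm_mult by (simp only: mult_smult_right)
  then have e: "smult 4 e = c * nonsq_norm b k" by (simp only: mult_left_cancel[OF c_neq_0])
  have deg: "degree q \<le> 1" if "degree (c * q) \<le> 4" for q
    using that degree_c c_neq_0 by (cases "q = 0") (simp_all add: degree_mult_eq)
  show ?thesis
  proof (rule that[of "smult (1 / 2) b" "smult (1 / 2) k"])
    show "e = c * nonsq_norm (smult (1 / 2) b) (smult (1 / 2) k)"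
      using arg_cong[OF e, of "smult (1 / 4)"] by (simp add: nonsq_norm_smult power2_eq_square)
  qed (use deg degree_d degree_h in \<open>simp_all add: bk\<close>)
qed

end

theorem obtain_factorisation:
  obtains b1 b2 where "degree b1 \<le> 1" "degree b2 \<le> 1" "d = smult 2 (c * b1)"
    "e = c * nonsq_norm b1 b2" "\<And>r. poly c r = 0 \<Longrightarrow> poly (pderiv c) r = 0"
proof -
  obtain h where h: "degree h \<le> 4" "nonsq_norm d h = smult 4 (c * e)"
    by (rule discriminant_eq_nonsq_times_square)
  show ?thesis by (rule factorisation[OF h], rule that, assumption+, rule c_roots_multiple[OF h])
qed

end

subsection \<open>Rational points on cubic curves\<close>

lemma dvd_degree_if_coprime_factor_of_power:
  fixes A B q :: "'a :: field_gcd poly"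
  assumes eq: "A * B = smult k (q ^ n)" and nz: "k \<noteq> 0" "q \<noteq> 0" "n > 0" and "coprime A B"
  shows "n dvd degree B"
proof -
  have AB: "A \<noteq> 0" "B \<noteq> 0" using eq nz by auto
  have "n dvd multiplicity p B" if p: "prime p" for p
  proof (cases "p dvd B")
    case True
    then have "\<not> p dvd A" using \<open>coprime A B\<close> p by (meson coprime_common_divisor not_prime_unit)
    then have "multiplicity p (A * B) = multiplicity p B"
      using AB p by (simp add: prime_elem_multiplicity_mult_distrib not_dvd_imp_multiplicity_0)
    moreover have "A * B = [:k:] * q ^ n" "is_unit [:k:]" using eq nz by (simp_all add: is_unit_const_poly_iff)
    then have "multiplicity p (A * B) = multiplicity p (q ^ n)" by (simp only: multiplicity_times_unit_right)
    moreover have "multiplicity p (q ^ n) = n * multiplicity p q"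
      using nz p by (simp add: prime_elem_multiplicity_power_distrib)
    ultimately show ?thesis by (metis dvd_triv_left)
  qed (simp add: not_dvd_imp_multiplicity_0)
  then obtain C where C: "normalize B = C ^ n"
    using is_nth_power_conv_multiplicity[OF nz(3)] by (metis is_nth_powerE)
  have "degree (normalize B) = degree B"
    using dvd_imp_degree_le[of B "normalize B"] dvd_imp_degree_le[of "normalize B" B] AB(2) by simp
  moreover have "C \<noteq> 0" using C AB(2) nz(3) by (auto simp: zero_power)
  ultimately have "degree B = n * degree C" by (simp add: C degree_power_eq mult.commute)
  then show ?thesis by simp
qed

lemma quadratic_takes_scaled_cube_value:
  fixes f :: "'a :: big_prime_field poly"
  assumes f: "degree f = 2" and k: "k \<noteq> 0"
  obtains t y where "poly f t = k * y ^ 3"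
proof -
  obtain a b c where f: "f = [:c, b, a:]" "a \<noteq> 0" using degree2_coeffs[OF f] .
  define \<delta> where "\<delta> = [:b\<^sup>2 - 4 * a * c, 0, 0, 4 * a * k:]"
  have deg: "degree \<delta> = 3" using f(2) k by (simp add: \<delta>_def)
  have "nonzero_square_points \<delta> \<noteq> {}"
  proof
    assume "nonzero_square_points \<delta> = {}"
    then obtain h where "\<delta> = smult nonsq (h\<^sup>2)"
      using eq_nonsq_times_square_if_no_nonzero_squares[of \<delta>] deg by auto
    then have "degree \<delta> = 2 * degree h" by (cases "h = 0") (simp_all add: degree_power_eq)
    then show False using deg by presburger
  qed
  then obtain y s where s: "poly \<delta> y = s\<^sup>2" by (auto simp: nonzero_square_points_def)
  define t where "t = (s - b) / (2 * a)"
  have "2 * a * t + b = s" unfolding t_def using f(2) by simp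
  then have "(2 * a * t + b)\<^sup>2 = poly \<delta> y" using s by simp
  then have "4 * a * poly f t = 4 * a * (k * y ^ 3)"
    by (simp add: f(1) \<delta>_def power2_eq_square power3_eq_cube algebra_simps)
  then show ?thesis using that f(2) by simp
qed

locale rootless_cubic_family =
  fixes q e :: "'a :: big_prime_field poly"
  assumes no_root: "\<And>v x. x ^ 3 + poly q v * x + poly e v \<noteq> 0"
begin

lemma no_common_root: "\<not> (poly q t = 0 \<and> poly e t = 0)"
  using no_root[of 0 t] by auto

definition discr :: "'a poly"
  where "discr = smult (- 4) (q ^ 3) + smult (- 27) (e\<^sup>2)"

lemma discr_eq_square:
  assumes "degree discr \<le> 10"
  shows "\<exists>h. discr = h\<^sup>2"
  using assms
proof (rule eq_square_if_all_values_squares)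
  fix t
  have "\<exists>s. - 4 * poly q t ^ 3 - 27 * (poly e t)\<^sup>2 = s\<^sup>2"
    by (rule discriminant_square_if_roots_multiple) (use no_root in blast)
  then show "\<exists>s. poly discr t = s\<^sup>2" by (auto simp: discr_def)
qed

end

text \<open>Cardano's formula: if \<open>\<theta>\<^sup>2 = - 27\<close> and \<open>h\<^sup>2\<close> is the discriminant, then a root of
  \<open>x\<^sup>3 + qx + e\<close> is the sum of cube roots of \<open>(h - \<theta>e) / (2\<theta>)\<close> and \<open>- (h + \<theta>e) / (2\<theta>)\<close>.\<close>

lemma cardano_product:
  fixes h q e :: "'a :: comm_ring_1 poly"
  assumes "smult (- 4) (q ^ 3) + smult (- 27) (e\<^sup>2) = h\<^sup>2" "\<theta>\<^sup>2 = - 27"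
  shows "(h - smult \<theta> e) * (h + smult \<theta> e) = smult (- 4) (q ^ 3)"
proof -
  have "(h - smult \<theta> e) * (h + smult \<theta> e) = h\<^sup>2 - smult (\<theta>\<^sup>2) (e\<^sup>2)"
    by (simp add: algebra_simps power2_eq_square)
  also have "\<dots> = smult (- 4) (q ^ 3)" unfolding assms(2) by (simp flip: assms(1))
  finally show ?thesis .
qed

locale rootless_depressed_cubic = rootless_cubic_family +
  assumes degree_q: "degree q \<le> 3" and degree_e: "degree e = 5"
begin

lemma q_neq_0: "q \<noteq> 0"
proof
  assume "q = 0"
  obtain x v where "x ^ 3 = poly (- e) v" using quintic_takes_cube_value[of "- e"] degree_e by auto
  then show False using no_root[of x v] \<open>q = 0\<close> by simp
qed

lemma e_neq_0: "e \<noteq> 0"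
  using degree_e by auto

lemma degree_discr: "degree discr = 10" and lead_coeff_discr: "lead_coeff discr = - 27 * (lead_coeff e)\<^sup>2"
proof -
  have "degree (q ^ 3) = 3 * degree q" by (cases "q = 0") (simp_all add: degree_power_eq)
  moreover have deg: "degree (smult (- 27) (e\<^sup>2)) = 10"
    using degree_e by (cases "e = 0") (simp_all add: degree_power_eq)
  ultimately have less: "degree (smult (- 4) (q ^ 3)) < degree (smult (- 27) (e\<^sup>2))"
    using degree_q by simp
  show "degree discr = 10" unfolding discr_def using degree_add_eq_right[OF less] deg by simp
  show "lead_coeff discr = - 27 * (lead_coeff e)\<^sup>2"
    unfolding discr_def using lead_coeff_add_le[OF less] by (simp add: lead_coeff_power)
qed

context
  fixes h A B :: "'a poly" and \<theta> :: 'a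
  assumes discr_eq: "discr = h\<^sup>2" and \<theta>_def: "\<theta> = lead_coeff h / lead_coeff e"
    and A_def: "A = h - smult \<theta> e" and B_def: "B = h + smult \<theta> e"
begin

lemma degree_h: "degree h = 5"
  using degree_discr unfolding discr_eq by (cases "h = 0") (simp_all add: degree_power_eq)

lemma \<theta>_square: "\<theta>\<^sup>2 = - 27"
proof -
  have "(lead_coeff h)\<^sup>2 = - 27 * (lead_coeff e)\<^sup>2"
    using lead_coeff_discr unfolding discr_eq by (simp add: lead_coeff_power)
  then show ?thesis using e_neq_0 by (simp add: \<theta>_def power_divide)
qed

lemma \<theta>_neq_0: "\<theta> \<noteq> 0"
  using \<theta>_square by auto

lemma A_mult_B: "A * B = smult (- 4) (q ^ 3)"
  unfolding A_def B_def using discr_eq \<theta>_square by (intro cardano_product) (simp add: discr_def)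

lemma A_B_neq_0: "A \<noteq> 0" "B \<noteq> 0"
  using A_mult_B q_neq_0 by auto

lemma poly_e_eq: "2 * \<theta> * poly e t = poly B t - poly A t"
  by (simp add: A_def B_def algebra_simps)

lemma no_common_root_A_B_q: "\<not> (poly A t = 0 \<and> poly B t = 0 \<and> poly q t = 0)"
  using no_common_root[of t] poly_e_eq[of t] \<theta>_neq_0 by auto

lemma common_factor_no_root:
  assumes "f dvd A" "f dvd B" "f dvd q"
  shows "poly f t \<noteq> 0"
proof
  assume "poly f t = 0"
  then have "poly A t = 0" "poly B t = 0" "poly q t = 0"
    using assms by (meson dvd_trans poly_eq_0_iff_dvd)+
  then show False using no_common_root_A_B_q by blast
qed

lemma degree_A: "degree A \<le> 4" and degree_B: "degree B = 5"
proof -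
  have "coeff A k = 0" if "5 \<le> k" for k
  proof (cases "k = 5")
    case True
    have "lead_coeff h = \<theta> * lead_coeff e" using e_neq_0 by (simp add: \<theta>_def)
    then have "coeff h 5 = \<theta> * coeff e 5" by (simp only: degree_h degree_e)
    then show ?thesis using True by (simp add: A_def)
  qed (use that degree_e degree_h in \<open>simp add: A_def coeff_eq_0\<close>)
  then have "degree A < 5" by (intro degree_lessI) auto
  then show degA: "degree A \<le> 4" by simp
  have "B = smult 2 h + (- A)" using smult_add_left[of 1 1 h] by (simp add: A_def B_def)
  moreover have "degree (- A) < degree (smult 2 h)" using degA degree_h by simp
  ultimately have "degree B = degree (smult 2 h)" by (simp only: degree_add_eq_left)
  then show "degree B = 5" using degree_h by simp
qed

lemma cardano_root:
  assumes A: "poly A t = 2 * \<theta> * u ^ 3" and u: "u \<noteq> 0"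
  shows False
proof -
  define x where "x = u - poly q t / (3 * u)"
  have "2 * (- 2 * poly q t ^ 3) = poly A t * poly B t"
    using arg_cong[OF A_mult_B, of "\<lambda>P. poly P t"] by simp
  also have "\<dots> = 2 * (\<theta> * u ^ 3 * poly B t)" unfolding A by (simp only: mult.assoc)
  finally have eq: "- 2 * poly q t ^ 3 = \<theta> * u ^ 3 * poly B t" by (subst (asm) mult_left_cancel) simp_all
  have "x ^ 3 + poly q t * x = u ^ 3 - poly q t ^ 3 / (27 * u ^ 3)"
    using u by (simp add: x_def field_simps power3_eq_cube)
  then have "2 * (x ^ 3 + poly q t * x) = 2 * u ^ 3 + (- 2 * poly q t ^ 3) / (27 * u ^ 3)"
    by (simp only: right_diff_distrib) simp
  also have "\<dots> = 2 * u ^ 3 + \<theta> * poly B t / 27" unfolding eq using u by simp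
  finally have double: "2 * (x ^ 3 + poly q t * x) = 2 * u ^ 3 + \<theta> * poly B t / 27" .
  have "2 * \<theta> * (x ^ 3 + poly q t * x + poly e t) =
      \<theta> * (2 * (x ^ 3 + poly q t * x)) + 2 * \<theta> * poly e t"
    by (simp add: algebra_simps)
  also have "\<dots> = 2 * \<theta> * u ^ 3 + \<theta>\<^sup>2 * poly B t / 27 + 2 * \<theta> * poly e t"
    unfolding double by (simp add: distrib_left power2_eq_square)
  also have "\<dots> = 0" unfolding poly_e_eq \<theta>_square A by simp
  finally show False using no_root \<theta>_neq_0 by simp
qed

lemma obtain_common_prime_factor:
  obtains f where "prime f" "f dvd A" "f dvd B" "f dvd q" "2 \<le> degree f"
proof -
  have "\<not> 3 dvd degree B" by (simp add: degree_B)
  then have "\<not> coprime A B"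
    using dvd_degree_if_coprime_factor_of_power[OF A_mult_B _ q_neq_0] by auto
  then obtain c where c: "c dvd A" "c dvd B" "\<not> is_unit c" by (auto simp: coprime_def)
  then have "c \<noteq> 0" using A_B_neq_0 by auto
  then obtain f where f: "f dvd c" "prime f" using prime_divisor_exists[OF _ c(3)] by blast
  have fA: "f dvd A" and fB: "f dvd B" using f(1) c(1,2) by (blast intro: dvd_trans)+
  have "f dvd smult (- 4) (q ^ 3)" unfolding A_mult_B[symmetric] using fA by (rule dvd_mult2)
  then have "f dvd q ^ 3" by (rule dvd_smult_cancel) simp
  then have fq: "f dvd q" using f(2) prime_dvd_power by blast
  have "\<not> is_unit f" using f(2) not_prime_unit by blast
  moreover have "f \<noteq> 0" using f(2) by auto
  ultimately have "degree f \<noteq> 0" by (simp add: is_unit_iff_degree)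
  moreover have "degree f \<noteq> 1"
    using degree_1_root[of f] common_factor_no_root[OF fA fB fq] by blast
  ultimately have "2 \<le> degree f" by linarith
  with f fA fB fq show ?thesis using that by blast
qed

lemma square_not_dvd_A:
  assumes f: "prime f" "2 \<le> degree f" "f dvd q" "f dvd B" "f * f dvd A"
  shows False
proof -
  obtain C where C: "A = f * f * C" using f(5) by blast
  then have nz: "f \<noteq> 0" "C \<noteq> 0" using A_B_neq_0 by auto
  then have "degree A = 2 * degree f + degree C" unfolding C by (simp add: degree_mult_eq)
  then have deg: "degree f = 2" "degree C = 0" using degree_A f(2) by linarith+
  then obtain a where a: "C = [:a:]" by (auto elim: degree_eq_zeroE)
  define c where "c = a / 2"
  have c: "C = [:2 * c:]" "c \<noteq> 0" using nz by (auto simp: c_def a)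
  obtain t y where y: "poly f t = 27 * \<theta> * c * y ^ 3"
    using quadratic_takes_scaled_cube_value[OF deg(1), of "27 * \<theta> * c"] c(2) \<theta>_neq_0 by auto
  have "poly f t \<noteq> 0" using f(3,4) by (intro common_factor_no_root) (simp_all add: C)
  then have "y \<noteq> 0" using y by auto
  show False
  proof (rule cardano_root)
    have "2 * \<theta> * (- 3 * \<theta> * c * y\<^sup>2) ^ 3 = - 54 * (\<theta>\<^sup>2)\<^sup>2 * c ^ 3 * y ^ 6"
      by (simp add: power_mult_distrib eval_nat_numeral mult_ac)
    also have "\<dots> = 1458 * \<theta>\<^sup>2 * c ^ 3 * y ^ 6" by (simp add: \<theta>_square)
    also have "\<dots> = poly A t"
      by (simp add: C c(1) y power_mult_distrib eval_nat_numeral mult_ac)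
    finally show "poly A t = 2 * \<theta> * (- 3 * \<theta> * c * y\<^sup>2) ^ 3" ..
    show "- 3 * \<theta> * c * y\<^sup>2 \<noteq> 0" using c(2) \<theta>_neq_0 \<open>y \<noteq> 0\<close> by simp
  qed
qed

lemma square_not_dvd_B:
  assumes f: "prime f" "2 \<le> degree f" "f dvd q" "f dvd A" "f * f dvd B"
  shows False
proof -
  obtain C where C: "B = f * f * C" using f(5) by blast
  obtain A1 q1 where A1: "A = f * A1" and q1: "q = f * q1" using f(3,4) by blast
  have nz: "f \<noteq> 0" "C \<noteq> 0" using A_B_neq_0 C by auto
  then have "degree B = 2 * degree f + degree C" unfolding C by (simp add: degree_mult_eq)
  then have "degree C = 1" using degree_B f(2) by presburger
  then obtain r where r: "C = smult (lead_coeff C) [:- r, 1:]" "poly C r = 0" by (rule degree_1_root)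
  have "(f * f * f) * (A1 * C) = (f * f * f) * smult (- 4) (q1 ^ 3)"
    using A_mult_B unfolding A1 C q1 by (simp add: power3_eq_cube mult_ac)
  then have A1C: "A1 * C = smult (- 4) (q1 ^ 3)" by (subst (asm) mult_left_cancel) (use nz in simp_all)
  from arg_cong[OF this, of "\<lambda>P. poly P r"] have q1r: "poly q1 r = 0" using r(2) by simp
  then obtain q2 where "q1 = [:- r, 1:] * q2" unfolding poly_eq_0_iff_dvd by blast
  moreover have "A1 * C = [:- r, 1:] * smult (lead_coeff C) A1"
    by (metis r(1) mult.commute mult_smult_left mult_smult_right)
  ultimately have "[:- r, 1:] * smult (lead_coeff C) A1 = [:- r, 1:] * smult (- 4) ([:- r, 1:]\<^sup>2 * q2 ^ 3)"
    using A1C by (simp only: power3_eq_cube power2_eq_square mult_smult_right mult_ac)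
  then have "smult (lead_coeff C) A1 = smult (- 4) ([:- r, 1:]\<^sup>2 * q2 ^ 3)"
    by (subst (asm) mult_left_cancel) simp_all
  from arg_cong[OF this, of "\<lambda>P. poly P r"] have "poly A1 r = 0" using nz(2) by simp
  then show False using no_common_root_A_B_q[of r] r(2) q1r by (simp add: A1 C q1)
qed

lemma cardano_contradiction: False
proof -
  obtain f where f: "prime f" "f dvd A" "f dvd B" "f dvd q" "2 \<le> degree f"
    by (rule obtain_common_prime_factor)
  then obtain A1 B1 q1 where A1: "A = f * A1" and B1: "B = f * B1" and q1: "q = f * q1" by blast
  have "f \<noteq> 0" using f(1) by auto
  have "(f * f) * (A1 * B1) = (f * f) * (f * smult (- 4) (q1 ^ 3))"
    using A_mult_B unfolding A1 B1 q1 by (simp add: power3_eq_cube mult_ac)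
  then have "A1 * B1 = f * smult (- 4) (q1 ^ 3)"
    by (subst (asm) mult_left_cancel) (use \<open>f \<noteq> 0\<close> in simp_all)
  then have "f dvd A1 * B1" by (rule dvdI)
  then consider "f dvd A1" | "f dvd B1" using prime_dvd_multD[OF f(1)] by blast
  then show False
  proof cases
    case 1
    then have "f * f dvd A" unfolding A1 by (rule mult_dvd_mono[OF dvd_refl])
    then show False by (rule square_not_dvd_A[OF f(1,5,4,3)])
  next
    case 2
    then have "f * f dvd B" unfolding B1 by (rule mult_dvd_mono[OF dvd_refl])
    then show False by (rule square_not_dvd_B[OF f(1,5,4,2)])
  qed
qed

end

lemma contradiction: False
  using discr_eq_square cardano_contradiction degree_discr by auto

end

theorem depressed_cubic_root_exists:
  fixes q e :: "'a :: big_prime_field poly"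
  assumes "degree q \<le> 3" "degree e = 5"
  shows "\<exists>v x. x ^ 3 + poly q v * x + poly e v = 0"
  using rootless_depressed_cubic.contradiction[of q e] assms
  unfolding rootless_depressed_cubic_def rootless_depressed_cubic_axioms_def rootless_cubic_family_def
  by blast

theorem cubic_root_exists:
  fixes c d e :: "'a :: big_prime_field poly"
  assumes k: "k \<noteq> 0" and deg: "degree c \<le> 1" "degree d \<le> 3" "degree e = 5"
  shows "\<exists>v x. k * x ^ 3 + poly c v * x\<^sup>2 + poly d v * x + poly e v = 0"
proof -
  define b where "b = smult (1 / 3) c"
  have b: "degree b \<le> 1" unfolding b_def using deg(1) by simp
  have c: "poly c v = 3 * poly b v" for v by (simp add: b_def)
  define q where "q = smult k d - smult 3 (b\<^sup>2)"
  define r where "r = smult 2 (b ^ 3) - smult k (b * d)"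
  have "degree (b\<^sup>2) \<le> 3" "degree (b ^ 3) \<le> 4" "degree (b * d) \<le> 4"
    using degree_power_le[of b 2] degree_power_le[of b 3] degree_mult_le[of b d] b deg(2) by linarith+
  then have q: "degree q \<le> 3" and "degree r \<le> 4"
    unfolding q_def r_def using deg(2) k by (simp_all add: degree_diff_le)
  then have "degree (smult (k\<^sup>2) e + r) = 5"
    using k deg(3) by (subst degree_add_eq_left) simp_all
  then obtain v x where root: "x ^ 3 + poly q v * x + poly (smult (k\<^sup>2) e + r) v = 0"
    using depressed_cubic_root_exists[OF q] by blast
  define y where "y = (x - poly b v) / k"
  have x: "x = k * y + poly b v" using k by (simp add: y_def)
  have "k\<^sup>2 * (k * y ^ 3 + poly c v * y\<^sup>2 + poly d v * y + poly e v) =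
      x ^ 3 + poly q v * x + poly (smult (k\<^sup>2) e + r) v"
    unfolding x q_def r_def c by (simp add: algebra_simps power2_eq_square power3_eq_cube)
  then have "k * y ^ 3 + poly c v * y\<^sup>2 + poly d v * y + poly e v = 0" using root k by simp
  then show ?thesis by blast
qed

subsection \<open>Plane cubics without nonsingular rational points\<close>

text \<open>The norm of \<open>k0 \<rho>\<^sup>2 + k1 \<rho> + k2\<close> for a root \<open>\<rho>\<close> of \<open>x\<^sup>3 + q x + e\<close>.\<close>

definition cubic_norm :: "'a :: comm_ring_1 \<Rightarrow> 'a \<Rightarrow> 'a \<Rightarrow> 'a \<Rightarrow> 'a \<Rightarrow> 'a"
  where "cubic_norm q e k0 k1 k2 = e\<^sup>2 * k0 ^ 3 - e * q * k0\<^sup>2 * k1 + q\<^sup>2 * k0\<^sup>2 * k2 + 3 * e * k0 * k1 * k2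
    - 2 * q * k0 * k2\<^sup>2 - e * k1 ^ 3 + q * k1\<^sup>2 * k2 + k2 ^ 3"

lemma cubic_norm_scale: "cubic_norm q e (s * k0) (s * k1) (s * k2) = s ^ 3 * cubic_norm q e k0 k1 k2"
  by (simp add: cubic_norm_def power2_eq_square power3_eq_cube algebra_simps)

lemma cubic_norm_eq_prod_roots:
  fixes x y z :: "'a :: idom"
  assumes "x ^ 3 + q * x + e = 0" "y ^ 3 + q * y + e = 0" "z ^ 3 + q * z + e = 0"
    and "x \<noteq> y" "x \<noteq> z" "y \<noteq> z"
  shows "cubic_norm q e k0 k1 k2 =
    (k0 * x\<^sup>2 + k1 * x + k2) * (k0 * y\<^sup>2 + k1 * y + k2) * (k0 * z\<^sup>2 + k1 * z + k2)"
proof -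
  have "z = (x + y + z) - x - y" by simp
  then have z: "z = - x - y" unfolding depressed_cubic_vieta(1)[OF assms] by simp
  show ?thesis unfolding cubic_norm_def depressed_cubic_vieta(2,3)[OF assms] z
    by (simp add: power2_eq_square power3_eq_cube algebra_simps)
qed

lemma cubic_norm_eq_0D:
  fixes q e :: "'a :: prime_field"
  assumes no_root: "\<And>x. x ^ 3 + q * x + e \<noteq> 0" and norm: "cubic_norm q e k0 k1 k2 = 0"
  shows "k0 = 0 \<and> k1 = 0 \<and> k2 = 0"
proof -
  obtain \<rho> where "poly (lift_ac [:e, q, 0, 1:]) \<rho> = 0"
    using alg_closure_root_exists[of "[:e, q, 0, 1:]"] by auto
  then interpret irreducible_cubic "[:e, q, 0, 1:]" \<rho>
    using no_root by unfold_locales (auto simp: algebra_simps power3_eq_cube)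
  define r where "r = [:k2, k1, k0:]"
  have r: "poly (lift_ac r) x = to_ac k0 * x\<^sup>2 + to_ac k1 * x + to_ac k2" for x
    by (simp add: r_def hom_distribs power2_eq_square algebra_simps)
  have eval: "poly (lift_ac [:e, q, 0, 1:]) x = x ^ 3 + to_ac q * x + to_ac e" for x
    by (simp add: algebra_simps power3_eq_cube)
  have roots: "poly (lift_ac [:e, q, 0, 1:]) (frob \<rho>) = 0"
    "poly (lift_ac [:e, q, 0, 1:]) (frob (frob \<rho>)) = 0"
    unfolding poly_lift_ac_frob root by simp_all
  have "0 = cubic_norm (to_ac q) (to_ac e) (to_ac k0) (to_ac k1) (to_ac k2)"
    using arg_cong[OF norm, of to_ac] by (simp add: cubic_norm_def)
  also have "\<dots> = poly (lift_ac r) \<rho> * poly (lift_ac r) (frob \<rho>) * poly (lift_ac r) (frob (frob \<rho>))"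
    unfolding r using root roots frob_neq frob_frob_neq unfolding eval
    by (intro cubic_norm_eq_prod_roots) (auto simp: frob.eq_iff)
  finally have "poly (lift_ac r) \<rho> = 0" by (simp add: poly_lift_ac_frob)
  then have "r = 0" by (rule eq_0_if_root) (simp add: r_def degree_pCons_eq_if)
  then show ?thesis by (simp add: r_def)
qed

lemma coeff_mult_degree_bounds:
  assumes "degree p \<le> a" "degree q \<le> b"
  shows "coeff (p * q) (a + b) = coeff p a * coeff q b"
proof -
  have "coeff p i * coeff q (a + b - i) = 0" if "i \<noteq> a" for i
  proof (cases "i < a")
    case True
    then have "coeff q (a + b - i) = 0" using assms by (intro coeff_eq_0) linarith
    then show ?thesis by simp
  next
    case False
    then have "coeff p i = 0" using assms that by (intro coeff_eq_0) linarith
    then show ?thesis by simp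
  qed
  then have "(\<Sum>i\<le>a + b. coeff p i * coeff q (a + b - i)) = (\<Sum>i\<in>{a}. coeff p i * coeff q (a + b - i))"
    by (intro sum.mono_neutral_right) auto
  then show ?thesis by (simp add: coeff_mult)
qed

lemma
  fixes A B C :: "'a :: comm_ring_1 poly"
  assumes d: "degree A \<le> d" "degree B \<le> d" "degree C \<le> d"
  shows degree_cubic_norm_le: "degree (cubic_norm [:q:] [:e:] A B C) \<le> 3 * d"
    and coeff_cubic_norm: "coeff (cubic_norm [:q:] [:e:] A B C) (3 * d) =
      cubic_norm q e (coeff A d) (coeff B d) (coeff C d)"
proof -
  have deg: "degree (x * y * z) \<le> 3 * d" if "degree x \<le> d" "degree y \<le> d" "degree z \<le> d" for x y z :: "'a poly"
    using degree_mult_le[of "x * y" z] degree_mult_le[of x y] that by linarith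
  have coeff: "coeff (x * y * z) (3 * d) = coeff x d * coeff y d * coeff z d"
    if "degree x \<le> d" "degree y \<le> d" "degree z \<le> d" for x y z :: "'a poly"
  proof -
    have "degree (x * y) \<le> d + d" using degree_mult_le[of x y] that by linarith
    then have "coeff (x * y * z) (d + d + d) = coeff x d * coeff y d * coeff z d"
      using that by (simp only: coeff_mult_degree_bounds)
    moreover have "3 * d = d + d + d" by simp
    ultimately show ?thesis by (simp only:)
  qed
  have n: "(3 :: 'a poly) = [:3:]" "(2 :: 'a poly) = [:2:]" by (simp_all add: numeral_poly)
  have eq: "cubic_norm [:q:] [:e:] A B C = smult (e\<^sup>2) (A * A * A) - smult (e * q) (A * A * B)
     + smult (q\<^sup>2) (A * A * C) + smult (3 * e) (A * B * C) - smult (2 * q) (A * C * C) - smult e (B * B * B)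
     + smult q (B * B * C) + C * C * C"
    unfolding cubic_norm_def n by (simp add: power2_eq_square power3_eq_cube mult_ac)
  show "degree (cubic_norm [:q:] [:e:] A B C) \<le> 3 * d"
    unfolding eq using d by (intro degree_add_le degree_diff_le order_trans[OF degree_smult_le] deg)
  show "coeff (cubic_norm [:q:] [:e:] A B C) (3 * d) = cubic_norm q e (coeff A d) (coeff B d) (coeff C d)"
    unfolding eq coeff_add coeff_diff coeff_smult coeff[OF d(1) d(1) d(1)] coeff[OF d(1) d(1) d(2)]
      coeff[OF d(1) d(1) d(3)] coeff[OF d] coeff[OF d(1) d(3) d(3)] coeff[OF d(2) d(2) d(2)]
      coeff[OF d(2) d(2) d(3)] coeff[OF d(3) d(3) d(3)]
    by (simp add: cubic_norm_def power2_eq_square power3_eq_cube mult_ac)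
qed

lemma three_dvd_degree_cubic_norm:
  fixes A B C :: "'a :: prime_field poly"
  assumes no_root: "\<And>x. x ^ 3 + q * x + e \<noteq> 0"
  shows "3 dvd degree (cubic_norm [:q:] [:e:] A B C)"
proof -
  define m where "m = max (degree A) (max (degree B) (degree C))"
  have degrees: "degree A \<le> m" "degree B \<le> m" "degree C \<le> m" by (simp_all add: m_def)
  show ?thesis
  proof (cases "cubic_norm q e (coeff A m) (coeff B m) (coeff C m) = 0")
    case True
    then have "coeff A m = 0" "coeff B m = 0" "coeff C m = 0" using cubic_norm_eq_0D[OF no_root] by blast+
    moreover have zero: "m = 0" if "coeff P m = 0" "m = degree P" for P :: "'a poly"
      using that by (metis degree_0 leading_coeff_0_iff)
    moreover have "m = degree A \<or> m = degree B \<or> m = degree C" unfolding m_def by linarith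
    ultimately have "m = 0" using zero[of A] zero[of B] zero[of C] by argo
    then have "degree (cubic_norm [:q:] [:e:] A B C) \<le> 3 * 0" using degrees by (intro degree_cubic_norm_le) simp_all
    then show ?thesis by simp
  next
    case False
    then have "coeff (cubic_norm [:q:] [:e:] A B C) (3 * m) \<noteq> 0" unfolding coeff_cubic_norm[OF degrees] .
    then have "3 * m \<le> degree (cubic_norm [:q:] [:e:] A B C)" by (rule le_degree)
    then have "degree (cubic_norm [:q:] [:e:] A B C) = 3 * m"
      using degree_cubic_norm_le[OF degrees] by (rule antisym[rotated])
    then show ?thesis by simp
  qed
qed

lemma discriminant_neq_0_if_no_root:
  fixes q e :: "'a :: big_prime_field"
  assumes no_root: "\<And>x. x ^ 3 + q * x + e \<noteq> 0"
  shows "4 * q ^ 3 + 27 * e\<^sup>2 \<noteq> 0"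
proof
  assume disc: "4 * q ^ 3 + 27 * e\<^sup>2 = 0"
  have "q \<noteq> 0"
  proof
    assume "q = 0"
    then show False using disc no_root[of 0] by simp
  qed
  then have "(3 * e / q) ^ 3 + q * (3 * e / q) + e = e * (4 * q ^ 3 + 27 * e\<^sup>2) / q ^ 3"
    by (simp add: field_simps power2_eq_square power3_eq_cube)
  then show False using no_root[of "3 * e / q"] unfolding disc by simp
qed

lemma proportional_if_same_root:
  fixes j n j' n' :: "'a :: big_prime_field"
  assumes roots: "\<And>w. 2 * w * j + n = 0 \<longleftrightarrow> 2 * w * j' + n' = 0" and "n \<noteq> 0"
  shows "n * j' = j * n'"
proof (cases "j = 0")
  case True
  then have "2 * w * j' + n' \<noteq> 0" for w using roots[of w] \<open>n \<noteq> 0\<close> by simp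
  from this[of "- n' / (2 * j')"] have "j' = 0" by (cases "j' = 0") simp_all
  then show ?thesis using True by simp
next
  case False
  define w where "w = - n / (2 * j)"
  have w: "2 * w * j = - n" using False by (simp add: w_def)
  then have "j * (2 * w * j' + n') = 0" using roots[of w] by simp
  moreover have "j * (2 * w * j' + n') = 2 * w * j * j' + j * n'" by (simp add: algebra_simps)
  ultimately show ?thesis unfolding w by simp
qed

lemma numeral_neq_0_alg_closure [simp]:
  "(numeral k :: 'a :: big_prime_field alg_closure) \<noteq> 0" "0 \<noteq> (numeral k :: 'a alg_closure)"
  if "numeral k \<le> (101 :: nat)"
  using numeral_neq_0_big_prime_field[OF that, where 'a='a] by (metis to_ac_eq_0_iff to_ac_numeral)+

lemma cube_if_coprime_factor_of_cube:
  fixes A B Q :: "'a :: alg_closed_field poly"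
  assumes AB: "A * B = smult k (Q ^ 3)" and nz: "k \<noteq> 0" "Q \<noteq> 0" and A: "degree A = 3"
    and coprime: "\<And>x. \<not> (poly A x = 0 \<and> poly B x = 0)"
  obtains r \<alpha> where "A = smult \<alpha> ([:- r, 1:] ^ 3)"
proof -
  have AB0: "A \<noteq> 0" "B \<noteq> 0" using AB nz by auto
  obtain r where r: "poly A r = 0" using alg_closed_imp_poly_has_root[of A] A by auto
  have "order r A + order r B = order r (A * B)" using AB0 by (simp add: order_mult)
  also have "\<dots> = 3 * order r Q" unfolding AB using nz by (simp add: order_smult order_power)
  finally have "order r A = 3 * order r Q" using coprime r by (simp add: order_0I)
  moreover have "order r A \<noteq> 0" using r AB0 order_root by blast
  ultimately have "3 \<le> order r A" by presburger
  then have "[:- r, 1:] ^ 3 dvd A" using order_divides by blast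
  then obtain u where u: "A = [:- r, 1:] ^ 3 * u" by (rule dvdE)
  then have "degree A = 3 + degree u" using AB0 by (auto simp: degree_mult_eq degree_power_eq)
  then obtain \<alpha> where "u = [:\<alpha>:]" using A by (auto elim: degree_eq_zeroE)
  then show ?thesis using that u by simp
qed

lemma quadratic_eq_if_roots:
  fixes P :: "'a :: field poly"
  assumes deg: "degree P = 2" and roots: "poly P r = 0" "poly P s = 0" "r \<noteq> s"
  shows "P = smult (lead_coeff P) ([:- r, 1:] * [:- s, 1:])"
proof -
  obtain P1 where P1: "P = [:- r, 1:] * P1" using roots(1) unfolding poly_eq_0_iff_dvd by blast
  then have "poly P1 s = 0" using roots(2,3) by simp
  then obtain P2 where P2: "P1 = [:- s, 1:] * P2" unfolding poly_eq_0_iff_dvd by blast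
  have P: "P = ([:- r, 1:] * [:- s, 1:]) * P2" unfolding P1 P2 by (simp only: mult.assoc)
  then have "P2 \<noteq> 0" using deg by auto
  then have "degree P = degree ([:- r, 1:] * [:- s, 1:]) + degree P2"
    unfolding P by (intro degree_mult_eq) auto
  then obtain c where "P2 = [:c:]" using deg by (auto elim: degree_eq_zeroE)
  then have P: "P = smult c ([:- r, 1:] * [:- s, 1:])" unfolding P by simp
  then have "lead_coeff P = c" by (simp only: lead_coeff_smult lead_coeff_mult) simp
  with P show ?thesis by simp
qed

lemma cardano_coefficients:
  fixes \<alpha> \<beta> \<theta> q :: "'a :: alg_closed_field"
  assumes "\<alpha> * \<beta> = - 4 * q ^ 3" "\<theta>\<^sup>2 = - 27" "\<alpha> \<noteq> 0" "(2 :: 'a) \<noteq> 0" "(3 :: 'a) \<noteq> 0"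
  obtains a b where "q = - 3 * a * b" "\<alpha> = 2 * \<theta> * a ^ 3" "\<beta> = - 2 * \<theta> * b ^ 3"
proof -
  have "(3 :: 'a) ^ 3 \<noteq> 0" using assms(5) by (simp only: power_eq_0_iff) simp
  then have \<theta>: "\<theta> \<noteq> 0" using assms(2) by auto
  obtain a where "a ^ 3 = \<alpha> / (2 * \<theta>)"
    using alg_closed_imp_poly_has_root[of "[:- (\<alpha> / (2 * \<theta>)), 0, 0, 1:]"]
    by (auto simp: power3_eq_cube mult.assoc)
  then have a: "\<alpha> = 2 * \<theta> * a ^ 3" using \<theta> assms(4) by simp
  define b where "b = - q / (3 * a)"
  have q: "q = - 3 * a * b" using a assms(3,5) by (auto simp: b_def)
  have "\<alpha> * (- 2 * \<theta> * b ^ 3) = - 4 * \<theta>\<^sup>2 * (a ^ 3 * b ^ 3)"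
    unfolding a by (simp add: power2_eq_square mult_ac)
  also have "\<dots> = - 4 * q ^ 3" unfolding assms(2) q by (simp add: power3_eq_cube algebra_simps)
  also have "\<dots> = \<alpha> * \<beta>" by (rule assms(1)[symmetric])
  finally have "\<beta> = - 2 * \<theta> * b ^ 3" by (simp only: mult_left_cancel[OF assms(3)])
  with q a show ?thesis by (rule that)
qed

lemma cubic_norm_eq_if_cardano_form:
  fixes a b r s k :: "'a :: comm_ring_1"
  assumes q: "q = - 3 * a * b"
    and quadratic: "[:l0 - 3 * k\<^sup>2, k1, q:] = smult q ([:- r, 1:] * [:- s, 1:])"
    and cubic: "[:m - k * l0 + 2 * k ^ 3, l1 - k * k1, k2 - k * q, e:] =
      - smult (a ^ 3) ([:- r, 1:] ^ 3) - smult (b ^ 3) ([:- s, 1:] ^ 3)"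
  shows "cubic_norm q e (3 * k) k1 k2 = m * (4 * q ^ 3 + 27 * e\<^sup>2)"
proof -
  have "l0 - 3 * k\<^sup>2 = - 3 * a * b * r * s" and k1: "k1 = 3 * a * b * (r + s)"
    using quadratic by (simp_all add: q algebra_simps)
  then have l0: "l0 = 3 * k\<^sup>2 - 3 * a * b * r * s" by (simp add: algebra_simps)
  have "m - k * l0 + 2 * k ^ 3 = a ^ 3 * r ^ 3 + b ^ 3 * s ^ 3"
    and "k2 - k * q = 3 * (a ^ 3 * r + b ^ 3 * s)" and e: "e = - (a ^ 3 + b ^ 3)"
    using cubic by (simp_all add: power3_eq_cube algebra_simps)
  then have m: "m = k * l0 - 2 * k ^ 3 + a ^ 3 * r ^ 3 + b ^ 3 * s ^ 3"
    and k2: "k2 = k * q + 3 * (a ^ 3 * r + b ^ 3 * s)" by (simp_all add: algebra_simps)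
  show ?thesis unfolding cubic_norm_def m l0 k2 k1 e q
    by (simp add: power2_eq_square power3_eq_cube algebra_simps)
qed

locale plane_cubic =
  fixes q e k0 k1 k2 l0 l1 m :: "'a :: big_prime_field"
begin

definition leading_form :: "'a \<Rightarrow> 'a \<Rightarrow> 'a"
  where "leading_form x t = x ^ 3 + q * x * t\<^sup>2 + e * t ^ 3"

definition value_at :: "'a \<Rightarrow> 'a \<Rightarrow> 'a"
  where "value_at x t = leading_form x t + (k0 * x\<^sup>2 + k1 * x * t + k2 * t\<^sup>2) + (l0 * x + l1 * t) + m"

definition dx_at :: "'a \<Rightarrow> 'a \<Rightarrow> 'a"
  where "dx_at x t = 3 * x\<^sup>2 + q * t\<^sup>2 + 2 * k0 * x + k1 * t + l0"

definition dt_at :: "'a \<Rightarrow> 'a \<Rightarrow> 'a"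
  where "dt_at x t = 2 * q * x * t + 3 * e * t\<^sup>2 + k1 * x + 2 * k2 * t + l1"

end

locale singular_plane_cubic = plane_cubic +
  assumes q_neq_0: "q \<noteq> 0" and no_root: "\<And>x. x ^ 3 + q * x + e \<noteq> 0"
    and singular: "\<And>x t. value_at x t = 0 \<Longrightarrow> dx_at x t = 0 \<and> dt_at x t = 0"
begin

lemma leading_form_neq_0:
  assumes "x \<noteq> 0 \<or> t \<noteq> 0"
  shows "leading_form x t \<noteq> 0"
proof (cases "t = 0")
  case False
  then have "leading_form x t = t ^ 3 * ((x / t) ^ 3 + q * (x / t) + e)"
    by (simp add: leading_form_def field_simps power2_eq_square power3_eq_cube)
  then show ?thesis using False no_root[of "x / t"] by simp
qed (use assms in \<open>simp add: leading_form_def\<close>)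

context
  fixes x0 t0
  assumes zero: "value_at x0 t0 = 0"
begin

definition quadratic_term :: "'a \<Rightarrow> 'a \<Rightarrow> 'a"
  where "quadratic_term x t = (3 * x0 + k0) * x\<^sup>2 + (2 * q * t0 + k1) * x * t + (q * x0 + 3 * e * t0 + k2) * t\<^sup>2"

lemma value_at_translate:
  "value_at (x0 + s * x) (t0 + s * t) = s\<^sup>2 * (quadratic_term x t + s * leading_form x t)"
proof -
  have "value_at (x0 + s * x) (t0 + s * t) = value_at x0 t0 + s * (x * dx_at x0 t0 + t * dt_at x0 t0)
      + s\<^sup>2 * (quadratic_term x t + s * leading_form x t)"
    unfolding value_at_def dx_at_def dt_at_def quadratic_term_def leading_form_def
    by (simp add: power2_eq_square power3_eq_cube algebra_simps)
  then show ?thesis using zero singular[OF zero] by simp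
qed

lemma directional_derivative_translate:
  "x * dx_at (x0 + s * x) (t0 + s * t) + t * dt_at (x0 + s * x) (t0 + s * t) =
    s * (2 * quadratic_term x t + 3 * (s * leading_form x t))"
proof -
  have "x * dx_at (x0 + s * x) (t0 + s * t) + t * dt_at (x0 + s * x) (t0 + s * t) =
      x * dx_at x0 t0 + t * dt_at x0 t0 + s * (2 * quadratic_term x t + 3 * (s * leading_form x t))"
    unfolding dx_at_def dt_at_def quadratic_term_def leading_form_def
    by (simp add: power2_eq_square power3_eq_cube algebra_simps)
  then show ?thesis using singular[OF zero] by simp
qed

text \<open>Otherwise the line through the singular zero in direction \<open>(x, t)\<close> meets the curve in a simple
  second zero.\<close>

lemma quadratic_term_eq_0: "quadratic_term x t = 0"
proof (rule ccontr)
  assume nz: "quadratic_term x t \<noteq> 0"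
  then have "x \<noteq> 0 \<or> t \<noteq> 0" by (auto simp: quadratic_term_def)
  then have "leading_form x t \<noteq> 0" by (rule leading_form_neq_0)
  moreover define s where "s = - quadratic_term x t / leading_form x t"
  ultimately have s: "s * leading_form x t = - quadratic_term x t" "s \<noteq> 0" using nz by simp_all
  have "value_at (x0 + s * x) (t0 + s * t) = 0" unfolding value_at_translate s by simp
  from singular[OF this] have "s * (2 * quadratic_term x t + 3 * (s * leading_form x t)) = 0"
    using directional_derivative_translate[of x s t] by simp
  then have "s * quadratic_term x t = 0" unfolding s(1) by simp
  then show False using nz s(2) by simp
qed

lemma cubic_norm_eq_if_zero: "cubic_norm q e k0 k1 k2 = m * (4 * q ^ 3 + 27 * e\<^sup>2)"
proof -
  note coefficients = quadratic_term_eq_0[unfolded quadratic_term_def]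
  have "k0 + 3 * x0 = 0" using coefficients[of 1 0] by (simp add: add.commute)
  then have k0: "k0 = - (3 * x0)" by (simp only: eq_neg_iff_add_eq_0)
  have "k2 + (q * x0 + 3 * e * t0) = 0"
    using coefficients[of 0 1] by (simp add: add_ac)
  then have k2: "k2 = - (q * x0 + 3 * e * t0)" by (simp only: eq_neg_iff_add_eq_0)
  have "k1 + 2 * q * t0 = 0"
    using coefficients[of 1 1] unfolding k0 k2 by (simp add: add_ac)
  then have k1: "k1 = - (2 * q * t0)" by (simp only: eq_neg_iff_add_eq_0)
  have "m = value_at (x0 + - 1 * x0) (t0 + - 1 * t0)" by (simp add: value_at_def leading_form_def)
  also have "\<dots> = - leading_form x0 t0" unfolding value_at_translate quadratic_term_eq_0 by simp
  finally have m: "m = - leading_form x0 t0" .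
  show ?thesis unfolding m leading_form_def cubic_norm_def k0 k1 k2
    by (simp add: power2_eq_square power3_eq_cube algebra_simps)
qed

end

context
  fixes k Q E
  assumes no_zero: "\<And>x t. value_at x t \<noteq> 0" and k0: "k0 = 3 * k"
    and Q_def: "Q = [:l0 - 3 * k\<^sup>2, k1, q:]" and E_def: "E = [:m - k * l0 + 2 * k ^ 3, l1 - k * k1, k2 - k * q, e:]"
begin

lemma degree_Q: "degree Q = 2" and degree_E: "degree E = 3"
  using q_neq_0 no_root[of 0] by (simp_all add: Q_def E_def)

lemma rootless: "rootless_cubic_family Q E"
proof
  fix t x
  have "value_at (x - k) t = x ^ 3 + poly Q t * x + poly E t"
    unfolding value_at_def leading_form_def Q_def E_def unfolding k0
    by (simp add: power2_eq_square power3_eq_cube algebra_simps)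
  then show "x ^ 3 + poly Q t * x + poly E t \<noteq> 0" using no_zero by metis
qed

lemma E_no_root: "poly E t \<noteq> 0"
  using rootless_cubic_family.no_root[OF rootless, of 0 t] by simp

lemma discriminant_root:
  obtains h where "degree h \<le> 3" "smult (- 4) (Q ^ 3) + smult (- 27) (E\<^sup>2) = h\<^sup>2"
proof -
  interpret rootless_cubic_family Q E by (rule rootless)
  have "degree discr \<le> 6"
    using degree_power_le[of Q 3] degree_power_le[of E 2] degree_Q degree_E
    unfolding discr_def by (intro degree_add_le order_trans[OF degree_smult_le]) simp_all
  then obtain h where h: "discr = h\<^sup>2" using discr_eq_square by auto
  then have "degree h \<le> 3" using \<open>degree discr \<le> 6\<close> by (cases "h = 0") (simp_all add: degree_power_eq)
  then show ?thesis using that h by (simp add: discr_def)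
qed

lemma lift_no_common_root: "\<not> (poly (lift_ac Q) x = 0 \<and> poly (lift_ac E) x = 0)"
proof
  assume common_root: "poly (lift_ac Q) x = 0 \<and> poly (lift_ac E) x = 0"
  then interpret irreducible_cubic E x using degree_E E_no_root by unfold_locales auto
  show False using eq_0_if_root[of Q] common_root degree_Q by auto
qed

lemma cardano_cubes_exist:
  obtains \<theta> r s \<alpha> \<beta> A B where "\<theta>\<^sup>2 = - 27" "smult (2 * \<theta>) (lift_ac E) = B - A"
    "A * B = smult (- 4) (lift_ac Q ^ 3)" "r \<noteq> s" "\<alpha> \<noteq> 0"
    "A = smult \<alpha> ([:- r, 1:] ^ 3)" "B = smult \<beta> ([:- s, 1:] ^ 3)"
proof -
  obtain h where h: "degree h \<le> 3" "smult (- 4) (Q ^ 3) + smult (- 27) (E\<^sup>2) = h\<^sup>2"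
    by (rule discriminant_root)
  obtain \<theta> :: "'a alg_closure" where \<theta>: "\<theta>\<^sup>2 = - 27"
    using alg_closed_imp_poly_has_root[of "[:27, 0, 1 :: 'a alg_closure:]"]
    by (auto simp: power2_eq_square eq_neg_iff_add_eq_0 add.commute)
  then have \<theta>0: "\<theta> \<noteq> 0" by auto
  define A B where "A = lift_ac h - smult \<theta> (lift_ac E)" and "B = lift_ac h + smult \<theta> (lift_ac E)"
  have AB: "A * B = smult (- 4) (lift_ac Q ^ 3)"
    unfolding A_def B_def using arg_cong[OF h(2), of lift_ac] \<theta>
    by (intro cardano_product) (simp_all add: hom_distribs)
  have E: "smult (2 * \<theta>) (lift_ac E) = B - A"
    by (simp add: A_def B_def algebra_simps flip: smult_add_left)
  have coprime: "\<not> (poly A x = 0 \<and> poly B x = 0)" for x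
  proof
    assume root: "poly A x = 0 \<and> poly B x = 0"
    then have "poly (lift_ac E) x = 0" using arg_cong[OF E, of "\<lambda>P. poly P x"] \<theta>0 by simp
    moreover have "poly (lift_ac Q) x = 0" using arg_cong[OF AB, of "\<lambda>P. poly P x"] root by simp
    ultimately show False using lift_no_common_root by blast
  qed
  have Q0: "lift_ac Q \<noteq> 0" using degree_Q by auto
  have "degree (A * B) = 6" unfolding AB using degree_Q Q0 by (simp add: degree_power_eq)
  moreover have "degree A \<le> 3" "degree B \<le> 3"
    unfolding A_def B_def using h(1) degree_E
    by (auto intro!: degree_diff_le degree_add_le intro: order_trans[OF degree_smult_le])
  ultimately have deg: "degree A = 3" "degree B = 3" using degree_mult_le[of A B] by linarith+
  obtain r \<alpha> where A: "A = smult \<alpha> ([:- r, 1:] ^ 3)"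
    by (rule cube_if_coprime_factor_of_cube[OF AB _ Q0 deg(1) coprime]) simp
  have "B * A = smult (- 4) (lift_ac Q ^ 3)" using AB by (simp only: mult.commute)
  then obtain s \<beta> where B: "B = smult \<beta> ([:- s, 1:] ^ 3)"
    by (rule cube_if_coprime_factor_of_cube[OF _ _ Q0 deg(2)]) (use coprime in auto)
  have "\<alpha> \<noteq> 0" using deg(1) unfolding A by auto
  moreover have "r \<noteq> s" using coprime[of r] A B by auto
  ultimately show ?thesis using that \<theta> E AB A B by blast
qed

lemma cardano_form_exists:
  obtains a b r s where "to_ac q = - 3 * a * b"
    "lift_ac Q = smult (to_ac q) ([:- r, 1:] * [:- s, 1:])"
    "lift_ac E = - smult (a ^ 3) ([:- r, 1:] ^ 3) - smult (b ^ 3) ([:- s, 1:] ^ 3)"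
proof -
  obtain \<theta> r s \<alpha> \<beta> A B where \<theta>: "\<theta>\<^sup>2 = - 27" and E: "smult (2 * \<theta>) (lift_ac E) = B - A"
    and AB: "A * B = smult (- 4) (lift_ac Q ^ 3)" and nz: "r \<noteq> s" "\<alpha> \<noteq> 0"
    and A: "A = smult \<alpha> ([:- r, 1:] ^ 3)" and B: "B = smult \<beta> ([:- s, 1:] ^ 3)"
    by (rule cardano_cubes_exist)
  have "poly (lift_ac Q) r = 0" "poly (lift_ac Q) s = 0"
    using arg_cong[OF AB, of "\<lambda>P. poly P r"] arg_cong[OF AB, of "\<lambda>P. poly P s"] A B by simp_all
  moreover have "lead_coeff (lift_ac Q) = to_ac q" using degree_Q by (simp add: Q_def numeral_2_eq_2)
  ultimately have Q: "lift_ac Q = smult (to_ac q) ([:- r, 1:] * [:- s, 1:])"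
    using quadratic_eq_if_roots[of "lift_ac Q" r s] degree_Q nz(1) by simp
  have "lead_coeff (A * B) = \<alpha> * \<beta>"
    unfolding A B lead_coeff_mult lead_coeff_smult lead_coeff_power by simp
  moreover have "lead_coeff (A * B) = - 4 * to_ac q ^ 3"
    unfolding AB Q lead_coeff_smult lead_coeff_power lead_coeff_mult by simp
  ultimately have "\<alpha> * \<beta> = - 4 * to_ac q ^ 3" by simp
  then obtain a b where ab: "to_ac q = - 3 * a * b" "\<alpha> = 2 * \<theta> * a ^ 3" "\<beta> = - 2 * \<theta> * b ^ 3"
    by (rule cardano_coefficients[OF _ \<theta> nz(2)]) simp_all
  have "smult (2 * \<theta>) (lift_ac E) =
      smult (2 * \<theta>) (- smult (a ^ 3) ([:- r, 1:] ^ 3) - smult (b ^ 3) ([:- s, 1:] ^ 3))"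
    unfolding E A B ab by (simp add: smult_diff_right)
  moreover have "2 * \<theta> \<noteq> 0" using \<theta> by auto
  ultimately have "lift_ac E = - smult (a ^ 3) ([:- r, 1:] ^ 3) - smult (b ^ 3) ([:- s, 1:] ^ 3)"
    by (simp only: smult_cancel)
  with ab(1) Q show ?thesis by (rule that)
qed

lemma cubic_norm_eq_if_no_zero: "cubic_norm q e k0 k1 k2 = m * (4 * q ^ 3 + 27 * e\<^sup>2)"
proof -
  obtain a b r s where form: "to_ac q = - 3 * a * b"
    "lift_ac Q = smult (to_ac q) ([:- r, 1:] * [:- s, 1:])"
    "lift_ac E = - smult (a ^ 3) ([:- r, 1:] ^ 3) - smult (b ^ 3) ([:- s, 1:] ^ 3)"
    by (rule cardano_form_exists)
  have "cubic_norm (to_ac q) (to_ac e) (3 * to_ac k) (to_ac k1) (to_ac k2) =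
      to_ac m * (4 * to_ac q ^ 3 + 27 * (to_ac e)\<^sup>2)"
  proof (rule cubic_norm_eq_if_cardano_form[OF form(1)])
    show "[:to_ac l0 - 3 * (to_ac k)\<^sup>2, to_ac k1, to_ac q:] = smult (to_ac q) ([:- r, 1:] * [:- s, 1:])"
      unfolding form(2)[symmetric] by (simp add: Q_def hom_distribs)
    show "[:to_ac m - to_ac k * to_ac l0 + 2 * to_ac k ^ 3, to_ac l1 - to_ac k * to_ac k1,
        to_ac k2 - to_ac k * to_ac q, to_ac e:] =
        - smult (a ^ 3) ([:- r, 1:] ^ 3) - smult (b ^ 3) ([:- s, 1:] ^ 3)"
      unfolding form(3)[symmetric] by (simp add: E_def hom_distribs)
  qed
  then have "to_ac (cubic_norm q e k0 k1 k2) = to_ac (m * (4 * q ^ 3 + 27 * e\<^sup>2))"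
    by (simp add: cubic_norm_def k0)
  then show ?thesis by (simp only: to_ac_eq_iff)
qed

end

theorem cubic_norm_eq: "cubic_norm q e k0 k1 k2 = m * (4 * q ^ 3 + 27 * e\<^sup>2)"
proof (cases "\<exists>x t. value_at x t = 0")
  case True
  then show ?thesis using cubic_norm_eq_if_zero by blast
next
  case False
  have "k0 = 3 * (k0 / 3)" by simp
  with False show ?thesis using cubic_norm_eq_if_no_zero[OF _ _ refl refl] by blast
qed

end

section \<open>Quadratic equations and square values\<close>

lemma square_valued_quadratic_False:
  fixes D :: "'a :: big_prime_field poly"
  assumes "degree D = 2" and squares: "\<And>s. \<exists>n. n \<noteq> 0 \<and> poly D s = n\<^sup>2"
  shows False
proof -
  obtain h where h: "D = h\<^sup>2" using eq_square_if_all_values_squares[of D] assms by fastforce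
  then have "h \<noteq> 0" using assms(1) by auto
  then have "degree h = 1" using assms(1) unfolding h by (simp add: degree_power_eq)
  then obtain t where "poly h t = 0" by (rule degree_1_root)
  then show False using squares[of t] h by auto
qed

text \<open>The square root of a quartic with the leading coefficients of \<open>(A s\<^sup>2 + l s + c)\<^sup>2\<close> is \<open>\<plusminus>(A s\<^sup>2 + l s + c)\<close>.\<close>

lemma quartic_square_root_no_zero:
  fixes A :: "'a :: big_prime_field"
  assumes A: "A \<noteq> 0" and squares: "\<And>s. \<exists>n. n \<noteq> 0 \<and> poly [:d0, d1, l\<^sup>2 + 2 * A * c, 2 * A * l, A\<^sup>2:] s = n\<^sup>2"
  shows "A * s\<^sup>2 + l * s + c \<noteq> 0"
proof -
  define D q where "D = [:d0, d1, l\<^sup>2 + 2 * A * c, 2 * A * l, A\<^sup>2:]" and "q = [:c, l, A:]"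
  have "degree D = 4" using A by (simp add: D_def)
  then obtain h where h: "D = h\<^sup>2" using eq_square_if_all_values_squares[of D] squares unfolding D_def by fastforce
  then have "h \<noteq> 0" using \<open>degree D = 4\<close> by auto
  then have "degree h = 2" using \<open>degree D = 4\<close> unfolding h by (simp add: degree_power_eq)
  have "(h - q) * (h + q) = D - q\<^sup>2" unfolding h by (simp add: power2_eq_square algebra_simps)
  also have "\<dots> = [:d0 - c\<^sup>2, d1 - 2 * l * c:]" unfolding D_def q_def by (simp add: power2_eq_square algebra_simps)
  finally have "degree ((h - q) * (h + q)) \<le> 1" by simp
  moreover have "2 \<le> degree (h - q) \<or> 2 \<le> degree (h + q)"
  proof -
    have "(h - q) + (h + q) = smult (1 + 1) h" unfolding smult_add_left by simp
    also have "degree \<dots> = 2" using \<open>degree h = 2\<close> by simp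
    finally show ?thesis using degree_add_le_max[of "h - q" "h + q"] by linarith
  qed
  ultimately have "h - q = 0 \<or> h + q = 0"
    using degree_mult_eq[of "h - q" "h + q"] by fastforce
  then have "poly q s \<noteq> 0" using squares[of s] h unfolding D_def[symmetric]
    by (auto simp: add_eq_0_iff2)
  then show ?thesis by (simp add: q_def power2_eq_square algebra_simps)
qed

lemma diagonal_conic_solvable:
  fixes A B M :: "'a :: big_prime_field"
  assumes A: "A \<noteq> 0" and B: "B \<noteq> 0"
  obtains s t where "A * s\<^sup>2 + B * t\<^sup>2 = M"
proof -
  define \<delta> where "\<delta> = [:M / A, 0, - B / A:]"
  have "\<exists>t s. poly \<delta> t = s\<^sup>2"
  proof (rule ccontr)
    assume no: "\<not> ?thesis"
    then have "nonzero_square_points \<delta> = {}" by (auto simp: nonzero_square_points_def)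
    moreover have d2: "degree \<delta> = 2" using A B by (simp add: \<delta>_def)
    ultimately obtain h where h: "\<delta> = smult nonsq (h\<^sup>2)"
      using eq_nonsq_times_square_if_no_nonzero_squares[of \<delta>] by auto
    then have "h \<noteq> 0" using d2 by auto
    then have "degree h = 1" using d2 unfolding h by (simp add: degree_power_eq)
    then obtain t where "poly h t = 0" by (rule degree_1_root)
    then have "poly \<delta> t = 0\<^sup>2" unfolding h by simp
    then show False using no by blast
  qed
  then obtain t s where "poly \<delta> t = s\<^sup>2" by blast
  then have "A * s\<^sup>2 = A * (M / A + t * (t * (- B / A)))" by (simp add: \<delta>_def)
  then have "A * s\<^sup>2 + B * t\<^sup>2 = M" using A by (simp add: power2_eq_square algebra_simps)
  then show ?thesis by (rule that)
qed

lemma affine_conic_solvable: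
  fixes A B k l m :: "'a :: big_prime_field"
  assumes A: "A \<noteq> 0" and B: "B \<noteq> 0"
  obtains s t where "A * s\<^sup>2 + k * s + B * t\<^sup>2 + l * t + m = 0"
proof -
  define u v where "u = k / (2 * A)" and "v = l / (2 * B)"
  have k: "k = 2 * A * u" and l: "l = 2 * B * v" using A B by (simp_all add: u_def v_def)
  obtain s t where st: "A * s\<^sup>2 + B * t\<^sup>2 = A * u\<^sup>2 + B * v\<^sup>2 - m" using diagonal_conic_solvable[OF A B] .
  have "A * (s - u)\<^sup>2 + k * (s - u) + B * (t - v)\<^sup>2 + l * (t - v) + m = A * s\<^sup>2 + B * t\<^sup>2 - (A * u\<^sup>2 + B * v\<^sup>2 - m)"
    unfolding k l by (simp add: power2_eq_square algebra_simps)
  then show ?thesis using that st by simp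
qed

section \<open>The Chevalley-Warning theorem\<close>

inductive polynomial_fun :: "'i set \<Rightarrow> nat \<Rightarrow> (('i \<Rightarrow> 'a :: comm_ring_1) \<Rightarrow> 'a) \<Rightarrow> bool" for I where
  monomial: "(\<Sum>i\<in>I. e i) \<le> D \<Longrightarrow> polynomial_fun I D (\<lambda>x. c * (\<Prod>i\<in>I. x i ^ e i))"
| add: "polynomial_fun I D G \<Longrightarrow> polynomial_fun I D H \<Longrightarrow> polynomial_fun I D (\<lambda>x. G x + H x)"

lemma polynomial_fun_const: "polynomial_fun I D (\<lambda>x. c)"
  using polynomial_fun.monomial[where I = I and e = "\<lambda>_. 0" and D = D and c = c] by simp

lemma polynomial_fun_proj:
  assumes "finite I" "i \<in> I"
  shows "polynomial_fun I 1 (\<lambda>x :: 'i \<Rightarrow> 'a :: comm_ring_1. x i)"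
proof -
  have "(\<Prod>j\<in>I. x j ^ (if j = i then 1 else 0)) = x i" for x :: "'i \<Rightarrow> 'a"
    using assms by (subst prod.remove[of _ i]) auto
  moreover have "(\<Sum>j\<in>I. if j = i then 1 else 0 :: nat) \<le> 1" using assms(1) by simp
  ultimately show ?thesis
    using polynomial_fun.monomial[where I = I and e = "\<lambda>j. if j = i then 1 else 0" and D = 1 and c = "1 :: 'a"] by simp
qed

lemma polynomial_fun_mult:
  assumes "polynomial_fun I D G" "polynomial_fun I E H"
  shows "polynomial_fun I (D + E) (\<lambda>x. G x * H x)"
  using assms
proof (induction arbitrary: H rule: polynomial_fun.induct)
  case (monomial e D c)
  from monomial(2) show ?case
  proof (induction rule: polynomial_fun.induct)
    case (monomial e' E c')
    have "polynomial_fun I (D + E) (\<lambda>x. (c * c') * (\<Prod>i\<in>I. x i ^ (e i + e' i)))"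
      using monomial \<open>sum e I \<le> D\<close> by (intro polynomial_fun.monomial) (simp add: sum.distrib)
    then show ?case by (simp add: power_add prod.distrib mult_ac)
  next
    case (add E G H)
    then show ?case unfolding distrib_left by (intro polynomial_fun.add)
  qed
next
  case (add D G' H')
  then show ?case unfolding distrib_right by (intro polynomial_fun.add) auto
qed

lemma polynomial_fun_sum:
  "(\<And>i. i \<in> A \<Longrightarrow> polynomial_fun I D (G i)) \<Longrightarrow> polynomial_fun I D (\<lambda>x. \<Sum>i\<in>A. G i x)"
  by (induction A rule: infinite_finite_induct)
    (auto intro: polynomial_fun_const polynomial_fun.add)

lemma polynomial_fun_power: "polynomial_fun I D G \<Longrightarrow> polynomial_fun I (k * D) (\<lambda>x. G x ^ k)"
  by (induction k) (auto intro: polynomial_fun_const polynomial_fun_mult)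

lemma polynomial_fun_prod_list:
  "(\<And>f. f \<in> set fs \<Longrightarrow> polynomial_fun I (k * d f) (\<lambda>x. g f x)) \<Longrightarrow>
    polynomial_fun I (k * (\<Sum>f\<leftarrow>fs. d f)) (\<lambda>x. \<Prod>f\<leftarrow>fs. g f x)"
  by (induction fs) (auto simp: distrib_left intro: polynomial_fun_const polynomial_fun_mult)

lemma exists_power_neq_1:
  assumes "0 < e" "e < CARD('a :: finite_field) - 1"
  obtains g :: "'a :: finite_field" where "g \<noteq> 0" "g ^ e \<noteq> 1"
proof -
  have "card {g :: 'a. g ^ e = 1} \<le> e" using assms(1) by (rule card_nth_roots_idom_le)
  also have "\<dots> < card (UNIV - {0 :: 'a})" using assms(2) by (simp add: card_Diff_subset)
  finally have "\<not> UNIV - {0 :: 'a} \<subseteq> {g. g ^ e = 1}" by (meson card_mono finite leD)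
  then show ?thesis using that by blast
qed

lemma sum_powers_eq_0:
  assumes "e < CARD('a :: finite_field) - 1"
  shows "(\<Sum>t\<in>(UNIV :: 'a set). t ^ e) = 0"
proof (cases "e = 0")
  case True
  then show ?thesis using CHAR_dvd_CARD[where ?'a='a] by (simp add: of_nat_eq_0_iff_char_dvd)
next
  case False
  then obtain g :: 'a where g: "g \<noteq> 0" "g ^ e \<noteq> 1" using exists_power_neq_1 assms by blast
  have "bij (\<lambda>t. g * t)"
    by (rule bij_betw_byWitness[where f' = "\<lambda>t. t / g"]) (use g in auto)
  then have "(\<Sum>t\<in>UNIV. (g * t) ^ e) = (\<Sum>t\<in>(UNIV :: 'a set). t ^ e)"
    by (rule sum.reindex_bij_betw)
  then have "g ^ e * (\<Sum>t\<in>(UNIV :: 'a set). t ^ e) = (\<Sum>t\<in>(UNIV :: 'a set). t ^ e)"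
    by (simp add: power_mult_distrib sum_distrib_left)
  then show ?thesis using g(2) by simp
qed

lemma sum_polynomial_fun_eq_0:
  fixes G :: "('i \<Rightarrow> 'a :: finite_field) \<Rightarrow> 'a"
  assumes "finite I" "polynomial_fun I D G" "D < card I * (CARD('a) - 1)"
  shows "(\<Sum>x\<in>PiE I (\<lambda>_. UNIV). G x) = 0"
  using assms(2,3)
proof (induction rule: polynomial_fun.induct)
  case (monomial e D c)
  obtain i where i: "i \<in> I" "e i < CARD('a) - 1"
  proof (rule ccontr)
    assume "\<not> thesis"
    then have "(\<Sum>i\<in>I. CARD('a) - 1) \<le> (\<Sum>i\<in>I. e i)" using that by (intro sum_mono) force
    then show False using monomial by simp
  qed
  have "(\<Sum>x\<in>PiE I (\<lambda>_. UNIV). \<Prod>i\<in>I. x i ^ e i) = (\<Prod>i\<in>I. \<Sum>t\<in>(UNIV :: 'a set). t ^ e i)"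
    using \<open>finite I\<close> by (intro prod_sum_PiE[symmetric]) auto
  also have "\<dots> = 0" using i \<open>finite I\<close> sum_powers_eq_0 by (intro prod_zero) auto
  finally show ?case by (simp add: sum_distrib_left[symmetric])
qed (simp add: sum.distrib)

locale finite_vector_space = vector_space scale
  for scale :: "'a :: finite_field \<Rightarrow> 'v :: {ab_group_add, finite} \<Rightarrow> 'v" (infixr "\<cdot>" 75)
begin

definition polynomial_map :: "nat \<Rightarrow> ('v \<Rightarrow> 'a) \<Rightarrow> bool"
  where "polynomial_map D F \<longleftrightarrow> (\<forall>B. polynomial_fun B D (\<lambda>x. F (\<Sum>b\<in>B. x b \<cdot> b)))"

lemma polynomial_map_const: "polynomial_map D (\<lambda>_. c)"
  by (simp add: polynomial_map_def polynomial_fun_const)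

lemma polynomial_map_diagonal:
  assumes add: "\<And>x y v. T (x + y) v = T x v + T y v" and scale: "\<And>c x v. T (c \<cdot> x) v = c * T x v"
    and T: "\<And>u. polynomial_map D (T u)"
  shows "polynomial_map (Suc D) (\<lambda>y. T y y)"
  unfolding polynomial_map_def
proof
  fix B
  have "T 0 v = 0" for v using scale[of 0 0 v] by simp
  then have "T (\<Sum>b\<in>B. x b \<cdot> b) v = (\<Sum>b\<in>B. x b * T b v)" for x v and B
    by (induction B rule: infinite_finite_induct) (simp_all add: add scale)
  moreover have "polynomial_fun B (1 + D) (\<lambda>x. \<Sum>b\<in>B. x b * T b (\<Sum>b\<in>B. x b \<cdot> b))"
    using T by (intro polynomial_fun_sum polynomial_fun_mult polynomial_fun_proj)
      (simp_all add: polynomial_map_def)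
  ultimately show "polynomial_fun B (Suc D) (\<lambda>x. T (\<Sum>b\<in>B. x b \<cdot> b) (\<Sum>b\<in>B. x b \<cdot> b))" by simp
qed

lemma polynomial_map_linear:
  assumes "\<And>x y. l (x + y) = l x + l y" "\<And>c x. l (c \<cdot> x) = c * l x"
  shows "polynomial_map (Suc 0) l"
  using polynomial_map_diagonal[of "\<lambda>x _. l x" 0] assms polynomial_map_const by simp

lemma sum_basis_eq_0_iff:
  assumes "independent B" "x \<in> PiE B (\<lambda>_. UNIV)"
  shows "(\<Sum>b\<in>B. x b \<cdot> b) = 0 \<longleftrightarrow> x = (\<lambda>b\<in>B. 0)"
proof
  assume "(\<Sum>b\<in>B. x b \<cdot> b) = 0"
  then have "x b = 0" if "b \<in> B" for b using independentD[OF assms(1), of B x b] that by simp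
  then show "x = (\<lambda>b\<in>B. 0)" using assms(2) by (auto simp: PiE_def extensional_def)
qed simp

definition zeros_indicator :: "(('v \<Rightarrow> 'a) \<times> nat) list \<Rightarrow> 'v \<Rightarrow> 'a"
  where "zeros_indicator fs z = (\<Prod>f\<leftarrow>fs. 1 - fst f z ^ (CARD('a) - 1))"

lemma CARD_minus_1_pos: "0 < CARD('a) - 1"
proof -
  have "card {0, 1 :: 'a} \<le> CARD('a)" by (intro card_mono) auto
  then show ?thesis by simp
qed

lemma zeros_indicator_eq: "zeros_indicator fs z = (if \<forall>f\<in>set fs. fst f z = 0 then 1 else 0)"
proof (induction fs)
  case (Cons f fs)
  have "1 - fst f z ^ (CARD('a) - 1) = (if fst f z = 0 then 1 else 0)"
    using CARD_minus_1_pos power_CARD_minus_1[of "fst f z"] by (simp add: zero_power)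
  with Cons show ?case by (simp add: zeros_indicator_def)
qed (simp add: zeros_indicator_def)

lemma polynomial_fun_zeros_indicator:
  assumes "\<And>f. f \<in> set fs \<Longrightarrow> polynomial_map (snd f) (fst f)"
  shows "polynomial_fun B ((CARD('a) - 1) * (\<Sum>f\<leftarrow>fs. snd f)) (\<lambda>x. zeros_indicator fs (\<Sum>b\<in>B. x b \<cdot> b))"
  unfolding zeros_indicator_def
proof (rule polynomial_fun_prod_list)
  fix f assume "f \<in> set fs"
  then have "polynomial_fun B (snd f) (\<lambda>x. fst f (\<Sum>b\<in>B. x b \<cdot> b))"
    using assms by (simp add: polynomial_map_def)
  from polynomial_fun_mult[OF polynomial_fun_const[of B 0 "- 1"] polynomial_fun_power[OF this]]
  have "polynomial_fun B ((CARD('a) - 1) * snd f)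
      (\<lambda>x. 1 + - 1 * fst f (\<Sum>b\<in>B. x b \<cdot> b) ^ (CARD('a) - 1))"
    by (intro polynomial_fun.add polynomial_fun_const) simp
  then show "polynomial_fun B ((CARD('a) - 1) * snd f)
      (\<lambda>x. 1 - fst f (\<Sum>b\<in>B. x b \<cdot> b) ^ (CARD('a) - 1))"
    by simp
qed

theorem chevalley_warning:
  assumes fs: "\<And>f. f \<in> set fs \<Longrightarrow> polynomial_map (snd f) (fst f) \<and> fst f 0 = 0"
    and B: "independent B" and deg: "(\<Sum>f\<leftarrow>fs. snd f) < card B"
  shows "\<exists>z\<in>span B. z \<noteq> 0 \<and> (\<forall>f\<in>set fs. fst f z = 0)"
proof (rule ccontr)
  assume none: "\<not> ?thesis"
  let ?X = "PiE B (\<lambda>_. UNIV :: 'a set)" and ?z = "\<lambda>x. \<Sum>b\<in>B. x b \<cdot> b"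
  have "(CARD('a) - 1) * (\<Sum>f\<leftarrow>fs. snd f) < card B * (CARD('a) - 1)"
    using deg CARD_minus_1_pos by (subst mult.commute) (rule mult_strict_right_mono)
  then have "(\<Sum>x\<in>?X. zeros_indicator fs (?z x)) = 0"
    using fs by (intro sum_polynomial_fun_eq_0[OF finite polynomial_fun_zeros_indicator]) simp_all
  moreover have "zeros_indicator fs (?z x) = (if x = (\<lambda>b\<in>B. 0) then 1 else 0)" if "x \<in> ?X" for x
  proof (cases "?z x = 0")
    case True
    then have "x = (\<lambda>b\<in>B. 0)" using sum_basis_eq_0_iff[OF B that] by blast
    moreover have "\<forall>f\<in>set fs. fst f (?z x) = 0" unfolding True using fs by blast
    ultimately show ?thesis unfolding zeros_indicator_eq by simp
  next
    case False
    then have "x \<noteq> (\<lambda>b\<in>B. 0)" using sum_basis_eq_0_iff[OF B that] by blast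
    moreover have "?z x \<in> span B" by (intro span_sum span_scale span_base)
    then have "\<not> (\<forall>f\<in>set fs. fst f (?z x) = 0)" using none False by blast
    ultimately show ?thesis unfolding zeros_indicator_eq by simp
  qed
  then have "(\<Sum>x\<in>?X. zeros_indicator fs (?z x)) = (\<Sum>x\<in>?X. if x = (\<lambda>b\<in>B. 0) then 1 else 0)"
    by (intro sum.cong refl)
  moreover have "\<dots> = 1" by (subst sum.delta) (auto intro: finite_PiE)
  ultimately show False by simp
qed

lemma span_Int_span_if_independent_Un:
  assumes B: "independent (B \<union> C)" and "B \<inter> C = {}" "z \<in> span B" "z \<in> span C"
  shows "z = 0"
proof -
  have "representation (B \<union> C) z = representation B z" "representation (B \<union> C) z = representation C z"
    by (rule representation_extend[OF B assms(3)] representation_extend[OF B assms(4)]; simp)+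
  then have "representation (B \<union> C) z b = 0" for b
    using representation_ne_zero[of B z b] representation_ne_zero[of C z b] \<open>B \<inter> C = {}\<close> by auto
  moreover have "z \<in> span (B \<union> C)" using assms(3) span_mono[of B "B \<union> C"] by blast
  ultimately show ?thesis using sum_nonzero_representation_eq[OF B, of z] by simp
qed

text \<open>Apply the theorem to a complement of the span.\<close>

corollary chevalley_warning_outside_span:
  assumes fs: "\<forall>f\<in>set fs. polynomial_map (snd f) (fst f) \<and> fst f 0 = 0"
    and deg: "(\<Sum>f\<leftarrow>fs. snd f) + card S < dim (UNIV :: 'v set)"
  shows "\<exists>z. z \<notin> span S \<and> (\<forall>f\<in>set fs. fst f z = 0)"
proof -
  obtain A where A: "A \<subseteq> S" "independent A" "S \<subseteq> span A" by (rule maximal_independent_subset)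
  obtain B where B: "A \<subseteq> B" "independent B" "UNIV \<subseteq> span B"
    by (rule maximal_independent_subset_extend[OF subset_UNIV A(2)])
  have "dim (UNIV :: 'v set) = card B" using B by (intro dim_eq_card) auto
  moreover have "card A \<le> card S" using A(1) by (intro card_mono) auto
  ultimately have "(\<Sum>f\<leftarrow>fs. snd f) < card (B - A)"
    using deg B(1) by (simp add: card_Diff_subset)
  moreover have "independent (B - A)" using B(2) by (rule independent_mono) blast
  ultimately obtain z where z: "z \<in> span (B - A)" "z \<noteq> 0" "\<forall>f\<in>set fs. fst f z = 0"
    using chevalley_warning[of fs "B - A"] fs by blast
  have "A \<union> (B - A) = B" using B(1) by blast
  then have "z \<notin> span A" using span_Int_span_if_independent_Un[of A "B - A" z] B(2) z by auto
  moreover have "span S \<subseteq> span A" using A(3) subspace_span by (rule span_minimal)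
  ultimately show ?thesis using z(3) by blast
qed

end

section \<open>Quintic forms all of whose zeros are singular\<close>

subsection \<open>Symmetric multilinear forms\<close>

lemma degree_le_1E:
  assumes "degree p \<le> 1"
  obtains a b where "p = [:a, b:]"
  by (rule that[of "coeff p 0" "coeff p 1"], rule poly_eqI)
    (use assms in \<open>auto simp: coeff_pCons coeff_eq_0 split: nat.splits\<close>)

locale quintic_form = vector_space scale
  for scale :: "'a :: big_prime_field \<Rightarrow> 'v :: ab_group_add \<Rightarrow> 'v" (infixr "\<cdot>" 75) +
  fixes \<Phi> :: "'v \<Rightarrow> 'v \<Rightarrow> 'v \<Rightarrow> 'v \<Rightarrow> 'v \<Rightarrow> 'a"
  assumes sym1: "\<Phi> x y c d e = \<Phi> y x c d e" and sym2: "\<Phi> b x y d e = \<Phi> b y x d e"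
    and sym3: "\<Phi> b c x y e = \<Phi> b c y x e" and sym4: "\<Phi> b c d x y = \<Phi> b c d y x"
    and add1: "\<Phi> (x + y) b c d e = \<Phi> x b c d e + \<Phi> y b c d e"
    and scale1: "\<Phi> (k \<cdot> x) b c d e = k * \<Phi> x b c d e"
begin

lemmas sym = sym1 sym2 sym3 sym4

lemma add2: "\<Phi> b (x + y) c d e = \<Phi> b x c d e + \<Phi> b y c d e"
  using add1[of x y b c d e] by (simp only: sym1[of b])
lemma add3: "\<Phi> b c (x + y) d e = \<Phi> b c x d e + \<Phi> b c y d e"
  using add2[of b x y c d e] by (simp only: sym2[of b c])
lemma add4: "\<Phi> b c d (x + y) e = \<Phi> b c d x e + \<Phi> b c d y e"
  using add3[of b c x y d e] by (simp only: sym3[of b c d])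
lemma add5: "\<Phi> b c d e (x + y) = \<Phi> b c d e x + \<Phi> b c d e y"
  using add4[of b c d x y e] by (simp only: sym4[of b c d e])
lemma scale2: "\<Phi> b (k \<cdot> x) c d e = k * \<Phi> b x c d e"
  using scale1[of k x b c d e] by (simp only: sym1[of b])
lemma scale3: "\<Phi> b c (k \<cdot> x) d e = k * \<Phi> b c x d e"
  using scale2[of b k x c d e] by (simp only: sym2[of b c])
lemma scale4: "\<Phi> b c d (k \<cdot> x) e = k * \<Phi> b c d x e"
  using scale3[of b c k x d e] by (simp only: sym3[of b c d])
lemma scale5: "\<Phi> b c d e (k \<cdot> x) = k * \<Phi> b c d e x"
  using scale4[of b c d k x e] by (simp only: sym4[of b c d e])

lemmas multilinear = add1 add2 add3 add4 add5 scale1 scale2 scale3 scale4 scale5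

lemma zero [simp]: "\<Phi> 0 b c d e = 0" "\<Phi> b 0 c d e = 0" "\<Phi> b c 0 d e = 0" "\<Phi> b c d 0 e = 0" "\<Phi> b c d e 0 = 0"
  using scale1[of 0 0 b c d e] scale2[of b 0 0 c d e] scale3[of b c 0 0 d e] scale4[of b c d 0 0 e] scale5[of b c d e 0 0]
  by simp_all

abbreviation f :: "'v \<Rightarrow> 'a"
  where "f v \<equiv> \<Phi> v v v v v"

lemma expand2: "\<Phi> b c d (t \<cdot> u + v) (t \<cdot> u + v) = t\<^sup>2 * \<Phi> b c d u u + 2 * t * \<Phi> b c d u v + \<Phi> b c d v v"
  by (simp add: multilinear sym4[of b c d v u] power2_eq_square algebra_simps)

lemma expand3: "\<Phi> b c (t \<cdot> u + v) (t \<cdot> u + v) (t \<cdot> u + v) =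
    t ^ 3 * \<Phi> b c u u u + 3 * t\<^sup>2 * \<Phi> b c u u v + 3 * t * \<Phi> b c u v v + \<Phi> b c v v v"
proof -
  define w where "w = t \<cdot> u + v"
  have s: "\<Phi> b c v u u = \<Phi> b c u u v" "\<Phi> b c v u v = \<Phi> b c u v v" by (metis sym3 sym4)+
  have "\<Phi> b c w w w = t * \<Phi> b c u w w + \<Phi> b c v w w"
    by (subst (1) w_def) (simp only: add3 scale3)
  then show ?thesis unfolding w_def expand2 s
    by (simp add: power2_eq_square power3_eq_cube algebra_simps)
qed

lemma expand4: "\<Phi> b (t \<cdot> u + v) (t \<cdot> u + v) (t \<cdot> u + v) (t \<cdot> u + v) =
    t ^ 4 * \<Phi> b u u u u + 4 * t ^ 3 * \<Phi> b u u u v + 6 * t\<^sup>2 * \<Phi> b u u v v + 4 * t * \<Phi> b u v v v + \<Phi> b v v v v"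
proof -
  have s: "\<Phi> b v u u u = \<Phi> b u u u v" "\<Phi> b v u u v = \<Phi> b u u v v" "\<Phi> b v u v v = \<Phi> b u v v v"
    by (metis sym2 sym3 sym4)+
  define w where "w = t \<cdot> u + v"
  have "\<Phi> b w w w w = t * \<Phi> b u w w w + \<Phi> b v w w w"
    by (subst (1) w_def) (simp only: add2 scale2)
  then show ?thesis unfolding w_def expand3 s
    by (simp add: eval_nat_numeral algebra_simps)
qed

lemma expand5: "f (t \<cdot> u + v) =
    t ^ 5 * f u + 5 * t ^ 4 * \<Phi> u u u u v + 10 * t ^ 3 * \<Phi> u u u v v + 10 * t\<^sup>2 * \<Phi> u u v v v
      + 5 * t * \<Phi> u v v v v + f v"
proof -
  have s: "\<Phi> v u u u u = \<Phi> u u u u v" "\<Phi> v u u u v = \<Phi> u u u v v" "\<Phi> v u u v v = \<Phi> u u v v v" "\<Phi> v u v v v = \<Phi> u v v v v"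
    by (metis sym)+
  define w where "w = t \<cdot> u + v"
  have "f w = t * \<Phi> u w w w w + \<Phi> v w w w w"
    by (subst (1) w_def) (simp only: add1 scale1)
  then show ?thesis unfolding w_def expand4 s
    by (simp add: eval_nat_numeral algebra_simps)
qed

lemma rotate: "\<Phi> w x y z b = \<Phi> b w x y z"
  by (metis sym)

lemma rotate_twice: "\<Phi> u v w y z = \<Phi> y z u v w"
  using rotate by metis

definition pencil2 :: "'v \<Rightarrow> 'v \<Rightarrow> 'v \<Rightarrow> 'v \<Rightarrow> 'v \<Rightarrow> 'a poly"
  where "pencil2 b c d u v = [:\<Phi> b c d v v, 2 * \<Phi> b c d u v, \<Phi> b c d u u:]"

definition pencil3 :: "'v \<Rightarrow> 'v \<Rightarrow> 'v \<Rightarrow> 'v \<Rightarrow> 'a poly"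
  where "pencil3 b c u v = [:\<Phi> b c v v v, 3 * \<Phi> b c u v v, 3 * \<Phi> b c u u v, \<Phi> b c u u u:]"

definition pencil4 :: "'v \<Rightarrow> 'v \<Rightarrow> 'v \<Rightarrow> 'a poly"
  where "pencil4 b u v = [:\<Phi> b v v v v, 4 * \<Phi> b u v v v, 6 * \<Phi> b u u v v, 4 * \<Phi> b u u u v, \<Phi> b u u u u:]"

definition pencil5 :: "'v \<Rightarrow> 'v \<Rightarrow> 'a poly"
  where "pencil5 u v = [:f v, 5 * \<Phi> u v v v v, 10 * \<Phi> u u v v v, 10 * \<Phi> u u u v v, 5 * \<Phi> u u u u v, f u:]"

lemma poly_pencil2: "poly (pencil2 b c d u v) t = \<Phi> b c d (t \<cdot> u + v) (t \<cdot> u + v)"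
  unfolding expand2 pencil2_def by (simp add: power2_eq_square algebra_simps)

lemma poly_pencil3: "poly (pencil3 b c u v) t = \<Phi> b c (t \<cdot> u + v) (t \<cdot> u + v) (t \<cdot> u + v)"
  unfolding expand3 pencil3_def by (simp add: eval_nat_numeral algebra_simps)

lemma poly_pencil4: "poly (pencil4 b u v) t = \<Phi> b (t \<cdot> u + v) (t \<cdot> u + v) (t \<cdot> u + v) (t \<cdot> u + v)"
  unfolding expand4 pencil4_def by (simp add: eval_nat_numeral algebra_simps)

lemma poly_pencil5: "poly (pencil5 u v) t = f (t \<cdot> u + v)"
  unfolding expand5 pencil5_def by (simp add: eval_nat_numeral algebra_simps)

lemma poly_pderiv_pencil3: "poly (pderiv (pencil3 b c u v)) t = 3 * \<Phi> b c u (t \<cdot> u + v) (t \<cdot> u + v)"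
  unfolding expand2 pencil3_def by (simp add: pderiv_pCons eval_nat_numeral algebra_simps)

lemma poly_pderiv_pencil4: "poly (pderiv (pencil4 b u v)) t = 4 * \<Phi> b u (t \<cdot> u + v) (t \<cdot> u + v) (t \<cdot> u + v)"
  unfolding expand3 pencil4_def by (simp add: pderiv_pCons eval_nat_numeral algebra_simps)

lemma poly_pderiv_pencil5:
  "poly (pderiv (pencil5 u v)) t = 5 * \<Phi> u (t \<cdot> u + v) (t \<cdot> u + v) (t \<cdot> u + v) (t \<cdot> u + v)"
  unfolding expand4 pencil5_def by (simp add: pderiv_pCons eval_nat_numeral algebra_simps)

lemma degree_pencil_le: "degree (pencil3 b c u v) \<le> 3" "degree (pencil4 b u v) \<le> 4" "degree (pencil5 u v) \<le> 5"
  by (simp_all add: pencil3_def pencil4_def pencil5_def degree_pCons_eq_if)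

lemma degree_pencil3: "\<Phi> b c u u u \<noteq> 0 \<Longrightarrow> degree (pencil3 b c u v) = 3"
  by (simp add: pencil3_def)

lemma degree_pencil5: "f u \<noteq> 0 \<Longrightarrow> degree (pencil5 u v) = 5"
  by (simp add: pencil5_def)

lemma line_vanish2:
  assumes "\<And>y. \<Phi> b c d y y = 0"
  shows "\<Phi> b c d x y = 0"
proof -
  have "\<Phi> b c d (1 \<cdot> x + y) (1 \<cdot> x + y) = 0" by (rule assms)
  then have "2 * \<Phi> b c d x y = 0" unfolding expand2 assms by simp
  then show ?thesis by simp
qed

lemma line_vanish3:
  assumes "\<And>t. \<Phi> b c (t \<cdot> u + v) (t \<cdot> u + v) (t \<cdot> u + v) = 0"
  shows "\<Phi> b c u u u = 0" "\<Phi> b c u u v = 0" "\<Phi> b c u v v = 0" "\<Phi> b c v v v = 0"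
proof -
  have "pencil3 b c u v = 0"
    using degree_pencil_le(1)[of b c u v] CARD_gt[where ?'a='a] assms
    by (intro poly_eq_0_if_vanishing) (auto simp: poly_pencil3)
  then show "\<Phi> b c u u u = 0" "\<Phi> b c u u v = 0" "\<Phi> b c u v v = 0" "\<Phi> b c v v v = 0"
    by (simp_all add: pencil3_def)
qed

lemma line_vanish4:
  assumes "\<And>t. \<Phi> b (t \<cdot> u + v) (t \<cdot> u + v) (t \<cdot> u + v) (t \<cdot> u + v) = 0"
  shows "\<Phi> b u u u u = 0" "\<Phi> b u u u v = 0" "\<Phi> b u u v v = 0" "\<Phi> b u v v v = 0" "\<Phi> b v v v v = 0"
proof -
  have "pencil4 b u v = 0"
    using degree_pencil_le(2)[of b u v] CARD_gt[where ?'a='a] assms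
    by (intro poly_eq_0_if_vanishing) (auto simp: poly_pencil4)
  then show "\<Phi> b u u u u = 0" "\<Phi> b u u u v = 0" "\<Phi> b u u v v = 0" "\<Phi> b u v v v = 0" "\<Phi> b v v v v = 0"
    by (simp_all add: pencil4_def)
qed

lemma line_vanish5:
  assumes "\<And>t. f (t \<cdot> u + v) = 0"
  shows "f u = 0" "\<Phi> u u u u v = 0" "\<Phi> u u u v v = 0" "\<Phi> u u v v v = 0" "\<Phi> u v v v v = 0" "f v = 0"
proof -
  have "pencil5 u v = 0"
    using degree_pencil_le(3)[of u v] CARD_gt[where ?'a='a] assms
    by (intro poly_eq_0_if_vanishing) (auto simp: poly_pencil5)
  then show "f u = 0" "\<Phi> u u u u v = 0" "\<Phi> u u u v v = 0" "\<Phi> u u v v v = 0" "\<Phi> u v v v v = 0" "f v = 0"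
    by (simp_all add: pencil5_def)
qed

lemma polarize3:
  assumes "\<And>y. \<Phi> b c y y y = 0"
  shows "\<Phi> b c x y z = 0"
proof (rule line_vanish2)
  fix y
  have "\<Phi> b c y y x = 0" using assms by (rule line_vanish3)
  then show "\<Phi> b c x y y = 0" by (metis sym3 sym4)
qed

lemma polarize4:
  assumes "\<And>y. \<Phi> b y y y y = 0"
  shows "\<Phi> b w x y z = 0"
proof (rule polarize3)
  fix y
  have "\<Phi> b y y y w = 0" using assms by (rule line_vanish4)
  then show "\<Phi> b w y y y = 0" by (metis sym2 sym3 sym4)
qed

end

locale singular_quintic = finite_vector_space scale + quintic_form scale \<Phi>
  for scale :: "'a :: big_prime_field \<Rightarrow> 'v :: {ab_group_add, finite} \<Rightarrow> 'v" (infixr "\<cdot>" 75)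
    and \<Phi> :: "'v \<Rightarrow> 'v \<Rightarrow> 'v \<Rightarrow> 'v \<Rightarrow> 'v \<Rightarrow> 'a" +
  assumes dim_ge: "6 \<le> dim (UNIV :: 'v set)"
    and nondegenerate: "(\<And>w x y z. \<Phi> v w x y z = 0) \<Longrightarrow> v = 0"
    and singular: "\<Phi> x x x x x = 0 \<Longrightarrow> \<Phi> x x x x z = 0"
begin

lemma vertex_eq_0: "(\<And>y. \<Phi> v y y y y = 0) \<Longrightarrow> v = 0"
  using nondegenerate polarize4 by blast

lemma polynomial_map_1: "polynomial_map 1 (\<lambda>y. \<Phi> b c d e y)"
  unfolding One_nat_def by (rule polynomial_map_linear) (rule add5 scale5)+

lemma polynomial_map_2: "polynomial_map 2 (\<lambda>y. \<Phi> b c d y y)"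
  unfolding numeral_2_eq_2
  by (rule polynomial_map_diagonal[of "\<lambda>x y. \<Phi> b c d x y"]) (rule add4 scale4 polynomial_map_1[unfolded One_nat_def])+

lemma polynomial_map_3: "polynomial_map 3 (\<lambda>y. \<Phi> b c y y y)"
  unfolding numeral_3_eq_3 using polynomial_map_2
  by (intro polynomial_map_diagonal[of "\<lambda>x y. \<Phi> b c x y y"] add3 scale3) (simp add: numeral_2_eq_2)

lemma polynomial_map_5: "polynomial_map 5 f"
proof -
  have "polynomial_map (Suc 3) (\<lambda>y. \<Phi> b y y y y)" for b
    by (rule polynomial_map_diagonal[of "\<lambda>x y. \<Phi> b x y y y"]) (rule add2 scale2 polynomial_map_3)+
  then have "polynomial_map (Suc (Suc 3)) f"
    by (intro polynomial_map_diagonal[of "\<lambda>x y. \<Phi> x y y y y"] add1 scale1)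
  then show ?thesis by simp
qed

lemmas polynomial_maps [simp] = polynomial_map_1[unfolded One_nat_def] polynomial_map_2 polynomial_map_3 polynomial_map_5

lemma exists_common_zero_outside_span:
  assumes "\<forall>g\<in>set gs. polynomial_map (snd g) (fst g) \<and> fst g 0 = 0" "(\<Sum>g\<leftarrow>gs. snd g) + card S < 6"
  shows "\<exists>z. z \<notin> span S \<and> (\<forall>g\<in>set gs. fst g z = 0)"
  using chevalley_warning_outside_span[OF assms(1), of S] assms(2) dim_ge by simp

subsection \<open>Singular zeros and isotropic lines\<close>

lemma expand_singular_zero:
  assumes "f a = 0"
  shows "f (x \<cdot> a + y) = 10 * x ^ 3 * \<Phi> a a a y y + 10 * x\<^sup>2 * \<Phi> a a y y y + 5 * x * \<Phi> a y y y y + f y"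
    and "\<Phi> (x \<cdot> a + y) (x \<cdot> a + y) (x \<cdot> a + y) (x \<cdot> a + y) a =
      6 * x\<^sup>2 * \<Phi> a a a y y + 4 * x * \<Phi> a a y y y + \<Phi> a y y y y"
proof -
  let ?v = "x \<cdot> a + y"
  show "f ?v = 10 * x ^ 3 * \<Phi> a a a y y + 10 * x\<^sup>2 * \<Phi> a a y y y + 5 * x * \<Phi> a y y y y + f y"
    unfolding expand5 using singular[OF assms] by simp
  show "\<Phi> ?v ?v ?v ?v a = 6 * x\<^sup>2 * \<Phi> a a a y y + 4 * x * \<Phi> a a y y y + \<Phi> a y y y y"
    unfolding rotate[of ?v ?v ?v ?v a] expand4 using singular[OF assms] by simp
qed

text \<open>Along a line of vectors isotropic for \<open>\<lambda>y. \<Phi> a a a y y\<close> the form is quadratic in the coefficient of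
  \<open>a\<close>.\<close>

context
  fixes a y z
  assumes a: "f a = 0" and q: "\<Phi> a a a y y = 0" "\<Phi> a a a y z = 0" "\<Phi> a a a z z = 0"
    and c: "\<Phi> a a y y y \<noteq> 0"
begin

lemma singular_quadratic_curve_isotropic:
  "singular_quadratic_curve (smult 10 (pencil3 a a y z)) (smult 5 (pencil4 a y z)) (pencil5 y z)"
proof
  show "degree (smult 10 (pencil3 a a y z)) = 3" using degree_pencil3[OF c] by simp
  show "degree (smult 5 (pencil4 a y z)) \<le> 4" using degree_pencil_le(2) by simp
  show "degree (pencil5 y z) \<le> 5" by (rule degree_pencil_le)
next
  fix x t
  define w where "w = t \<cdot> y + z"
  define v where "v = x \<cdot> a + w"
  assume on_curve: "poly (smult 10 (pencil3 a a y z)) t * x\<^sup>2 + poly (smult 5 (pencil4 a y z)) t * x + poly (pencil5 y z) t = 0"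
  have q': "\<Phi> a a a w w = 0" "\<Phi> a a a y w = 0"
    using q by (simp_all add: w_def expand2, simp add: multilinear)
  have "f v = 10 * x\<^sup>2 * \<Phi> a a w w w + 5 * x * \<Phi> a w w w w + f w"
    unfolding v_def expand_singular_zero(1)[OF a] q' by simp
  also have "\<dots> = 0"
    using on_curve unfolding poly_smult poly_pencil3 poly_pencil4 poly_pencil5 by (simp add: w_def mult_ac)
  finally have v: "\<Phi> v v v v u = 0" for u by (rule singular)
  have "5 * \<Phi> v v v v a = 2 * (10 * \<Phi> a a w w w) * x + 5 * \<Phi> a w w w w"
    unfolding v_def expand_singular_zero(2)[OF a] q' by simp
  moreover have "\<Phi> y a a a a = 0" "\<Phi> y a a a w = 0"
    using q'(2) singular[OF a, of y]
    by (simp_all only: sym1[of y a a] sym2[of a y a] sym3[of a a y a] sym4[of a a a y a])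
  then have "\<Phi> v v v v y = 6 * x\<^sup>2 * \<Phi> y a a w w + 4 * x * \<Phi> y a w w w + \<Phi> y w w w w"
    unfolding rotate[of v v v v y] unfolding v_def expand4 by simp
  then have "5 * \<Phi> v v v v y = 10 * (3 * \<Phi> a a y w w) * x\<^sup>2 + 5 * (4 * \<Phi> a y w w w) * x + 5 * \<Phi> y w w w w"
    by (simp add: sym1[of y a] sym2[of a y a])
  ultimately show "2 * poly (smult 10 (pencil3 a a y z)) t * x + poly (smult 5 (pencil4 a y z)) t = 0 \<and>
      poly (pderiv (smult 10 (pencil3 a a y z))) t * x\<^sup>2 + poly (pderiv (smult 5 (pencil4 a y z))) t * x
        + poly (pderiv (pencil5 y z)) t = 0"
    unfolding pderiv_smult poly_smult poly_pencil3 poly_pencil4 poly_pderiv_pencil3 poly_pderiv_pencil4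
      poly_pderiv_pencil5 w_def[symmetric] v by simp
qed

lemma isotropic_factorisation:
  obtains b1 b2 where "degree b1 \<le> 1" "degree b2 \<le> 1" "pencil4 a y z = smult 4 (pencil3 a a y z * b1)"
    "pencil5 y z = smult 10 (pencil3 a a y z * nonsq_norm b1 b2)"
    "\<forall>r. poly (pencil3 a a y z) r = 0 \<longrightarrow> poly (pderiv (pencil3 a a y z)) r = 0"
proof (rule singular_quadratic_curve.obtain_factorisation[OF singular_quadratic_curve_isotropic])
  fix b1 b2
  assume b: "degree b1 \<le> 1" "degree b2 \<le> 1"
    "smult 5 (pencil4 a y z) = smult 2 (smult 10 (pencil3 a a y z) * b1)"
    "pencil5 y z = smult 10 (pencil3 a a y z) * nonsq_norm b1 b2"
    "\<And>r. poly (smult 10 (pencil3 a a y z)) r = 0 \<Longrightarrow> poly (pderiv (smult 10 (pencil3 a a y z))) r = 0"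
  have "(20 :: 'a) / 5 = 4" by (simp add: divide_eq_eq)
  moreover have "pencil4 a y z = smult (20 / 5) (pencil3 a a y z * b1)"
    using arg_cong[OF b(3), of "smult (1 / 5)"] by simp
  ultimately have "pencil4 a y z = smult 4 (pencil3 a a y z * b1)" by (simp only:)
  then show ?thesis using b that by (simp add: pderiv_smult)
qed

lemma isotropic_cubic_zero:
  assumes z: "\<Phi> a a z z z = 0"
  shows "\<Phi> a a y y z = 0" "\<Phi> a a y z z = 0" "\<Phi> a z z z z = 0" "f z = 0"
proof -
  obtain b1 b2 where "degree b1 \<le> 1" "degree b2 \<le> 1"
    and b: "pencil4 a y z = smult 4 (pencil3 a a y z * b1)"
    "pencil5 y z = smult 10 (pencil3 a a y z * nonsq_norm b1 b2)"
    "\<forall>r. poly (pencil3 a a y z) r = 0 \<longrightarrow> poly (pderiv (pencil3 a a y z)) r = 0"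
    by (rule isotropic_factorisation)
  have root: "poly (pencil3 a a y z) 0 = 0" using z by (simp add: poly_pencil3)
  then show "\<Phi> a z z z z = 0" "f z = 0"
    using arg_cong[OF b(1), of "\<lambda>P. poly P 0"] arg_cong[OF b(2), of "\<lambda>P. poly P 0"]
    by (simp_all add: poly_pencil4 poly_pencil5)
  obtain k where "pencil3 a a y z = smult k ([:- 0, 1:] * ([:- 0, 1:] * [:- 0, 1:]))"
    using cubic_with_multiple_roots[OF degree_pencil3[OF c] b(3)[rule_format] root] .
  then show "\<Phi> a a y y z = 0" "\<Phi> a a y z z = 0" by (simp_all add: pencil3_def)
qed

lemma isotropic_pencil5:
  assumes y: "\<Phi> a y y y y = 0" "\<Phi> a y y y z = 0"
  obtains n0 n1 where "pencil4 a y z = 0" "pencil5 y z = smult (- 10 * nonsq) (pencil3 a a y z * [:n0, n1:]\<^sup>2)"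
proof -
  obtain b1 b2 where b: "degree b1 \<le> 1" "degree b2 \<le> 1" "pencil4 a y z = smult 4 (pencil3 a a y z * b1)"
    "pencil5 y z = smult 10 (pencil3 a a y z * nonsq_norm b1 b2)"
    by (rule isotropic_factorisation)
  obtain \<beta>0 \<beta>1 n0 n1 where b1: "b1 = [:\<beta>0, \<beta>1:]" and b2: "b2 = [:n0, n1:]"
    using degree_le_1E[OF b(1)] degree_le_1E[OF b(2)] by metis
  have "4 * (\<Phi> a a y y y * \<beta>1) = 0"
    using arg_cong[OF b(3), of "\<lambda>P. coeff P 4"] y
    by (simp add: pencil3_def pencil4_def b1 eval_nat_numeral algebra_simps)
  then have "\<beta>1 = 0" using c by simp
  then have "4 * (\<Phi> a a y y y * \<beta>0) = 0"
    using arg_cong[OF b(3), of "\<lambda>P. coeff P 3"] y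
    by (simp add: pencil3_def pencil4_def b1 eval_nat_numeral algebra_simps)
  then have "b1 = 0" using c \<open>\<beta>1 = 0\<close> by (simp add: b1)
  show ?thesis
  proof (rule that)
    show "pencil4 a y z = 0" unfolding b(3) \<open>b1 = 0\<close> by simp
    show "pencil5 y z = smult (- 10 * nonsq) (pencil3 a a y z * [:n0, n1:]\<^sup>2)"
      unfolding b(4) nonsq_norm_def \<open>b1 = 0\<close> b2 by simp
  qed
qed

lemma isotropic_nonsq_square:
  assumes y: "\<Phi> a y y y y = 0" "\<Phi> a y y y z = 0"
  obtains n0 n1 where "pencil5 y z = smult (- 10 * nonsq) (pencil3 a a y z * [:n0, n1:]\<^sup>2)"
    "\<Phi> a z z z z = 0" "f z = - 10 * nonsq * \<Phi> a a z z z * n0\<^sup>2" "f y = - 10 * nonsq * \<Phi> a a y y y * n1\<^sup>2"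
    "\<Phi> y y y y z = - 2 * nonsq * (2 * \<Phi> a a y y y * n1 * n0 + 3 * \<Phi> a a y y z * n1\<^sup>2)"
    "\<Phi> y y y z z = - nonsq * (\<Phi> a a y y y * n0\<^sup>2 + 6 * \<Phi> a a y y z * n1 * n0 + 3 * \<Phi> a a y z z * n1\<^sup>2)"
proof -
  obtain n0 n1 where pencil4: "pencil4 a y z = 0"
    and pencil5: "pencil5 y z = smult (- 10 * nonsq) (pencil3 a a y z * [:n0, n1:]\<^sup>2)"
    by (rule isotropic_pencil5[OF y])
  have "[:n0, n1:]\<^sup>2 = [:n0\<^sup>2, 2 * n0 * n1, n1\<^sup>2:]" by (simp add: power2_eq_square)
  with pencil5 have coeffs: "coeff (pencil5 y z) k =
      - 10 * nonsq * coeff (pencil3 a a y z * [:n0\<^sup>2, 2 * n0 * n1, n1\<^sup>2:]) k" for k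
    by (simp only: coeff_smult)
  have cancel: "x = x'" if "5 * x = 5 * x' \<or> 10 * x = 10 * x'" for x x' :: 'a using that by auto
  show ?thesis
  proof (rule that[OF pencil5])
    show "f z = - 10 * nonsq * \<Phi> a a z z z * n0\<^sup>2"
      using coeffs[of 0] by (simp add: pencil3_def pencil5_def)
    show "\<Phi> a z z z z = 0"
      using arg_cong[OF pencil4, of "\<lambda>P. poly P 0"] by (simp add: poly_pencil4)
    show "f y = - 10 * nonsq * \<Phi> a a y y y * n1\<^sup>2"
      using coeffs[of 5] by (simp add: pencil3_def pencil5_def eval_nat_numeral)
    show "\<Phi> y y y y z = - 2 * nonsq * (2 * \<Phi> a a y y y * n1 * n0 + 3 * \<Phi> a a y y z * n1\<^sup>2)"
      by (rule cancel, rule disjI1)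
        (use coeffs[of 4] in \<open>simp add: pencil3_def pencil5_def eval_nat_numeral algebra_simps\<close>)
    show "\<Phi> y y y z z = - nonsq * (\<Phi> a a y y y * n0\<^sup>2 + 6 * \<Phi> a a y y z * n1 * n0 + 3 * \<Phi> a a y z z * n1\<^sup>2)"
      by (rule cancel, rule disjI2)
        (use coeffs[of 3] in \<open>simp add: pencil3_def pencil5_def eval_nat_numeral algebra_simps\<close>)
  qed
qed

end

text \<open>The quadratic form \<open>\<lambda>y. \<Phi> a a a y y\<close> of a zero \<open>a\<close> cannot vanish identically: otherwise the form has
  a vertex.\<close>

context
  fixes a
  assumes a: "f a = 0" and vanish: "\<And>y z. \<Phi> a a a y z = 0"
begin

lemma totally_isotropic_translate:
  "f (s \<cdot> a + y) = 10 * s\<^sup>2 * \<Phi> a a y y y + 5 * s * \<Phi> a y y y y + f y"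
  "\<Phi> a a (s \<cdot> a + y) (s \<cdot> a + y) (s \<cdot> a + y) = \<Phi> a a y y y"
  "\<Phi> a (s \<cdot> a + y) (s \<cdot> a + y) (s \<cdot> a + y) (s \<cdot> a + y) = 4 * s * \<Phi> a a y y y + \<Phi> a y y y y"
  subgoal unfolding expand_singular_zero(1)[OF a] vanish by simp
  subgoal unfolding expand3 vanish by simp
  subgoal unfolding expand4 vanish by simp
  done

lemma totally_isotropic_cubic_neq_0:
  assumes "a \<noteq> 0"
  obtains y where "\<Phi> a a y y y \<noteq> 0"
proof (rule ccontr)
  assume "\<not> thesis"
  then have C: "\<Phi> a a y y y = 0" for y using that by blast
  have "\<Phi> a y y y y = 0" for y
  proof (rule ccontr)
    assume D: "\<Phi> a y y y y \<noteq> 0"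
    define x where "x = - f y / (5 * \<Phi> a y y y y)"
    have "f (x \<cdot> a + y) = 0" unfolding totally_isotropic_translate C using D by (simp add: x_def)
    from singular[OF this, of a] show False unfolding expand_singular_zero(2)[OF a] vanish C using D by simp
  qed
  then show False using vertex_eq_0 assms by blast
qed

lemma totally_isotropic_square_form:
  assumes "a \<noteq> 0"
  obtains y0 k m where "\<Phi> a a y0 y0 y0 \<noteq> 0" "\<Phi> a y0 y0 y0 y0 = 0"
    "\<forall>u v. m (u + v) = m u + m v" "\<forall>c u. m (c \<cdot> u) = c * m u"
    "\<forall>z. \<Phi> a y0 y0 y0 z = 0 \<longrightarrow> \<Phi> a z z z z = 0 \<and> f z = k * \<Phi> a a z z z * (m z)\<^sup>2"
proof (cases "\<exists>y. \<Phi> a a y y y \<noteq> 0 \<and> \<Phi> a y y y y = 0 \<and> f y \<noteq> 0")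
  case True
  then obtain y where y: "\<Phi> a a y y y \<noteq> 0" "\<Phi> a y y y y = 0" "f y \<noteq> 0" by blast
  define N where "N = - f y / (10 * nonsq * \<Phi> a a y y y)"
  define m where "m z = (- \<Phi> y y y y z / (2 * nonsq) - 3 * \<Phi> a a y y z * N) / (2 * \<Phi> a a y y y)" for z
  show ?thesis
  proof (rule that[OF y(1,2)]; (intro allI impI)?)
    show "m (u + v) = m u + m v" "m (c \<cdot> u) = c * m u" for u v c
      unfolding m_def by (simp_all add: multilinear algebra_simps add_divide_distrib diff_divide_distrib)
    fix z assume z: "\<Phi> a y y y z = 0"
    obtain n0 n1 where fz: "f z = - 10 * nonsq * \<Phi> a a z z z * n0\<^sup>2"
      and D: "\<Phi> a z z z z = 0" and fy: "f y = - 10 * nonsq * \<Phi> a a y y y * n1\<^sup>2"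
      and yz: "\<Phi> y y y y z = - 2 * nonsq * (2 * \<Phi> a a y y y * n1 * n0 + 3 * \<Phi> a a y y z * n1\<^sup>2)"
      by (rule isotropic_nonsq_square[OF a vanish vanish vanish y(1,2) z])
    have N: "N = n1\<^sup>2" unfolding N_def fy using y(1) by simp
    have "m z = n1 * n0" unfolding m_def N yz using y(1) by (simp add: field_simps)
    moreover have "n1 \<noteq> 0" using y(3) fy by auto
    ultimately have "(- 10 * nonsq / N) * \<Phi> a a z z z * (m z)\<^sup>2 = - 10 * nonsq * \<Phi> a a z z z * n0\<^sup>2"
      unfolding N by (simp add: power_mult_distrib)
    then show "\<Phi> a z z z z = 0 \<and> f z = (- 10 * nonsq / N) * \<Phi> a a z z z * (m z)\<^sup>2"
      using D fz by simp
  qed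
next
  case False
  obtain y1 where y1: "\<Phi> a a y1 y1 y1 \<noteq> 0" using totally_isotropic_cubic_neq_0[OF assms] .
  define y where "y = (- \<Phi> a y1 y1 y1 y1 / (4 * \<Phi> a a y1 y1 y1)) \<cdot> a + y1"
  have y: "\<Phi> a a y y y \<noteq> 0" "\<Phi> a y y y y = 0"
    unfolding y_def totally_isotropic_translate using y1 by simp_all
  show ?thesis
  proof (rule that[OF y, of "\<lambda>_. 0" 0]; (intro allI impI)?)
    fix z assume z: "\<Phi> a y y y z = 0"
    obtain n0 where fz: "f z = - 10 * nonsq * \<Phi> a a z z z * n0\<^sup>2" and D: "\<Phi> a z z z z = 0"
      by (rule isotropic_nonsq_square[OF a vanish vanish vanish y z])
    have "f z = 0"
    proof (cases "\<Phi> a a z z z = 0")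
      case True
      then show ?thesis unfolding fz by simp
    qed (use False D in blast)
    then show "\<Phi> a z z z z = 0 \<and> f z = 0 * \<Phi> a a z z z * 0\<^sup>2" using D by simp
  qed simp_all
qed

lemma totally_isotropic_cubic_vertex:
  assumes y0: "\<Phi> a a y0 y0 y0 \<noteq> 0" and z: "\<Phi> a a z z z = 0"
  shows "\<Phi> a a z x y = 0"
proof (rule line_vanish2)
  fix y
  have v: "\<Phi> a a y y z = 0" if "\<Phi> a a y y y \<noteq> 0" for y
    using isotropic_cubic_zero(1)[OF a vanish vanish vanish that z] .
  have "pencil3 a a y0 y * pencil2 a a z y0 y = 0"
  proof (rule poly_eq_0_if_vanishing)
    have "\<Phi> a a z x x = \<Phi> a a x x z" for x by (metis sym3 sym4)
    then show "poly (pencil3 a a y0 y * pencil2 a a z y0 y) t = 0" for t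
      using v[of "t \<cdot> y0 + y"] unfolding poly_mult poly_pencil3 poly_pencil2 by auto
    have "degree (pencil2 a a z y0 y) \<le> 2" by (simp add: pencil2_def degree_pCons_eq_if)
    then show "degree (pencil3 a a y0 y * pencil2 a a z y0 y) < CARD('a)"
      using degree_mult_le[of "pencil3 a a y0 y" "pencil2 a a z y0 y"] degree_pencil_le(1)[of a a y0 y] CARD_gt[where ?'a='a]
      by linarith
  qed
  moreover have "pencil3 a a y0 y \<noteq> 0" using y0 by (simp add: pencil3_def)
  ultimately have "pencil2 a a z y0 y = 0" by simp
  then show "\<Phi> a a z y y = 0" by (simp add: pencil2_def)
qed

lemma totally_isotropic_eq_0: "a = 0"
proof (rule ccontr)
  assume "a \<noteq> 0"
  obtain y0 k m where y0: "\<Phi> a a y0 y0 y0 \<noteq> 0" "\<Phi> a y0 y0 y0 y0 = 0"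
    and "\<forall>x y. m (x + y) = m x + m y" "\<forall>c x. m (c \<cdot> x) = c * m x"
    and "\<forall>z. \<Phi> a y0 y0 y0 z = 0 \<longrightarrow> \<Phi> a z z z z = 0 \<and> f z = k * \<Phi> a a z z z * (m z)\<^sup>2"
    by (rule totally_isotropic_square_form[OF \<open>a \<noteq> 0\<close>])
  then have m: "m (x + y) = m x + m y" "m (c \<cdot> x) = c * m x"
    and k: "\<Phi> a y0 y0 y0 z = 0 \<Longrightarrow> \<Phi> a z z z z = 0 \<and> f z = k * \<Phi> a a z z z * (m z)\<^sup>2" for x y c z
    by blast+
  have "m 0 = 0" using m(2)[of 0 0] by simp
  then obtain z where z: "z \<noteq> 0" "\<Phi> a y0 y0 y0 z = 0" "m z = 0" "\<Phi> a a z z z = 0"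
    using polynomial_map_linear[of m, OF m]
      exists_common_zero_outside_span[of "[(\<lambda>z. \<Phi> a y0 y0 y0 z, 1), (m, 1), (\<lambda>z. \<Phi> a a z z z, 3)]" "{}"] by auto
  have cubic: "\<Phi> a a (s \<cdot> z + y) (s \<cdot> z + y) (s \<cdot> z + y) = \<Phi> a a y y y" for s y
    unfolding expand3 by (simp add: totally_isotropic_cubic_vertex[OF y0(1) z(4)])
  have periodic: "f (s \<cdot> z + y) = f y" for s y
  proof -
    define \<beta> where "\<beta> = \<Phi> a y0 y0 y0 y / \<Phi> a a y0 y0 y0"
    define y' where "y' = (- \<beta>) \<cdot> a + y"
    have y: "y = \<beta> \<cdot> a + y'" by (simp add: y'_def)
    have "\<Phi> a y0 y0 y0 a = \<Phi> a a y0 y0 y0" by (metis sym)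
    then have y': "\<Phi> a y0 y0 y0 y' = 0" unfolding y'_def add5 scale5 \<beta>_def using y0 by simp
    then have sz: "\<Phi> a y0 y0 y0 (s \<cdot> z + y') = 0" using z by (simp add: multilinear)
    have "f (s \<cdot> z + y') = f y'" using k[OF y'] k[OF sz] m z(3) cubic by simp
    then have "f (\<beta> \<cdot> a + (s \<cdot> z + y')) = f (\<beta> \<cdot> a + y')"
      unfolding totally_isotropic_translate(1) using k[OF y'] k[OF sz] cubic by simp
    moreover have "\<beta> \<cdot> a + (s \<cdot> z + y') = s \<cdot> z + y" by (simp add: y'_def)
    ultimately show ?thesis unfolding y[symmetric] by simp
  qed
  have "\<Phi> z y y y y = 0" for y
  proof -
    have "pencil5 z y - [:f y:] = 0"
      using degree_pencil_le(3)[of z y] CARD_gt[where ?'a='a]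
      by (intro poly_eq_0_if_vanishing) (auto simp: poly_pencil5 periodic intro: le_less_trans[OF degree_diff_le])
    then show ?thesis by (simp add: pencil5_def)
  qed
  then show False using vertex_eq_0 z(1) by blast
qed

end

theorem exists_anisotropic:
  assumes "f a = 0" "a \<noteq> 0"
  obtains y where "\<Phi> a a a y y \<noteq> 0"
  using totally_isotropic_eq_0[OF assms(1) line_vanish2] assms(2) by blast

subsection \<open>Planes of zeros\<close>

definition zero_plane :: "'v \<Rightarrow> 'v \<Rightarrow> bool"
  where "zero_plane a b \<longleftrightarrow> (\<forall>x t. f (x \<cdot> a + t \<cdot> b) = 0)"

definition independent_pair :: "'v \<Rightarrow> 'v \<Rightarrow> bool"
  where "independent_pair a b \<longleftrightarrow> (\<forall>x t. x \<cdot> a + t \<cdot> b = 0 \<longrightarrow> x = 0 \<and> t = 0)"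

lemma zero_plane_change_basis:
  assumes "zero_plane a b"
  shows "zero_plane (x \<cdot> a + t \<cdot> b) (x' \<cdot> a + t' \<cdot> b)"
  unfolding zero_plane_def
proof (intro allI)
  fix r s
  have "r \<cdot> (x \<cdot> a + t \<cdot> b) + s \<cdot> (x' \<cdot> a + t' \<cdot> b) = (r * x + s * x') \<cdot> a + (r * t + s * t') \<cdot> b"
    by (simp add: scale_right_distrib scale_left_distrib algebra_simps)
  then show "f (r \<cdot> (x \<cdot> a + t \<cdot> b) + s \<cdot> (x' \<cdot> a + t' \<cdot> b)) = 0"
    using assms unfolding zero_plane_def by simp
qed

lemma zero_plane_shear:
  assumes "zero_plane a b"
  shows "zero_plane a (x \<cdot> a + b)" "zero_plane (x \<cdot> a + b) a"
  using zero_plane_change_basis[OF assms, of 1 0 x 1] zero_plane_change_basis[OF assms, of x 1 1 0] by simp_all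

lemma independent_pair_change_basis:
  assumes ab: "independent_pair a b" and det: "x * t' - x' * t \<noteq> 0"
  shows "independent_pair (x \<cdot> a + t \<cdot> b) (x' \<cdot> a + t' \<cdot> b)"
  unfolding independent_pair_def
proof (intro allI impI)
  fix r s assume "r \<cdot> (x \<cdot> a + t \<cdot> b) + s \<cdot> (x' \<cdot> a + t' \<cdot> b) = 0"
  then have "(r * x + s * x') \<cdot> a + (r * t + s * t') \<cdot> b = 0"
    by (simp add: scale_right_distrib scale_left_distrib algebra_simps)
  then have coeffs: "r * x + s * x' = 0" "r * t + s * t' = 0" using ab unfolding independent_pair_def by blast+
  have "r * (x * t' - x' * t) = t' * (r * x + s * x') - x' * (r * t + s * t')" by (simp add: algebra_simps)
  moreover have "s * (x * t' - x' * t) = x * (r * t + s * t') - t * (r * x + s * x')" by (simp add: algebra_simps)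
  ultimately show "r = 0 \<and> s = 0" unfolding coeffs using det by simp
qed

lemma independent_pair_neq_0:
  assumes "independent_pair a b"
  shows "a \<noteq> 0" "x \<cdot> a + b \<noteq> 0"
proof -
  have "1 \<cdot> a + 0 \<cdot> b = 0 \<longrightarrow> (1 :: 'a) = 0" using assms unfolding independent_pair_def by blast
  then show "a \<noteq> 0" by auto
  have "x \<cdot> a + 1 \<cdot> b = 0 \<longrightarrow> (1 :: 'a) = 0" using assms unfolding independent_pair_def by blast
  then show "x \<cdot> a + b \<noteq> 0" by auto
qed

lemma independent_pairI:
  assumes "a \<noteq> 0" "b \<notin> span {a}"
  shows "independent_pair a b"
  unfolding independent_pair_def
proof (intro allI impI)
  fix x t assume combination: "x \<cdot> a + t \<cdot> b = 0"
  have "t = 0"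
  proof (rule ccontr)
    assume t: "t \<noteq> 0"
    have "t \<cdot> b = - (x \<cdot> a)" using combination by (simp add: eq_neg_iff_add_eq_0 add.commute)
    then have "t \<cdot> b \<in> span {a}" by (simp add: span_neg span_scale span_base)
    then have "inverse t \<cdot> (t \<cdot> b) \<in> span {a}" by (rule span_scale)
    then show False using assms(2) t by simp
  qed
  then show "x = 0 \<and> t = 0" using combination assms(1) by simp
qed

lemma zero_planeD:
  assumes "zero_plane a b"
  shows "f a = 0" "f b = 0" "\<Phi> a a a a y = 0" "\<Phi> a a a b y = 0" "\<Phi> a a b b y = 0" "\<Phi> a b b b y = 0" "\<Phi> b b b b y = 0"
proof -
  have z: "f (t \<cdot> a + b) = 0" for t
    using assms[unfolded zero_plane_def, rule_format, of t 1] by simp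
  show "f a = 0" "f b = 0" by (rule line_vanish5[OF z])+
  have y: "\<Phi> y (t \<cdot> a + b) (t \<cdot> a + b) (t \<cdot> a + b) (t \<cdot> a + b) = 0" for t
    using singular[OF z[of t], of y] by (simp only: rotate[of _ _ _ _ y])
  show "\<Phi> a a a a y = 0" "\<Phi> a a a b y = 0" "\<Phi> a a b b y = 0" "\<Phi> a b b b y = 0" "\<Phi> b b b b y = 0"
    unfolding rotate[of _ _ _ _ y] by (rule line_vanish4[OF y])+
qed

lemma zero_plane_double:
  assumes ab: "zero_plane a b" and y: "\<Phi> a a a y y = 0"
  shows "\<Phi> a a b y y = 0"
proof (rule ccontr)
  assume nz: "\<Phi> a a b y y \<noteq> 0"
  note d = zero_planeD[OF ab]
  have s: "\<Phi> a a b b b = 0" "\<Phi> a a b b y = 0" "\<Phi> a a a y b = 0" "\<Phi> a a a b b = 0"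
    using d sym4[of a a a y b] by simp_all
  have cubic: "\<Phi> a a (l \<cdot> b + y) (l \<cdot> b + y) (l \<cdot> b + y) = 3 * l * \<Phi> a a b y y + \<Phi> a a y y y" for l
    unfolding expand3 s by simp
  define l :: 'a where "l = (if \<Phi> a a y y y = 0 then 1 else 0)"
  define v where "v = l \<cdot> b + y"
  have "\<Phi> a a v v v \<noteq> 0" unfolding v_def cubic using nz by (simp add: l_def)
  moreover have "\<Phi> a a a v v = 0" unfolding v_def expand2 using y s d by simp
  moreover have "\<Phi> a a a v b = 0" unfolding v_def add4 scale4 using s by simp
  ultimately have "\<Phi> a a v v b = 0" using isotropic_cubic_zero(1)[OF d(1) _ _ s(4) _ s(1)] by blast
  then have "\<Phi> a a b v v = 0" by (simp only: sym3[of a a v b] sym4[of a a v v b])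
  then show False unfolding v_def expand2 using nz s by simp
qed

lemma zero_plane_triple:
  assumes ab: "zero_plane a b" and y: "\<Phi> a a a y y = 0"
  shows "\<Phi> a b b y y = 0"
proof (rule ccontr)
  assume n: "\<Phi> a b b y y \<noteq> 0"
  define m where "m = \<Phi> b b b y y"
  define r where "r = - 3 * \<Phi> a b b y y"
  define u where "u = m \<cdot> a + r \<cdot> b"
  note s = zero_plane_double[OF ab y] y m_def[symmetric] sym1[of b a] sym2[of _ b a]
  have "\<Phi> u u u y y = 3 * m * r * r * \<Phi> a b b y y + r * r * r * m"
    unfolding u_def by (simp add: multilinear s algebra_simps)
  then have "\<Phi> u u u y y = 0" unfolding r_def by simp
  moreover have "zero_plane u a" using zero_plane_change_basis[OF ab, of m r 1 0] unfolding u_def by simp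
  ultimately have "\<Phi> u u a y y = 0" by (rule zero_plane_double[rotated])
  moreover have "\<Phi> u u a y y = r * r * \<Phi> a b b y y" unfolding u_def by (simp add: multilinear s algebra_simps)
  ultimately show False using n unfolding r_def by simp
qed

lemma expand_plane_cubic:
  "\<Phi> (x \<cdot> a + b) (x \<cdot> a + b) (x \<cdot> a + b) v w =
    x ^ 3 * \<Phi> a a a v w + 3 * x\<^sup>2 * \<Phi> a a b v w + 3 * x * \<Phi> a b b v w + \<Phi> b b b v w"
  unfolding rotate_twice[of _ _ _ v w] by (rule expand3)

lemma zero_plane_isotropic_relations:
  assumes ab: "zero_plane a b" and v: "\<Phi> (x \<cdot> a + b) (x \<cdot> a + b) (x \<cdot> a + b) v v = 0"
  shows "\<Phi> a a b v v = - x * \<Phi> a a a v v" "\<Phi> b b b v v = - (x ^ 3) * \<Phi> a a a v v"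
proof -
  let ?u = "x \<cdot> a + b"
  note s = sym1[of b a] sym2[of _ b a]
  have "zero_plane ?u a" by (rule zero_plane_shear[OF ab])
  then have "\<Phi> ?u ?u a v v = 0" "\<Phi> ?u a a v v = 0"
    using zero_plane_double zero_plane_triple v by blast+
  then have lin: "x * \<Phi> a a a v v + \<Phi> a a b v v = 0"
    and quad: "x\<^sup>2 * \<Phi> a a a v v + 2 * x * \<Phi> a a b v v + \<Phi> a b b v v = 0"
    by (simp_all add: multilinear s power2_eq_square algebra_simps)
  show A: "\<Phi> a a b v v = - x * \<Phi> a a a v v" using lin by (simp add: add_eq_0_iff)
  have "\<Phi> a b b v v = - (x\<^sup>2 * \<Phi> a a a v v + 2 * x * \<Phi> a a b v v)" using quad by (simp only: add_eq_0_iff)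
  then have B: "\<Phi> a b b v v = x\<^sup>2 * \<Phi> a a a v v" unfolding A by (simp add: power2_eq_square algebra_simps)
  have "\<Phi> b b b v v = - (x ^ 3 * \<Phi> a a a v v + 3 * x\<^sup>2 * \<Phi> a a b v v + 3 * x * \<Phi> a b b v v)"
    using v unfolding expand_plane_cubic by (simp only: add_eq_0_iff)
  then show "\<Phi> b b b v v = - (x ^ 3) * \<Phi> a a a v v"
    unfolding A B by (simp add: power2_eq_square power3_eq_cube algebra_simps)
qed

text \<open>If \<open>\<Phi> a a a y y = 0\<close> but \<open>\<Phi> b b b y y \<noteq> 0\<close>, then \<open>\<Phi> u u u v v\<close> for \<open>u = x \<cdot> a + b\<close> and
  \<open>v = w \<cdot> y + z\<close> is a quadratic polynomial in \<open>w\<close> whose discriminant, a polynomial in \<open>x\<close>, is a nonzero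
  square for at most four \<open>x\<close>.\<close>

context
  fixes a b y z
  assumes ab: "zero_plane a b" and y: "\<Phi> a a a y y = 0" "\<Phi> b b b y y \<noteq> 0" and z: "\<Phi> a a a z z \<noteq> 0"
begin

definition aaa_pencil :: "'a poly"
  where "aaa_pencil = [:\<Phi> a a a z z, 2 * \<Phi> a a a y z:]"

definition aab_pencil :: "'a poly"
  where "aab_pencil = [:\<Phi> a a b z z, 2 * \<Phi> a a b y z:]"

definition bbb_pencil :: "'a poly"
  where "bbb_pencil = [:\<Phi> b b b z z, 2 * \<Phi> b b b y z, \<Phi> b b b y y:]"

definition isotropic_resultant :: "'a poly"
  where "isotropic_resultant = aaa_pencil * aaa_pencil * bbb_pencil - aab_pencil * aab_pencil * aab_pencil"

lemma poly_plane_pencils: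
  "poly aaa_pencil w = \<Phi> a a a (w \<cdot> y + z) (w \<cdot> y + z)"
  "poly aab_pencil w = \<Phi> a a b (w \<cdot> y + z) (w \<cdot> y + z)"
  "poly bbb_pencil w = \<Phi> b b b (w \<cdot> y + z) (w \<cdot> y + z)"
  unfolding aaa_pencil_def aab_pencil_def bbb_pencil_def expand2 using y zero_plane_double[OF ab y(1)]
  by (simp_all add: power2_eq_square algebra_simps)

lemma isotropic_point:
  assumes "\<Phi> (x \<cdot> a + b) (x \<cdot> a + b) (x \<cdot> a + b) (w \<cdot> y + z) (w \<cdot> y + z) = 0"
  shows "x * poly aaa_pencil w = - poly aab_pencil w" "poly isotropic_resultant w = 0"
  using zero_plane_isotropic_relations[OF ab assms]
  by (simp_all add: isotropic_resultant_def poly_plane_pencils power3_eq_cube)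

lemma isotropic_resultant_neq_0: "isotropic_resultant \<noteq> 0"
proof
  assume R: "isotropic_resultant = 0"
  note defs = isotropic_resultant_def aaa_pencil_def aab_pencil_def bbb_pencil_def
  have "4 * \<Phi> a a a y z * \<Phi> a a a y z * \<Phi> b b b y y = 0"
    using arg_cong[OF R, of "\<lambda>P. coeff P 4"] by (simp add: defs eval_nat_numeral algebra_simps)
  then have yz: "\<Phi> a a a y z = 0" using y by simp
  have "8 * \<Phi> a a b y z ^ 3 = 0"
    using arg_cong[OF R, of "\<lambda>P. coeff P 3"] yz by (simp add: defs eval_nat_numeral algebra_simps)
  then have "\<Phi> a a b y z = 0" by simp
  then have "\<Phi> a a a z z * \<Phi> a a a z z * \<Phi> b b b y y = 0"
    using arg_cong[OF R, of "\<lambda>P. coeff P 2"] yz by (simp add: defs eval_nat_numeral algebra_simps)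
  then show False using y z by simp
qed

lemma degree_isotropic_resultant_le: "degree isotropic_resultant \<le> 4"
proof -
  have "degree aaa_pencil \<le> 1" "degree aab_pencil \<le> 1" "degree bbb_pencil \<le> 2"
    by (simp_all add: aaa_pencil_def aab_pencil_def bbb_pencil_def degree_pCons_eq_if)
  then have "degree (aaa_pencil * aaa_pencil * bbb_pencil) \<le> 4" "degree (aab_pencil * aab_pencil * aab_pencil) \<le> 4"
    using degree_mult_le[of "aaa_pencil * aaa_pencil" bbb_pencil] degree_mult_le[of aaa_pencil aaa_pencil]
      degree_mult_le[of "aab_pencil * aab_pencil" aab_pencil] degree_mult_le[of aab_pencil aab_pencil]
    by linarith+
  then show ?thesis unfolding isotropic_resultant_def by (rule degree_diff_le)
qed

definition isotropic_discr :: "'a poly"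
  where "isotropic_discr = (pencil3 y z a b)\<^sup>2 - smult (\<Phi> b b b y y) (pencil3 z z a b)"

lemma isotropic_points_if_discr_square:
  assumes s: "s \<noteq> 0" "poly isotropic_discr x = s\<^sup>2"
  obtains w1 w2 where "w1 \<noteq> w2"
    "\<And>w. w \<in> {w1, w2} \<Longrightarrow> \<Phi> (x \<cdot> a + b) (x \<cdot> a + b) (x \<cdot> a + b) (w \<cdot> y + z) (w \<cdot> y + z) = 0"
proof -
  let ?u = "x \<cdot> a + b"
  define k M C where "k = \<Phi> b b b y y" and "M = poly (pencil3 y z a b) x" and "C = poly (pencil3 z z a b) x"
  have M: "M = \<Phi> ?u ?u ?u y z" and C: "C = \<Phi> ?u ?u ?u z z"
    using rotate_twice[of ?u ?u ?u y z] rotate_twice[of ?u ?u ?u z z]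
    by (simp_all add: M_def C_def poly_pencil3)
  have "\<Phi> ?u ?u ?u y y = k"
    unfolding expand_plane_cubic using y zero_plane_double[OF ab y(1)] zero_plane_triple[OF ab y(1)] by (simp add: k_def)
  then have eval: "\<Phi> ?u ?u ?u (w \<cdot> y + z) (w \<cdot> y + z) = k * w\<^sup>2 + 2 * w * M + C" for w
    unfolding expand2[of ?u ?u ?u] M C by simp
  have root: "k * ((r - M) / k)\<^sup>2 + 2 * ((r - M) / k) * M + C = 0" if "r\<^sup>2 = s\<^sup>2" for r
  proof -
    have "k * (k * ((r - M) / k)\<^sup>2 + 2 * ((r - M) / k) * M + C) = r\<^sup>2 - (M\<^sup>2 - k * C)"
      using y(2) by (simp add: k_def field_simps power2_eq_square)
    also have "M\<^sup>2 - k * C = s\<^sup>2" using s(2) by (simp add: isotropic_discr_def k_def M_def C_def)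
    finally show ?thesis using that y(2) by (simp add: k_def)
  qed
  show ?thesis
  proof (rule that[of "(s - M) / k" "(- s - M) / k"])
    have "(s - M) / k - (- s - M) / k = 2 * s / k" by (simp add: diff_divide_distrib)
    moreover have "2 * s / k \<noteq> 0" using s(1) y(2) by (simp add: k_def)
    ultimately show "(s - M) / k \<noteq> (- s - M) / k" by auto
    fix w assume "w \<in> {(s - M) / k, (- s - M) / k}"
    then show "\<Phi> (x \<cdot> a + b) (x \<cdot> a + b) (x \<cdot> a + b) (w \<cdot> y + z) (w \<cdot> y + z) = 0"
      unfolding eval using root[of s] root[of "- s"] by auto
  qed
qed

lemma nonzero_square_points_isotropic_discr_subset:
  "nonzero_square_points isotropic_discr \<subseteq>
    (\<lambda>w. - poly aab_pencil w / poly aaa_pencil w) ` {w. poly isotropic_resultant w = 0}"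
proof
  fix x assume "x \<in> nonzero_square_points isotropic_discr"
  then obtain s where "s \<noteq> 0" "poly isotropic_discr x = s\<^sup>2" unfolding nonzero_square_points_def by blast
  then obtain w1 w2 where w12: "w1 \<noteq> w2"
    and iso: "\<And>w. w \<in> {w1, w2} \<Longrightarrow> \<Phi> (x \<cdot> a + b) (x \<cdot> a + b) (x \<cdot> a + b) (w \<cdot> y + z) (w \<cdot> y + z) = 0"
    by (rule isotropic_points_if_discr_square) blast
  have "poly aaa_pencil w1 \<noteq> 0 \<or> poly aaa_pencil w2 \<noteq> 0"
  proof (rule ccontr)
    assume "\<not> ?thesis"
    then have vanish: "poly aaa_pencil w1 = 0" "poly aaa_pencil w2 = 0" by simp_all
    have "2 * \<Phi> a a a y z * (w1 - w2) = poly aaa_pencil w1 - poly aaa_pencil w2"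
      by (simp add: aaa_pencil_def algebra_simps)
    then have "\<Phi> a a a y z = 0" unfolding vanish using w12 by simp
    then show False using vanish(1) z by (simp add: aaa_pencil_def)
  qed
  then obtain w where w: "w \<in> {w1, w2}" "poly aaa_pencil w \<noteq> 0" by blast
  then have "x = x * poly aaa_pencil w / poly aaa_pencil w" by simp
  also have "\<dots> = - poly aab_pencil w / poly aaa_pencil w" unfolding isotropic_point(1)[OF iso[OF w(1)]] ..
  finally have "x = - poly aab_pencil w / poly aaa_pencil w" .
  moreover have "poly isotropic_resultant w = 0" by (rule isotropic_point(2)[OF iso[OF w(1)]])
  ultimately show "x \<in> (\<lambda>w. - poly aab_pencil w / poly aaa_pencil w) ` {w. poly isotropic_resultant w = 0}"
    by blast
qed

lemma isotropic_discr_contradiction: False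
proof -
  have "card (nonzero_square_points isotropic_discr) \<le> card {w. poly isotropic_resultant w = 0}"
    by (rule surj_card_le[OF _ nonzero_square_points_isotropic_discr_subset]) simp
  also have "\<dots> \<le> 4"
    using card_poly_roots_bound[OF isotropic_resultant_neq_0] degree_isotropic_resultant_le by linarith
  finally have card: "card (nonzero_square_points isotropic_discr) \<le> 4" .
  have "degree ((pencil3 y z a b)\<^sup>2) \<le> 6"
    using degree_power_le[of "pencil3 y z a b" 2] degree_pencil_le(1)[of y z a b] by linarith
  moreover have "degree (smult (\<Phi> b b b y y) (pencil3 z z a b)) \<le> 6"
    using degree_pencil_le(1)[of z z a b] by simp
  ultimately have deg: "degree isotropic_discr \<le> 6" unfolding isotropic_discr_def by (rule degree_diff_le)
  then obtain h where h: "isotropic_discr = smult nonsq (h\<^sup>2)"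
    using eq_nonsq_times_square_if_at_most_4_nonzero_squares[OF _ card] by auto
  have "degree h \<le> 3" using deg unfolding h by (cases "h = 0") (simp_all add: degree_power_eq)
  then obtain h0 h1 h2 h3 where hh: "h = [:h0, h1, h2, h3:]"
    by (intro that[of "coeff h 0" "coeff h 1" "coeff h 2" "coeff h 3"] poly_eqI)
      (auto simp: coeff_pCons coeff_eq_0 eval_nat_numeral split: nat.splits)
  have coeffs: "coeff (pencil3 y z a b * pencil3 y z a b - smult (\<Phi> b b b y y) (pencil3 z z a b)) j =
      coeff (smult nonsq ([:h0, h1, h2, h3:] * [:h0, h1, h2, h3:])) j" for j
    using h unfolding isotropic_discr_def hh by (simp only: power2_eq_square)
  have "(\<Phi> y z a a a)\<^sup>2 = nonsq * h3\<^sup>2" using coeffs[of 6] by (simp add: pencil3_def eval_nat_numeral)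
  then have lead: "\<Phi> y z a a a = 0" "h3 = 0" by (simp_all only: square_eq_nonsq_times_square_iff)
  have "(3 * \<Phi> y z a a b)\<^sup>2 = nonsq * h2\<^sup>2" using coeffs[of 4] lead by (simp add: pencil3_def eval_nat_numeral)
  then have next_lead: "3 * \<Phi> y z a a b = 0" "h2 = 0" by (simp_all only: square_eq_nonsq_times_square_iff)
  have "\<Phi> b b b y y * \<Phi> z z a a a = 0" using coeffs[of 3] lead next_lead by (simp add: pencil3_def eval_nat_numeral)
  then show False using y z rotate_twice[of a a a z z] by simp
qed

end

lemma zero_plane_isotropic:
  assumes ab: "zero_plane a b" and a: "a \<noteq> 0" and y: "\<Phi> a a a y y = 0"
  shows "\<Phi> b b b y y = 0"
proof -
  obtain z where "\<Phi> a a a z z \<noteq> 0" using exists_anisotropic[OF zero_planeD(1)[OF ab] a] .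
  then show ?thesis using isotropic_discr_contradiction[OF ab y] by blast
qed

lemma zero_plane_anisotropic:
  assumes ab: "zero_plane a b" and z: "\<Phi> a a a z z \<noteq> 0" and u: "u = x \<cdot> a + t \<cdot> b" "u \<noteq> 0"
  shows "\<Phi> u u u z z \<noteq> 0"
proof -
  have "zero_plane u a" using zero_plane_change_basis[OF ab, of x t 1 0] u(1) by simp
  then show ?thesis using zero_plane_isotropic u(2) z by blast
qed

lemma diagonalizing_shear:
  assumes ab: "zero_plane a b" "independent_pair a b" and z: "\<Phi> a a a z z \<noteq> 0"
  obtains b' where "zero_plane a b'" "independent_pair a b'" "\<Phi> a a b' z z = 0"
    "\<Phi> a b' b' z z = \<Phi> a b b z z - (\<Phi> a a b z z)\<^sup>2 / \<Phi> a a a z z"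
proof -
  define c where "c = - (\<Phi> a a b z z / \<Phi> a a a z z)"
  let ?b = "c \<cdot> a + b"
  show ?thesis
  proof (rule that)
    show "zero_plane a ?b" by (rule zero_plane_shear[OF ab(1)])
    show "independent_pair a ?b" using independent_pair_change_basis[OF ab(2), of 1 1 c 0] by simp
    show "\<Phi> a a ?b z z = 0" using z by (simp add: multilinear c_def del: scale_minus_left)
    have "\<Phi> a ?b ?b z z = c * c * \<Phi> a a a z z + 2 * c * \<Phi> a a b z z + \<Phi> a b b z z"
      by (simp add: multilinear sym2[of a b a] algebra_simps)
    also have "\<dots> = \<Phi> a b b z z - (\<Phi> a a b z z)\<^sup>2 / \<Phi> a a a z z"
      unfolding c_def using z by (simp add: field_simps power2_eq_square)
    finally show "\<Phi> a ?b ?b z z = \<Phi> a b b z z - (\<Phi> a a b z z)\<^sup>2 / \<Phi> a a a z z" .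
  qed
qed

lemma adapted_basis:
  assumes ab: "zero_plane a b" "independent_pair a b" and z: "\<Phi> a a a z z \<noteq> 0" and y: "\<Phi> a a a y y = 0"
  obtains a' b' where "zero_plane a' b'" "independent_pair a' b'" "\<Phi> a' a' a' z z \<noteq> 0" "\<Phi> a' a' b' z z = 0"
    "\<Phi> a' b' b' z z \<noteq> 0" "\<Phi> a' a' a' y y = 0"
proof -
  obtain c where c: "zero_plane a c" "independent_pair a c" "\<Phi> a a c z z = 0"
    using diagonalizing_shear[OF ab z] .
  show ?thesis
  proof (cases "\<Phi> a c c z z = 0")
    case False
    then show ?thesis using that c z y by blast
  next
    case True
    have n: "\<Phi> c c c z z \<noteq> 0"
      using zero_plane_anisotropic[OF c(1) z, of c 0 1] independent_pair_neq_0(2)[OF c(2), of 0] by simp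
    define d where "d = 1 \<cdot> a + 1 \<cdot> c"
    have d: "zero_plane d c" "independent_pair d c" "zero_plane a d"
      using zero_plane_change_basis[OF c(1), of 1 1 0 1] independent_pair_change_basis[OF c(2), of 1 1 0 1]
        zero_plane_shear(1)[OF c(1), of 1] unfolding d_def by simp_all
    have v: "\<Phi> d d d z z = \<Phi> a a a z z + \<Phi> c c c z z" "\<Phi> d d c z z = \<Phi> c c c z z" "\<Phi> d c c z z = \<Phi> c c c z z"
      unfolding d_def by (simp_all add: multilinear sym1[of c a] sym2[of _ c a] c(3) True)
    have dz: "\<Phi> d d d z z \<noteq> 0"
      using zero_plane_anisotropic[OF c(1) z d_def] independent_pair_neq_0(1)[OF d(2)] by blast
    obtain b' where b': "zero_plane d b'" "independent_pair d b'" "\<Phi> d d b' z z = 0"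
      "\<Phi> d b' b' z z = \<Phi> d c c z z - (\<Phi> d d c z z)\<^sup>2 / \<Phi> d d d z z"
      using diagonalizing_shear[OF d(1,2) dz] .
    have "\<Phi> d b' b' z z * \<Phi> d d d z z = \<Phi> c c c z z * \<Phi> a a a z z"
      using dz unfolding b'(4) v by (simp add: field_simps power2_eq_square)
    then have "\<Phi> d b' b' z z \<noteq> 0" using n z by auto
    moreover have "\<Phi> d d d y y = 0"
      using zero_plane_isotropic[OF d(3) independent_pair_neq_0(1)[OF ab(2)] y] .
    ultimately show ?thesis using that b' dz by blast
  qed
qed

lemma plane_translate:
  assumes ab: "zero_plane a b" and v: "\<Phi> a a b v v = 0"
  shows "f (x \<cdot> a + (t \<cdot> b + v)) =
      10 * (x ^ 3 * \<Phi> a a a v v + 3 * x * t\<^sup>2 * \<Phi> a b b v v + t ^ 3 * \<Phi> b b b v v)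
      + 10 * (x\<^sup>2 * \<Phi> a a v v v + 2 * x * t * \<Phi> a b v v v + t\<^sup>2 * \<Phi> b b v v v)
      + 5 * (x * \<Phi> a v v v v + t * \<Phi> b v v v v) + f v"
    and "w = x \<cdot> a + (t \<cdot> b + v) \<Longrightarrow> \<Phi> w w w w a =
      6 * (x\<^sup>2 * \<Phi> a a a v v + t\<^sup>2 * \<Phi> a b b v v) + 4 * (x * \<Phi> a a v v v + t * \<Phi> a b v v v) + \<Phi> a v v v v"
    and "w = x \<cdot> a + (t \<cdot> b + v) \<Longrightarrow> \<Phi> w w w w b =
      6 * (2 * x * t * \<Phi> a b b v v + t\<^sup>2 * \<Phi> b b b v v) + 4 * (x * \<Phi> a b v v v + t * \<Phi> b b v v v) + \<Phi> b v v v v"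
proof -
  note d = zero_planeD[OF ab]
  let ?u = "t \<cdot> b + v"
  have aaa: "\<Phi> a a a ?u ?u = \<Phi> a a a v v" unfolding expand2 using d v by simp
  have aa: "\<Phi> a a ?u ?u ?u = 3 * t * \<Phi> a a b v v + \<Phi> a a v v v" unfolding expand3 using d by simp
  have a: "\<Phi> a ?u ?u ?u ?u = 6 * t\<^sup>2 * \<Phi> a b b v v + 4 * t * \<Phi> a b v v v + \<Phi> a v v v v"
    unfolding expand4 using d by simp
  have b: "f ?u = 10 * t ^ 3 * \<Phi> b b b v v + 10 * t\<^sup>2 * \<Phi> b b v v v + 5 * t * \<Phi> b v v v v + f v"
    by (rule expand_singular_zero(1)[OF d(2)])
  show "f (x \<cdot> a + ?u) =
      10 * (x ^ 3 * \<Phi> a a a v v + 3 * x * t\<^sup>2 * \<Phi> a b b v v + t ^ 3 * \<Phi> b b b v v)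
      + 10 * (x\<^sup>2 * \<Phi> a a v v v + 2 * x * t * \<Phi> a b v v v + t\<^sup>2 * \<Phi> b b v v v)
      + 5 * (x * \<Phi> a v v v v + t * \<Phi> b v v v v) + f v"
    unfolding expand_singular_zero(1)[OF d(1)] aaa aa a b v by (simp add: algebra_simps)
  assume w: "w = x \<cdot> a + ?u"
  show "\<Phi> w w w w a =
      6 * (x\<^sup>2 * \<Phi> a a a v v + t\<^sup>2 * \<Phi> a b b v v) + 4 * (x * \<Phi> a a v v v + t * \<Phi> a b v v v) + \<Phi> a v v v v"
    unfolding w expand_singular_zero(2)[OF d(1)] aaa aa a v by (simp add: algebra_simps)
  have w: "w = t \<cdot> b + (x \<cdot> a + v)" unfolding w by (simp add: add_ac)
  note sort = sym1[of b a] sym2[of _ b a] sym3[of _ _ b a] sym4[of _ _ _ b a]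
  have "\<Phi> b b b (x \<cdot> a + v) (x \<cdot> a + v) = \<Phi> b b b v v" unfolding expand2 by (simp add: sort d)
  moreover have "\<Phi> b b (x \<cdot> a + v) (x \<cdot> a + v) (x \<cdot> a + v) = 3 * x * \<Phi> a b b v v + \<Phi> b b v v v"
    unfolding expand3 by (simp add: sort d)
  moreover have "\<Phi> b (x \<cdot> a + v) (x \<cdot> a + v) (x \<cdot> a + v) (x \<cdot> a + v) = 4 * x * \<Phi> a b v v v + \<Phi> b v v v v"
    unfolding expand4 by (simp add: sort d v)
  ultimately show "\<Phi> w w w w b =
      6 * (2 * x * t * \<Phi> a b b v v + t\<^sup>2 * \<Phi> b b b v v) + 4 * (x * \<Phi> a b v v v + t * \<Phi> b b v v v) + \<Phi> b v v v v"
    unfolding w expand_singular_zero(2)[OF d(2)] by (simp add: algebra_simps)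
qed

lemma cubic_norm_plane:
  assumes ab: "zero_plane a b" and q: "q \<noteq> 0" "\<And>x. x ^ 3 + q * x + e \<noteq> 0"
    and k: "\<Phi> a a a v v = k" "k \<noteq> 0"
    and v: "\<Phi> a a b v v = 0" "3 * \<Phi> a b b v v = q * k" "\<Phi> b b b v v = e * k"
  shows "10 * cubic_norm q e (\<Phi> a a v v v) (2 * \<Phi> a b v v v) (\<Phi> b b v v v) =
    f v * k\<^sup>2 * (4 * q ^ 3 + 27 * e\<^sup>2)"
proof -
  define k0 k1 k2 where "k0 = \<Phi> a a v v v / k" and "k1 = 2 * \<Phi> a b v v v / k" and "k2 = \<Phi> b b v v v / k"
  define l0 l1 m where "l0 = \<Phi> a v v v v / (2 * k)" and "l1 = \<Phi> b v v v v / (2 * k)" and "m = f v / (10 * k)"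
  have eqs: "\<Phi> a a v v v = k * k0" "2 * \<Phi> a b v v v = k * k1" "\<Phi> b b v v v = k * k2"
    "\<Phi> a v v v v = 2 * k * l0" "\<Phi> b v v v v = 2 * k * l1" "f v = 10 * k * m"
    using k(2) by (simp_all add: k0_def k1_def k2_def l0_def l1_def m_def)
  interpret singular_plane_cubic q e k0 k1 k2 l0 l1 m
  proof
    fix x t
    define w where "w = x \<cdot> a + (t \<cdot> b + v)"
    assume on_curve: "plane_cubic.value_at q e k0 k1 k2 l0 l1 m x t = 0"
    have "f w = 10 * (x ^ 3 * k + x * t\<^sup>2 * (3 * \<Phi> a b b v v) + t ^ 3 * (e * k))
        + 10 * (x\<^sup>2 * (k * k0) + x * t * (2 * \<Phi> a b v v v) + t\<^sup>2 * (k * k2))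
        + 5 * (x * (2 * k * l0) + t * (2 * k * l1)) + 10 * k * m"
      unfolding w_def plane_translate(1)[OF ab v(1)] eqs(1,3-6) k(1) v(3) by (simp add: algebra_simps)
    also have "\<dots> = 10 * k * plane_cubic.value_at q e k0 k1 k2 l0 l1 m x t"
      unfolding v(2) eqs(2) plane_cubic.value_at_def plane_cubic.leading_form_def by (simp add: algebra_simps)
    finally have "f w = 0" using on_curve by simp
    then have w: "\<Phi> w w w w u = 0" for u by (rule singular)
    have "\<Phi> w w w w a = 2 * (3 * x\<^sup>2 * k + t\<^sup>2 * (3 * \<Phi> a b b v v))
        + 2 * (2 * x * (k * k0) + t * (2 * \<Phi> a b v v v)) + 2 * k * l0"
      unfolding plane_translate(2)[OF ab v(1) w_def] eqs(1,4) k(1) by (simp add: algebra_simps)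
    also have "\<dots> = 2 * k * plane_cubic.dx_at q k0 k1 l0 x t"
      unfolding v(2) eqs(2) plane_cubic.dx_at_def by (simp add: algebra_simps)
    finally have dx: "plane_cubic.dx_at q k0 k1 l0 x t = 0" using w k(2) by simp
    have "\<Phi> w w w w b = 2 * (2 * x * t * (3 * \<Phi> a b b v v) + 3 * t\<^sup>2 * (e * k))
        + 2 * (x * (2 * \<Phi> a b v v v) + 2 * t * (k * k2)) + 2 * k * l1"
      unfolding plane_translate(3)[OF ab v(1) w_def] eqs(3,5) v(3) by (simp add: algebra_simps)
    also have "\<dots> = 2 * k * plane_cubic.dt_at q e k1 k2 l1 x t"
      unfolding v(2) eqs(2) plane_cubic.dt_at_def by (simp add: algebra_simps)
    finally show "plane_cubic.dx_at q k0 k1 l0 x t = 0 \<and> plane_cubic.dt_at q e k1 k2 l1 x t = 0"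
      using dx w k(2) by simp
  qed (use q in auto)
  have "10 * (k ^ 3 * cubic_norm q e k0 k1 k2) = 10 * (k ^ 3 * (m * (4 * q ^ 3 + 27 * e\<^sup>2)))"
    unfolding cubic_norm_eq ..
  then show ?thesis unfolding eqs cubic_norm_scale by (simp add: power2_eq_square power3_eq_cube mult_ac)
qed

text \<open>The plane \<open>\<langle>a, b\<rangle>\<close> in a basis adapted to the binary cubic form \<open>\<lambda>u. \<Phi> u u u z z\<close>, which by
  anisotropy is a multiple of \<open>x\<^sup>3 + q x t\<^sup>2 + e t\<^sup>3\<close>.\<close>

context
  fixes a b y z q e
  assumes ab: "zero_plane a b" "independent_pair a b"
    and z: "\<Phi> a a a z z \<noteq> 0" "\<Phi> a a b z z = 0" "\<Phi> a b b z z \<noteq> 0" and y: "\<Phi> a a a y y = 0"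
    and q_def: "q = 3 * \<Phi> a b b z z / \<Phi> a a a z z" and e_def: "e = \<Phi> b b b z z / \<Phi> a a a z z"
begin

lemma q_e_eqs: "\<Phi> a a a z z * q = 3 * \<Phi> a b b z z" "\<Phi> a a a z z * e = \<Phi> b b b z z" "q \<noteq> 0"
  using z by (simp_all add: q_def e_def)

lemma plane_cubic_no_root: "x ^ 3 + q * x + e \<noteq> 0"
proof -
  have "\<Phi> (x \<cdot> a + b) (x \<cdot> a + b) (x \<cdot> a + b) z z \<noteq> 0"
    using zero_plane_anisotropic[OF ab(1) z(1), of "x \<cdot> a + b" x 1] independent_pair_neq_0(2)[OF ab(2)] by simp
  moreover have "\<Phi> (x \<cdot> a + b) (x \<cdot> a + b) (x \<cdot> a + b) z z = \<Phi> a a a z z * (x ^ 3 + q * x + e)"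
    unfolding expand_plane_cubic distrib_left q_e_eqs mult.assoc[symmetric] z(2) by (simp add: mult_ac)
  ultimately show ?thesis by auto
qed

lemma plane_isotropic_y:
  "\<Phi> a a b y y = 0" "\<Phi> a b b y y = 0" "\<Phi> b b b y y = 0"
  using zero_plane_double[OF ab(1) y] zero_plane_triple[OF ab(1) y]
    zero_plane_isotropic[OF ab(1) independent_pair_neq_0(1)[OF ab(2)] y] by blast+

lemma plane_proportional:
  assumes u: "u = x \<cdot> a + b"
  shows "\<Phi> a a a z z * \<Phi> u u u y z = \<Phi> a a a y z * \<Phi> u u u z z"
proof -
  have "u \<noteq> 0" "a \<noteq> 0" using independent_pair_neq_0[OF ab(2)] by (simp_all add: u)
  have plane: "zero_plane a u" "zero_plane u a" unfolding u by (rule zero_plane_shear[OF ab(1)])+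
  have "\<Phi> u u u y y = 0" using zero_plane_isotropic[OF plane(1) \<open>a \<noteq> 0\<close> y] .
  then have "2 * w * \<Phi> a a a y z + \<Phi> a a a z z = 0 \<longleftrightarrow> 2 * w * \<Phi> u u u y z + \<Phi> u u u z z = 0" for w
    using zero_plane_isotropic[OF plane(1) \<open>a \<noteq> 0\<close>, of "w \<cdot> y + z"]
      zero_plane_isotropic[OF plane(2) \<open>u \<noteq> 0\<close>, of "w \<cdot> y + z"] y by (auto simp: expand2)
  then show ?thesis using z(1) by (rule proportional_if_same_root)
qed

lemma plane_values_y_z:
  "\<Phi> a a b y z = 0" "\<Phi> a a a z z * \<Phi> a b b y z = \<Phi> a a a y z * \<Phi> a b b z z"
  "\<Phi> a a a z z * \<Phi> b b b y z = \<Phi> a a a y z * \<Phi> b b b z z"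
proof -
  have "smult (\<Phi> a a a z z) (pencil3 y z a b) - smult (\<Phi> a a a y z) (pencil3 z z a b) = 0"
  proof (rule poly_eq_0_if_vanishing)
    show "poly (smult (\<Phi> a a a z z) (pencil3 y z a b) - smult (\<Phi> a a a y z) (pencil3 z z a b)) x = 0" for x
      using plane_proportional[OF refl, of x] rotate_twice[of "x \<cdot> a + b" "x \<cdot> a + b" "x \<cdot> a + b"]
      by (simp add: poly_pencil3)
    have "degree (smult (\<Phi> a a a z z) (pencil3 y z a b) - smult (\<Phi> a a a y z) (pencil3 z z a b)) \<le> 3"
      using degree_pencil_le(1) by (intro degree_diff_le order_trans[OF degree_smult_le])
    then show "degree (smult (\<Phi> a a a z z) (pencil3 y z a b) - smult (\<Phi> a a a y z) (pencil3 z z a b)) < CARD('a)"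
      using CARD_gt[where ?'a='a] by simp
  qed
  then have coeffs: "\<Phi> a a a z z * coeff (pencil3 y z a b) k = \<Phi> a a a y z * coeff (pencil3 z z a b) k" for k
    by (metis coeff_smult right_minus_eq)
  note rotate = rotate_twice[of a a b] rotate_twice[of a b b] rotate_twice[of b b b]
  show "\<Phi> a a b y z = 0" "\<Phi> a a a z z * \<Phi> a b b y z = \<Phi> a a a y z * \<Phi> a b b z z"
    "\<Phi> a a a z z * \<Phi> b b b y z = \<Phi> a a a y z * \<Phi> b b b z z"
    using coeffs[of 2] coeffs[of 1] coeffs[of 0] z by (simp_all add: pencil3_def eval_nat_numeral flip: rotate)
qed

lemma plane_values_line:
  assumes v: "v = w \<cdot> y + z"
  shows "\<Phi> a a b v v = 0" "3 * \<Phi> a b b v v = q * \<Phi> a a a v v" "\<Phi> b b b v v = e * \<Phi> a a a v v"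
proof -
  have exp: "\<Phi> a a a v v = 2 * w * \<Phi> a a a y z + \<Phi> a a a z z" unfolding v expand2 y by simp
  show "\<Phi> a a b v v = 0" unfolding v expand2 plane_isotropic_y plane_values_y_z z by simp
  have "\<Phi> a a a z z * (3 * \<Phi> a b b v v) =
      3 * (2 * w * (\<Phi> a a a z z * \<Phi> a b b y z) + \<Phi> a a a z z * \<Phi> a b b z z)"
    unfolding v expand2 plane_isotropic_y by (simp add: algebra_simps)
  also have "\<dots> = (3 * \<Phi> a b b z z) * \<Phi> a a a v v" unfolding plane_values_y_z exp by (simp add: algebra_simps)
  also have "\<dots> = \<Phi> a a a z z * (q * \<Phi> a a a v v)" unfolding q_e_eqs(1)[symmetric] by (simp only: mult.assoc)
  finally show "3 * \<Phi> a b b v v = q * \<Phi> a a a v v" using z(1) by simp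
  have "\<Phi> a a a z z * \<Phi> b b b v v =
      2 * w * (\<Phi> a a a z z * \<Phi> b b b y z) + \<Phi> a a a z z * \<Phi> b b b z z"
    unfolding v expand2 plane_isotropic_y by (simp add: algebra_simps)
  also have "\<dots> = \<Phi> b b b z z * \<Phi> a a a v v" unfolding plane_values_y_z exp by (simp add: algebra_simps)
  also have "\<dots> = \<Phi> a a a z z * (e * \<Phi> a a a v v)" unfolding q_e_eqs(2)[symmetric] by (simp only: mult.assoc)
  finally show "\<Phi> b b b v v = e * \<Phi> a a a v v" using z(1) by simp
qed

lemma cubic_norm_line:
  fixes A B C k_poly
  defines "A \<equiv> pencil3 a a y z" and "B \<equiv> smult 2 (pencil3 a b y z)" and "C \<equiv> pencil3 b b y z"
    and "k_poly \<equiv> [:\<Phi> a a a z z, 2 * \<Phi> a a a y z:]"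
  shows "smult 10 (cubic_norm [:q:] [:e:] A B C) = smult (4 * q ^ 3 + 27 * e\<^sup>2) (pencil5 y z * k_poly\<^sup>2)"
proof -
  define U V where "U = smult 10 (cubic_norm [:q:] [:e:] A B C)"
    and "V = smult (4 * q ^ 3 + 27 * e\<^sup>2) (pencil5 y z * k_poly\<^sup>2)"
  have k: "poly k_poly w = \<Phi> a a a (w \<cdot> y + z) (w \<cdot> y + z)" for w
    unfolding expand2 y k_poly_def by (simp add: algebra_simps)
  have norm: "poly (cubic_norm [:q:] [:e:] A B C) w = cubic_norm q e (poly A w) (poly B w) (poly C w)" for w
    by (simp add: cubic_norm_def)
  have deg: "degree A \<le> 3" "degree B \<le> 3" "degree C \<le> 3" "degree k_poly \<le> 1"
    using degree_pencil_le(1) by (simp_all add: A_def B_def C_def k_poly_def degree_pCons_eq_if)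
  have "(U - V) * k_poly = 0"
  proof (rule poly_eq_0_if_vanishing)
    fix w
    let ?v = "w \<cdot> y + z"
    have "poly U w = 10 * cubic_norm q e (\<Phi> a a ?v ?v ?v) (2 * \<Phi> a b ?v ?v ?v) (\<Phi> b b ?v ?v ?v)"
      unfolding U_def poly_smult norm by (simp add: A_def B_def C_def poly_pencil3)
    then have "poly U w = poly V w" if nz: "poly k_poly w \<noteq> 0"
      using cubic_norm_plane[OF ab(1) q_e_eqs(3) plane_cubic_no_root refl _ plane_values_line[OF refl], of w] nz
      by (simp add: V_def k poly_pencil5 mult_ac)
    then show "poly ((U - V) * k_poly) w = 0" by auto
  next
    have "degree U \<le> 9"
      using degree_cubic_norm_le[OF deg(1-3), of q e] unfolding U_def by (intro order_trans[OF degree_smult_le]) simp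
    moreover have "degree (pencil5 y z * k_poly\<^sup>2) \<le> 7"
      using degree_mult_le[of "pencil5 y z" "k_poly\<^sup>2"] degree_power_le[of k_poly 2] degree_pencil_le(3)[of y z] deg(4)
      by linarith
    then have "degree V \<le> 9" unfolding V_def by (intro order_trans[OF degree_smult_le]) simp
    ultimately have "degree (U - V) \<le> 9" by (rule degree_diff_le)
    then show "degree ((U - V) * k_poly) < CARD('a)"
      using degree_mult_le[of "U - V" k_poly] deg(4) CARD_gt[where ?'a='a] by linarith
  qed
  moreover have "k_poly \<noteq> 0" using z(1) by (simp add: k_poly_def)
  ultimately show ?thesis by (simp add: U_def V_def)
qed

lemma adapted_zero_plane_isotropic_zero: "f y = 0"
proof (rule ccontr)
  assume fy: "f y \<noteq> 0"
  define k_poly where "k_poly = [:\<Phi> a a a z z, 2 * \<Phi> a a a y z:]"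
  let ?N = "cubic_norm [:q:] [:e:] (pencil3 a a y z) (smult 2 (pencil3 a b y z)) (pencil3 b b y z)"
  have "k_poly \<noteq> 0" "pencil5 y z \<noteq> 0" using z(1) fy by (auto simp: k_poly_def pencil5_def)
  moreover have "4 * q ^ 3 + 27 * e\<^sup>2 \<noteq> 0" by (rule discriminant_neq_0_if_no_root[OF plane_cubic_no_root])
  ultimately have deg: "degree (smult 10 ?N) = 5 + 2 * degree k_poly"
    unfolding cubic_norm_line k_poly_def[symmetric] using degree_pencil5[OF fy]
    by (simp add: degree_mult_eq degree_power_eq)
  have "3 dvd degree ?N" by (rule three_dvd_degree_cubic_norm[OF plane_cubic_no_root])
  then have "3 dvd degree (smult 10 ?N)" by simp
  then have "3 dvd 5 + 2 * degree k_poly" unfolding deg .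
  moreover have "degree k_poly \<le> 1" by (simp add: k_poly_def)
  ultimately show False by presburger
qed

end

lemma zero_plane_isotropic_zero:
  assumes ab: "zero_plane a b" "independent_pair a b" and y: "\<Phi> a a a y y = 0"
  shows "f y = 0"
proof -
  obtain z where "\<Phi> a a a z z \<noteq> 0"
    using exists_anisotropic[OF zero_planeD(1)[OF ab(1)] independent_pair_neq_0(1)[OF ab(2)]] .
  then obtain a' b' where "zero_plane a' b'" "independent_pair a' b'" "\<Phi> a' a' a' z z \<noteq> 0"
    "\<Phi> a' a' b' z z = 0" "\<Phi> a' b' b' z z \<noteq> 0" "\<Phi> a' a' a' y y = 0"
    using adapted_basis[OF ab _ y] by metis
  then show ?thesis using adapted_zero_plane_isotropic_zero[OF _ _ _ _ _ _ refl refl] by blast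
qed

lemma zero_span_insert:
  assumes zero: "\<And>v. v \<in> span S \<Longrightarrow> f v = 0" and ab: "a \<in> span S" "b \<in> span S" "independent_pair a b"
    and y: "\<Phi> a a a y y = 0" and v: "v \<in> span (insert y S)"
  shows "f v = 0"
proof -
  obtain r where "v - r \<cdot> y \<in> span S" using v unfolding span_breakdown_eq by blast
  then obtain w where w: "w \<in> span S" "v = w + r \<cdot> y" by (metis diff_add_cancel)
  obtain c x t where c: "c \<in> span S" "independent_pair a c" "w = x \<cdot> a + t \<cdot> c"
  proof (cases "w \<in> span {a}")
    case True
    then obtain x where "w = x \<cdot> a" by (auto simp: span_singleton)
    then show ?thesis using that[of b x 0] ab by simp
  next
    case False
    then show ?thesis
      using that[of w 0 1] w(1) independent_pairI[OF independent_pair_neq_0(1)[OF ab(3)]] by simp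
  qed
  have plane: "zero_plane a c"
    unfolding zero_plane_def using zero ab(1) c(1) by (simp add: span_add span_scale)
  have "\<Phi> a a a a u = 0" "\<Phi> a a a u a = 0" "\<Phi> a a a c u = 0" "\<Phi> a a a u c = 0" for u
    using zero_planeD(3,4)[OF plane] sym4 by metis+
  then have "\<Phi> a a a v v = 0" unfolding w(2) c(3) using y by (simp add: multilinear)
  then show ?thesis by (rule zero_plane_isotropic_zero[OF plane c(2)])
qed

lemma independent_pair_iff: "independent_pair a b \<longleftrightarrow> a \<noteq> 0 \<and> b \<notin> span {a}"
proof
  assume ab: "independent_pair a b"
  have "b \<noteq> x \<cdot> a" for x using independent_pair_neq_0(2)[OF ab, of "- x"] by auto
  then show "a \<noteq> 0 \<and> b \<notin> span {a}" using independent_pair_neq_0(1)[OF ab] by (auto simp: span_singleton)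
qed (use independent_pairI in blast)

lemma zero_plane_span:
  assumes ab: "zero_plane a b" and v: "v \<in> span {a, b}"
  shows "f v = 0"
proof -
  obtain x t where "v - x \<cdot> a = t \<cdot> b" using v by (auto simp: span_breakdown_eq[of v a] span_singleton)
  then have "v = x \<cdot> a + t \<cdot> b" by (simp add: algebra_simps)
  then show ?thesis using ab by (simp add: zero_plane_def)
qed

lemma exists_zero_space:
  assumes ab: "zero_plane a b" "independent_pair a b"
  obtains B where "independent B" "card B = 4" "a \<in> B" "b \<in> B" "\<forall>v\<in>span B. f v = 0"
proof -
  have card: "card {x, y, z} \<le> 3" "card {x, y} \<le> 2" for x y z :: 'v
    by (simp_all add: card_insert_if)
  obtain y1 where y1: "y1 \<notin> span {b, a}" "\<Phi> a a a y1 y1 = 0"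
    using exists_common_zero_outside_span[of "[(\<lambda>y. \<Phi> a a a y y, 2)]" "{b, a}"] card(2)[of b a] by auto
  obtain y2 where y2: "y2 \<notin> span {y1, b, a}" "\<Phi> a a a y2 y2 = 0"
    using exists_common_zero_outside_span[of "[(\<lambda>y. \<Phi> a a a y y, 2)]" "{y1, b, a}"] card(1)[of y1 b a] by auto
  have "f v = 0" if "v \<in> span {b, a}" for v
    using zero_plane_span[OF ab(1), of v] that by (simp add: insert_commute)
  then have "f v = 0" if "v \<in> span {y1, b, a}" for v
    using zero_span_insert[OF _ _ _ ab(2) y1(2) that] by (simp add: span_base)
  then have "f v = 0" if "v \<in> span {y2, y1, b, a}" for v
    using zero_span_insert[OF _ _ _ ab(2) y2(2) that] by (simp add: span_base)
  moreover have ab': "a \<noteq> 0" "b \<notin> span {a}" using ab(2) unfolding independent_pair_iff by blast+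
  then have "independent {y2, y1, b, a}" using y1 y2 by (intro independent_insertI independent_empty) auto
  moreover have "b \<notin> {a}" "y1 \<notin> {b, a}" "y2 \<notin> {y1, b, a}"
    using contra_subsetD[OF span_superset] ab'(2) y1(1) y2(1) by blast+
  then have "card {y2, y1, b, a} = 4" by simp
  ultimately show ?thesis by (intro that[of "{y2, y1, b, a}"]) auto
qed

text \<open>Every \<open>y\<close> is isotropic for some zero \<open>u\<close> of the four-dimensional space of zeros, by Chevalley's
  theorem; hence \<open>f y = 0\<close>.\<close>

theorem no_zero_plane:
  assumes ab: "zero_plane a b" "independent_pair a b"
  shows False
proof -
  obtain B where B: "independent B" "card B = 4" "a \<in> B" "b \<in> B" "\<forall>v\<in>span B. f v = 0"
    by (rule exists_zero_space[OF ab])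
  have ab': "a \<noteq> 0" "b \<notin> span {a}" using ab(2) unfolding independent_pair_iff by blast+
  have f_eq_0: "f y = 0" for y
  proof -
    obtain u where u: "u \<in> span B" "u \<noteq> 0" "\<Phi> y y u u u = 0"
      using chevalley_warning[of "[(\<lambda>u. \<Phi> y y u u u, 3)]" B] B(1,2) by auto
    have "a \<notin> span {u} \<or> b \<notin> span {u}"
    proof (rule ccontr)
      assume "\<not> ?thesis"
      then obtain k l where "a = k \<cdot> u" "b = l \<cdot> u" by (auto simp: span_singleton)
      moreover from this have "b = (l / k) \<cdot> a" using ab'(1) by auto
      ultimately show False using ab'(2) by (metis insertI1 span_base span_scale)
    qed
    then obtain c where c: "c \<in> B" "c \<notin> span {u}" using B(3,4) by blast
    have "zero_plane u c"
      unfolding zero_plane_def using B(5) u(1) c(1) by (simp add: span_add span_scale span_base)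
    moreover have "independent_pair u c" using u(2) c(2) by (rule independent_pairI)
    moreover have "\<Phi> u u u y y = 0" using u(3) rotate_twice[of u u u y y] by simp
    ultimately show ?thesis by (rule zero_plane_isotropic_zero)
  qed
  have "\<Phi> a v v v v = 0" for v by (rule line_vanish5(5)) (rule f_eq_0)
  then show False using vertex_eq_0 ab'(1) by blast
qed

subsection \<open>Pairs of zeros\<close>

lemma independent_zeros_not_flat:
  assumes "f a = 0" "a \<noteq> 0" "y \<notin> span {a}" "\<Phi> a a a y y = 0" "\<Phi> a a y y y = 0" "\<Phi> a y y y y = 0" "f y = 0"
  shows False
proof (rule no_zero_plane)
  show "zero_plane a y" unfolding zero_plane_def expand_singular_zero(1)[OF assms(1)]
    using assms(4-7) by (simp add: multilinear)
qed (use assms(2,3) independent_pairI in blast)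

lemma zero_pair_dichotomy:
  assumes a: "f a = 0" and b: "f b = 0" and ab: "a \<noteq> 0" "b \<notin> span {a}"
  shows "\<Phi> a a a b b = 0 \<and> \<Phi> a a b b b \<noteq> 0 \<or> \<Phi> a a a b b \<noteq> 0 \<and> \<Phi> a a b b b = 0"
proof -
  have abbbb: "\<Phi> a b b b b = 0" using singular[OF b, of a] rotate[of b b b b a] by simp
  have "\<not> (\<Phi> a a a b b = 0 \<and> \<Phi> a a b b b = 0)" using independent_zeros_not_flat[OF a ab _ _ abbbb b] by blast
  moreover have "\<not> (\<Phi> a a a b b \<noteq> 0 \<and> \<Phi> a a b b b \<noteq> 0)"
  proof
    assume nz: "\<Phi> a a a b b \<noteq> 0 \<and> \<Phi> a a b b b \<noteq> 0"
    define x where "x = - \<Phi> a a b b b / \<Phi> a a a b b"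
    have x: "x * \<Phi> a a a b b = - \<Phi> a a b b b" "x \<noteq> 0" using nz by (simp_all add: x_def)
    define w where "w = x \<cdot> a + b"
    have "f w = 10 * x\<^sup>2 * (x * \<Phi> a a a b b + \<Phi> a a b b b)"
      unfolding w_def expand_singular_zero(1)[OF a] using abbbb b
      by (simp add: power2_eq_square power3_eq_cube algebra_simps)
    then have "f w = 0" unfolding x by simp
    then have "\<Phi> w w w w a = 0" by (rule singular)
    moreover have "\<Phi> w w w w a = x * (6 * (x * \<Phi> a a a b b) + 4 * \<Phi> a a b b b)"
      unfolding w_def expand_singular_zero(2)[OF a] abbbb by (simp add: power2_eq_square algebra_simps)
    ultimately have "x * (- 2 * \<Phi> a a b b b) = 0" unfolding x by simp
    then show False using x(2) nz by simp
  qed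
  ultimately show ?thesis by blast
qed

lemma zero_pair_isotropic:
  assumes a: "f a = 0" and b: "f b = 0" and e: "\<Phi> a a a b b = 0" "\<Phi> a a b b b \<noteq> 0"
    and z: "\<Phi> a a a z z = 0" "\<Phi> a a a b z = 0" "\<Phi> a b b b z = 0" "z \<notin> span {b}"
  shows "\<Phi> a a z z z \<noteq> 0" "\<Phi> a z z z z = 0" "f z \<noteq> 0" "\<exists>n. n \<noteq> 0 \<and> \<Phi> b b b z z = - nonsq * \<Phi> a a b b b * n\<^sup>2"
proof -
  have ab: "\<Phi> a b b b b = 0" using singular[OF b, of a] rotate[of b b b b a] by simp
  obtain n0 n1 where pencil: "pencil5 b z = smult (- 10 * nonsq) (pencil3 a a b z * [:n0, n1:]\<^sup>2)"
    and D: "\<Phi> a z z z z = 0" and fz: "f z = - 10 * nonsq * \<Phi> a a z z z * n0\<^sup>2"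
    and fb: "f b = - 10 * nonsq * \<Phi> a a b b b * n1\<^sup>2"
    and bz: "\<Phi> b b b z z = - nonsq * (\<Phi> a a b b b * n0\<^sup>2 + 6 * \<Phi> a a b b z * n1 * n0 + 3 * \<Phi> a a b z z * n1\<^sup>2)"
    by (rule isotropic_nonsq_square[OF a e(1) z(2,1) e(2) ab z(3)])
  have n1: "n1 = 0" using fb b e(2) by simp
  have a0: "a \<noteq> 0" and b0: "b \<noteq> 0" using e by auto
  show C: "\<Phi> a a z z z \<noteq> 0"
  proof
    assume C: "\<Phi> a a z z z = 0"
    have "z \<notin> span {a}"
    proof
      assume "z \<in> span {a}"
      then obtain c where c: "z = c \<cdot> a" by (auto simp: span_singleton)
      then have "c * \<Phi> a a b b b = 0" using z(3) rotate_twice[of b b b a a] rotate[of a b b b a] by (simp add: scale5)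
      then show False using z(4) e(2) c by (simp add: span_zero)
    qed
    then show False using independent_zeros_not_flat[OF a a0 _ z(1) C D] fz C by simp
  qed
  have n0: "n0 \<noteq> 0"
  proof
    assume "n0 = 0"
    then have "pencil5 b z = 0" using pencil n1 by simp
    then show False using independent_zeros_not_flat[OF b b0 z(4)] by (simp add: pencil5_def)
  qed
  show "\<Phi> a z z z z = 0" by (rule D)
  show "f z \<noteq> 0" unfolding fz using C n0 by simp
  show "\<exists>n. n \<noteq> 0 \<and> \<Phi> b b b z z = - nonsq * \<Phi> a a b b b * n\<^sup>2" using bz n0 n1 by auto
qed

subsection \<open>Conics of zeros\<close>

context
  fixes e1 e2 e3
  assumes e1: "f e1 = 0" and conic: "\<And>s. f (s\<^sup>2 \<cdot> e1 + (s \<cdot> e2 + e3)) = 0"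
    and indep: "\<And>s. e1 \<noteq> 0 \<and> s\<^sup>2 \<cdot> e1 + (s \<cdot> e2 + e3) \<notin> span {e1}"
begin

lemma conic_pencils:
  "monom 10 6 * pencil2 e1 e1 e1 e2 e3 + monom 10 4 * pencil3 e1 e1 e2 e3 + monom 5 2 * pencil4 e1 e2 e3 + pencil5 e2 e3 = 0"
    (is "?F = 0")
  "monom 6 4 * pencil2 e1 e1 e1 e2 e3 + monom 4 2 * pencil3 e1 e1 e2 e3 + pencil4 e1 e2 e3 = 0" (is "?G = 0")
proof -
  have "poly ?F s = f (s\<^sup>2 \<cdot> e1 + (s \<cdot> e2 + e3))" for s
    unfolding expand_singular_zero(1)[OF e1]
    by (simp add: poly_monom poly_pencil2 poly_pencil3 poly_pencil4 poly_pencil5 flip: power_mult)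
  then have "poly ?F s = 0" for s using conic by simp
  moreover have "poly ?G s = \<Phi> (s\<^sup>2 \<cdot> e1 + (s \<cdot> e2 + e3)) (s\<^sup>2 \<cdot> e1 + (s \<cdot> e2 + e3)) (s\<^sup>2 \<cdot> e1 + (s \<cdot> e2 + e3))
      (s\<^sup>2 \<cdot> e1 + (s \<cdot> e2 + e3)) e1" for s
    unfolding expand_singular_zero(2)[OF e1]
    by (simp add: poly_monom poly_pencil2 poly_pencil3 poly_pencil4 flip: power_mult)
  then have "poly ?G s = 0" for s using singular[OF conic] by simp
  moreover have "degree ?F \<le> 8" "degree ?G \<le> 8"
    by (simp_all add: pencil2_def pencil3_def pencil4_def pencil5_def monom_altdef eval_nat_numeral degree_pCons_eq_if)
  ultimately show "?F = 0" "?G = 0" using CARD_gt[where ?'a='a] by (auto intro!: poly_eq_0_if_vanishing)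
qed

lemma conic_coefficients:
  "\<Phi> e1 e1 e1 e2 e2 = 0" "\<Phi> e1 e1 e1 e2 e3 = 0" "\<Phi> e1 e1 e2 e2 e2 = 0"
  "3 * \<Phi> e1 e1 e2 e2 e3 = - (2 * \<Phi> e1 e1 e1 e3 e3)"
proof -
  note coeffs = conic_pencils[THEN arg_cong, of "\<lambda>P. coeff P k" for k]
  note defs = pencil2_def pencil3_def pencil4_def pencil5_def coeff_monom_mult eval_nat_numeral
  have F8: "10 * \<Phi> e1 e1 e1 e2 e2 = 0" using coeffs(1)[of 8] by (simp add: defs)
  have F7: "10 * (2 * \<Phi> e1 e1 e1 e2 e3 + \<Phi> e1 e1 e2 e2 e2) = 0"
    using coeffs(1)[of 7] by (simp add: defs algebra_simps)
  have F6: "5 * (2 * \<Phi> e1 e1 e1 e3 e3 + 6 * \<Phi> e1 e1 e2 e2 e3 + \<Phi> e1 e2 e2 e2 e2) = 0"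
    using coeffs(1)[of 6] by (simp add: defs algebra_simps)
  have G5: "4 * (3 * \<Phi> e1 e1 e1 e2 e3 + \<Phi> e1 e1 e2 e2 e2) = 0"
    using coeffs(2)[of 5] by (simp add: defs algebra_simps)
  have G4: "6 * \<Phi> e1 e1 e1 e3 e3 + 12 * \<Phi> e1 e1 e2 e2 e3 + \<Phi> e1 e2 e2 e2 e2 = 0"
    using coeffs(2)[of 4] by (simp add: defs algebra_simps)
  show "\<Phi> e1 e1 e1 e2 e2 = 0" using F8 by simp
  have lin: "2 * \<Phi> e1 e1 e1 e2 e3 + \<Phi> e1 e1 e2 e2 e2 = 0" "3 * \<Phi> e1 e1 e1 e2 e3 + \<Phi> e1 e1 e2 e2 e2 = 0"
    using F7 G5 unfolding mult_eq_0_iff by simp_all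
  have "\<Phi> e1 e1 e1 e2 e3 = (3 * \<Phi> e1 e1 e1 e2 e3 + \<Phi> e1 e1 e2 e2 e2) - (2 * \<Phi> e1 e1 e1 e2 e3 + \<Phi> e1 e1 e2 e2 e2)"
    by (simp add: algebra_simps)
  then show "\<Phi> e1 e1 e1 e2 e3 = 0" unfolding lin by simp
  then show "\<Phi> e1 e1 e2 e2 e2 = 0" using lin by simp
  have "2 * (3 * \<Phi> e1 e1 e2 e2 e3 + 2 * \<Phi> e1 e1 e1 e3 e3) =
      (6 * \<Phi> e1 e1 e1 e3 e3 + 12 * \<Phi> e1 e1 e2 e2 e3 + \<Phi> e1 e2 e2 e2 e2)
      - (2 * \<Phi> e1 e1 e1 e3 e3 + 6 * \<Phi> e1 e1 e2 e2 e3 + \<Phi> e1 e2 e2 e2 e2)"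
    by (simp add: algebra_simps)
  also have "\<dots> = 0" using F6 unfolding mult_eq_0_iff G4 by simp
  finally have "3 * \<Phi> e1 e1 e2 e2 e3 + 2 * \<Phi> e1 e1 e1 e3 e3 = 0" unfolding mult_eq_0_iff by simp
  then show "3 * \<Phi> e1 e1 e2 e2 e3 = - (2 * \<Phi> e1 e1 e1 e3 e3)" by (simp only: eq_neg_iff_add_eq_0)
qed

lemma conic_of_zeros:
  shows "\<Phi> e1 e1 e1 e3 e3 = 0" "\<Phi> e1 e1 e3 e3 e3 \<noteq> 0"
proof -
  have dichotomy: "\<Phi> e1 e1 e1 e3 e3 = 0 \<and> poly P s \<noteq> 0 \<or> \<Phi> e1 e1 e1 e3 e3 \<noteq> 0 \<and> poly P s = 0"
    if P: "P = [:\<Phi> e1 e1 e3 e3 e3, 3 * \<Phi> e1 e1 e2 e3 e3, \<Phi> e1 e1 e1 e3 e3:]" for s P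
  proof -
    define q where "q = s\<^sup>2 \<cdot> e1 + (s \<cdot> e2 + e3)"
    have "\<Phi> e1 e1 e1 q q = \<Phi> e1 e1 e1 e3 e3"
      unfolding q_def expand2[of e1 e1 e1 "s\<^sup>2"] expand2[of e1 e1 e1 s] using singular[OF e1] conic_coefficients by simp
    moreover have "\<Phi> e1 e1 q q q = 3 * s\<^sup>2 * \<Phi> e1 e1 e1 e3 e3
        + (s\<^sup>2 * (3 * \<Phi> e1 e1 e2 e2 e3) + 3 * s * \<Phi> e1 e1 e2 e3 e3 + \<Phi> e1 e1 e3 e3 e3)"
      unfolding q_def expand3[of e1 e1 "s\<^sup>2"] expand3[of e1 e1 s] expand2[of e1 e1 e1 s]
      using singular[OF e1] conic_coefficients(1-3) by (simp add: algebra_simps)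
    then have "\<Phi> e1 e1 q q q = poly P s"
      unfolding conic_coefficients(4) P by (simp add: power2_eq_square algebra_simps)
    ultimately show ?thesis using zero_pair_dichotomy[OF e1 conic[of s, folded q_def]] indep[of s, folded q_def] by simp
  qed
  define P where "P = [:\<Phi> e1 e1 e3 e3 e3, 3 * \<Phi> e1 e1 e2 e3 e3, \<Phi> e1 e1 e1 e3 e3:]"
  note dichotomy = dichotomy[OF P_def]
  show zero: "\<Phi> e1 e1 e1 e3 e3 = 0"
  proof (rule ccontr)
    assume nz: "\<Phi> e1 e1 e1 e3 e3 \<noteq> 0"
    then have "poly P s = 0" for s using dichotomy by blast
    then have "P = 0" using CARD_gt[where ?'a='a]
      by (intro poly_eq_0_if_vanishing) (auto simp: P_def degree_pCons_eq_if)
    then show False using nz by (simp add: P_def)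
  qed
  then show "\<Phi> e1 e1 e3 e3 e3 \<noteq> 0" using dichotomy[of 0] by (simp add: P_def)
qed

end

subsection \<open>The radical of the quadratic form of a zero\<close>

text \<open>On the hyperplane section \<open>residual_space\<close> the linear form \<open>n0 + n1 t\<close> of
  \<open>isotropic_nonsq_square\<close> has \<open>n0 = 0\<close>.\<close>

context
  fixes a y
  assumes a: "f a = 0" and y: "\<Phi> a a a y y = 0" "\<Phi> a a y y y \<noteq> 0" "\<Phi> a y y y y = 0" "f y \<noteq> 0"
begin

definition residual_form :: "'v \<Rightarrow> 'a"
  where "residual_form w = 5 * \<Phi> a a y y y * \<Phi> y y y y w - 3 * f y * \<Phi> a a y y w"

definition residual_space :: "'v set"
  where "residual_space = {w. \<Phi> a a a y w = 0 \<and> \<Phi> a y y y w = 0 \<and> residual_form w = 0}"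

lemma residual_form_linear [simp]:
  "residual_form (u + v) = residual_form u + residual_form v" "residual_form (c \<cdot> u) = c * residual_form u"
  "residual_form 0 = 0"
  by (simp_all add: residual_form_def multilinear algebra_simps)

lemma polynomial_map_residual_form [simp]: "polynomial_map (Suc 0) residual_form"
  by (rule polynomial_map_linear) simp_all

lemma subspace_residual_space: "subspace residual_space"
  by (rule subspaceI) (simp_all add: residual_space_def multilinear)

lemma residual_form_y: "residual_form y \<noteq> 0"
proof -
  have "residual_form y = 2 * \<Phi> a a y y y * f y" by (simp add: residual_form_def algebra_simps)
  then show ?thesis using y by simp
qed

lemma yyya: "\<Phi> a y y y a = \<Phi> a a y y y"
  by (rule rotate)

lemma residual_space_zero:
  assumes w: "w \<in> residual_space" "\<Phi> a a a w w = 0"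
  shows "f w = 0"
proof -
  have w': "\<Phi> a a a y w = 0" "\<Phi> a y y y w = 0" "residual_form w = 0" using w(1) by (simp_all add: residual_space_def)
  obtain n0 n1 where fw: "f w = - 10 * nonsq * \<Phi> a a w w w * n0\<^sup>2"
    and fy: "f y = - 10 * nonsq * \<Phi> a a y y y * n1\<^sup>2"
    and yw: "\<Phi> y y y y w = - 2 * nonsq * (2 * \<Phi> a a y y y * n1 * n0 + 3 * \<Phi> a a y y w * n1\<^sup>2)"
    by (rule isotropic_nonsq_square[OF a y(1) w'(1) w(2) y(2,3) w'(2)])
  have "residual_form w = - 20 * nonsq * (\<Phi> a a y y y)\<^sup>2 * n1 * n0"
    unfolding residual_form_def yw fy by (simp add: power2_eq_square algebra_simps)
  moreover have "n1 \<noteq> 0" using y(4) fy by auto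
  ultimately have "n0 = 0" using w'(3) y(2) by simp
  then show ?thesis using fw by simp
qed

lemma residual_conic:
  assumes e: "e1 \<in> residual_space" "e2 \<in> residual_space" "e3 \<in> residual_space"
    and orth: "\<Phi> a a a e1 e1 = 0" "\<Phi> a a a e3 e3 = 0" "\<Phi> a a a e1 e2 = 0" "\<Phi> a a a e2 e3 = 0"
    and hyp: "2 * \<Phi> a a a e1 e3 + \<Phi> a a a e2 e2 = 0" "\<Phi> a a a e1 e3 \<noteq> 0"
  shows "\<Phi> e1 e1 e1 e3 e3 = 0" "\<Phi> e1 e1 e3 e3 e3 \<noteq> 0"
proof -
  have e1: "f e1 = 0" using residual_space_zero e orth by blast
  have conic: "f (s\<^sup>2 \<cdot> e1 + (s \<cdot> e2 + e3)) = 0" for s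
  proof (rule residual_space_zero)
    show "s\<^sup>2 \<cdot> e1 + (s \<cdot> e2 + e3) \<in> residual_space"
      using e subspace_residual_space by (intro subspace_add subspace_scale)
    have "\<Phi> a a a (s\<^sup>2 \<cdot> e1 + (s \<cdot> e2 + e3)) (s\<^sup>2 \<cdot> e1 + (s \<cdot> e2 + e3)) =
        s\<^sup>2 * (2 * \<Phi> a a a e1 e3 + \<Phi> a a a e2 e2)"
      unfolding expand2[of a a a "s\<^sup>2"] expand2[of a a a s] using orth
      by (simp add: multilinear power2_eq_square algebra_simps)
    then show "\<Phi> a a a (s\<^sup>2 \<cdot> e1 + (s \<cdot> e2 + e3)) (s\<^sup>2 \<cdot> e1 + (s \<cdot> e2 + e3)) = 0" unfolding hyp by simp
  qed
  have indep: "e1 \<noteq> 0 \<and> s\<^sup>2 \<cdot> e1 + (s \<cdot> e2 + e3) \<notin> span {e1}" for s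
  proof
    show "e1 \<noteq> 0" using hyp(2) by auto
    have "\<Phi> a a a e1 (s\<^sup>2 \<cdot> e1 + (s \<cdot> e2 + e3)) \<noteq> 0" using orth hyp(2) by (simp add: multilinear)
    then show "s\<^sup>2 \<cdot> e1 + (s \<cdot> e2 + e3) \<notin> span {e1}" using orth(1) by (auto simp: span_singleton scale5)
  qed
  show "\<Phi> e1 e1 e1 e3 e3 = 0" "\<Phi> e1 e1 e3 e3 e3 \<noteq> 0"
    by (rule conic_of_zeros[OF e1 conic indep])+
qed

lemma no_residual_conic:
  assumes e: "e1 \<in> residual_space" "e2 \<in> residual_space" "e3 \<in> residual_space"
    and orth: "\<Phi> a a a e1 e1 = 0" "\<Phi> a a a e3 e3 = 0" "\<Phi> a a a e1 e2 = 0" "\<Phi> a a a e2 e3 = 0"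
    and hyp: "2 * \<Phi> a a a e1 e3 + \<Phi> a a a e2 e2 = 0" "\<Phi> a a a e1 e3 \<noteq> 0"
  shows False
proof -
  have "\<Phi> e3 e3 e3 e1 e1 = 0"
    by (rule residual_conic(1)[OF e(3,2,1) orth(2,1)]) (use orth hyp sym4[of a a a] in simp_all)
  then show False using residual_conic(2)[OF assms] rotate_twice[of e3 e3 e3 e1 e1] by simp
qed

lemma residual_zero_plane:
  assumes e: "e \<in> residual_space" "e' \<in> residual_space" "e \<noteq> 0" "e' \<notin> span {e}"
    and iso: "\<Phi> a a a e e = 0" "\<Phi> a a a e e' = 0" "\<Phi> a a a e' e' = 0"
  shows False
proof (rule no_zero_plane)
  show "zero_plane e e'" unfolding zero_plane_def
  proof (intro allI residual_space_zero)
    fix x t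
    show "x \<cdot> e + t \<cdot> e' \<in> residual_space"
      using e subspace_residual_space by (intro subspace_add subspace_scale)
    show "\<Phi> a a a (x \<cdot> e + t \<cdot> e') (x \<cdot> e + t \<cdot> e') = 0"
      using iso sym4[of a a a e' e] by (simp add: multilinear)
  qed
qed (use e independent_pairI in blast)

lemma residual_space_isotropic_orthogonal:
  assumes e: "e \<in> residual_space" "\<Phi> a a a e e = 0" "e \<noteq> 0" and w: "w \<in> residual_space"
  shows "\<Phi> a a a e w = 0"
proof (rule ccontr)
  assume g: "\<Phi> a a a e w \<noteq> 0"
  define e3 where "e3 = (- \<Phi> a a a w w / (2 * \<Phi> a a a e w)) \<cdot> e + w"
  have e3: "e3 \<in> residual_space" unfolding e3_def
    using e w subspace_residual_space by (intro subspace_add subspace_scale)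
  have ee3: "\<Phi> a a a e e3 = \<Phi> a a a e w" using e by (simp add: e3_def multilinear del: scale_minus_left)
  have e33: "\<Phi> a a a e3 e3 = 0" unfolding e3_def expand2 using e g by simp
  obtain e2 where e2: "e2 \<noteq> 0" "e2 \<in> residual_space" "\<Phi> a a a e e2 = 0" "\<Phi> a a a e3 e2 = 0"
    using exists_common_zero_outside_span[of "[(\<lambda>w. \<Phi> a a a y w, 1), (\<lambda>w. \<Phi> a y y y w, 1), (residual_form, 1),
      (\<lambda>w. \<Phi> a a a e w, 1), (\<lambda>w. \<Phi> a a a e3 w, 1)]" "{}"] by (auto simp: residual_space_def)
  have e23: "\<Phi> a a a e2 e3 = 0" using e2(4) sym4 by metis
  show False
  proof (cases "\<Phi> a a a e2 e2 = 0")
    case True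
    have "e2 \<notin> span {e}"
    proof
      assume "e2 \<in> span {e}"
      then obtain c where "e2 = c \<cdot> e" by (auto simp: span_singleton)
      then show False using e23 ee3 g e2(1) by (simp add: scale4)
    qed
    then show False using residual_zero_plane[OF e(1) e2(2) e(3)] e(2) e2(3) True by blast
  next
    case False
    define k where "k = - \<Phi> a a a e2 e2 / (2 * \<Phi> a a a e w)"
    have k: "2 * (k * \<Phi> a a a e w) + \<Phi> a a a e2 e2 = 0" "k \<noteq> 0" using g False by (simp_all add: k_def)
    show False
    proof (rule no_residual_conic[of "k \<cdot> e" e2 e3])
      show "k \<cdot> e \<in> residual_space" using e(1) subspace_residual_space by (intro subspace_scale)
    qed (use e2 e3 e33 e23 e(2) ee3 k g in \<open>simp_all add: scale4 scale5\<close>)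
  qed
qed

lemma residual_space_isotropic_exists:
  obtains e where "e \<in> residual_space" "e \<noteq> 0" "\<Phi> a a a e e = 0" "f e = 0" "e \<notin> span {a}"
proof -
  obtain e where e: "e \<noteq> 0" "e \<in> residual_space" "\<Phi> a a a e e = 0"
    using exists_common_zero_outside_span[of "[(\<lambda>w. \<Phi> a a a y w, 1), (\<lambda>w. \<Phi> a y y y w, 1), (residual_form, 1),
      (\<lambda>w. \<Phi> a a a w w, 2)]" "{}"] by (auto simp: residual_space_def)
  have "e \<notin> span {a}"
  proof
    assume "e \<in> span {a}"
    then obtain c where c: "e = c \<cdot> a" by (auto simp: span_singleton)
    then have "c * \<Phi> a a y y y = 0" using e(2) yyya by (simp add: residual_space_def scale5)
    then show False using e(1) c y(2) by simp
  qed
  then show ?thesis using that e residual_space_zero by blast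
qed

lemma functional_proportional:
  fixes l m :: "'v \<Rightarrow> 'a"
  assumes l: "\<And>u v. l (u + v) = l u + l v" "\<And>c v. l (c \<cdot> v) = c * l v"
    and m: "\<And>u v. m (u + v) = m u + m v" "\<And>c v. m (c \<cdot> v) = c * m v"
    and ker: "\<And>v. l v = 0 \<Longrightarrow> m v = 0"
  obtains c where "\<And>v. m v = c * l v"
proof (cases "\<exists>u. l u \<noteq> 0")
  case True
  then obtain u where u: "l u \<noteq> 0" by blast
  show ?thesis
  proof (rule that[of "m u / l u"])
    fix v
    have "l ((- l v / l u) \<cdot> u + v) = 0" unfolding l using u by simp
    then have "(- l v / l u) * m u + m v = 0" using ker unfolding m[symmetric] by blast
    then show "m v = m u / l u * l v" by (simp add: add_eq_0_iff)
  qed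
next
  case False
  then show ?thesis using that[of 0] ker by simp
qed

lemma radical_vector_exists:
  obtains r where "\<And>w. \<Phi> a a a r w = 0" "r \<notin> span {a}"
proof -
  obtain e where e: "e \<in> residual_space" "e \<noteq> 0" "\<Phi> a a a e e = 0" using residual_space_isotropic_exists by metis
  then have e': "\<Phi> a a a y e = 0" "\<Phi> a y y y e = 0" "residual_form e = 0" by (simp_all add: residual_space_def)
  have perp: "\<Phi> a a a e y = 0" "\<Phi> a a a e a = 0" "\<Phi> a a a y a = 0"
    using e'(1) singular[OF a] sym4 by metis+
  have ker: "\<Phi> a a a e v = 0" if v: "\<Phi> a a a y v = 0" for v
  proof -
    define v1 where "v1 = (- \<Phi> a y y y v / \<Phi> a a y y y) \<cdot> a + v"
    define v2 where "v2 = (- residual_form v1 / residual_form y) \<cdot> y + v1"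
    have v1: "\<Phi> a a a y v1 = 0" "\<Phi> a y y y v1 = 0" unfolding v1_def add5 scale5 using perp v y yyya by simp_all
    have "v2 \<in> residual_space"
      unfolding residual_space_def v2_def mem_Collect_eq add5 scale5 residual_form_linear
      using v1 y residual_form_y by simp
    then have "\<Phi> a a a e v2 = 0" using residual_space_isotropic_orthogonal e by blast
    then show ?thesis unfolding v2_def v1_def add5 scale5 using perp by simp
  qed
  obtain m where m: "\<And>v. \<Phi> a a a e v = m * \<Phi> a a a y v"
    using functional_proportional[of "\<Phi> a a a y" "\<Phi> a a a e", OF add5 scale5 add5 scale5 ker] by blast
  define r where "r = (- m) \<cdot> y + e"
  have rad: "\<Phi> a a a r w = 0" for w unfolding r_def add4 scale4 m by simp
  have "r \<notin> span {a}"
  proof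
    assume "r \<in> span {a}"
    then obtain c where c: "r = c \<cdot> a" by (auto simp: span_singleton)
    have "\<Phi> a y y y r = 0" unfolding r_def add5 scale5 using e' y by simp
    then have "r = 0" unfolding c scale5 yyya using y by simp
    then have "- m * residual_form y = 0"
      using residual_form_linear(1)[of "(- m) \<cdot> y" e] e'(3) unfolding r_def[symmetric]
      by (simp del: scale_minus_left)
    then show False using \<open>r = 0\<close> residual_form_y e(2) by (simp add: r_def)
  qed
  with rad show ?thesis by (rule that)
qed

lemma not_radical:
  assumes rad: "\<And>w. \<Phi> a a a y w = 0"
  shows False
proof -
  obtain e where e: "e \<in> residual_space" "e \<noteq> 0" "\<Phi> a a a e e = 0" using residual_space_isotropic_exists by metis
  obtain e' where e': "e' \<notin> span {e}" "\<Phi> a y y y e' = 0" "residual_form e' = 0" "\<Phi> a a a e' e' = 0"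
    using exists_common_zero_outside_span[of "[(\<lambda>w. \<Phi> a y y y w, 1), (residual_form, 1), (\<lambda>w. \<Phi> a a a w w, 2)]" "{e}"]
    by auto
  then have "e' \<in> residual_space" using rad by (simp add: residual_space_def)
  then show False
    using residual_zero_plane[OF e(1) _ e(2) e'(1) e(3) _ e'(4)] residual_space_isotropic_orthogonal e by blast
qed

end

subsection \<open>Zeros in the radical\<close>

context
  fixes a b
  assumes a: "f a = 0" and b: "f b = 0" and rad: "\<And>w. \<Phi> a a a b w = 0" and ab: "\<Phi> a a b b b \<noteq> 0"
begin

definition radical_form :: "'v \<Rightarrow> 'v \<Rightarrow> 'a"
  where "radical_form u v = \<Phi> b b b u v / (- nonsq * \<Phi> a a b b b)"

lemma radical_form_bilinear [simp]:
  "radical_form (u + u') v = radical_form u v + radical_form u' v" "radical_form v (u + u') = radical_form v u + radical_form v u'"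
  "radical_form (c \<cdot> u) v = c * radical_form u v" "radical_form v (c \<cdot> u) = c * radical_form v u"
  by (simp_all add: radical_form_def multilinear add_divide_distrib)

lemma radical_form_commute: "radical_form u v = radical_form v u"
  unfolding radical_form_def by (metis sym4)

lemma radical_form_square:
  assumes "z \<notin> span {b}" "\<Phi> a b b b z = 0" "\<Phi> a a a z z = 0"
  shows "\<exists>n. n \<noteq> 0 \<and> radical_form z z = n\<^sup>2"
proof -
  obtain n where "n \<noteq> 0" "\<Phi> b b b z z = - nonsq * \<Phi> a a b b b * n\<^sup>2"
    using zero_pair_isotropic(4)[OF a b rad ab assms(3) rad assms(2,1)] by blast
  then show ?thesis using ab by (auto simp: radical_form_def)
qed

lemma isotropic_not_orthogonal:
  assumes u: "u \<notin> span {b}" "\<Phi> a b b b u = 0" "\<Phi> a a a u u = 0"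
    and v: "v \<notin> span {u, b}" "\<Phi> a b b b v = 0" "\<Phi> a a a v v = 0"
  shows "\<Phi> a a a u v \<noteq> 0"
proof
  assume uv: "\<Phi> a a a u v = 0"
  define D where "D = [:radical_form v v, 2 * radical_form u v, radical_form u u:]"
  have "\<exists>n. n \<noteq> 0 \<and> poly D s = n\<^sup>2" for s
  proof -
    have "s \<cdot> u \<in> span {u, b}" by (intro span_scale span_base) simp
    then have "s \<cdot> u + v \<notin> span {b}"
      using v(1) span_add_eq[of "s \<cdot> u"] span_mono[of "{b}" "{u, b}"] by blast
    moreover have "\<Phi> a b b b (s \<cdot> u + v) = 0" using u v by (simp add: multilinear)
    moreover have "\<Phi> a a a (s \<cdot> u + v) (s \<cdot> u + v) = 0" unfolding expand2 using u v uv by simp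
    moreover have "poly D s = radical_form (s \<cdot> u + v) (s \<cdot> u + v)"
      using radical_form_commute[of v u] by (simp add: D_def algebra_simps)
    ultimately show ?thesis using radical_form_square by metis
  qed
  moreover have "degree D = 2" using radical_form_square[OF u] by (auto simp: D_def)
  ultimately show False using square_valued_quadratic_False by blast
qed

lemma hyperbolic_pair_exists:
  obtains e e' where "\<Phi> a b b b e = 0" "\<Phi> a a a e e = 0" "\<Phi> a b b b e' = 0" "\<Phi> a a a e' e' = 0" "\<Phi> a a a e e' = - 1 / 2"
proof -
  obtain u where u: "u \<notin> span {b}" "\<Phi> a b b b u = 0" "\<Phi> a a a u u = 0"
    using exists_common_zero_outside_span[of "[(\<lambda>w. \<Phi> a b b b w, 1), (\<lambda>w. \<Phi> a a a w w, 2)]" "{b}"] by auto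
  have "card {u, b} \<le> 2" by (simp add: card_insert_if)
  then obtain v where v: "v \<notin> span {u, b}" "\<Phi> a b b b v = 0" "\<Phi> a a a v v = 0"
    using exists_common_zero_outside_span[of "[(\<lambda>w. \<Phi> a b b b w, 1), (\<lambda>w. \<Phi> a a a w w, 2)]" "{u, b}"] by auto
  have uv: "\<Phi> a a a u v \<noteq> 0" by (rule isotropic_not_orthogonal[OF u v])
  show ?thesis
    by (rule that[of "(- 1 / (2 * \<Phi> a a a u v)) \<cdot> u" v])
      (use u v uv in \<open>simp_all add: scale4 scale5 del: scale_minus_left\<close>)
qed

context
  fixes e e'
  assumes e: "\<Phi> a b b b e = 0" "\<Phi> a a a e e = 0" and e': "\<Phi> a b b b e' = 0" "\<Phi> a a a e' e' = 0"
    and ee': "\<Phi> a a a e e' = - 1 / 2"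
begin

lemma hyperbolic_not_in_span: "\<Phi> a a a e z \<noteq> 0 \<Longrightarrow> z \<notin> span {b}" "\<Phi> a a a z e' \<noteq> 0 \<Longrightarrow> z \<notin> span {b}"
  using rad rad[THEN trans[OF sym4]] by (auto simp: span_singleton scale4 scale5)

lemma hyperbolic_complement_anisotropic:
  assumes g: "g \<notin> span {b}" "\<Phi> a b b b g = 0" "\<Phi> a a a e g = 0" "\<Phi> a a a e' g = 0"
  shows "\<Phi> a a a g g \<noteq> 0"
proof
  assume gg: "\<Phi> a a a g g = 0"
  have "g \<notin> span {e, b}"
  proof
    assume "g \<in> span {e, b}"
    then obtain c where c: "g - c \<cdot> e \<in> span {b}" by (auto simp: span_insert)
    have "\<Phi> a a a e' (g - c \<cdot> e) = 0" using c rad[THEN trans[OF sym4]] by (auto simp: span_singleton scale5)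
    then have "c * \<Phi> a a a e e' = 0"
      using g(4) add5[of a a a e' "g - c \<cdot> e" "c \<cdot> e"] sym4[of a a a e' e] by (simp add: scale5)
    then show False using c g(1) ee' by simp
  qed
  moreover have "e \<notin> span {b}" using hyperbolic_not_in_span(2)[of e] ee' by simp
  ultimately show False using isotropic_not_orthogonal e g gg by blast
qed

lemma hyperbolic_complement_orthogonal_pair:
  obtains g1 g2 where "\<Phi> a b b b g1 = 0" "\<Phi> a a a e g1 = 0" "\<Phi> a a a e' g1 = 0" "\<Phi> a a a g1 g1 \<noteq> 0"
    "\<Phi> a b b b g2 = 0" "\<Phi> a a a e g2 = 0" "\<Phi> a a a e' g2 = 0" "\<Phi> a a a g2 g2 \<noteq> 0" "\<Phi> a a a g1 g2 = 0"
proof -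
  obtain g1 where g1: "g1 \<notin> span {b}" "\<Phi> a b b b g1 = 0" "\<Phi> a a a e g1 = 0" "\<Phi> a a a e' g1 = 0"
    using exists_common_zero_outside_span[of "[(\<lambda>w. \<Phi> a b b b w, 1), (\<lambda>w. \<Phi> a a a e w, 1), (\<lambda>w. \<Phi> a a a e' w, 1)]" "{b}"]
    by auto
  obtain g2 where g2: "g2 \<notin> span {b}" "\<Phi> a b b b g2 = 0" "\<Phi> a a a e g2 = 0" "\<Phi> a a a e' g2 = 0" "\<Phi> a a a g1 g2 = 0"
    using exists_common_zero_outside_span[of "[(\<lambda>w. \<Phi> a b b b w, 1), (\<lambda>w. \<Phi> a a a e w, 1), (\<lambda>w. \<Phi> a a a e' w, 1),
      (\<lambda>w. \<Phi> a a a g1 w, 1)]" "{b}"] by auto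
  show ?thesis
    using that g1 g2 hyperbolic_complement_anisotropic[OF g1] hyperbolic_complement_anisotropic[OF g2(1-4)] by blast
qed

lemma parabola_no_zero:
  assumes g: "\<Phi> a b b b g = 0" "\<Phi> a a a e g = 0" "\<Phi> a a a g g \<noteq> 0"
    and w: "\<Phi> a b b b w = 0" "\<Phi> a a a w w = 0" "\<Phi> a a a e w = - 1 / 2" "\<Phi> a a a g w = 0"
    and \<epsilon>: "\<epsilon> \<noteq> 0" "radical_form e e = \<epsilon>\<^sup>2" and l: "radical_form e g = \<epsilon> * l"
    and c: "2 * (\<epsilon> * \<Phi> a a a g g) * c = radical_form g g + 2 * \<Phi> a a a g g * radical_form e w - l\<^sup>2"
  shows "\<epsilon> * \<Phi> a a a g g * s\<^sup>2 + l * s + c \<noteq> 0"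
proof (rule quartic_square_root_no_zero)
  define k where "k = \<Phi> a a a g g"
  show "\<epsilon> * \<Phi> a a a g g \<noteq> 0" using \<epsilon> g by simp
  fix s
  define z where "z = (k * s\<^sup>2) \<cdot> e + (s \<cdot> g + w)"
  have "\<Phi> a a a z z = 0"
    unfolding z_def expand2[of a a a "k * s\<^sup>2"] expand2[of a a a s]
    using e g w by (simp add: multilinear k_def algebra_simps)
  moreover have "\<Phi> a b b b z = 0" unfolding z_def using e g w by (simp add: multilinear)
  moreover have "z \<notin> span {b}"
    by (rule hyperbolic_not_in_span) (simp add: z_def multilinear e g w)
  ultimately have "\<exists>n. n \<noteq> 0 \<and> radical_form z z = n\<^sup>2" by (intro radical_form_square)
  moreover have "l\<^sup>2 + 2 * (\<epsilon> * k) * c = radical_form g g + 2 * k * radical_form e w"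
    using c unfolding k_def by simp
  then have "poly [:radical_form w w, 2 * radical_form g w, l\<^sup>2 + 2 * (\<epsilon> * k) * c, 2 * (\<epsilon> * k) * l, (\<epsilon> * k)\<^sup>2:] s
      = radical_form z z"
    using radical_form_commute[of g e] radical_form_commute[of w e] radical_form_commute[of w g] \<epsilon> l
    by (simp add: z_def power2_eq_square algebra_simps)
  ultimately show "\<exists>n. n \<noteq> 0 \<and> poly [:radical_form w w, 2 * radical_form g w, l\<^sup>2 + 2 * (\<epsilon> * \<Phi> a a a g g) * c,
      2 * (\<epsilon> * \<Phi> a a a g g) * l, (\<epsilon> * \<Phi> a a a g g)\<^sup>2:] s = n\<^sup>2"
    unfolding k_def by simp
qed

lemma hyperbolic_pair_False: False
proof -
  obtain g1 g2 where g1: "\<Phi> a b b b g1 = 0" "\<Phi> a a a e g1 = 0" "\<Phi> a a a e' g1 = 0" "\<Phi> a a a g1 g1 \<noteq> 0"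
    and g2: "\<Phi> a b b b g2 = 0" "\<Phi> a a a e g2 = 0" "\<Phi> a a a e' g2 = 0" "\<Phi> a a a g2 g2 \<noteq> 0"
    and g12: "\<Phi> a a a g1 g2 = 0" by (rule hyperbolic_complement_orthogonal_pair)
  define k1 k2 where "k1 = \<Phi> a a a g1 g1" and "k2 = \<Phi> a a a g2 g2"
  have "e \<notin> span {b}" using hyperbolic_not_in_span(2)[of e] ee' by simp
  then obtain \<epsilon> where \<epsilon>: "\<epsilon> \<noteq> 0" "radical_form e e = \<epsilon>\<^sup>2" using radical_form_square e by blast
  define l1 l2 where "l1 = radical_form e g1 / \<epsilon>" and "l2 = radical_form e g2 / \<epsilon>"
  have l: "radical_form e g1 = \<epsilon> * l1" "radical_form e g2 = \<epsilon> * l2" using \<epsilon> by (simp_all add: l1_def l2_def)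
  define m where "m = (radical_form g1 g1 + 2 * k1 * radical_form e e' - l1\<^sup>2) / (2 * (\<epsilon> * k1))"
  have m: "2 * (\<epsilon> * k1) * m = radical_form g1 g1 + 2 * k1 * radical_form e e' - l1\<^sup>2"
    using \<epsilon> g1(4) by (simp add: m_def k1_def)
  have "\<epsilon> * k1 * s\<^sup>2 + l1 * s + (\<epsilon> * k2 * t\<^sup>2 + l2 * t + m) \<noteq> 0" for s t
  proof -
    define w where "w = (k2 * t\<^sup>2) \<cdot> e + (t \<cdot> g2 + e')"
    have w: "\<Phi> a b b b w = 0" "\<Phi> a a a e w = - 1 / 2" "\<Phi> a a a g1 w = 0"
      unfolding w_def add5 scale5 using e e' ee' g1 g2 g12 sym4[of a a a g1 e] sym4[of a a a g1 e'] by simp_all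
    have ww: "\<Phi> a a a w w = 0"
      unfolding w_def expand2[of a a a "k2 * t\<^sup>2"] expand2[of a a a t]
      using e e' ee' g2 sym4[of a a a g2 e'] by (simp add: multilinear k2_def algebra_simps)
    have "radical_form e w = \<epsilon>\<^sup>2 * k2 * t\<^sup>2 + \<epsilon> * l2 * t + radical_form e e'" by (simp add: w_def \<epsilon> l)
    then have "2 * (\<epsilon> * k1) * (\<epsilon> * k2 * t\<^sup>2 + l2 * t + m) = radical_form g1 g1 + 2 * k1 * radical_form e w - l1\<^sup>2"
      using m by (simp add: power2_eq_square algebra_simps)
    then show ?thesis
      using parabola_no_zero[OF g1(1,2,4) w(1) ww w(2,3) \<epsilon> l(1)] unfolding k1_def by blast
  qed
  moreover obtain s t where "\<epsilon> * k1 * s\<^sup>2 + l1 * s + \<epsilon> * k2 * t\<^sup>2 + l2 * t + m = 0"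
    using affine_conic_solvable[of "\<epsilon> * k1" "\<epsilon> * k2" l1 l2 m] \<epsilon>(1) g1(4) g2(4) unfolding k1_def k2_def by auto
  ultimately show False by (simp add: add.assoc)
qed

end

end

theorem radical_zero_cubic_eq_0:
  assumes "f a = 0" "f b = 0" "\<And>w. \<Phi> a a a b w = 0"
  shows "\<Phi> a a b b b = 0"
proof (rule ccontr)
  assume "\<Phi> a a b b b \<noteq> 0"
  note radical = assms this
  show False by (rule hyperbolic_pair_exists[OF radical], rule hyperbolic_pair_False[OF radical])
qed

subsection \<open>The singular quintic does not exist\<close>

lemma translate_quartic_eq_0:
  assumes a: "f a = 0" and y: "\<Phi> a a a y y = 0" "\<Phi> a a y y y \<noteq> 0"
  obtains s y' where "y' = s \<cdot> a + y" "\<Phi> a y' y' y' y' = 0" "\<Phi> a a y' y' y' \<noteq> 0"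
    "\<Phi> a a a y' y' = 0" "\<forall>w. \<Phi> a a a y' w = \<Phi> a a a y w"
proof -
  note vertex = singular[OF a]
  define s where "s = - \<Phi> a y y y y / (4 * \<Phi> a a y y y)"
  show ?thesis
  proof (rule that[OF refl, of s])
    show "\<Phi> a (s \<cdot> a + y) (s \<cdot> a + y) (s \<cdot> a + y) (s \<cdot> a + y) = 0"
      unfolding expand4 vertex y(1) using y(2) by (simp add: s_def)
    show "\<Phi> a a (s \<cdot> a + y) (s \<cdot> a + y) (s \<cdot> a + y) \<noteq> 0" unfolding expand3 vertex y(1) using y(2) by simp
    show "\<Phi> a a a (s \<cdot> a + y) (s \<cdot> a + y) = 0" unfolding expand2 vertex y(1) by simp
    show "\<forall>w. \<Phi> a a a (s \<cdot> a + y) w = \<Phi> a a a y w" unfolding add4 scale4 vertex by simp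
  qed
qed

lemma zero_pair_cubic_eq_0:
  assumes a: "f a = 0" and b: "f b = 0" and ab: "\<Phi> a a a b b = 0"
  shows "\<Phi> a a b b b = 0"
proof (rule ccontr)
  assume abb: "\<Phi> a a b b b \<noteq> 0"
  obtain z where z: "z \<notin> span {b}" "\<Phi> a a a z z = 0" "\<Phi> a a a b z = 0" "\<Phi> a b b b z = 0"
    using exists_common_zero_outside_span[of "[(\<lambda>w. \<Phi> a a a w w, 2), (\<lambda>w. \<Phi> a a a b w, 1), (\<lambda>w. \<Phi> a b b b w, 1)]" "{b}"]
    by auto
  obtain r where r: "\<And>w. \<Phi> a a a r w = 0" "r \<notin> span {a}"
    using radical_vector_exists[OF a z(2) zero_pair_isotropic(1-3)[OF a b ab abb z(2,3,4,1)]] by blast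
  have br: "\<Phi> a a a b r = 0" using r(1) sym4 by metis
  have "\<Phi> a a r r r \<noteq> 0"
  proof
    assume C: "\<Phi> a a r r r = 0"
    have "a \<noteq> 0" using abb by auto
    then show False
      using independent_zeros_not_flat[OF a _ r(2,1) C] isotropic_cubic_zero(3,4)[OF a ab br r(1) abb C] by blast
  qed
  then obtain s r' where r': "\<Phi> a r' r' r' r' = 0" "\<Phi> a a r' r' r' \<noteq> 0" "\<Phi> a a a r' w = 0" for w
    using translate_quartic_eq_0[OF a r(1)] r(1) by metis
  show False
  proof (cases "f r' = 0")
    case True
    then show False using radical_zero_cubic_eq_0[OF a _ r'(3)] r'(2) by blast
  next
    case False
    then show False using not_radical[OF a r'(3) r'(2,1) _ r'(3)] by blast
  qed
qed

lemma functional_kernel_projection: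
  fixes l :: "'v \<Rightarrow> 'a"
  assumes l: "\<And>x y. l (x + y) = l x + l y" "\<And>c x. l (c \<cdot> x) = c * l x" and "S \<noteq> {}"
  obtains v where "v \<in> S" "\<forall>x\<in>S. \<exists>c. l (x + c \<cdot> v) = 0"
proof (cases "\<exists>v\<in>S. l v \<noteq> 0")
  case True
  then obtain v where v: "v \<in> S" "l v \<noteq> 0" by blast
  have "l (x + (- l x / l v) \<cdot> v) = 0" for x unfolding l using v(2) by simp
  then show ?thesis using that v(1) by blast
next
  case False
  obtain v where "v \<in> S" using \<open>S \<noteq> {}\<close> by blast
  have "l (x + 0 \<cdot> v) = 0" if "x \<in> S" for x using False that by simp
  then show ?thesis using that \<open>v \<in> S\<close> by blast
qed

lemma zeros_proportional:
  assumes a: "f a = 0" "a \<noteq> 0" and w: "f w = 0"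
  shows "w \<in> span {a}"
proof (rule ccontr)
  assume wa: "w \<notin> span {a}"
  have "\<Phi> w w w a a = \<Phi> a a w w w" "\<Phi> w w a a a = \<Phi> a a a w w"
    by (rule rotate_twice, rule rotate_twice[symmetric])
  then show False using zero_pair_dichotomy[OF a(1) w a(2) wa] zero_pair_cubic_eq_0[OF a(1) w] zero_pair_cubic_eq_0[OF w a(1)] by auto
qed

context
  fixes a
  assumes a: "f a = 0" "a \<noteq> 0"
begin

lemma translate_not_zero:
  assumes "y \<notin> span {a}"
  shows "f (x \<cdot> a + y) \<noteq> 0"
proof
  assume "f (x \<cdot> a + y) = 0"
  then have "x \<cdot> a + y \<in> span {a}" by (rule zeros_proportional[OF a])
  moreover have "x \<cdot> a \<in> span {a}" by (intro span_scale span_base) simp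
  ultimately show False using assms span_add_eq by blast
qed

lemma isotropic_cubic_eq_0:
  assumes y: "\<Phi> a a a y y = 0" "y \<notin> span {a}"
  shows "\<Phi> a a y y y = 0"
proof (rule ccontr)
  assume "\<Phi> a a y y y \<noteq> 0"
  then obtain s y' where y': "y' = s \<cdot> a + y" "\<Phi> a y' y' y' y' = 0" "\<Phi> a a y' y' y' \<noteq> 0" "\<Phi> a a a y' y' = 0"
    using translate_quartic_eq_0[OF a(1) y(1)] by metis
  have "f y' \<noteq> 0" unfolding y'(1) using y(2) by (rule translate_not_zero)
  then obtain e where "f e = 0" "e \<notin> span {a}" using residual_space_isotropic_exists[OF a(1) y'(4,3,2)] by blast
  then show False using zeros_proportional[OF a] by blast
qed

lemma isotropic_quartic_eq_0:
  assumes y: "\<Phi> a a a y y = 0" "y \<notin> span {a}"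
  shows "\<Phi> a y y y y = 0"
proof (rule ccontr)
  assume D: "\<Phi> a y y y y \<noteq> 0"
  have "f ((- f y / (5 * \<Phi> a y y y y)) \<cdot> a + y) = 0"
    unfolding expand_singular_zero(1)[OF a(1)] y(1) isotropic_cubic_eq_0[OF y] using D by simp
  then show False using translate_not_zero[OF y(2)] by blast
qed

text \<open>Otherwise the quintic on \<open>x \<cdot> a + (v \<cdot> y + z)\<close> is a cubic in \<open>x\<close> to which \<open>cubic_root_exists\<close> applies.\<close>

lemma isotropic_extends:
  assumes y: "\<Phi> a a a y y = 0" "y \<notin> span {a}" and z: "\<Phi> a a a y z = 0" "\<Phi> a a y y z = 0"
  shows "\<Phi> a a a z z = 0"
proof (rule ccontr)
  assume k: "\<Phi> a a a z z \<noteq> 0"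
  let ?P2 = "pencil2 a a a y z" and ?P3 = "pencil3 a a y z" and ?P4 = "pencil4 a y z" and ?P5 = "pencil5 y z"
  note vanish = y(1) z isotropic_cubic_eq_0[OF y] isotropic_quartic_eq_0[OF y]
  have P2: "?P2 = [:\<Phi> a a a z z:]" by (simp add: pencil2_def vanish)
  have "f y \<noteq> 0" using translate_not_zero[OF y(2), of 0] by simp
  then have "degree ?P5 = 5" by (rule degree_pencil5)
  moreover have "degree (smult 10 ?P3) \<le> 1" "degree (smult 5 ?P4) \<le> 3"
    by (simp_all add: pencil3_def pencil4_def vanish degree_pCons_eq_if)
  moreover have "10 * \<Phi> a a a z z \<noteq> 0" using k by simp
  ultimately obtain v x where
    "10 * \<Phi> a a a z z * x ^ 3 + poly (smult 10 ?P3) v * x\<^sup>2 + poly (smult 5 ?P4) v * x + poly ?P5 v = 0"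
    using cubic_root_exists by metis
  moreover have "\<Phi> a a a z z = poly ?P2 v" by (simp add: P2)
  ultimately have "f (x \<cdot> a + (v \<cdot> y + z)) = 0"
    unfolding expand_singular_zero(1)[OF a(1)] poly_smult poly_pencil2 poly_pencil3 poly_pencil4 poly_pencil5
    by (simp add: mult_ac)
  then have "v \<cdot> y + z \<in> span {a}" using translate_not_zero by blast
  then have "\<Phi> a a a z (v \<cdot> y + z) = 0" using singular[OF a(1)] sym4[of a a a z a] by (auto simp: span_singleton scale5)
  then show False using k z(1) sym4[of a a a z y] by (simp add: multilinear)
qed

lemma isotropic_radical_vector_exists:
  obtains r where "r \<notin> span {a}" "\<forall>x. \<Phi> a a a r x = 0"
proof -
  obtain y where y: "y \<notin> span {a}" "\<Phi> a a a y y = 0"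
    using exists_common_zero_outside_span[of "[(\<lambda>w. \<Phi> a a a w w, 2)]" "{a}"] by auto
  define K where "K = {x. \<Phi> a a a y x = 0}"
  have "K \<noteq> {}" using y(2) unfolding K_def by blast
  obtain v1 where "v1 \<in> UNIV" and v1: "\<forall>x\<in>UNIV. \<exists>c. \<Phi> a a a y (x + c \<cdot> v1) = 0"
    by (rule functional_kernel_projection[of "\<Phi> a a a y", OF add5 scale5 UNIV_not_empty])
  obtain v2 where v2: "v2 \<in> K" "\<forall>x\<in>K. \<exists>c. \<Phi> a a y y (x + c \<cdot> v2) = 0"
    by (rule functional_kernel_projection[of "\<Phi> a a y y", OF add5 scale5 \<open>K \<noteq> {}\<close>])
  obtain r where r: "r \<notin> span {a}" "r \<in> K" "\<Phi> a a y y r = 0" "\<Phi> a a a v1 r = 0" "\<Phi> a a a v2 r = 0"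
    using exists_common_zero_outside_span[of "[(\<lambda>w. \<Phi> a a a y w, 1), (\<lambda>w. \<Phi> a a y y w, 1), (\<lambda>w. \<Phi> a a a v1 w, 1),
      (\<lambda>w. \<Phi> a a a v2 w, 1)]" "{a}"] unfolding K_def by auto
  have isotropic: "\<Phi> a a a z z = 0" if "z \<in> K" "\<Phi> a a y y z = 0" for z
    using isotropic_extends[OF y(2,1)] that unfolding K_def by blast
  have "\<Phi> a a a r x = 0" for x
  proof -
    obtain c where c: "x + c \<cdot> v1 \<in> K" using v1 unfolding K_def by blast
    then obtain d where d: "\<Phi> a a y y ((x + c \<cdot> v1) + d \<cdot> v2) = 0" using v2(2) by blast
    define t where "t = (x + c \<cdot> v1) + d \<cdot> v2"
    have t: "t \<in> K" "\<Phi> a a y y t = 0" using c d v2(1) unfolding t_def K_def by (simp_all add: multilinear)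
    have "\<Phi> a a a (1 \<cdot> r + t) (1 \<cdot> r + t) = 0"
      by (rule isotropic) (use t r(2,3) in \<open>simp_all add: K_def multilinear\<close>)
    then have "\<Phi> a a a r t = 0" unfolding expand2 using isotropic[OF r(2,3)] isotropic[OF t] by simp
    then show ?thesis using r(4,5) sym4[of a a a r v1] sym4[of a a a r v2] unfolding t_def by (simp add: multilinear)
  qed
  with r(1) show ?thesis using that by blast
qed

end

theorem singular_quintic_False: False
proof -
  obtain a where a: "f a = 0" "a \<noteq> 0" using exists_common_zero_outside_span[of "[(f, 5)]" "{}"] by auto
  obtain r where r: "r \<notin> span {a}" "\<forall>x. \<Phi> a a a r x = 0" by (rule isotropic_radical_vector_exists[OF a])
  obtain v where v: "\<Phi> a a a v v \<noteq> 0" by (rule exists_anisotropic[OF a])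
  obtain u where u: "u \<notin> span {a}" "\<Phi> a a r r u = 0" "\<Phi> a a a v u = 0" "\<Phi> a a v u u = 0"
    using exists_common_zero_outside_span[of "[(\<lambda>w. \<Phi> a a r r w, 1), (\<lambda>w. \<Phi> a a a v w, 1), (\<lambda>w. \<Phi> a a v w w, 2)]" "{a}"]
    by auto
  have uu: "\<Phi> a a a u u = 0" using isotropic_extends[OF a _ r(1)] r(2) u(2) by blast
  have "\<Phi> a a a u v = 0" "\<Phi> a a u u v = 0" using u(3,4) sym3 sym4 by metis+
  then show False using isotropic_extends[OF a uu u(1)] v by blast
qed

end

section \<open>Integral forms\<close>

subsection \<open>Evaluation in a commutative ring\<close>

definition eval_monom :: "(nat \<Rightarrow> 'r :: comm_ring_1) \<Rightarrow> (nat \<Rightarrow>\<^sub>0 nat) \<Rightarrow> 'r"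
  where "eval_monom x \<alpha> = (\<Prod>i\<in>Poly_Mapping.keys \<alpha>. x i ^ Poly_Mapping.lookup \<alpha> i)"

definition eval_zpoly :: "zpoly \<Rightarrow> (nat \<Rightarrow> 'r :: comm_ring_1) \<Rightarrow> 'r"
  where "eval_zpoly F x = (\<Sum>\<alpha>\<in>Poly_Mapping.keys F. of_int (Poly_Mapping.lookup F \<alpha>) * eval_monom x \<alpha>)"

lemma zeval_eq_eval_zpoly: "zeval F x = eval_zpoly F x"
  by (simp add: zeval_def eval_zpoly_def eval_monom_def)

lemma of_int_eval_zpoly: "of_int (eval_zpoly F x) = eval_zpoly F (\<lambda>i. of_int (x i))"
  by (simp add: eval_zpoly_def eval_monom_def)

lemma poly_eval_zpoly: "poly (eval_zpoly F P) t = eval_zpoly F (\<lambda>i. poly (P i) t)"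
  by (simp add: eval_zpoly_def eval_monom_def poly_sum poly_prod)

lemma eval_monom_superset:
  assumes "finite S" "Poly_Mapping.keys \<alpha> \<subseteq> S"
  shows "eval_monom x \<alpha> = (\<Prod>i\<in>S. x i ^ Poly_Mapping.lookup \<alpha> i)"
  unfolding eval_monom_def using assms by (intro prod.mono_neutral_left) (auto simp: in_keys_iff)

lemma eval_monom_add: "eval_monom x (\<alpha> + \<beta>) = eval_monom x \<alpha> * eval_monom x \<beta>"
proof -
  let ?S = "Poly_Mapping.keys \<alpha> \<union> Poly_Mapping.keys \<beta>"
  have "eval_monom x (\<alpha> + \<beta>) = (\<Prod>i\<in>?S. x i ^ Poly_Mapping.lookup (\<alpha> + \<beta>) i)"
    by (intro eval_monom_superset) (use Poly_Mapping.keys_add[of \<alpha> \<beta>] in auto)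
  then show ?thesis by (simp add: lookup_add power_add prod.distrib eval_monom_superset[of ?S])
qed

lemma eval_zpoly_superset:
  assumes "finite S" "Poly_Mapping.keys F \<subseteq> S"
  shows "eval_zpoly F x = (\<Sum>\<alpha>\<in>S. of_int (Poly_Mapping.lookup F \<alpha>) * eval_monom x \<alpha>)"
  unfolding eval_zpoly_def using assms by (intro sum.mono_neutral_left) (auto simp: in_keys_iff)

lemma eval_zpoly_add: "eval_zpoly (F + G) x = eval_zpoly F x + eval_zpoly G x"
proof -
  let ?S = "Poly_Mapping.keys F \<union> Poly_Mapping.keys G"
  have "eval_zpoly (F + G) x = (\<Sum>\<alpha>\<in>?S. of_int (Poly_Mapping.lookup (F + G) \<alpha>) * eval_monom x \<alpha>)"
    by (intro eval_zpoly_superset) (use Poly_Mapping.keys_add[of F G] in auto)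
  then show ?thesis by (simp add: lookup_add distrib_right sum.distrib eval_zpoly_superset[of ?S])
qed

lemma eval_zpoly_0 [simp]: "eval_zpoly 0 x = 0"
  by (simp add: eval_zpoly_def)

lemma eval_zpoly_sum: "eval_zpoly (\<Sum>i\<in>A. F i) x = (\<Sum>i\<in>A. eval_zpoly (F i) x)"
  by (induction A rule: infinite_finite_induct) (simp_all add: eval_zpoly_add)

lemma eval_zpoly_single: "eval_zpoly (Poly_Mapping.single \<alpha> c) x = of_int c * eval_monom x \<alpha>"
  by (simp add: eval_zpoly_def)

lemma sum_single_lookup:
  "(\<Sum>\<alpha>\<in>Poly_Mapping.keys F. Poly_Mapping.single \<alpha> (Poly_Mapping.lookup F \<alpha>)) = F"
proof (rule poly_mapping_eqI)
  fix \<beta>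
  have "(\<Sum>\<alpha>\<in>Poly_Mapping.keys F. Poly_Mapping.lookup (Poly_Mapping.single \<alpha> (Poly_Mapping.lookup F \<alpha>)) \<beta>) =
      (\<Sum>\<alpha>\<in>Poly_Mapping.keys F. if \<alpha> = \<beta> then Poly_Mapping.lookup F \<beta> else 0)"
    by (intro sum.cong) (auto simp: lookup_single when_def)
  then show "Poly_Mapping.lookup (\<Sum>\<alpha>\<in>Poly_Mapping.keys F. Poly_Mapping.single \<alpha> (Poly_Mapping.lookup F \<alpha>)) \<beta> =
      Poly_Mapping.lookup F \<beta>"
    by (simp add: lookup_sum in_keys_iff)
qed

lemma eval_zpoly_mult: "eval_zpoly (F * G) x = eval_zpoly F x * eval_zpoly G x"
proof -
  have "F * G = (\<Sum>\<alpha>\<in>Poly_Mapping.keys F. \<Sum>\<beta>\<in>Poly_Mapping.keys G.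
      Poly_Mapping.single (\<alpha> + \<beta>) (Poly_Mapping.lookup F \<alpha> * Poly_Mapping.lookup G \<beta>))"
    by (subst sum_single_lookup[of F, symmetric], subst sum_single_lookup[of G, symmetric])
      (simp add: sum_product mult_single)
  then have "eval_zpoly (F * G) x = (\<Sum>\<alpha>\<in>Poly_Mapping.keys F. \<Sum>\<beta>\<in>Poly_Mapping.keys G.
      (of_int (Poly_Mapping.lookup F \<alpha>) * eval_monom x \<alpha>) * (of_int (Poly_Mapping.lookup G \<beta>) * eval_monom x \<beta>))"
    by (simp add: eval_zpoly_sum eval_zpoly_single eval_monom_add mult_ac)
  then show ?thesis by (simp add: eval_zpoly_def sum_product)
qed

lemma eval_zpoly_1 [simp]: "eval_zpoly 1 x = 1"
  using eval_zpoly_single[of 0 1 x] by (simp add: eval_monom_def)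

lemma eval_zpoly_power: "eval_zpoly (F ^ k) x = eval_zpoly F x ^ k"
  by (induction k) (simp_all add: eval_zpoly_mult)

lemma eval_zpoly_prod: "eval_zpoly (\<Prod>i\<in>A. F i) x = (\<Prod>i\<in>A. eval_zpoly (F i) x)"
  by (induction A rule: infinite_finite_induct) (simp_all add: eval_zpoly_mult)

lemma eval_zpoly_zConst: "eval_zpoly (zConst k) x = of_int k"
  unfolding zConst_def eval_zpoly_single by (simp add: eval_monom_def)

lemma eval_zpoly_zVar: "eval_zpoly (zVar j) x = x j"
  unfolding zVar_def eval_zpoly_single by (simp add: eval_monom_def)

lemma eval_zpoly_lin_subst:
  "eval_zpoly (lin_subst n A F) x = eval_zpoly F (\<lambda>i. \<Sum>j<n. of_int (A i j) * x j)"
  unfolding lin_subst_def eval_zpoly_sum eval_zpoly_mult eval_zpoly_prod eval_zpoly_power eval_zpoly_zConst eval_zpoly_zVar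
  by (simp add: eval_zpoly_def eval_monom_def)

lemma eval_zpoly_cong:
  assumes "is_int_form n d F" "\<And>i. i < n \<Longrightarrow> x i = y i"
  shows "eval_zpoly F x = eval_zpoly F y"
  unfolding eval_zpoly_def eval_monom_def using assms
  by (intro sum.cong prod.cong refl arg_cong2[of _ _ _ _ "(*)"] arg_cong2[of _ _ _ _ "(^)"])
    (auto simp: is_int_form_def)

subsection \<open>Linear substitutions\<close>

lemma mon_deg_superset:
  assumes "finite S" "Poly_Mapping.keys \<alpha> \<subseteq> S"
  shows "mon_deg \<alpha> = (\<Sum>i\<in>S. Poly_Mapping.lookup \<alpha> i)"
  unfolding mon_deg_def using assms by (intro sum.mono_neutral_left) (auto simp: in_keys_iff)

lemma mon_deg_add: "mon_deg (\<alpha> + \<beta>) = mon_deg \<alpha> + mon_deg \<beta>"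
proof -
  let ?S = "Poly_Mapping.keys \<alpha> \<union> Poly_Mapping.keys \<beta>"
  have "mon_deg (\<alpha> + \<beta>) = (\<Sum>i\<in>?S. Poly_Mapping.lookup (\<alpha> + \<beta>) i)"
    by (intro mon_deg_superset) (use Poly_Mapping.keys_add[of \<alpha> \<beta>] in auto)
  then show ?thesis by (simp add: lookup_add sum.distrib mon_deg_superset[of ?S])
qed

lemma lookup_le_mon_deg: "Poly_Mapping.lookup \<alpha> i \<le> mon_deg \<alpha>"
  unfolding mon_deg_def by (cases "i \<in> Poly_Mapping.keys \<alpha>") (auto intro: member_le_sum simp: in_keys_iff)

lemma is_int_form_sum:
  "(\<And>i. i \<in> A \<Longrightarrow> is_int_form n d (P i)) \<Longrightarrow> is_int_form n d (\<Sum>i\<in>A. P i)"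
proof (induction A rule: infinite_finite_induct)
  case (insert i A)
  then show ?case using Poly_Mapping.keys_add[of "P i" "\<Sum>i\<in>A. P i"] by (fastforce simp: is_int_form_def)
qed (simp_all add: is_int_form_def)

lemma is_int_form_mult:
  assumes "is_int_form n d P" "is_int_form n e Q"
  shows "is_int_form n (d + e) (P * Q)"
  unfolding is_int_form_def
proof
  fix \<gamma> assume "\<gamma> \<in> Poly_Mapping.keys (P * Q)"
  then obtain \<alpha> \<beta> where "\<alpha> \<in> Poly_Mapping.keys P" "\<beta> \<in> Poly_Mapping.keys Q" "\<gamma> = \<alpha> + \<beta>"
    using keys_mult[of P Q] by blast
  then show "Poly_Mapping.keys \<gamma> \<subseteq> {..<n} \<and> mon_deg \<gamma> = d + e"
    using assms Poly_Mapping.keys_add[of \<alpha> \<beta>] by (fastforce simp: is_int_form_def mon_deg_add)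
qed

lemma is_int_form_zConst: "is_int_form n 0 (zConst c)"
  by (auto simp: is_int_form_def zConst_def mon_deg_def)

lemma is_int_form_1: "is_int_form n 0 1"
  using is_int_form_zConst[of n 1] by (simp add: zConst_def)

lemma is_int_form_zVar: "j < n \<Longrightarrow> is_int_form n 1 (zVar j)"
  by (auto simp: is_int_form_def zVar_def mon_deg_def lookup_single when_def)

lemma is_int_form_power: "is_int_form n d P \<Longrightarrow> is_int_form n (k * d) (P ^ k)"
  by (induction k) (simp_all add: is_int_form_1 is_int_form_mult)

lemma is_int_form_prod:
  "(\<And>i. i \<in> A \<Longrightarrow> is_int_form n (d i) (P i)) \<Longrightarrow> is_int_form n (\<Sum>i\<in>A. d i) (\<Prod>i\<in>A. P i)"
  by (induction A rule: infinite_finite_induct) (simp_all add: is_int_form_1 is_int_form_mult)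

lemma is_int_form_lin_subst:
  assumes "is_int_form n d F"
  shows "is_int_form n d (lin_subst n A F)"
  unfolding lin_subst_def
proof (rule is_int_form_sum)
  fix \<alpha> assume "\<alpha> \<in> Poly_Mapping.keys F"
  then have d: "d = 0 + (\<Sum>i\<in>Poly_Mapping.keys \<alpha>. Poly_Mapping.lookup \<alpha> i * 1)"
    using assms by (simp add: is_int_form_def mon_deg_def)
  have "is_int_form n (0 + 1) (zConst c * zVar j)" if "j < n" for c j
    using that by (intro is_int_form_mult is_int_form_zConst is_int_form_zVar)
  then show "is_int_form n d (zConst (Poly_Mapping.lookup F \<alpha>) *
      (\<Prod>i\<in>Poly_Mapping.keys \<alpha>. (\<Sum>j<n. zConst (A i j) * zVar j) ^ Poly_Mapping.lookup \<alpha> i))"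
    unfolding d
    by (intro is_int_form_mult is_int_form_zConst is_int_form_prod is_int_form_power is_int_form_sum) simp
qed

lemma invertible_mod_permute:
  assumes A: "invertible_mod p n A" and \<tau>: "\<tau> permutes {..<n}"
  shows "invertible_mod p n (\<lambda>i j. A i (\<tau> j))"
proof -
  obtain B where B: "\<And>i k. i < n \<Longrightarrow> k < n \<Longrightarrow> (\<Sum>j<n. A i j * B j k) mod p = (if i = k then 1 else 0) mod p"
    using A unfolding invertible_mod_def by blast
  have "(\<Sum>j<n. A i (\<tau> j) * B (\<tau> j) k) = (\<Sum>j<n. A i j * B j k)" for i k
    using sum.permute[OF \<tau>, of "\<lambda>j. A i j * B j k"] by (simp add: o_def)
  then show ?thesis unfolding invertible_mod_def using B by (intro exI[of _ "\<lambda>j k. B (\<tau> j) k"]) simp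
qed

lemma invertible_mod_replace_column:
  assumes m: "m < n" and u: "[V m * u = 1] (mod p)"
  shows "invertible_mod p n (\<lambda>i j. if j = m then V i else if i = j then 1 else 0)"
  unfolding invertible_mod_def
proof (intro exI allI impI)
  fix i k assume "i < n" "k < n"
  let ?A = "\<lambda>i j. if j = m then V i else if i = j then 1 else 0"
  let ?B = "\<lambda>j k. if j = m then if k = m then u else 0 else (if j = k then 1 else 0) - (if k = m then V j * u else 0)"
  have "(\<Sum>j<n. ?A i j * ?B j k) = ?A i m * ?B m k + (\<Sum>j\<in>{..<n} - {m}. ?A i j * ?B j k)"
    using m by (intro sum.remove) auto
  also have "(\<Sum>j\<in>{..<n} - {m}. ?A i j * ?B j k) = (\<Sum>j\<in>{..<n} - {m}. if j = i then ?B i k else 0)"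
    by (intro sum.cong) auto
  also have "\<dots> = (if i = m then 0 else ?B i k)" using \<open>i < n\<close> by simp
  also have "?A i m * ?B m k + \<dots> = (if i = m then if k = m then V m * u else 0 else if i = k then 1 else 0)"
    by simp
  also have "\<dots> mod p = (if i = k then 1 else 0) mod p" using u by (auto simp: cong_def)
  finally show "(\<Sum>j<n. ?A i j * ?B j k) mod p = (if i = k then 1 else 0) mod p" .
qed

subsection \<open>The order modulo a prime\<close>

lemma sum_powers_CARD_minus_1: "(\<Sum>t\<in>(UNIV :: 'a :: prime_field set). t ^ (CARD('a) - 1)) = - 1"
proof -
  have "CARD('a) > 1" using prime_CARD[where ?'a='a] by (rule prime_gt_1_nat)
  then have "(\<Sum>t\<in>(UNIV :: 'a set). t ^ (CARD('a) - 1)) = (\<Sum>t\<in>UNIV - {0 :: 'a}. 1)"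
    by (intro sum.mono_neutral_cong_right) (auto simp: power_CARD_minus_1 simp del: One_nat_def)
  also have "\<dots> = of_nat CARD('a) - 1" using \<open>CARD('a) > 1\<close> by (simp add: card_Diff_subset of_nat_diff)
  also have "\<dots> = - 1" by (simp flip: CHAR_eq_CARD)
  finally show ?thesis .
qed

lemma sum_powers_orthogonal:
  assumes "a < CARD('a :: prime_field) - 1" "b < CARD('a) - 1"
  shows "(\<Sum>t\<in>(UNIV :: 'a set). t ^ (a + (CARD('a) - 1 - b))) = (if a = b then - 1 else 0)"
proof -
  consider "a = b" | "a < b" | k where "a = b + Suc k" using less_imp_Suc_add[of b a] by (metis add_Suc_right nat_neq_iff)
  then show ?thesis
  proof cases
    case 1
    then show ?thesis using assms sum_powers_CARD_minus_1 by simp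
  next
    case 2
    then have "a + (CARD('a) - 1 - b) < CARD('a) - 1" using assms(2) by linarith
    then show ?thesis using 2 sum_powers_eq_0 by simp
  next
    case 3
    have "a + (CARD('a) - 1 - b) = CARD('a) + k" using 3 assms by linarith
    then have "t ^ (a + (CARD('a) - 1 - b)) = t ^ Suc k" for t :: 'a
      by (simp only: power_add power_CARD power_Suc)
    then have "(\<Sum>t\<in>(UNIV :: 'a set). t ^ (a + (CARD('a) - 1 - b))) = (\<Sum>t\<in>UNIV. t ^ Suc k)" by (rule sum.cong[OF refl])
    also have "\<dots> = 0" using 3 assms(1) by (intro sum_powers_eq_0) linarith
    finally show ?thesis using 3 by simp
  qed
qed

text \<open>Coefficients are recovered from values by summing against complementary monomials.\<close>

lemma coefficient_eq_0_if_vanishing: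
  fixes c :: "(nat \<Rightarrow>\<^sub>0 nat) \<Rightarrow> 'a :: prime_field"
  assumes S: "finite S" "\<And>\<alpha> i. \<alpha> \<in> S \<Longrightarrow> Poly_Mapping.keys \<alpha> \<subseteq> {..<n} \<and> Poly_Mapping.lookup \<alpha> i < CARD('a) - 1"
    and vanish: "\<And>x. (\<Sum>\<alpha>\<in>S. c \<alpha> * eval_monom x \<alpha>) = 0" and \<beta>: "\<beta> \<in> S"
  shows "c \<beta> = 0"
proof -
  let ?X = "PiE {..<n} (\<lambda>_. UNIV :: 'a set)"
  define w where "w x = (\<Prod>i<n. x i ^ (CARD('a) - 1 - Poly_Mapping.lookup \<beta> i))" for x :: "nat \<Rightarrow> 'a"
  have pairing: "(\<Sum>x\<in>?X. eval_monom x \<alpha> * w x) = (if \<alpha> = \<beta> then (- 1) ^ n else 0)" if \<alpha>: "\<alpha> \<in> S" for \<alpha>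
  proof -
    have "eval_monom x \<alpha> * w x = (\<Prod>i<n. x i ^ (Poly_Mapping.lookup \<alpha> i + (CARD('a) - 1 - Poly_Mapping.lookup \<beta> i)))" for x
      using S(2)[OF \<alpha>] by (simp add: eval_monom_superset[of "{..<n}"] w_def power_add prod.distrib)
    then have "(\<Sum>x\<in>?X. eval_monom x \<alpha> * w x)
        = (\<Prod>i<n. \<Sum>t\<in>(UNIV :: 'a set). t ^ (Poly_Mapping.lookup \<alpha> i + (CARD('a) - 1 - Poly_Mapping.lookup \<beta> i)))"
      by (simp add: prod_sum_PiE)
    also have "\<dots> = (\<Prod>i<n. if Poly_Mapping.lookup \<alpha> i = Poly_Mapping.lookup \<beta> i then - 1 else 0)"
      using S(2)[OF \<alpha>] S(2)[OF \<beta>] by (intro prod.cong refl sum_powers_orthogonal) auto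
    also have "\<dots> = (if \<alpha> = \<beta> then (- 1) ^ n else 0)"
    proof (cases "\<alpha> = \<beta>")
      case False
      then obtain i where i: "Poly_Mapping.lookup \<alpha> i \<noteq> Poly_Mapping.lookup \<beta> i" by (meson poly_mapping_eqI)
      then have "i \<in> Poly_Mapping.keys \<alpha> \<union> Poly_Mapping.keys \<beta>" by (auto simp: in_keys_iff)
      then have "i < n" using S(2)[OF \<alpha>] S(2)[OF \<beta>] by blast
      then show ?thesis using False i by (auto intro!: prod_zero)
    qed simp
    finally show ?thesis .
  qed
  have "0 = (\<Sum>x\<in>?X. (\<Sum>\<alpha>\<in>S. c \<alpha> * eval_monom x \<alpha>) * w x)" by (simp add: vanish)
  also have "\<dots> = (\<Sum>\<alpha>\<in>S. c \<alpha> * (\<Sum>x\<in>?X. eval_monom x \<alpha> * w x))"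
    by (simp add: sum_distrib_right sum_distrib_left mult.assoc sum.swap[of _ S])
  also have "\<dots> = (\<Sum>\<alpha>\<in>S. if \<alpha> = \<beta> then c \<beta> * (- 1) ^ n else 0)"
    by (intro sum.cong) (auto simp: pairing)
  also have "\<dots> = c \<beta> * (- 1) ^ n" using S(1) \<beta> by simp
  finally show ?thesis by simp
qed

lemma involves_only_mod_if_independent:
  assumes G: "is_int_form (Suc l) d G" and d: "d < CARD('a :: prime_field) - 1"
    and independent: "\<And>x :: nat \<Rightarrow> 'a. eval_zpoly G (x(l := 0)) = eval_zpoly G x"
  shows "involves_only_mod (int CARD('a)) l G"
  unfolding involves_only_mod_def
proof (intro ballI impI)
  fix \<beta> assume \<beta>: "\<beta> \<in> Poly_Mapping.keys G" "\<not> Poly_Mapping.keys \<beta> \<subseteq> {..<l}"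
  define S where "S = {\<alpha> \<in> Poly_Mapping.keys G. l \<in> Poly_Mapping.keys \<alpha>}"
  have sub: "S \<subseteq> Poly_Mapping.keys G" by (auto simp: S_def)
  have "(\<Sum>\<alpha>\<in>S. of_int (Poly_Mapping.lookup G \<alpha>) * eval_monom x \<alpha>) = 0" for x :: "nat \<Rightarrow> 'a"
  proof -
    let ?sum = "\<lambda>S x. \<Sum>\<alpha>\<in>S. of_int (Poly_Mapping.lookup G \<alpha>) * eval_monom x \<alpha> :: 'a"
    have "eval_monom (x(l := 0)) \<alpha> = 0" if "\<alpha> \<in> S" for \<alpha>
      unfolding eval_monom_def using that by (intro prod_zero bexI[of _ l]) (auto simp: S_def in_keys_iff zero_power)
    then have "?sum S (x(l := 0)) = 0" by simp
    moreover have "eval_monom (x(l := 0)) \<alpha> = eval_monom x \<alpha>" if "\<alpha> \<in> Poly_Mapping.keys G - S" for \<alpha>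
      unfolding eval_monom_def using that by (intro prod.cong) (auto simp: S_def)
    then have "?sum (Poly_Mapping.keys G - S) (x(l := 0)) = ?sum (Poly_Mapping.keys G - S) x" by simp
    moreover have "eval_zpoly G y = ?sum (Poly_Mapping.keys G - S) y + ?sum S y" for y
      unfolding eval_zpoly_def by (rule sum.subset_diff[OF sub]) simp
    ultimately show ?thesis using independent[of x] by simp
  qed
  then have "(of_int (Poly_Mapping.lookup G \<beta>) :: 'a) = 0"
  proof (rule coefficient_eq_0_if_vanishing[rotated 2, where S = S and n = "Suc l"])
    have keys: "Poly_Mapping.keys \<alpha> \<subseteq> {..<Suc l}" "mon_deg \<alpha> = d" if "\<alpha> \<in> Poly_Mapping.keys G" for \<alpha>
      using G that by (simp_all add: is_int_form_def)
    have "l \<in> Poly_Mapping.keys \<beta>" using keys(1)[OF \<beta>(1)] \<beta>(2) unfolding lessThan_Suc by blast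
    then show "\<beta> \<in> S" using \<beta>(1) by (simp add: S_def)
    show "Poly_Mapping.keys \<alpha> \<subseteq> {..<Suc l} \<and> Poly_Mapping.lookup \<alpha> i < CARD('a) - 1" if "\<alpha> \<in> S" for \<alpha> i
      using keys[of \<alpha>] that d lookup_le_mon_deg[of \<alpha> i] unfolding S_def by simp
  qed (simp add: S_def)
  then show "int CARD('a) dvd Poly_Mapping.lookup G \<beta>" by (simp only: of_int_eq_0_iff_dvd)
qed

lemma of_int_lift:
  fixes v :: "nat \<Rightarrow> 'a :: prime_field"
  obtains V where "\<forall>i. of_int (V i) = v i"
proof -
  have "\<forall>i. \<exists>k. of_int k = v i" using surj_of_int by (metis surjD)
  then show ?thesis using choice[of "\<lambda>i k. of_int k = v i"] that by blast
qed

lemma order_mod_less_if_translation_invariant: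
  fixes v :: "nat \<Rightarrow> 'a :: prime_field"
  assumes F: "is_int_form n d F" "d < CARD('a) - 1" and m: "m < n" "v m \<noteq> 0"
    and invariant: "\<And>x t. eval_zpoly F (\<lambda>i. x i + t * v i) = eval_zpoly F x"
  shows "order_mod (int CARD('a)) n F < n"
proof -
  obtain l where n: "n = Suc l" using m(1) by (cases n) auto
  obtain V where V: "\<forall>i. of_int (V i) = v i" by (rule of_int_lift)
  define \<tau> where "\<tau> = Transposition.transpose m l"
  define A where "A i j = (if \<tau> j = m then V i else if i = \<tau> j then 1 else 0)" for i j
  obtain u :: int where "of_int u = inverse (v m)" using surj_of_int by (metis surjD)
  then have "(of_int (V m * u - 1) :: 'a) = 0" using V m(2) by simp
  then have "[V m * u = 1] (mod int CARD('a))" by (simp only: of_int_eq_0_iff_dvd cong_iff_dvd_diff)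
  then have "invertible_mod (int CARD('a)) n (\<lambda>i j. if j = m then V i else if i = j then 1 else 0)"
    using m(1) by (intro invertible_mod_replace_column)
  moreover have "\<tau> permutes {..<n}" unfolding \<tau>_def using m(1) n by (intro permutes_swap_id) auto
  ultimately have "invertible_mod (int CARD('a)) n A" unfolding A_def by (rule invertible_mod_permute)
  moreover have "involves_only_mod (int CARD('a)) l (lin_subst n A F)"
  proof (rule involves_only_mod_if_independent)
    show "is_int_form (Suc l) d (lin_subst n A F)" using is_int_form_lin_subst[OF F(1)] unfolding n .
    fix x :: "nat \<Rightarrow> 'a"
    have "A i l = V i" for i by (simp add: A_def \<tau>_def)
    then have "(\<Sum>j<n. of_int (A i j) * x j) = (\<Sum>j<n. of_int (A i j) * (x(l := 0)) j) + x l * v i" for i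
      unfolding n by (simp add: V mult.commute)
    then show "eval_zpoly (lin_subst n A F) (x(l := 0)) = eval_zpoly (lin_subst n A F) x"
      unfolding eval_zpoly_lin_subst by (simp add: invariant)
  qed (rule F(2))
  ultimately have "equiv_m_vars_mod (int CARD('a)) n F l" unfolding equiv_m_vars_mod_def by blast
  then have "order_mod (int CARD('a)) n F \<le> l" unfolding order_mod_def by (rule Least_le)
  then show ?thesis using n by simp
qed

section \<open>Density from a nonsingular zero\<close>

lemma taylor_dvd:
  fixes g :: "int poly"
  shows "h\<^sup>2 dvd poly g (t + h) - poly g t - h * poly (pderiv g) t"
proof (induction g)
  case (pCons a g)
  have "poly (pCons a g) (t + h) - poly (pCons a g) t - h * poly (pderiv (pCons a g)) t =
     (t + h) * (poly g (t + h) - poly g t - h * poly (pderiv g) t) + h\<^sup>2 * poly (pderiv g) t"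
    by (simp add: pderiv_pCons power2_eq_square algebra_simps)
  then show ?case using pCons.IH by simp
qed simp

lemma newton_step:
  fixes g :: "int poly"
  assumes d: "coprime (poly (pderiv g) t) p" and t: "p ^ Suc k dvd poly g t - c"
  obtains h where "p ^ Suc k dvd h" "p ^ Suc (Suc k) dvd poly g (t + h) - c"
proof -
  define d where "d = poly (pderiv g) t"
  obtain m where m: "poly g t - c = p ^ Suc k * m" using t by blast
  have "gcd d p = 1" using d by (simp add: d_def)
  then obtain u w where "u * d + w * p = 1" using bezout_int[of d p] by auto
  then have uw: "1 - u * d = w * p" by (simp add: algebra_simps)
  define h where "h = p ^ Suc k * (- (m * u))"
  obtain r where "poly g (t + h) - poly g t - h * d = h\<^sup>2 * r" using taylor_dvd[of h g t] unfolding d_def by blast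
  then have "poly g (t + h) - c = p ^ Suc k * (m * (1 - u * d)) + h\<^sup>2 * r"
    using m by (simp add: h_def algebra_simps)
  also have "\<dots> = p ^ Suc (Suc k) * (m * w) + h\<^sup>2 * r" unfolding uw by (simp add: mult_ac)
  finally have "poly g (t + h) - c = p ^ Suc (Suc k) * (m * w) + h\<^sup>2 * r" .
  moreover have "p ^ Suc (Suc k) dvd (p ^ Suc k)\<^sup>2"
    unfolding power_mult[symmetric] by (rule le_imp_power_dvd) simp
  then have "p ^ Suc (Suc k) dvd h\<^sup>2 * r" unfolding h_def power_mult_distrib by (simp add: dvd_mult2)
  ultimately have "p ^ Suc (Suc k) dvd poly g (t + h) - c" by simp
  then show ?thesis using that[of h] by (simp add: h_def)
qed

lemma hensel:
  fixes g :: "int poly"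
  assumes p: "prime p" and g0: "p dvd poly g 0" and g1: "\<not> p dvd poly (pderiv g) 0" and c: "p dvd c"
  shows "\<exists>t. p dvd t \<and> p ^ Suc k dvd poly g t - c"
proof (induction k)
  case 0
  show ?case using g0 c by (intro exI[of _ 0]) simp
next
  case (Suc k)
  then obtain t where t: "p dvd t" "p ^ Suc k dvd poly g t - c" by blast
  have "t dvd poly (pderiv g) t - poly (pderiv g) 0" by (cases "pderiv g") simp
  then have "p dvd poly (pderiv g) t - poly (pderiv g) 0" using t(1) dvd_trans by blast
  then have "\<not> p dvd poly (pderiv g) t" using g1 by (metis dvd_diff_commute dvd_diffD1 zdvd_zdiffD)
  then have "coprime (poly (pderiv g) t) p" using p by (intro prime_imp_coprime[THEN coprime_commute[THEN iffD1]])
  then obtain h where h: "p ^ Suc k dvd h" "p ^ Suc (Suc k) dvd poly g (t + h) - c" by (rule newton_step[OF _ t(2)])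
  have "p dvd h" using h(1) by (metis dvd_mult_left power_Suc)
  then show ?case using h(2) t(1) by (intro exI[of _ "t + h"]) simp
qed

lemma padic_dense_if_represents_multiples:
  assumes p: "prime p" and represents: "\<And>c k. p dvd c \<Longrightarrow> \<exists>x. p ^ Suc k dvd zeval F x - c"
  shows "padic_dense p (ratio_set F)"
  unfolding padic_dense_def
proof (intro allI)
  fix q :: rat and k :: nat
  obtain u w where q: "q = of_int u / of_int w" "w \<noteq> 0"
    by (cases q) (simp add: Fract_of_int_quotient)
  have "\<not> is_unit p" using p by auto
  define e where "e = multiplicity p w"
  obtain w' where w: "w = p ^ e * w'" "\<not> p dvd w'"
    using multiplicity_decompose'[OF q(2) \<open>\<not> is_unit p\<close>] unfolding e_def by blast
  obtain y r where y: "zeval F y - p * w = p ^ Suc (2 * e + k + 1) * r"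
    using represents[OF dvd_triv_left, of "2 * e + k + 1" w] unfolding dvd_def by blast
  obtain z s where z: "zeval F z - p * u = p ^ Suc (2 * e + k + 1) * s"
    using represents[OF dvd_triv_left, of "2 * e + k + 1" u] unfolding dvd_def by blast
  have p_2e: "p ^ (e * 2) = p ^ e * p ^ e" by (simp add: power_mult power2_eq_square)
  define v where "v = w' + p * (p ^ (e + k) * r)"
  have "zeval F y = p * w + p ^ Suc (2 * e + k + 1) * r" using y by simp
  also have "\<dots> = p ^ Suc e * v" unfolding v_def by (subst w(1)) (simp add: power_add p_2e algebra_simps)
  finally have Fy: "zeval F y = p ^ Suc e * v" .
  have v: "\<not> p dvd v" using w(2) unfolding v_def by (simp add: dvd_add_left_iff)
  then have nz: "v \<noteq> 0" "w' \<noteq> 0" "p \<noteq> 0" using w(2) p by auto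
  have "zeval F z * w - u * zeval F y = (zeval F z - p * u) * w - u * (zeval F y - p * w)"
    by (simp add: algebra_simps)
  also have "\<dots> = p ^ Suc (2 * e) * (p ^ k * (p * (s * w - u * r)))"
    unfolding y z by (simp add: power_add algebra_simps)
  finally have numerator: "zeval F z * w - u * zeval F y = p ^ Suc (2 * e) * (p ^ k * (p * (s * w - u * r)))" .
  have denominator: "zeval F y * w = p ^ Suc (2 * e) * (v * w')"
    unfolding Fy by (subst w(1)) (simp add: p_2e mult_ac)
  have "of_int (zeval F z) / of_int (zeval F y) - q = (of_int (zeval F z * w - u * zeval F y) / of_int (zeval F y * w) :: rat)"
    using nz q by (simp add: Fy diff_frac_eq)
  also have "\<dots> = of_int (p ^ k * (p * (s * w - u * r))) / of_int (v * w')"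
    unfolding numerator denominator using nz by (simp add: mult.assoc[symmetric] del: power_Suc)
  finally have "of_int (zeval F z) / of_int (zeval F y) - q
      = (of_int (p ^ k * (p * (s * w - u * r))) / of_int (v * w') :: rat)" .
  moreover have "zeval F y \<noteq> 0" using nz by (simp add: Fy)
  then have "of_int (zeval F z) / of_int (zeval F y) \<in> ratio_set F" unfolding ratio_set_def by blast
  moreover have "v * w' \<noteq> 0" "\<not> p dvd v * w'" using nz v w(2) p by (simp_all add: prime_dvd_mult_iff)
  ultimately show "\<exists>s\<in>ratio_set F. \<exists>a b. b \<noteq> 0 \<and> \<not> p dvd b \<and> s - q = of_int (p ^ k * a) / of_int b" by blast
qed

lemma degree_eval_zpoly_line:
  fixes x z :: "nat \<Rightarrow> 'r :: idom"
  assumes "is_int_form n d F"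
  shows "degree (eval_zpoly F (\<lambda>i. [:x i, z i:])) \<le> d"
  unfolding eval_zpoly_def
proof (rule degree_sum_le)
  fix \<alpha> assume "\<alpha> \<in> Poly_Mapping.keys F"
  then have deg: "d = (\<Sum>i\<in>Poly_Mapping.keys \<alpha>. Poly_Mapping.lookup \<alpha> i)"
    using assms by (simp add: is_int_form_def mon_deg_def)
  have "degree ([:x i, z i:] ^ k) \<le> k" for i k
    using degree_power_le[of "[:x i, z i:]" k] by (cases "z i = 0") auto
  then have "(\<Sum>i\<in>Poly_Mapping.keys \<alpha>. degree ([:x i, z i:] ^ Poly_Mapping.lookup \<alpha> i)) \<le> d"
    unfolding deg by (intro sum_mono)
  then have "degree (eval_monom (\<lambda>i. [:x i, z i:]) \<alpha>) \<le> d"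
    unfolding eval_monom_def
    using degree_prod_sum_le[of "Poly_Mapping.keys \<alpha>" "\<lambda>i. [:x i, z i:] ^ Poly_Mapping.lookup \<alpha> i"] by simp
  then show "degree (of_int (Poly_Mapping.lookup F \<alpha>) * eval_monom (\<lambda>i. [:x i, z i:]) \<alpha>) \<le> d"
    by (intro degree_mult_le[THEN order_trans]) (simp add: of_int_poly)
qed simp

lemma padic_dense_if_nonsingular_on_line:
  fixes x z :: "nat \<Rightarrow> 'a :: prime_field"
  assumes F: "is_int_form n d F" "d < CARD('a)"
    and P: "\<And>t. eval_zpoly F (\<lambda>i. x i + t * z i) = poly P t" "degree P < CARD('a)"
    and zero: "poly P 0 = 0" "poly (pderiv P) 0 \<noteq> 0"
  shows "padic_dense (int CARD('a)) (ratio_set F)"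
proof -
  obtain x' where x': "\<forall>i. of_int (x' i) = x i" by (rule of_int_lift)
  obtain z' where z': "\<forall>i. of_int (z' i) = z i" by (rule of_int_lift)
  define g where "g = eval_zpoly F (\<lambda>i. [:x' i, z' i:])"
  have g: "poly g t = zeval F (\<lambda>i. x' i + t * z' i)" for t
    unfolding g_def poly_eval_zpoly zeval_eq_eval_zpoly by simp
  have reduction: "map_poly of_int g - P = 0"
  proof (rule poly_eq_0_if_vanishing)
    have "degree g < CARD('a)" using degree_eval_zpoly_line[OF F(1)] F(2) unfolding g_def by (rule le_less_trans)
    then show "degree (map_poly (of_int :: int \<Rightarrow> 'a) g - P) < CARD('a)"
      using P(2) map_poly_degree_leq[of "of_int :: int \<Rightarrow> 'a" g] degree_diff_le_max[of "map_poly of_int g" P] by linarith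
    fix y :: 'a
    obtain t :: int where t: "y = of_int t" using surj_of_int by (metis surjD)
    have "poly (map_poly of_int g) y = (of_int (poly g t) :: 'a)" unfolding t by (rule of_int_hom.poly_map_poly)
    also have "\<dots> = poly P y" unfolding g zeval_eq_eval_zpoly of_int_eval_zpoly P(1)[symmetric] by (simp add: x' z' t)
    finally show "poly (map_poly of_int g - P) y = 0" by simp
  qed
  have at_0: "of_int (poly h 0) = poly (map_poly (of_int :: int \<Rightarrow> 'a) h) 0" for h
    using of_int_hom.poly_map_poly[of h 0, where ?'a='a] by simp
  have p: "prime (int CARD('a))" using prime_CARD[where ?'a='a] by simp
  show ?thesis
  proof (rule padic_dense_if_represents_multiples[OF p])
    fix c k assume c: "int CARD('a) dvd c"
    have "(of_int (poly g 0) :: 'a) = 0" "(of_int (poly (pderiv g) 0) :: 'a) \<noteq> 0"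
      unfolding at_0 of_int_hom.map_poly_pderiv using reduction zero by simp_all
    then have "\<exists>t. int CARD('a) dvd t \<and> int CARD('a) ^ Suc k dvd poly g t - c"
      unfolding of_int_eq_0_iff_dvd by (rule hensel[OF p _ _ c])
    then show "\<exists>y. int CARD('a) ^ Suc k dvd zeval F y - c" unfolding g by blast
  qed
qed

section \<open>Polarisation\<close>

definition monom_list :: "(nat \<Rightarrow>\<^sub>0 nat) \<Rightarrow> nat list"
  where "monom_list \<alpha> = concat (map (\<lambda>i. replicate (Poly_Mapping.lookup \<alpha> i) i) (sorted_list_of_set (Poly_Mapping.keys \<alpha>)))"

lemma length_monom_list: "length (monom_list \<alpha>) = mon_deg \<alpha>"
proof -
  have "length (concat (map (\<lambda>i. replicate (e i) i) is)) = (\<Sum>i\<leftarrow>is. e i)" for e and "is" :: "nat list"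
    by (induction "is") simp_all
  then show ?thesis unfolding monom_list_def mon_deg_def by (simp add: sum.distinct_set_conv_list[symmetric])
qed

lemma prod_monom_list: "(\<Prod>j<mon_deg \<alpha>. x (monom_list \<alpha> ! j)) = eval_monom x \<alpha>"
proof -
  have "prod_list (map x (concat (map (\<lambda>i. replicate (e i) i) is))) = (\<Prod>i\<leftarrow>is. x i ^ e i)" for e and "is" :: "nat list"
    by (induction "is") (simp_all add: prod_list_replicate)
  then have "eval_monom x \<alpha> = prod_list (map x (monom_list \<alpha>))"
    unfolding eval_monom_def monom_list_def by (simp add: prod.distinct_set_conv_list[symmetric])
  also have "\<dots> = (\<Prod>j<mon_deg \<alpha>. x (monom_list \<alpha> ! j))"
    unfolding prod.list_conv_set_nth by (intro prod.cong) (auto simp: length_monom_list)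
  finally show ?thesis ..
qed

definition polarization :: "nat \<Rightarrow> zpoly \<Rightarrow> (nat \<Rightarrow> nat \<Rightarrow> 'a :: field) \<Rightarrow> 'a"
  where "polarization d F x = (\<Sum>\<sigma> | \<sigma> permutes {..<d}. \<Sum>\<alpha>\<in>Poly_Mapping.keys F.
    of_int (Poly_Mapping.lookup F \<alpha>) * (\<Prod>j<d. x j (monom_list \<alpha> ! \<sigma> j))) / of_nat (fact d)"

lemma polarization_permute:
  assumes \<tau>: "\<tau> permutes {..<d}" and y: "\<And>j. j < d \<Longrightarrow> y j = x (\<tau> j)"
  shows "polarization d F y = polarization d F x"
proof -
  have "(\<Prod>j<d. y j (L ! (\<sigma> \<circ> \<tau>) j)) = (\<Prod>j<d. x j (L ! \<sigma> j))" for \<sigma> L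
    using prod.permute[OF \<tau>, of "\<lambda>j. x j (L ! \<sigma> j)"] by (simp add: y)
  then show ?thesis unfolding polarization_def by (subst sum_permutations_compose_right[OF \<tau>]) simp
qed

lemma prod_lessThan_fun_upd:
  "k < d \<Longrightarrow> (\<Prod>j<d. (x(k := w)) j (l j)) = w (l k) * (\<Prod>j\<in>{..<d :: nat} - {k}. x j (l j))"
  by (subst prod.remove[of _ k]) auto

lemma polarization_upd_add:
  assumes "k < d"
  shows "polarization d F (x(k := \<lambda>i. u i + v i)) = polarization d F (x(k := u)) + polarization d F (x(k := v))"
  unfolding polarization_def prod_lessThan_fun_upd[OF assms]
  by (simp add: distrib_left distrib_right sum.distrib add_divide_distrib)

lemma polarization_upd_scale:
  assumes "k < d"
  shows "polarization d F (x(k := \<lambda>i. c * u i)) = c * polarization d F (x(k := u))"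
  unfolding polarization_def prod_lessThan_fun_upd[OF assms] by (simp add: sum_distrib_left mult_ac)

lemma polarization_diagonal:
  fixes x :: "nat \<Rightarrow> 'a :: field"
  assumes F: "is_int_form n d F" and d: "of_nat (fact d) \<noteq> (0 :: 'a)"
  shows "polarization d F (\<lambda>_. x) = eval_zpoly F x"
proof -
  have "(\<Prod>j<d. x (monom_list \<alpha> ! \<sigma> j)) = eval_monom x \<alpha>" if "\<sigma> permutes {..<d}" "\<alpha> \<in> Poly_Mapping.keys F" for \<sigma> \<alpha>
    using prod.permute[OF that(1), of "\<lambda>j. x (monom_list \<alpha> ! j)"] prod_monom_list[of x \<alpha>] F that(2)
    by (simp add: is_int_form_def o_def)
  then have "polarization d F (\<lambda>_. x) = (\<Sum>\<sigma> | \<sigma> permutes {..<d}. eval_zpoly F x) / of_nat (fact d)"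
    unfolding polarization_def eval_zpoly_def by simp
  also have "\<dots> = eval_zpoly F x" using d card_permutations[of "{..<d}" d] by simp
  finally show ?thesis .
qed

section \<open>Quintic forms over large prime fields\<close>

definition coord_index :: "nat \<Rightarrow> 'n :: finite"
  where "coord_index = (SOME h. bij_betw h {..<CARD('n)} UNIV)"

lemma bij_betw_coord_index: "bij_betw (coord_index :: nat \<Rightarrow> 'n :: finite) {..<CARD('n)} UNIV"
proof -
  have "\<exists>h. bij_betw h {..<CARD('n)} (UNIV :: 'n set)"
    using ex_bij_betw_nat_finite[of "UNIV :: 'n set"] by (simp add: atLeast0LessThan)
  then show ?thesis unfolding coord_index_def by (rule someI_ex)
qed

definition coords :: "('a :: zero) ^ ('n :: finite) \<Rightarrow> nat \<Rightarrow> 'a"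
  where "coords v i = (if i < CARD('n) then v $ coord_index i else 0)"

lemma coords_add: "coords (u + v :: ('a :: monoid_add) ^ ('n :: finite)) = (\<lambda>i. coords u i + coords v i)"
  by (auto simp: coords_def)

lemma coords_scale: "coords (c *s v :: ('a :: semiring_1) ^ ('n :: finite)) = (\<lambda>i. c * coords v i)"
  by (auto simp: coords_def)

lemma coords_eq_0_iff: "coords v = (\<lambda>_. 0) \<longleftrightarrow> v = (0 :: ('a :: zero) ^ ('n :: finite))"
proof
  assume zero: "coords v = (\<lambda>_. 0)"
  show "v = 0"
  proof (subst vec_eq_iff, intro allI)
    fix k :: 'n
    obtain i where "i < CARD('n)" "k = coord_index i" using bij_betw_coord_index[where ?'n='n] by (auto simp: bij_betw_def)
    then show "v $ k = 0 $ k" using fun_cong[OF zero, of i] by (simp add: coords_def)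
  qed
qed (simp add: coords_def fun_eq_iff)

lemma coords_exists:
  obtains v :: "('a :: zero) ^ ('n :: finite)" where "\<forall>i<CARD('n). coords v i = x i"
proof (rule that, intro allI impI)
  fix i assume i: "i < CARD('n)"
  have "inj_on (coord_index :: nat \<Rightarrow> 'n) {..<CARD('n)}" using bij_betw_coord_index by (rule bij_betw_imp_inj_on)
  then show "coords (\<chi> k :: 'n. x (inv_into {..<CARD('n)} coord_index k)) i = x i"
    using i by (simp add: coords_def inv_into_f_f)
qed

definition polar :: "zpoly \<Rightarrow> 'a ^ 'n \<Rightarrow> 'a ^ 'n \<Rightarrow> 'a ^ 'n \<Rightarrow> 'a ^ 'n \<Rightarrow> ('a :: field) ^ ('n :: finite) \<Rightarrow> 'a"
  where "polar F a b c d e = polarization 5 F ((!) (map coords [a, b, c, d, e]))"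

lemma polar_permute:
  assumes "\<tau> permutes {..<5}" "\<And>j. j < 5 \<Longrightarrow> [a', b', c', d', e'] ! j = [a, b, c, d, e] ! \<tau> j"
  shows "polar F a' b' c' d' e' = polar F a b c d e"
  unfolding polar_def
proof (rule polarization_permute[OF assms(1)])
  fix j :: nat assume "j < 5"
  moreover from this have "\<tau> j < 5" using permutes_in_image[OF assms(1), of j] by simp
  ultimately show "map coords [a', b', c', d', e'] ! j = map coords [a, b, c, d, e] ! \<tau> j"
    using assms(2)[of j] nth_map[of j "[a', b', c', d', e']" coords] nth_map[of "\<tau> j" "[a, b, c, d, e]" coords] by simp
qed

lemma polar_diagonal:
  fixes v :: "('a :: big_prime_field) ^ ('n :: finite)"
  assumes "is_int_form n 5 F"
  shows "polar F v v v v v = eval_zpoly F (coords v)"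
proof -
  have "of_nat (fact 5) = (4 * 30 :: 'a)" by (simp add: fact_numeral)
  also have "\<dots> \<noteq> 0" unfolding mult_eq_0_iff by simp
  finally have "of_nat (fact 5) \<noteq> (0 :: 'a)" .
  then have "polarization 5 F (\<lambda>_. coords v) = eval_zpoly F (coords v)" by (rule polarization_diagonal[OF assms])
  moreover have "polar F v v v v v = polarization 5 F (\<lambda>_. coords v)"
    unfolding polar_def by (rule polarization_permute[OF permutes_id]) (auto simp: less_Suc_eq numeral_eq_Suc)
  ultimately show ?thesis by simp
qed

lemma quintic_form_polar: "quintic_form (*s) (polar F :: ('a :: big_prime_field) ^ ('n :: finite) \<Rightarrow> _)"
proof
  fix a b c d e u v :: "'a ^ 'n" and k
  have transpositions: "Transposition.transpose i (Suc i) permutes {..<5}" if "i < 4" for i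
    using that by (intro permutes_swap_id) auto
  show "polar F u v c d e = polar F v u c d e" "polar F b u v d e = polar F b v u d e"
    "polar F b c u v e = polar F b c v u e" "polar F b c d u v = polar F b c d v u"
    by (rule polar_permute[OF transpositions, of 0] polar_permute[OF transpositions, of 1]
          polar_permute[OF transpositions, of 2] polar_permute[OF transpositions, of 3];
        auto simp: less_Suc_eq numeral_eq_Suc Transposition.transpose_def; fail)+
  have upd: "polar F x b c d e = polarization 5 F (((!) (map coords [0, b, c, d, e]))(0 := coords x))" for x
    unfolding polar_def by (rule arg_cong[of _ _ "polarization 5 F"]) (auto simp: fun_eq_iff nth_Cons split: nat.split)
  show "polar F (u + v) b c d e = polar F u b c d e + polar F v b c d e"
    unfolding upd coords_add by (rule polarization_upd_add) simp
  show "polar F (k *s u) b c d e = k * polar F u b c d e"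
    unfolding upd coords_scale by (rule polarization_upd_scale) simp
qed

lemma finite_vector_space_vec: "finite_vector_space ((*s) :: 'a :: finite_field \<Rightarrow> 'a ^ ('n :: finite) \<Rightarrow> _)"
  by unfold_locales

lemma polar_nondegenerate:
  fixes v :: "('a :: big_prime_field) ^ ('n :: finite)"
  assumes F: "is_int_form CARD('n) 5 F" "nondegenerate_mod (int CARD('a)) CARD('n) F"
    and v: "\<And>w x y z. polar F v w x y z = 0"
  shows "v = 0"
proof (rule ccontr)
  interpret quintic_form "(*s)" "polar F :: 'a ^ 'n \<Rightarrow> _" by (rule quintic_form_polar)
  assume "v \<noteq> 0"
  then have "coords v \<noteq> (\<lambda>_. 0)" by (simp only: coords_eq_0_iff not_False_eq_True)
  then obtain m where m: "coords v m \<noteq> 0" by blast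
  then have "m < CARD('n)" by (auto simp: coords_def split: if_splits)
  moreover have "eval_zpoly F (\<lambda>i. x i + t * coords v i) = eval_zpoly F x" for x t
  proof -
    obtain w :: "'a ^ 'n" where w: "\<forall>i<CARD('n). coords w i = x i" by (rule coords_exists)
    have "eval_zpoly F (\<lambda>i. x i + t * coords v i) = eval_zpoly F (coords (t *s v + w))"
      by (rule eval_zpoly_cong[OF F(1)]) (simp add: coords_add coords_scale w)
    also have "\<dots> = polar F w w w w w"
      using expand5[of t v w] unfolding v polar_diagonal[OF F(1), symmetric] by simp
    also have "\<dots> = eval_zpoly F x"
      unfolding polar_diagonal[OF F(1)] by (rule eval_zpoly_cong[OF F(1)]) (simp add: w)
    finally show ?thesis .
  qed
  moreover have "5 < CARD('a) - 1" using CARD_gt[where ?'a='a] by simp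
  ultimately have "order_mod (int CARD('a)) CARD('n) F < CARD('n)"
    using order_mod_less_if_translation_invariant[OF F(1)] m by blast
  then show False using F(2) by (simp add: nondegenerate_mod_def)
qed

lemma padic_dense_if_polar_nonsingular:
  fixes x z :: "('a :: big_prime_field) ^ ('n :: finite)"
  assumes F: "is_int_form CARD('n) 5 F" and x: "polar F x x x x x = 0" "polar F x x x x z \<noteq> 0"
  shows "padic_dense (int CARD('a)) (ratio_set F)"
proof -
  interpret quintic_form "(*s)" "polar F :: 'a ^ 'n \<Rightarrow> _" by (rule quintic_form_polar)
  have card: "5 < CARD('a)" using CARD_gt[where ?'a='a] by simp
  show ?thesis
  proof (rule padic_dense_if_nonsingular_on_line[OF F card])
    show "eval_zpoly F (\<lambda>i. coords x i + t * coords z i) = poly (pencil5 z x) t" for t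
      unfolding poly_pencil5 polar_diagonal[OF F] coords_add coords_scale by (simp add: add.commute)
    show "degree (pencil5 z x) < CARD('a)" using degree_pencil_le(3) card by (rule le_less_trans)
    show "poly (pencil5 z x) 0 = 0" using x(1) by (simp add: poly_pencil5)
    show "poly (pderiv (pencil5 z x)) 0 \<noteq> 0"
      using x(2) rotate[of x x x x z] by (simp add: poly_pderiv_pencil5)
  qed
qed

definition quintic_density :: "nat \<Rightarrow> nat \<Rightarrow> bool"
  where "quintic_density p n \<longleftrightarrow>
    (\<forall>F. is_int_form n 5 F \<and> nondegenerate_mod (int p) n F \<longrightarrow> padic_dense (int p) (ratio_set F))"

theorem quintic_density_CARD:
  assumes n: "6 \<le> CARD('n :: finite)"
  shows "quintic_density CARD('a :: big_prime_field) CARD('n)"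
  unfolding quintic_density_def
proof (intro allI impI, elim conjE, rule ccontr)
  fix F
  assume F: "is_int_form CARD('n) 5 F" "nondegenerate_mod (int CARD('a)) CARD('n) F"
    and not_dense: "\<not> padic_dense (int CARD('a)) (ratio_set F)"
  have "singular_quintic (*s) (polar F :: 'a ^ 'n \<Rightarrow> _)"
  proof (intro singular_quintic.intro singular_quintic_axioms.intro finite_vector_space_vec quintic_form_polar)
    show "6 \<le> vec.dim (UNIV :: ('a ^ 'n) set)" unfolding vec_dim_card by (rule n)
    show "polar F x x x x z = 0" if "polar F x x x x x = 0" for x z :: "'a ^ 'n"
      using padic_dense_if_polar_nonsingular[OF F(1) that] not_dense by blast
  qed (rule polar_nondegenerate[OF F])
  then show False by (rule singular_quintic.singular_quintic_False)
qed

section \<open>Prescribing the prime and the number of variables\<close>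

text \<open>Types cannot depend on \<open>p\<close> and \<open>n\<close>. Hence the residue and index types are built for one pair \<open>worst_case\<close>,
  chosen such that density for this pair implies density for all pairs.\<close>

definition admissible :: "nat \<Rightarrow> nat \<Rightarrow> bool"
  where "admissible p n \<longleftrightarrow> prime p \<and> 101 < p \<and> 6 \<le> n"

definition worst_case :: "nat \<times> nat"
  where "worst_case = (SOME c. admissible (fst c) (snd c) \<and>
    (quintic_density (fst c) (snd c) \<longrightarrow> (\<forall>p n. admissible p n \<longrightarrow> quintic_density p n)))"

lemma worst_case:
  "admissible (fst worst_case) (snd worst_case)"
  "quintic_density (fst worst_case) (snd worst_case) \<Longrightarrow> admissible p n \<Longrightarrow> quintic_density p n"
proof -
  obtain q :: nat where "prime q" "101 < q" using bigger_prime by blast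
  then have "admissible q 6" by (simp add: admissible_def)
  then have "\<exists>c. admissible (fst c) (snd c) \<and>
      (quintic_density (fst c) (snd c) \<longrightarrow> (\<forall>p n. admissible p n \<longrightarrow> quintic_density p n))"
    by (metis fst_conv snd_conv)
  from someI_ex[OF this, folded worst_case_def]
  show "admissible (fst worst_case) (snd worst_case)"
    "quintic_density (fst worst_case) (snd worst_case) \<Longrightarrow> admissible p n \<Longrightarrow> quintic_density p n" by blast+
qed

class big_prime_card = prime_card +
  assumes big_card: "101 < CARD('a)"

instance mod_ring :: (big_prime_card) big_prime_field
  by standard (simp_all add: prime_card big_card)

typedef residue = "{..<fst worst_case}"
  using worst_case(1) by (intro exI[of _ 0]) (simp add: admissible_def)

typedef coordinate = "{..<snd worst_case}"
  using worst_case(1) by (intro exI[of _ 0]) (simp add: admissible_def)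

lemma CARD_residue: "CARD(residue) = fst worst_case"
  by (simp add: type_definition.card[OF type_definition_residue])

lemma CARD_coordinate: "CARD(coordinate) = snd worst_case"
  by (simp add: type_definition.card[OF type_definition_coordinate])

instance residue :: big_prime_card
  by standard (use worst_case(1) in \<open>simp_all add: CARD_residue admissible_def\<close>)

instance coordinate :: finite
  by standard (simp add: type_definition.univ[OF type_definition_coordinate])

lemma quintic_density_if_admissible: "admissible p n \<Longrightarrow> quintic_density p n"
proof (rule worst_case(2))
  have "6 \<le> CARD(coordinate)" using worst_case(1) by (simp add: CARD_coordinate admissible_def)
  from quintic_density_CARD[OF this, where ?'a = "residue mod_ring"]
  show "quintic_density (fst worst_case) (snd worst_case)" by (simp add: CARD_residue CARD_coordinate)
qed

theorem theorem1p3: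
  fixes p :: int and n :: nat and F :: zpoly
  assumes "prime p" and "p > 101"
    and "is_int_form n 5 F"
    and "nondegenerate_mod p n F"
    and "order_mod p n F \<ge> 6"
  shows "padic_dense p (ratio_set F)"
proof -
  have p: "int (nat p) = p" using assms(2) by simp
  have "prime (nat p)" using assms(1) by (simp add: prime_nat_iff_prime)
  moreover have "6 \<le> n" using assms(4,5) by (simp add: nondegenerate_mod_def)
  ultimately have "admissible (nat p) n" using assms(2) by (simp add: admissible_def)
  then have "quintic_density (nat p) n" by (rule quintic_density_if_admissible)
  then show ?thesis using assms(3,4) unfolding quintic_density_def p by blast
qed

end
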